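(* Let $p\ge3$, $k\ge1$, and for $1\le r\le k$ let $\mu_r$ be a centered probability measure on a bounded Borel set $\Lambda_r\subset\mathbb{R}$ with critical temperature $\beta_{r,c}$. Let $$\bar{\mathcal{R}}=\{\bar\beta=(\beta_1,\dots,\beta_k):\beta_r>0\ \forall r,\ F(\bar\beta)=0\}.$$ Then $\bar{\mathcal{R}}=(0,\beta_{1,c}]\times\cdots\times(0,\beta_{k,c}]$.
   Context: Let $Y$ be a random $p$-tensor of size $N^p$ with i.i.d. standard Gaussian entries, $X_N(\sigma)=N^{-(p-1)/2}\sum_{i_1,\dots,i_p}Y_{i_1,\dots,i_p}\sigma_{i_1}\cdots\sigma_{i_p}$ and $R(\sigma,\sigma')=\frac1N\sum_{i=1}^N\sigma_i\sigma'_i$. Scalar model: for a measure $\mu$ on bounded $\Lambda$, $F_N(\beta)=\frac1N\log\int\exp(\beta X_N(\sigma)-\frac{\beta^2N}{2}R(\sigma,\sigma)^p)\mu^{\otimes N}(d\sigma)$ converges a.s. to a deterministic $F(\beta)\le0$, and the critical temperature is $\sup\{\beta>0:F(\beta)=0\}$; $\beta_{r,c}$ is this with $\mu=\mu_r$. Vector model: $\bar\Lambda=\Lambda_1\times\cdots\times\Lambda_k$, $\bar\mu=\mu_1\otimes\cdots\otimes\mu_k$; a configuration $\bar\sigma=(\bar\sigma_1,\dots,\bar\sigma_N)\in\bar\Lambda^N$ has rows $\sigma(r)\in\Lambda_r^N$; with the same $Y$ for all $r$, $$H_{N,\bar\beta}(\bar\sigma)=\sum_{r=1}^k\beta_rX_N(\sigma(r))-\sum_{r,r'=1}^k\frac{\beta_r\beta_{r'}}{2}NR(\sigma(r),\sigma(r'))^p,$$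 $F_N(\bar\beta)=\frac1N\log\int e^{H_{N,\bar\beta}(\bar\sigma)}\bar\mu^{\otimes N}(d\bar\sigma)$ and $F(\bar\beta)=\limsup_{N\to\infty}F_N(\bar\beta)$ (almost surely equal to the deterministic $\limsup_N\mathbb{E}F_N(\bar\beta)$). *)

theory Defs
  imports "HOL-Probability.Probability"
begin

definition std_gauss :: "real measure" where
  "std_gauss = density lborel std_normal_density"

definition tensor_idx :: "nat \<Rightarrow> nat \<Rightarrow> (nat \<Rightarrow> nat) set" where
  "tensor_idx p N = {..<p} \<rightarrow>\<^sub>E {..<N}"

definition gauss_tensor :: "nat \<Rightarrow> nat \<Rightarrow> ((nat \<Rightarrow> nat) \<Rightarrow> real) measure" where
  "gauss_tensor p N = PiM (tensor_idx p N) (\<lambda>_. std_gauss)"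

definition Xfield :: "nat \<Rightarrow> nat \<Rightarrow> ((nat \<Rightarrow> nat) \<Rightarrow> real) \<Rightarrow> (nat \<Rightarrow> real) \<Rightarrow> real" where
  "Xfield p N Y \<sigma> = real N powr (- (real p - 1) / 2) *
     (\<Sum>i\<in>tensor_idx p N. Y i * (\<Prod>j<p. \<sigma> (i j)))"

definition overlap :: "nat \<Rightarrow> (nat \<Rightarrow> real) \<Rightarrow> (nat \<Rightarrow> real) \<Rightarrow> real" where
  "overlap N \<sigma> \<sigma>' = (1 / real N) * (\<Sum>i<N. \<sigma> i * \<sigma>' i)"

text \<open>Scalar model: F_N(beta) for a fixed realisation Y, and its limit F(beta)
  (taken as limsup of the expectation, which is the a.s. limit).\<close>
definition scalar_FN :: "nat \<Rightarrow> real measure \<Rightarrow> real \<Rightarrow> nat \<Rightarrow> ((nat \<Rightarrow> nat) \<Rightarrow> real) \<Rightarrow> real" where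
  "scalar_FN p \<mu> \<beta> N Y = (1 / real N) * ln (\<integral>\<sigma>. exp (\<beta> * Xfield p N Y \<sigma>
       - \<beta>\<^sup>2 * real N / 2 * overlap N \<sigma> \<sigma> ^ p) \<partial>(PiM {..<N} (\<lambda>_. \<mu>)))"

definition scalar_F :: "nat \<Rightarrow> real measure \<Rightarrow> real \<Rightarrow> ereal" where
  "scalar_F p \<mu> \<beta> = limsup (\<lambda>N. ereal (\<integral>Y. scalar_FN p \<mu> \<beta> N Y \<partial>(gauss_tensor p N)))"

definition crit_temp :: "nat \<Rightarrow> real measure \<Rightarrow> ereal" where
  "crit_temp p \<mu> = Sup (ereal ` {\<beta>. \<beta> > 0 \<and> scalar_F p \<mu> \<beta> = 0})"

text \<open>Vector model. A configuration is sigmabar : nat => ('k => real), with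
  sigmabar i in Lambda_bar; row r is sigma(r) = (\<lambda>i. sigmabar i r).\<close>
definition vec_H :: "nat \<Rightarrow> nat \<Rightarrow> ((nat \<Rightarrow> nat) \<Rightarrow> real) \<Rightarrow> real ^ 'k \<Rightarrow> (nat \<Rightarrow> 'k \<Rightarrow> real) \<Rightarrow> real" where
  "vec_H p N Y \<beta> \<sigma> =
     (\<Sum>r\<in>UNIV. \<beta> $ r * Xfield p N Y (\<lambda>i. \<sigma> i r))
     - (\<Sum>r\<in>UNIV. \<Sum>r'\<in>UNIV. \<beta> $ r * \<beta> $ r' / 2 * real N
          * overlap N (\<lambda>i. \<sigma> i r) (\<lambda>i. \<sigma> i r') ^ p)"

definition vec_FN :: "nat \<Rightarrow> ('k::finite \<Rightarrow> real measure) \<Rightarrow> real ^ 'k \<Rightarrow> nat \<Rightarrow> ((nat \<Rightarrow> nat) \<Rightarrow> real) \<Rightarrow> real" where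
  "vec_FN p \<mu> \<beta> N Y = (1 / real N) * ln (\<integral>\<sigma>. exp (vec_H p N Y \<beta> \<sigma>)
       \<partial>(PiM {..<N} (\<lambda>_. PiM UNIV \<mu>)))"

text \<open>F(betabar) = limsup_N E F_N(betabar) (a.s. equal to limsup_N F_N(betabar)).\<close>
definition vec_F :: "nat \<Rightarrow> ('k::finite \<Rightarrow> real measure) \<Rightarrow> real ^ 'k \<Rightarrow> ereal" where
  "vec_F p \<mu> \<beta> = limsup (\<lambda>N. ereal (\<integral>Y. vec_FN p \<mu> \<beta> N Y \<partial>(gauss_tensor p N)))"

end

theory Submission
  imports Defs
begin

text \<open>The mixture likelihood \<open>L(Y) = \<integral> exp (\<langle>v \<sigma>, Y\<rangle> - \<bar>v \<sigma>\<bar>\<^sup>2 / 2)\<close> is the density of a planted law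
  with respect to the law of pure noise \<open>Y\<close>, and \<open>N F\<^sub>N = ln L\<close>. So \<open>F = 0\<close> says that the null entropy
  \<open>- E ln L\<close> is \<open>o(N)\<close>. By Gaussian and site-wise concentration of \<open>ln L\<close>, combined with Jensen's
  inequality, this is equivalent to the planted entropy \<open>E L ln L\<close> being \<open>o(N)\<close>, up to passing to
  subsequences.

  For one spike the planted entropy is subadditive in \<open>N\<close> up to a constant: interpolate between
  the tensor on \<open>n + m\<close> sites and two independent tensors on the blocks. The interpolation error is
  governed by negative overlaps, which the planted law suppresses. Hence smallness along a
  subsequence of sizes is smallness along all sizes, and the spikes can be treated at the same \<open>N\<close>.

  If every spike is subcritical, the rows are added one at a time; a further independent spike lowers
  \<open>E ln L\<close> by no more than its own planted entropy allows. Conversely, when the joint null entropy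
  is \<open>o(N)\<close>, one tests the joint planted law against the likelihood of row \<open>r\<close> alone: since the measures are
  centred, the other spikes contribute only \<open>O(1)\<close> on average, and concentration transfers
  triviality to row \<open>r\<close>. Spins are truncated to \<open>[-B, B]\<close>, which changes nothing almost surely.\<close>

section \<open>Gaussian measure\<close>

text \<open>The limsup in \<open>F\<close> is the obstacle: it grants smallness of each spike only
  along its own sequence of sizes, and nothing obvious makes \<open>E ln L\<close> superadditive in
  \<open>N\<close>. The planted entropy is a relative entropy, so it obeys a chain rule, and its
  increments are averages over two posterior samples; this is what makes interpolation possible and
  why the proof keeps changing between the two laws. Every change of law rests on one device. For a
  functional \<open>f\<close> of the data with total squared oscillation \<open>O(N)\<close>, the
  product of the means of \<open>exp (s * f)\<close> and \<open>exp (- s * f)\<close> is at most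
  \<open>exp (s\<^sup>2 * O(N))\<close>. Jensen's inequality turns this into a linear inequality
  between entropies with error \<open>s\<^sup>2 * O(N)\<close>; division by \<open>s\<close> leaves
  \<open>s * O(N)\<close>, and \<open>s\<close> is chosen small at the very end. The interpolation
  is discrete: a Gaussian rotation splits off a signal of squared norm \<open>\<kappa>\<close>, the
  entropy gained is half an average covariance up to \<open>O(\<kappa> powr (3/2))\<close>, and the
  errors of \<open>n\<close> steps with \<open>\<kappa>\<close> of order \<open>1/n\<close> vanish
  as \<open>n\<close> grows. No derivative of an entropy is ever taken.\<close>

lemma distr_PiM_pair:
  assumes I: "finite I" and M: "\<And>i. prob_space (M i)" and M': "\<And>i. prob_space (M' i)"
    and N: "\<And>i. prob_space (N i)"
    and h: "\<And>i. i \<in> I \<Longrightarrow> h i \<in> measurable (M i \<Otimes>\<^sub>M M' i) (N i)"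
    and d: "\<And>i. i \<in> I \<Longrightarrow> distr (M i \<Otimes>\<^sub>M M' i) (N i) (h i) = N i"
  shows "distr (PiM I M \<Otimes>\<^sub>M PiM I M') (PiM I N) (\<lambda>(x,y). \<lambda>i\<in>I. h i (x i, y i)) = PiM I N"
proof -
  interpret M: product_prob_space M I using M by (simp add: product_prob_space_def product_prob_space_axioms_def product_sigma_finite_def prob_space_imp_sigma_finite)
  interpret M': product_prob_space M' I using M' by (simp add: product_prob_space_def product_prob_space_axioms_def product_sigma_finite_def prob_space_imp_sigma_finite)
  interpret N: product_prob_space N I using N by (simp add: product_prob_space_def product_prob_space_axioms_def product_sigma_finite_def prob_space_imp_sigma_finite)
  have meas: "(\<lambda>(x,y). \<lambda>i\<in>I. h i (x i, y i)) \<in> measurable (PiM I M \<Otimes>\<^sub>M PiM I M') (PiM I N)"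
    unfolding split_beta' by (intro measurable_restrict measurable_compose[OF _ h]) auto
  show ?thesis
  \<comment> \<open>The two measures are compared on boxes, where Tonelli's theorem factorises the
    integral over the coordinates.\<close>
  proof (rule N.PiM_eqI[OF I])
    fix A assume A: "\<And>i. i \<in> I \<Longrightarrow> A i \<in> sets (N i)"
    let ?f = "\<lambda>i x y. indicator (A i) (h i (x, y)) :: ennreal"
    have fm: "(\<lambda>p. ?f i (fst p) (snd p)) \<in> borel_measurable (M i \<Otimes>\<^sub>M M' i)" if "i \<in> I" for i
      using measurable_compose[OF h[OF that] borel_measurable_indicator[OF A[OF that]]] by simp
    have fm2: "(\<lambda>y. ?f i x y) \<in> borel_measurable (M' i)" if "i \<in> I" "x \<in> space (M i)" for i x
      using measurable_compose[OF measurable_Pair1'[OF that(2)] fm[OF that(1)]] by simp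
    have fm3: "(\<lambda>x. \<integral>\<^sup>+y. ?f i x y \<partial>M' i) \<in> borel_measurable (M i)" if "i \<in> I" for i
    proof -
      have "sigma_finite_measure (M' i)" by (intro prob_space_imp_sigma_finite M')
      from sigma_finite_measure.borel_measurable_nn_integral_fst[OF this fm[OF that]] show ?thesis by simp
    qed
    have AA: "Pi\<^sub>E I A \<in> sets (PiM I N)" using A by (intro sets_PiM_I_finite I)
    have "emeasure (distr (PiM I M \<Otimes>\<^sub>M PiM I M') (PiM I N) (\<lambda>(x,y). \<lambda>i\<in>I. h i (x i, y i))) (Pi\<^sub>E I A)
       = (\<integral>\<^sup>+p. indicator (Pi\<^sub>E I A) ((\<lambda>(x,y). \<lambda>i\<in>I. h i (x i, y i)) p) \<partial>(PiM I M \<Otimes>\<^sub>M PiM I M'))"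
      using AA by (subst nn_integral_indicator[symmetric], simp) (subst nn_integral_distr[OF meas], auto)
    also have "\<dots> = (\<integral>\<^sup>+p. (\<Prod>i\<in>I. ?f i (fst p i) (snd p i)) \<partial>(PiM I M \<Otimes>\<^sub>M PiM I M'))"
      by (intro nn_integral_cong) (auto simp: indicator_def I PiE_def Pi_def split: if_splits)
    also have "\<dots> = (\<integral>\<^sup>+x. \<integral>\<^sup>+y. (\<Prod>i\<in>I. ?f i (x i) (y i)) \<partial>PiM I M' \<partial>PiM I M)"
    proof -
      have *: "(\<lambda>p. (\<Prod>i\<in>I. ?f i (fst p i) (snd p i))) \<in> borel_measurable (PiM I M \<Otimes>\<^sub>M PiM I M')"
      proof (rule borel_measurable_prod_ennreal)
        fix i assume i: "i \<in> I"
        have "(\<lambda>p. (fst p i, snd p i)) \<in> measurable (PiM I M \<Otimes>\<^sub>M PiM I M') (M i \<Otimes>\<^sub>M M' i)"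
          using i by measurable
        from measurable_compose[OF this fm[OF i]]
        show "(\<lambda>p. ?f i (fst p i) (snd p i)) \<in> borel_measurable (PiM I M \<Otimes>\<^sub>M PiM I M')" by simp
      qed
      show ?thesis using sigma_finite_measure.nn_integral_fst[OF prob_space_imp_sigma_finite[OF prob_space_PiM[OF M']] *] by simp
    qed
    also have "\<dots> = (\<integral>\<^sup>+x. (\<Prod>i\<in>I. \<integral>\<^sup>+y. ?f i (x i) y \<partial>M' i) \<partial>PiM I M)"
    proof (intro nn_integral_cong)
      fix x assume "x \<in> space (PiM I M)"
      then have "x i \<in> space (M i)" if "i \<in> I" for i using that by (auto simp: space_PiM)
      then show "(\<integral>\<^sup>+y. (\<Prod>i\<in>I. ?f i (x i) (y i)) \<partial>PiM I M') = (\<Prod>i\<in>I. \<integral>\<^sup>+y. ?f i (x i) y \<partial>M' i)"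
        by (intro M'.product_nn_integral_prod I fm2)
    qed
    also have "\<dots> = (\<Prod>i\<in>I. \<integral>\<^sup>+x. (\<integral>\<^sup>+y. ?f i x y \<partial>M' i) \<partial>M i)"
      by (intro M.product_nn_integral_prod I fm3)
    also have "\<dots> = (\<Prod>i\<in>I. emeasure (N i) (A i))"
    proof (intro prod.cong refl)
      fix i assume i: "i \<in> I"
      have sf: "sigma_finite_measure (M' i)" by (intro prob_space_imp_sigma_finite M')
      have "(\<integral>\<^sup>+x. (\<integral>\<^sup>+y. ?f i x y \<partial>M' i) \<partial>M i) = (\<integral>\<^sup>+p. indicator (A i) (h i p) \<partial>(M i \<Otimes>\<^sub>M M' i))"
        using sigma_finite_measure.nn_integral_fst[OF sf fm[OF i]] by simp
      also have "\<dots> = emeasure (distr (M i \<Otimes>\<^sub>M M' i) (N i) (h i)) (A i)"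
        using A[OF i] by (subst nn_integral_indicator[symmetric], simp) (subst nn_integral_distr[OF h[OF i]], auto)
      finally show "(\<integral>\<^sup>+x. (\<integral>\<^sup>+y. ?f i x y \<partial>M' i) \<partial>M i) = emeasure (N i) (A i)"
        by (simp add: d[OF i])
    qed
    finally show "emeasure (distr (PiM I M \<Otimes>\<^sub>M PiM I M') (PiM I N) (\<lambda>(x,y). \<lambda>i\<in>I. h i (x i, y i))) (Pi\<^sub>E I A) = (\<Prod>i\<in>I. emeasure (N i) (A i))" .
  qed simp
qed

lemma prob_space_std_gauss: "prob_space std_gauss"
  unfolding std_gauss_def by (rule prob_space_normal_density) simp

lemma space_std_gauss [simp]: "space std_gauss = UNIV"
  and sets_std_gauss [simp, measurable_cong]: "sets std_gauss = sets borel"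
  by (simp_all add: std_gauss_def)

interpretation std_gauss: prob_space std_gauss by (rule prob_space_std_gauss)

text \<open>Completing the square. Stated for nonnegative integrals, it applies to indicators of
  boxes without integrability conditions.\<close>

lemma nn_integral_std_gauss_shift:
  assumes [measurable]: "f \<in> borel_measurable borel"
  shows "(\<integral>\<^sup>+y. ennreal (exp (u * y - u\<^sup>2 / 2)) * f y \<partial>std_gauss) = (\<integral>\<^sup>+y. f (y + u) \<partial>std_gauss)"
proof -
  have "(\<integral>\<^sup>+y. ennreal (exp (u * y - u\<^sup>2 / 2)) * f y \<partial>std_gauss) =
      (\<integral>\<^sup>+y. ennreal (std_normal_density y) * (ennreal (exp (u * y - u\<^sup>2 / 2)) * f y) \<partial>lborel)"
    unfolding std_gauss_def by (subst nn_integral_density) auto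
  also have "\<dots> = (\<integral>\<^sup>+y. ennreal (std_normal_density (y - u)) * f y \<partial>lborel)"
  proof (intro nn_integral_cong)
    fix y :: real
    have "std_normal_density y * exp (u * y - u\<^sup>2 / 2) = std_normal_density (y - u)"
      by (simp add: std_normal_density_def exp_add[symmetric] power2_eq_square field_simps)
    then show "ennreal (std_normal_density y) * (ennreal (exp (u * y - u\<^sup>2 / 2)) * f y) = ennreal (std_normal_density (y - u)) * f y"
      by (simp add: mult.assoc[symmetric] ennreal_mult'[symmetric])
  qed
  also have "\<dots> = (\<integral>\<^sup>+y. ennreal (std_normal_density y) * f (y + u) \<partial>lborel)"
    using nn_integral_real_affine[of "\<lambda>y. ennreal (std_normal_density (y - u)) * f y" 1 u]
    by (simp add: add.commute)
  also have "\<dots> = (\<integral>\<^sup>+y. f (y + u) \<partial>std_gauss)"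
    unfolding std_gauss_def by (subst nn_integral_density) auto
  finally show ?thesis .
qed

text \<open>Proved by characteristic functions and Levy uniqueness. Rotation invariance later lets
  one Gaussian observation be replaced by two independent, weaker ones.\<close>

lemma distr_std_gauss_rotate:
  fixes a b :: real
  assumes ab: "a\<^sup>2 + b\<^sup>2 = 1"
  shows "distr (std_gauss \<Otimes>\<^sub>M std_gauss) std_gauss (\<lambda>(x, y). a * x + b * y) = std_gauss"
proof -
  interpret P: pair_prob_space std_gauss std_gauss ..
  let ?D = "distr (std_gauss \<Otimes>\<^sub>M std_gauss) borel (\<lambda>(x, y). a * x + b * y)"
  have rg: "real_distribution std_gauss"
    by unfold_locales simp_all
  have m: "(\<lambda>(x, y). a * x + b * y) \<in> measurable (std_gauss \<Otimes>\<^sub>M std_gauss) borel" by measurable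
  interpret D: prob_space ?D using m by (rule P.prob_space_distr)
  have rd: "real_distribution ?D" by unfold_locales simp_all
  have cg: "char std_gauss t = complex_of_real (exp (- (t\<^sup>2) / 2))" for t
    unfolding std_gauss_def using char_std_normal_distribution by (metis)
  have "char ?D t = char std_gauss t" for t
  proof -
    have "char ?D t = (\<integral>p. iexp (t * a * fst p) * iexp (t * b * snd p) \<partial>(std_gauss \<Otimes>\<^sub>M std_gauss))"
      unfolding char_def by (subst integral_distr[OF m]) (auto simp: split_beta' algebra_simps exp_add[symmetric])
    also have "\<dots> = (\<integral>x. \<integral>y. iexp (t * a * x) * iexp (t * b * y) \<partial>std_gauss \<partial>std_gauss)"
      by (subst P.integral_fst'[symmetric]) (auto simp: intro!: P.integrable_const_bound[where B=1] simp: norm_mult)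
    also have "\<dots> = char std_gauss (t * a) * char std_gauss (t * b)"
      unfolding char_def by simp
    also have "\<dots> = complex_of_real (exp (- (t\<^sup>2) / 2))"
    proof -
      have "- ((t * a)\<^sup>2) / 2 + - ((t * b)\<^sup>2) / 2 = - (t\<^sup>2 * (a\<^sup>2 + b\<^sup>2)) / 2"
        by (simp add: power_mult_distrib algebra_simps add_divide_distrib)
      then have "exp (- ((t * a)\<^sup>2) / 2) * exp (- ((t * b)\<^sup>2) / 2) = exp (- (t\<^sup>2) / 2)"
        unfolding exp_add[symmetric] using ab by simp
      then show ?thesis unfolding cg by (metis of_real_mult)
    qed
    finally show ?thesis by (simp add: cg)
  qed
  then have "?D = std_gauss" by (intro Levy_uniqueness[OF rd rg]) auto
  moreover have "distr (std_gauss \<Otimes>\<^sub>M std_gauss) std_gauss (\<lambda>(x, y). a * x + b * y) = ?D"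
    by (rule distr_cong) auto
  ultimately show ?thesis by simp
qed

section \<open>Cameron-Martin densities\<close>

abbreviation gauss :: "'i set \<Rightarrow> ('i \<Rightarrow> real) measure" where
  "gauss I \<equiv> PiM I (\<lambda>_. std_gauss)"

text \<open>The Cameron-Martin density of the law of \<open>Y + u\<close> with respect to pure noise
  \<open>Y\<close>; the Gibbs weights of both models are of this form.\<close>

definition cm_dens :: "'i set \<Rightarrow> ('i \<Rightarrow> real) \<Rightarrow> ('i \<Rightarrow> real) \<Rightarrow> real" where
  "cm_dens I u Y = exp ((\<Sum>i\<in>I. u i * Y i) - (\<Sum>i\<in>I. (u i)\<^sup>2) / 2)"

lemma cm_dens_pos [simp]: "cm_dens I u Y > 0" "cm_dens I u Y \<ge> 0" "cm_dens I u Y \<noteq> 0"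
  by (simp_all add: cm_dens_def)

lemma cm_dens_prod: "finite I \<Longrightarrow> cm_dens I u Y = (\<Prod>i\<in>I. exp (u i * Y i - (u i)\<^sup>2 / 2))"
  by (simp add: cm_dens_def exp_sum[symmetric] sum_subtractf sum_divide_distrib)

lemma cm_dens_measurable [measurable]: "cm_dens I u \<in> borel_measurable (gauss I)"
  unfolding cm_dens_def by measurable

interpretation gauss: product_prob_space "\<lambda>_. std_gauss" I for I :: "'i set"
  by (simp add: product_prob_space_def product_prob_space_axioms_def product_sigma_finite_def
      prob_space_imp_sigma_finite prob_space_std_gauss)

lemma prob_space_gauss: "prob_space (gauss I)"
  by (rule prob_space_PiM) (rule prob_space_std_gauss)

lemma measure_space_gauss [simp]: "measure (gauss I) (space (gauss I)) = 1"
  by (rule prob_space.prob_space[OF prob_space_gauss])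

lemma shift_measurable [measurable]: "(\<lambda>Y. \<lambda>i\<in>I. Y i + u i) \<in> measurable (gauss I) (gauss I)"
  by measurable

lemma density_cm_dens:
  assumes I: "finite I"
  shows "density (gauss I) (\<lambda>Y. ennreal (cm_dens I u Y)) = distr (gauss I) (gauss I) (\<lambda>Y. \<lambda>i\<in>I. Y i + u i)"
proof -
  \<comment> \<open>Both measures are identified with the product of the shifted one-dimensional
    laws \<open>S i\<close>, by their values on boxes.\<close>
  define S where "S i = distr std_gauss std_gauss (\<lambda>y. y + u i)" for i
  have ps: "prob_space (S i)" for i unfolding S_def by (rule std_gauss.prob_space_distr) simp
  interpret S: product_prob_space S I using ps by (simp add: product_prob_space_def product_prob_space_axioms_def product_sigma_finite_def prob_space_imp_sigma_finite)
  have sS: "sets (S i) = sets borel" for i by (simp add: S_def)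
  have sPi: "sets (gauss I) = sets (PiM I S)" by (intro sets_PiM_cong refl) (simp add: sS)
  have "density (gauss I) (\<lambda>Y. ennreal (cm_dens I u Y)) = PiM I S"
  proof (rule S.PiM_eqI[OF I])
    fix A assume A: "\<And>i. i \<in> I \<Longrightarrow> A i \<in> sets (S i)"
    then have A': "A i \<in> sets borel" if "i \<in> I" for i using that sS by auto
    have AA: "Pi\<^sub>E I A \<in> sets (gauss I)" using A' by (intro sets_PiM_I_finite I) auto
    have "emeasure (density (gauss I) (\<lambda>Y. ennreal (cm_dens I u Y))) (Pi\<^sub>E I A) = (\<integral>\<^sup>+Y. ennreal (cm_dens I u Y) * indicator (Pi\<^sub>E I A) Y \<partial>gauss I)"
      by (intro emeasure_density AA) measurable
    also have "\<dots> = (\<integral>\<^sup>+Y. (\<Prod>i\<in>I. ennreal (exp (u i * Y i - (u i)\<^sup>2 / 2)) * indicator (A i) (Y i)) \<partial>gauss I)"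
    proof (intro nn_integral_cong)
      fix Y assume Y: "Y \<in> space (gauss I)"
      have "(\<Prod>i\<in>I. indicator (A i) (Y i) :: ennreal) = indicator (Pi\<^sub>E I A) Y"
        using Y I by (auto simp: indicator_def space_PiM PiE_def Pi_def split: if_splits)
      then show "ennreal (cm_dens I u Y) * indicator (Pi\<^sub>E I A) Y = (\<Prod>i\<in>I. ennreal (exp (u i * Y i - (u i)\<^sup>2 / 2)) * indicator (A i) (Y i))"
        by (simp add: cm_dens_prod[OF I] prod.distrib prod_ennreal)
    qed
    also have "\<dots> = (\<Prod>i\<in>I. \<integral>\<^sup>+y. ennreal (exp (u i * y - (u i)\<^sup>2 / 2)) * indicator (A i) y \<partial>std_gauss)"
      using A' by (intro gauss.product_nn_integral_prod I) auto
    also have "\<dots> = (\<Prod>i\<in>I. emeasure (S i) (A i))"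
    proof (intro prod.cong refl)
      fix i assume i: "i \<in> I"
      note [measurable] = A'[OF i]
      have "(\<integral>\<^sup>+y. ennreal (exp (u i * y - (u i)\<^sup>2 / 2)) * indicator (A i) y \<partial>std_gauss) = (\<integral>\<^sup>+y. indicator (A i) (y + u i) \<partial>std_gauss)"
        by (rule nn_integral_std_gauss_shift) measurable
      also have "\<dots> = emeasure (S i) (A i)"
        unfolding S_def by (subst nn_integral_indicator[symmetric], simp) (subst nn_integral_distr, auto)
      finally show "(\<integral>\<^sup>+y. ennreal (exp (u i * y - (u i)\<^sup>2 / 2)) * indicator (A i) y \<partial>std_gauss) = emeasure (S i) (A i)" .
    qed
    finally show "emeasure (density (gauss I) (\<lambda>Y. ennreal (cm_dens I u Y))) (Pi\<^sub>E I A) = (\<Prod>i\<in>I. emeasure (S i) (A i))" .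
  qed (simp add: sPi)
  also have "PiM I S = distr (gauss I) (gauss I) (\<lambda>Y. \<lambda>i\<in>I. Y i + u i)"
  proof (rule S.PiM_eqI[OF I, symmetric])
    fix A assume A: "\<And>i. i \<in> I \<Longrightarrow> A i \<in> sets (S i)"
    then have A': "A i \<in> sets borel" if "i \<in> I" for i using that sS by auto
    have AA: "Pi\<^sub>E I A \<in> sets (gauss I)" using A' by (intro sets_PiM_I_finite I) auto
    have 1: "(\<lambda>Y. \<lambda>i\<in>I. Y i + u i) -` Pi\<^sub>E I A \<inter> space (gauss I) = Pi\<^sub>E I (\<lambda>i. (\<lambda>y. y + u i) -` A i)"
      by (auto simp: space_PiM PiE_def Pi_def extensional_def)
    have 2: "(\<lambda>y. y + u i) -` A i \<in> sets borel" if "i \<in> I" for i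
      using measurable_sets_borel[OF _ A'[OF that], of "\<lambda>y. y + u i"] by simp
    have "emeasure (distr (gauss I) (gauss I) (\<lambda>Y. \<lambda>i\<in>I. Y i + u i)) (Pi\<^sub>E I A) = emeasure (gauss I) (Pi\<^sub>E I (\<lambda>i. (\<lambda>y. y + u i) -` A i))"
      by (subst emeasure_distr[OF shift_measurable AA]) (simp add: 1)
    also have "\<dots> = (\<Prod>i\<in>I. emeasure (S i) (A i))"
      using 2 A' by (subst gauss.emeasure_PiM[OF I]) (auto simp: S_def emeasure_distr intro!: prod.cong)
    finally show "emeasure (distr (gauss I) (gauss I) (\<lambda>Y. \<lambda>i\<in>I. Y i + u i)) (Pi\<^sub>E I A) = (\<Prod>i\<in>I. emeasure (S i) (A i))" .
  qed (simp add: sPi)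
  finally show ?thesis .
qed

lemma integrable_exp_std_gauss: "integrable std_gauss (\<lambda>y. exp (k * y :: real))"
proof -
  have "(\<integral>\<^sup>+y. ennreal (exp (k * y)) \<partial>std_gauss) = (\<integral>\<^sup>+y. ennreal (exp (k * y - k\<^sup>2 / 2)) * ennreal (exp (k\<^sup>2 / 2)) \<partial>std_gauss)"
    by (intro nn_integral_cong) (simp add: ennreal_mult'[symmetric] exp_add[symmetric])
  also have "\<dots> = ennreal (exp (k\<^sup>2 / 2))"
    by (subst nn_integral_std_gauss_shift) (auto simp: std_gauss.emeasure_space_1[simplified])
  finally show ?thesis by (intro integrableI_bounded) auto
qed

lemma integral_exp_std_gauss: "(\<integral>y. exp (k * y) \<partial>std_gauss) = exp (k\<^sup>2 / 2)"
proof -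
  have "(\<integral>\<^sup>+y. ennreal (exp (k * y)) \<partial>std_gauss) = (\<integral>\<^sup>+y. ennreal (exp (k * y - k\<^sup>2 / 2)) * ennreal (exp (k\<^sup>2 / 2)) \<partial>std_gauss)"
    by (intro nn_integral_cong) (simp add: ennreal_mult'[symmetric] exp_add[symmetric])
  also have "\<dots> = ennreal (exp (k\<^sup>2 / 2))"
    by (subst nn_integral_std_gauss_shift) (auto simp: std_gauss.emeasure_space_1[simplified])
  finally show ?thesis by (subst integral_eq_nn_integral) auto
qed

section \<open>Domination by exponentials of the noise\<close>

definition l1_norm :: "'i set \<Rightarrow> ('i \<Rightarrow> real) \<Rightarrow> real" where
  "l1_norm I Y = (\<Sum>i\<in>I. \<bar>Y i\<bar>)"

lemma l1_norm_nonneg [simp]: "l1_norm I Y \<ge> 0" by (simp add: l1_norm_def sum_nonneg)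

lemma l1_norm_measurable [measurable]: "l1_norm I \<in> borel_measurable (gauss I)"
  unfolding l1_norm_def by measurable

text \<open>The sum of absolute values serves as norm because its exponential factorises over the
  coordinates, which reduces everything to one-dimensional exponential moments.\<close>

lemma integrable_exp_l1_norm:
  assumes "finite I" shows "integrable (gauss I) (\<lambda>Y. exp (k * l1_norm I Y))"
proof -
  have "integrable std_gauss (\<lambda>y. exp (k * \<bar>y\<bar>))"
  proof (rule Bochner_Integration.integrable_bound)
    show "integrable std_gauss (\<lambda>y. exp (k * y) + exp (- k * y))"
      by (intro Bochner_Integration.integrable_add integrable_exp_std_gauss)
    show "AE y in std_gauss. norm (exp (k * \<bar>y\<bar>)) \<le> norm (exp (k * y) + exp (- k * y))"
    proof (rule AE_I2)
      fix y
      have "exp (k * \<bar>y\<bar>) \<le> exp (k * y) + exp (- k * y)" by (cases "y \<ge> 0") auto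
      then show "norm (exp (k * \<bar>y\<bar>)) \<le> norm (exp (k * y) + exp (- k * y))" by simp
    qed
  qed auto
  then have "integrable (gauss I) (\<lambda>Y. \<Prod>i\<in>I. exp (k * \<bar>Y i\<bar>))"
    by (intro gauss.product_integrable_prod assms)
  then show ?thesis using assms by (simp add: l1_norm_def sum_distrib_left exp_sum)
qed

text \<open>All integrands below grow at most exponentially in the Gaussian variable \<open>n z\<close>.\<close>

definition exp_dominated :: "'i set \<Rightarrow> ('z \<Rightarrow> 'i \<Rightarrow> real) \<Rightarrow> ('z \<Rightarrow> real) \<Rightarrow> bool" where
  "exp_dominated I n f \<longleftrightarrow> (\<exists>K k. 0 \<le> K \<and> 0 \<le> k \<and> (\<forall>z. \<bar>f z\<bar> \<le> K * exp (k * l1_norm I (n z))))"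

lemma exp_dominatedI:
  assumes "\<And>z. \<bar>f z\<bar> \<le> K * exp (k * l1_norm I (n z))" "0 \<le> k"
  shows "exp_dominated I n f"
  unfolding exp_dominated_def
proof (rule exI[of _ "\<bar>K\<bar>"], rule exI[of _ k], intro conjI allI)
  fix z
  note assms(1)[of z]
  also have "K * exp (k * l1_norm I (n z)) \<le> \<bar>K\<bar> * exp (k * l1_norm I (n z))" by (intro mult_right_mono) auto
  finally show "\<bar>f z\<bar> \<le> \<bar>K\<bar> * exp (k * l1_norm I (n z))" .
qed (use assms in auto)

lemma exp_dominated_bounded: "(\<And>z. \<bar>f z\<bar> \<le> K) \<Longrightarrow> exp_dominated I n f"
  by (rule exp_dominatedI[of _ K 0]) auto

lemma exp_dominated_const [intro!, simp]: "exp_dominated I n (\<lambda>z. c)" by (rule exp_dominated_bounded) auto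

lemma exp_dominated_le: "exp_dominated I n g \<Longrightarrow> (\<And>z. \<bar>f z\<bar> \<le> \<bar>g z\<bar>) \<Longrightarrow> exp_dominated I n f"
  unfolding exp_dominated_def by (meson order_trans)

lemma exp_dominated_exp_l1_norm: "exp_dominated I n (\<lambda>z. exp (c * l1_norm I (n z)))"
  by (rule exp_dominatedI[of _ 1 "\<bar>c\<bar>"]) (auto intro: mult_right_mono)

lemma exp_dominated_l1_norm: "exp_dominated I n (\<lambda>z. l1_norm I (n z))"
proof (rule exp_dominatedI[of _ 1 1])
  fix z
  have "1 + l1_norm I (n z) \<le> exp (l1_norm I (n z))" by (rule exp_ge_add_one_self)
  then show "\<bar>l1_norm I (n z)\<bar> \<le> 1 * exp (1 * l1_norm I (n z))"
    unfolding mult_1 using l1_norm_nonneg[of I "n z"] by linarith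
qed simp

lemma exp_dominated_mult [intro]:
  assumes "exp_dominated I n f" "exp_dominated I n g" shows "exp_dominated I n (\<lambda>z. f z * g z)"
proof -
  obtain K k where 1: "0 \<le> K" "0 \<le> k" "\<And>z. \<bar>f z\<bar> \<le> K * exp (k * l1_norm I (n z))" using assms(1) unfolding exp_dominated_def by auto
  obtain K' k' where 2: "0 \<le> K'" "0 \<le> k'" "\<And>z. \<bar>g z\<bar> \<le> K' * exp (k' * l1_norm I (n z))" using assms(2) unfolding exp_dominated_def by auto
  show ?thesis
  proof (rule exp_dominatedI[of _ "K * K'" "k + k'"])
    fix z show "\<bar>f z * g z\<bar> \<le> K * K' * exp ((k + k') * l1_norm I (n z))"
      unfolding abs_mult distrib_right exp_add
      using mult_mono[OF 1(3)[of z] 2(3)[of z]] 1(1) by (simp add: mult_ac)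
  qed (use 1 2 in auto)
qed

lemma exp_dominated_add [intro]:
  assumes "exp_dominated I n f" "exp_dominated I n g" shows "exp_dominated I n (\<lambda>z. f z + g z)"
proof -
  obtain K k where 1: "0 \<le> K" "0 \<le> k" "\<And>z. \<bar>f z\<bar> \<le> K * exp (k * l1_norm I (n z))" using assms(1) unfolding exp_dominated_def by auto
  obtain K' k' where 2: "0 \<le> K'" "0 \<le> k'" "\<And>z. \<bar>g z\<bar> \<le> K' * exp (k' * l1_norm I (n z))" using assms(2) unfolding exp_dominated_def by auto
  show ?thesis
  proof (rule exp_dominatedI[of _ "K + K'" "k + k'"])
    fix z
    have "K * exp (k * l1_norm I (n z)) \<le> K * exp ((k + k') * l1_norm I (n z))"
      using 1(1,2) 2(1,2) by (intro mult_left_mono iffD2[OF exp_le_cancel_iff] mult_right_mono) auto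
    moreover have "K' * exp (k' * l1_norm I (n z)) \<le> K' * exp ((k + k') * l1_norm I (n z))"
      using 1(1,2) 2(1,2) by (intro mult_left_mono iffD2[OF exp_le_cancel_iff] mult_right_mono) auto
    ultimately show "\<bar>f z + g z\<bar> \<le> (K + K') * exp ((k + k') * l1_norm I (n z))"
      using 1(3)[of z] 2(3)[of z] abs_triangle_ineq[of "f z" "g z"] by (simp add: distrib_right)
  qed (use 1 2 in auto)
qed

lemma exp_dominated_uminus [intro]: "exp_dominated I n f \<Longrightarrow> exp_dominated I n (\<lambda>z. - f z)"
  by (erule exp_dominated_le) simp

lemma exp_dominated_diff [intro]: "exp_dominated I n f \<Longrightarrow> exp_dominated I n g \<Longrightarrow> exp_dominated I n (\<lambda>z. f z - g z)"
  using exp_dominated_add[OF _ exp_dominated_uminus] by fastforce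

lemma exp_dominated_power [intro]: "exp_dominated I n f \<Longrightarrow> exp_dominated I n (\<lambda>z. f z ^ k)"
  by (induction k) auto

lemma exp_dominated_integrable:
  assumes "finite I" "f \<in> borel_measurable (gauss I)" "exp_dominated I (\<lambda>Y. Y) f"
  shows "integrable (gauss I) f"
proof -
  obtain K k where 1: "0 \<le> K" "0 \<le> k" "\<And>z. \<bar>f z\<bar> \<le> K * exp (k * l1_norm I z)" using assms(3) unfolding exp_dominated_def by auto
  show ?thesis
  proof (rule Bochner_Integration.integrable_bound)
    show "integrable (gauss I) (\<lambda>z. K * exp (k * l1_norm I z))" using integrable_exp_l1_norm[OF assms(1)] by simp
    show "AE z in gauss I. norm (f z) \<le> norm (K * exp (k * l1_norm I z))" using 1 by (auto simp: abs_mult)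
  qed fact
qed

lemma exp_dominated_integrable_pair:
  assumes "finite I" "prob_space N" "f \<in> borel_measurable (gauss I \<Otimes>\<^sub>M N)" "exp_dominated I fst f"
  shows "integrable (gauss I \<Otimes>\<^sub>M N) f"
proof -
  interpret N: prob_space N by fact
  interpret P: pair_prob_space "gauss I" N ..
  obtain K k where 1: "0 \<le> K" "0 \<le> k" "\<And>z. \<bar>f z\<bar> \<le> K * exp (k * l1_norm I (fst z))" using assms(4) unfolding exp_dominated_def by auto
  have i: "integrable (gauss I) (\<lambda>z. K * exp (k * l1_norm I z))" using integrable_exp_l1_norm[OF assms(1)] by simp
  have "integrable (distr (gauss I \<Otimes>\<^sub>M N) (gauss I) fst) (\<lambda>z. K * exp (k * l1_norm I z))"
    using i by (simp add: N.distr_pair_fst)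
  then have i2: "integrable (gauss I \<Otimes>\<^sub>M N) (\<lambda>z. K * exp (k * l1_norm I (fst z)))"
    by (subst (asm) integrable_distr_eq) auto
  show ?thesis
    by (rule Bochner_Integration.integrable_bound[OF i2 assms(3)]) (use 1 in \<open>auto simp: abs_mult\<close>)
qed

lemma exp_dominated_swap:
  assumes "finite I" "prob_space N" "(\<lambda>(Y, \<sigma>). f Y \<sigma>) \<in> borel_measurable (gauss I \<Otimes>\<^sub>M N)"
    "exp_dominated I fst (\<lambda>(Y, \<sigma>). f Y \<sigma>)"
  shows "(\<integral>Y. \<integral>\<sigma>. f Y \<sigma> \<partial>N \<partial>gauss I) = (\<integral>\<sigma>. \<integral>Y. f Y \<sigma> \<partial>gauss I \<partial>N)"
proof -
  interpret N: prob_space N by fact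
  interpret P: pair_prob_space "gauss I" N ..
  show ?thesis
    using P.Fubini_integral[of f] exp_dominated_integrable_pair[OF assms] by (simp add: split_beta')
qed

lemma (in prob_space) abs_integral_le:
  assumes "\<And>x. \<bar>f x\<bar> \<le> (B::real)" shows "\<bar>\<integral>x. f x \<partial>M\<bar> \<le> B"
proof (cases "integrable M f")
  case True
  have "(\<integral>x. f x \<partial>M) \<le> (\<integral>x. B \<partial>M)" using assms by (intro integral_mono True) (auto simp: abs_le_iff)
  moreover have "(\<integral>x. - B \<partial>M) \<le> (\<integral>x. f x \<partial>M)" using assms by (intro integral_mono True) (auto simp: abs_le_iff minus_le_iff)
  ultimately show ?thesis by (simp add: prob_space)
next
  \<comment> \<open>A non-integrable function has integral 0, and \<open>B\<close> is nonnegative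
    because it bounds an absolute value.\<close>
  case False
  then show ?thesis using assms[of undefined] by (simp add: not_integrable_integral_eq)
qed

lemma exp_dominated_integral:
  assumes "prob_space N" "exp_dominated I fst (\<lambda>(Y, \<sigma>). f Y \<sigma>)"
  shows "exp_dominated I (\<lambda>Y. Y) (\<lambda>Y. \<integral>\<sigma>. f Y \<sigma> \<partial>N)"
proof -
  interpret N: prob_space N by fact
  obtain K k where 1: "0 \<le> K" "0 \<le> k" "\<And>Y \<sigma>. \<bar>f Y \<sigma>\<bar> \<le> K * exp (k * l1_norm I Y)" using assms(2) unfolding exp_dominated_def by auto
  show ?thesis by (rule exp_dominatedI[of _ K k]) (use 1 N.abs_integral_le[OF 1(3)] in auto)
qed

lemma abs_lin_le:
  assumes "finite I" "\<And>i. i \<in> I \<Longrightarrow> \<bar>u i\<bar> \<le> c"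
  shows "\<bar>\<Sum>i\<in>I. u i * Y i\<bar> \<le> c * l1_norm I Y"
proof -
  have "\<bar>\<Sum>i\<in>I. u i * Y i\<bar> \<le> (\<Sum>i\<in>I. \<bar>u i * Y i\<bar>)" by (rule sum_abs)
  also have "\<dots> \<le> (\<Sum>i\<in>I. c * \<bar>Y i\<bar>)"
    by (intro sum_mono) (auto simp: abs_mult intro!: mult_right_mono assms)
  finally show ?thesis by (simp add: l1_norm_def sum_distrib_left)
qed

text \<open>The two-sided bound makes the logarithm of any average of such densities grow at most
  linearly in \<open>l1_norm\<close>.\<close>

lemma cm_dens_bounds:
  assumes "finite I" "\<And>i. i \<in> I \<Longrightarrow> \<bar>u i\<bar> \<le> c"
  shows "cm_dens I u Y \<le> exp (c * l1_norm I Y)" "exp (- (c * l1_norm I Y + c\<^sup>2 * card I / 2)) \<le> cm_dens I u Y"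
proof -
  have 1: "0 \<le> (\<Sum>i\<in>I. (u i)\<^sup>2)" by (simp add: sum_nonneg)
  have "(u i)\<^sup>2 \<le> c\<^sup>2" if "i \<in> I" for i using assms(2)[OF that] by (metis abs_ge_zero power2_abs power_mono)
  then have 2: "(\<Sum>i\<in>I. (u i)\<^sup>2) \<le> c\<^sup>2 * card I" using sum_bounded_above[of I "\<lambda>i. (u i)\<^sup>2" "c\<^sup>2"] by (simp add: mult.commute)
  note 3 = abs_lin_le[of I u c Y, OF assms]
  show "cm_dens I u Y \<le> exp (c * l1_norm I Y)" unfolding cm_dens_def using 1 3 by (simp add: abs_le_iff)
  show "exp (- (c * l1_norm I Y + c\<^sup>2 * card I / 2)) \<le> cm_dens I u Y" unfolding cm_dens_def using 2 3 by (simp add: abs_le_iff)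
qed

lemma exp_dominated_cm_dens:
  assumes "finite I" "\<And>z i. i \<in> I \<Longrightarrow> \<bar>u z i\<bar> \<le> c"
  shows "exp_dominated I n (\<lambda>z. cm_dens I (u z) (n z))"
  by (rule exp_dominated_le[OF exp_dominated_exp_l1_norm[of I n c]]) (use cm_dens_bounds(1)[of I "u z" c for z] assms in auto)

lemma cm_dens_shift: "cm_dens I u (\<lambda>i\<in>I. Y i + w i) = cm_dens I u Y * exp (\<Sum>i\<in>I. u i * w i)"
  by (simp add: cm_dens_def exp_add[symmetric] distrib_left sum.distrib algebra_simps)

text \<open>The cross term is the only interaction between two signals seen in the same noise; it
  vanishes for signals on disjoint coordinates.\<close>

lemma cm_dens_add: "cm_dens I (\<lambda>i. u i + w i) Y = cm_dens I u Y * cm_dens I w Y * exp (- (\<Sum>i\<in>I. u i * w i))"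
  by (simp add: cm_dens_def exp_add[symmetric] power2_sum sum.distrib algebra_simps sum_distrib_left add_divide_distrib)

lemma cm_dens_cong: "(\<And>i. i \<in> I \<Longrightarrow> u i = u' i) \<Longrightarrow> (\<And>i. i \<in> I \<Longrightarrow> Y i = Y' i) \<Longrightarrow> cm_dens I u Y = cm_dens I u' Y'"
  by (simp add: cm_dens_def)

lemma integral_cm_dens_mult:
  fixes F :: "('i \<Rightarrow> real) \<Rightarrow> real"
  assumes "finite I" and [measurable]: "F \<in> borel_measurable (gauss I)"
  shows "(\<integral>Y. cm_dens I u Y * F Y \<partial>gauss I) = (\<integral>Y. F (\<lambda>i\<in>I. Y i + u i) \<partial>gauss I)"
proof -
  have "(\<integral>Y. cm_dens I u Y * F Y \<partial>gauss I) = (\<integral>Y. F Y \<partial>density (gauss I) (\<lambda>Y. ennreal (cm_dens I u Y)))"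
    by (subst integral_density) auto
  also have "\<dots> = (\<integral>Y. F (\<lambda>i\<in>I. Y i + u i) \<partial>gauss I)"
    unfolding density_cm_dens[OF assms(1)] by (subst integral_distr) auto
  finally show ?thesis .
qed

lemma nn_integral_cm_dens_mult:
  assumes "finite I" and [measurable]: "F \<in> borel_measurable (gauss I)"
  shows "(\<integral>\<^sup>+Y. ennreal (cm_dens I u Y) * F Y \<partial>gauss I) = (\<integral>\<^sup>+Y. F (\<lambda>i\<in>I. Y i + u i) \<partial>gauss I)"
proof -
  have "(\<integral>\<^sup>+Y. ennreal (cm_dens I u Y) * F Y \<partial>gauss I) = (\<integral>\<^sup>+Y. F Y \<partial>density (gauss I) (\<lambda>Y. ennreal (cm_dens I u Y)))"
    by (subst nn_integral_density) auto
  also have "\<dots> = (\<integral>\<^sup>+Y. F (\<lambda>i\<in>I. Y i + u i) \<partial>gauss I)"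
    unfolding density_cm_dens[OF assms(1)] by (subst nn_integral_distr) auto
  finally show ?thesis .
qed

lemma integral_cm_dens: "finite I \<Longrightarrow> (\<integral>Y. cm_dens I u Y \<partial>gauss I) = 1"
  using integral_cm_dens_mult[of I "\<lambda>_. 1" u] measure_space_gauss[of I] by simp

lemma integral_cm_dens_cm_dens: "finite I \<Longrightarrow> (\<integral>Y. cm_dens I u Y * cm_dens I w Y \<partial>gauss I) = exp (\<Sum>i\<in>I. u i * w i)"
  using integral_cm_dens_mult[of I "cm_dens I w" u] integral_cm_dens[of I w] by (simp add: cm_dens_shift mult.commute)

section \<open>Mixture likelihoods and concentration\<close>

text \<open>The bound is demanded for every \<open>\<sigma>\<close> and not only almost surely, so
  that domination involves no null sets; the spins are clipped for this reason.\<close>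

definition bounded_feat :: "'i set \<Rightarrow> 's measure \<Rightarrow> real \<Rightarrow> ('s \<Rightarrow> 'i \<Rightarrow> real) \<Rightarrow> bool" where
  "bounded_feat I M c v \<longleftrightarrow> finite I \<and> prob_space M \<and> 0 \<le> c \<and> (\<forall>i\<in>I. (\<lambda>\<sigma>. v \<sigma> i) \<in> borel_measurable M) \<and>
     (\<forall>\<sigma>. \<forall>i\<in>I. \<bar>v \<sigma> i\<bar> \<le> c)"

definition mix_lik :: "'i set \<Rightarrow> 's measure \<Rightarrow> ('s \<Rightarrow> 'i \<Rightarrow> real) \<Rightarrow> ('i \<Rightarrow> real) \<Rightarrow> real" where
  "mix_lik I M v Y = (\<integral>\<sigma>. cm_dens I (v \<sigma>) Y \<partial>M)"

text \<open>Taken without the minus sign: it is minus the relative entropy of pure noise with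
  respect to the planted law, hence nonpositive.\<close>

definition null_ent :: "'i set \<Rightarrow> 's measure \<Rightarrow> ('s \<Rightarrow> 'i \<Rightarrow> real) \<Rightarrow> real" where
  "null_ent I M v = (\<integral>Y. ln (mix_lik I M v Y) \<partial>gauss I)"

text \<open>The relative entropy of the planted law with respect to pure noise.\<close>

definition planted_ent :: "'i set \<Rightarrow> 's measure \<Rightarrow> ('s \<Rightarrow> 'i \<Rightarrow> real) \<Rightarrow> real" where
  "planted_ent I M v = (\<integral>Y. mix_lik I M v Y * ln (mix_lik I M v Y) \<partial>gauss I)"

lemma cm_dens_joint_measurable:
  assumes "finite I" "\<And>i. i \<in> I \<Longrightarrow> (\<lambda>z. u z i) \<in> borel_measurable Q" "\<And>i. i \<in> I \<Longrightarrow> (\<lambda>z. y z i) \<in> borel_measurable Q"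
  shows "(\<lambda>z. cm_dens I (u z) (y z)) \<in> borel_measurable Q"
  unfolding cm_dens_def using assms by measurable

text \<open>Jensen's inequality for the probability density \<open>L\<close>, from the tangent of
  \<open>exp\<close> at the mean. It is applied with planted densities, with posterior densities and
  with the constant weight 1.\<close>

lemma exp_integral_le_weighted:
  fixes L X :: "'y \<Rightarrow> real"
  assumes "integrable M L" "(\<integral>y. L y \<partial>M) = 1" "\<And>y. L y \<ge> 0"
    "integrable M (\<lambda>y. L y * X y)" "integrable M (\<lambda>y. L y * exp (X y))"
  shows "exp (\<integral>y. L y * X y \<partial>M) \<le> (\<integral>y. L y * exp (X y) \<partial>M)"
proof -
  define m where "m = (\<integral>y. L y * X y \<partial>M)"
  have "(\<integral>y. exp m * (L y + (L y * X y - m * L y)) \<partial>M) \<le> (\<integral>y. L y * exp (X y) \<partial>M)"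
  proof (intro integral_mono)
    fix y
    have "exp m * (1 + (X y - m)) \<le> exp m * exp (X y - m)"
      by (intro mult_left_mono exp_ge_add_one_self) auto
    then have "exp m * (1 + (X y - m)) \<le> exp (X y)" by (simp add: exp_add[symmetric])
    then have "L y * (exp m * (1 + (X y - m))) \<le> L y * exp (X y)" using assms(3) by (intro mult_left_mono)
    then show "exp m * (L y + (L y * X y - m * L y)) \<le> L y * exp (X y)" by (simp add: algebra_simps)
  qed (use assms in auto)
  also have "(\<integral>y. exp m * (L y + (L y * X y - m * L y)) \<partial>M) = exp m"
    using assms by (simp add: m_def)
  finally show ?thesis by (simp add: m_def)
qed

context
  fixes I :: "'i set" and M :: "'s measure" and c :: real and v :: "'s \<Rightarrow> 'i \<Rightarrow> real"
  assumes bf: "bounded_feat I M c v"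
begin

lemma bounded_featD: "finite I" "prob_space M" "0 \<le> c" "\<And>i. i \<in> I \<Longrightarrow> (\<lambda>\<sigma>. v \<sigma> i) \<in> borel_measurable M"
  "\<And>\<sigma> i. i \<in> I \<Longrightarrow> \<bar>v \<sigma> i\<bar> \<le> c"
  using bf unfolding bounded_feat_def by auto

interpretation M: prob_space M by (rule bounded_featD)

lemma cm_dens_feat_measurable: "(\<lambda>z. cm_dens I (v (snd z)) (fst z)) \<in> borel_measurable (gauss I \<Otimes>\<^sub>M M)"
  by (intro cm_dens_joint_measurable bounded_featD measurable_compose[OF measurable_snd bounded_featD(4)]) auto

lemma cm_dens_feat_measurable1: "(\<lambda>\<sigma>. cm_dens I (v \<sigma>) Y) \<in> borel_measurable M"
  by (intro cm_dens_joint_measurable bounded_featD) auto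

lemma cm_dens_feat_integrable: "integrable M (\<lambda>\<sigma>. cm_dens I (v \<sigma>) Y)"
  by (rule M.integrable_const_bound[where B="exp (c * l1_norm I Y)", OF _ cm_dens_feat_measurable1]) (simp add: cm_dens_bounds bounded_featD)

lemma mix_lik_measurable [measurable]: "mix_lik I M v \<in> borel_measurable (gauss I)"
  unfolding mix_lik_def using cm_dens_feat_measurable by (intro M.borel_measurable_lebesgue_integral) (simp add: split_beta')

lemma mix_lik_le: "mix_lik I M v Y \<le> exp (c * l1_norm I Y)"
proof -
  have "mix_lik I M v Y \<le> (\<integral>\<sigma>. exp (c * l1_norm I Y) \<partial>M)"
    unfolding mix_lik_def by (intro integral_mono cm_dens_feat_integrable) (auto simp: cm_dens_bounds bounded_featD)
  then show ?thesis by (simp add: M.prob_space)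
qed

lemma mix_lik_ge: "exp (- (c * l1_norm I Y + c\<^sup>2 * card I / 2)) \<le> mix_lik I M v Y"
proof -
  have "(\<integral>\<sigma>. exp (- (c * l1_norm I Y + c\<^sup>2 * card I / 2)) \<partial>M) \<le> mix_lik I M v Y"
    unfolding mix_lik_def using cm_dens_bounds(2)[of I, OF bounded_featD(1,5)] by (intro integral_mono cm_dens_feat_integrable) auto
  then show ?thesis by (simp add: M.prob_space)
qed

lemma mix_lik_pos: "0 < mix_lik I M v Y" using mix_lik_ge[of Y] by (meson exp_gt_zero less_le_trans)

lemma abs_ln_mix_lik_le: "\<bar>ln (mix_lik I M v Y)\<bar> \<le> c * l1_norm I Y + c\<^sup>2 * card I / 2"
proof -
  have "0 \<le> c\<^sup>2 * card I / 2" by simp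
  moreover have "ln (mix_lik I M v Y) \<le> c * l1_norm I Y" using mix_lik_le[of Y] mix_lik_pos[of Y] by (metis ln_exp ln_le_cancel_iff exp_gt_zero)
  moreover have "- (c * l1_norm I Y + c\<^sup>2 * card I / 2) \<le> ln (mix_lik I M v Y)" using mix_lik_ge[of Y] mix_lik_pos[of Y] by (metis ln_exp ln_le_cancel_iff exp_gt_zero)
  ultimately show ?thesis unfolding abs_le_iff by linarith
qed

lemma exp_dominated_ln_mix_lik: "exp_dominated I n (\<lambda>z. ln (mix_lik I M v (n z)))"
proof (rule exp_dominated_le)
  show "exp_dominated I n (\<lambda>z. c * l1_norm I (n z) + c\<^sup>2 * card I / 2)"
    by (intro exp_dominated_add exp_dominated_mult exp_dominated_l1_norm exp_dominated_const)
  show "\<bar>ln (mix_lik I M v (n z))\<bar> \<le> \<bar>c * l1_norm I (n z) + c\<^sup>2 * card I / 2\<bar>" for z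
    using abs_ln_mix_lik_le[of "n z"] by simp
qed

lemma exp_dominated_mix_lik: "exp_dominated I n (\<lambda>z. mix_lik I M v (n z))"
  by (rule exp_dominated_le[OF exp_dominated_exp_l1_norm[of I n c]]) (use mix_lik_le mix_lik_pos in \<open>auto simp: less_imp_le\<close>)

lemma exp_dominated_exp_ln_mix_lik: "exp_dominated I n (\<lambda>z. exp (s * ln (mix_lik I M v (n z))))"
proof (rule exp_dominatedI[of _ "exp (\<bar>s\<bar> * (c\<^sup>2 * card I / 2))" "\<bar>s\<bar> * c"])
  fix z
  have "s * ln (mix_lik I M v (n z)) \<le> \<bar>s\<bar> * (c * l1_norm I (n z) + c\<^sup>2 * card I / 2)"
    using mult_left_mono[OF abs_ln_mix_lik_le[of "n z"], of "\<bar>s\<bar>"] abs_ge_self[of "s * ln (mix_lik I M v (n z))"]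
    by (simp add: abs_mult)
  then show "\<bar>exp (s * ln (mix_lik I M v (n z)))\<bar> \<le> exp (\<bar>s\<bar> * (c\<^sup>2 * card I / 2)) * exp (\<bar>s\<bar> * c * l1_norm I (n z))"
    by (simp add: exp_add[symmetric] algebra_simps)
qed (use bounded_featD in auto)

lemma exp_dominated_inverse_mix_lik: "exp_dominated I n (\<lambda>z. 1 / mix_lik I M v (n z))"
  using exp_dominated_exp_ln_mix_lik[of n "-1"] mix_lik_pos by (simp add: exp_minus inverse_eq_divide)

lemma integrable_mix_lik: "integrable (gauss I) (mix_lik I M v)"
  by (intro exp_dominated_integrable bounded_featD mix_lik_measurable exp_dominated_mix_lik)

lemma integral_mix_lik: "(\<integral>Y. mix_lik I M v Y \<partial>gauss I) = 1"
proof -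
  have "(\<integral>Y. mix_lik I M v Y \<partial>gauss I) = (\<integral>\<sigma>. \<integral>Y. cm_dens I (v \<sigma>) Y \<partial>gauss I \<partial>M)"
    unfolding mix_lik_def
    by (intro exp_dominated_swap bounded_featD) (use cm_dens_feat_measurable exp_dominated_cm_dens[of I "\<lambda>z. v (snd z)" c fst] bounded_featD in \<open>auto simp: split_beta'\<close>)
  also have "\<dots> = 1" by (simp add: integral_cm_dens bounded_featD M.prob_space)
  finally show ?thesis .
qed

lemma integrable_ln_mix_lik: "integrable (gauss I) (\<lambda>Y. ln (mix_lik I M v Y))"
  by (intro exp_dominated_integrable bounded_featD exp_dominated_ln_mix_lik borel_measurable_ln mix_lik_measurable)

lemma integrable_mix_lik_ln_mix_lik: "integrable (gauss I) (\<lambda>Y. mix_lik I M v Y * ln (mix_lik I M v Y))"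
  by (intro exp_dominated_integrable bounded_featD exp_dominated_mult exp_dominated_mix_lik exp_dominated_ln_mix_lik borel_measurable_times borel_measurable_ln mix_lik_measurable)

text \<open>From \<open>x * ln x \<ge> x - 1\<close> and the fact that the likelihood has null mean
  1.\<close>

lemma planted_ent_nonneg: "planted_ent I M v \<ge> 0"
proof -
  have "(\<integral>Y. mix_lik I M v Y - 1 \<partial>gauss I) \<le> planted_ent I M v"
    unfolding planted_ent_def
  proof (intro integral_mono integrable_mix_lik_ln_mix_lik)
    show "integrable (gauss I) (\<lambda>Y. mix_lik I M v Y - 1)" using integrable_mix_lik by simp
    fix Y
    have "ln (1 / mix_lik I M v Y) \<le> 1 / mix_lik I M v Y - 1" using mix_lik_pos[of Y] by (intro ln_le_minus_one) simp
    then have "1 - 1 / mix_lik I M v Y \<le> ln (mix_lik I M v Y)" using mix_lik_pos[of Y] by (simp add: ln_div)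
    then have "mix_lik I M v Y * (1 - 1 / mix_lik I M v Y) \<le> mix_lik I M v Y * ln (mix_lik I M v Y)" using mix_lik_pos[of Y] by (intro mult_left_mono) auto
    then show "mix_lik I M v Y - 1 \<le> mix_lik I M v Y * ln (mix_lik I M v Y)" using mix_lik_pos[of Y] by (simp add: algebra_simps)
  qed
  then show ?thesis using integrable_mix_lik by (simp add: integral_mix_lik)
qed

lemma null_ent_nonpos: "null_ent I M v \<le> 0"
proof -
  have "null_ent I M v \<le> (\<integral>Y. mix_lik I M v Y - 1 \<partial>gauss I)"
    unfolding null_ent_def using integrable_mix_lik
    by (intro integral_mono integrable_ln_mix_lik) (auto simp: mix_lik_pos intro!: ln_le_minus_one)
  then show ?thesis using integrable_mix_lik by (simp add: integral_mix_lik)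
qed

end

section \<open>Exponential moments of a function and of its negative\<close>

lemma cosh_le_exp_square: "cosh (x::real) \<le> exp (x\<^sup>2)"
proof -
  have "cosh y \<le> exp (y\<^sup>2)" if "0 \<le> y" for y :: real
  proof (cases "y \<le> 1")
    case True
    have "exp y \<le> 1 + y + y\<^sup>2" using that True by (rule exp_bound)
    moreover have "exp (- y) \<le> 1 - y + y\<^sup>2 / 2"
    proof -
      have "1 + y + y\<^sup>2 / 2 \<le> exp y" using exp_lower_Taylor_quadratic[OF that] by simp
      then have "exp (- y) * (1 + y + y\<^sup>2 / 2) \<le> 1" by (simp add: exp_minus field_simps)
      moreover have "1 \<le> (1 - y + y\<^sup>2 / 2) * (1 + y + y\<^sup>2 / 2)"
      proof -
        have "(1 - y + y\<^sup>2 / 2) * (1 + y + y\<^sup>2 / 2) = 1 + y^4 / 4" by (simp add: field_simps power2_eq_square power4_eq_xxxx)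
        then show ?thesis by simp
      qed
      ultimately have "exp (- y) * (1 + y + y\<^sup>2 / 2) \<le> (1 - y + y\<^sup>2 / 2) * (1 + y + y\<^sup>2 / 2)" by linarith
      moreover have "0 < 1 + y + y\<^sup>2 / 2" using that by (simp add: add_pos_nonneg)
      ultimately show ?thesis by (simp add: mult_le_cancel_right)
    qed
    moreover have "cosh y = (exp y + exp (- y)) / 2" by (simp add: cosh_def)
    ultimately have "cosh y \<le> 1 + y\<^sup>2" using zero_le_power2[of y] by argo
    then show ?thesis using exp_ge_add_one_self[of "y\<^sup>2"] by linarith
  next
    case False
    have "exp (- y) \<le> exp y" using that by simp
    then have "cosh y \<le> exp y" by (simp add: cosh_def)
    also have "\<dots> \<le> exp (y\<^sup>2)" using False by (simp add: power2_eq_square)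
    finally show ?thesis .
  qed
  from this[of "\<bar>x\<bar>"] show ?thesis by (simp add: cosh_real_abs)
qed

text \<open>The conventions for \<open>inverse\<close> cover the extreme values: for
  \<open>a = 0\<close> the right side is infinite because \<open>C\<close> is positive, and for
  infinite \<open>a\<close> the hypothesis forces \<open>b = 0\<close>.\<close>

lemma ennreal_le_mult_inverse:
  fixes a b :: ennreal
  assumes "a * b \<le> ennreal C" "0 < C"
  shows "b \<le> ennreal C * inverse a"
proof -
  consider "a = 0" | "a = \<top>" | r where "0 < r" "a = ennreal r"
    by (cases a) (auto simp: less_le)
  then show ?thesis
  proof cases
    case 1 then show ?thesis using assms(2) by simp
  next
    case 2
    then have "b = 0" using assms(1) by (cases "b = 0") (auto simp: top_unique)
    then show ?thesis by simp
  next
    case 3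
    have "b = inverse a * (a * b)" using 3
      by (simp add: mult.assoc[symmetric] inverse_ennreal ennreal_mult'[symmetric])
    also have "\<dots> \<le> inverse a * ennreal C" using assms(1) by (rule mult_left_mono) simp
    finally show ?thesis by (simp add: mult.commute)
  qed
qed

text \<open>With \<open>t = ln a - ln b\<close> the left side is \<open>2 * cosh t\<close>, and the
  hypotheses say that \<open>\<bar>t\<bar>\<close> is at most \<open>d\<close>; the values zero and
  infinity occur only for both numbers at once.\<close>

lemma ennreal_ratio_add_inverse_le:
  fixes a b :: ennreal
  assumes "a \<le> ennreal (exp d) * b" "b \<le> ennreal (exp d) * a"
  shows "a * inverse b + b * inverse a \<le> ennreal (2 * cosh d)"
proof -
  consider "b = 0" | "b = \<top>" | "b \<noteq> 0" "b \<noteq> \<top>" by auto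
  then show ?thesis
  proof cases
    case 1 then have "a = 0" using assms(1) by simp then show ?thesis using 1 by simp
  next
    case 2 then have "a = \<top>" using assms(2) by (simp add: ennreal_mult_eq_top_iff top_unique)
    then show ?thesis using 2 by simp
  next
    case 3
    then have "a \<noteq> 0" "a \<noteq> \<top>" using assms by (auto simp: ennreal_mult_eq_top_iff top_unique)
    then obtain x y where xy: "a = ennreal x" "b = ennreal y" "0 < x" "0 < y"
      using 3 by (cases a; cases b) auto
    have 1: "x \<le> exp d * y" "y \<le> exp d * x" using assms xy by (auto simp: ennreal_mult'[symmetric] mult_nonneg_nonneg)
    define t where "t = ln x - ln y"
    have "ln x \<le> ln (exp d * y)" "ln y \<le> ln (exp d * x)" using 1 xy by auto
    then have t: "\<bar>t\<bar> \<le> d" using xy by (simp add: t_def ln_mult)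
    have "x / y = exp t" "y / x = exp (- t)" using xy by (simp_all add: t_def exp_diff exp_minus)
    then have "x / y + y / x = 2 * cosh t" by (simp add: cosh_def)
    also have "\<dots> \<le> 2 * cosh d"
    proof -
      have "cosh \<bar>t\<bar> \<le> cosh d" using t by (subst cosh_real_nonneg_le_iff) auto
      then show ?thesis by simp
    qed
    finally show ?thesis using xy by (simp add: inverse_ennreal ennreal_mult'[symmetric] ennreal_plus[symmetric] divide_inverse del: ennreal_plus)
  qed
qed

text \<open>Bounding the product of the exponential moments of \<open>f\<close> and \<open>-f\<close>, instead of the moment of
  the centred variable, tensorises without any reference to the mean of \<open>f\<close>.\<close>

lemma nn_integral_mult_inverse_le:
  assumes "prob_space M" and F[measurable]: "F \<in> borel_measurable M"
    and d: "\<And>x y. x \<in> space M \<Longrightarrow> y \<in> space M \<Longrightarrow> F x \<le> ennreal (exp (d x y)) * F y"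
    and sym: "\<And>x y. d x y = d y x"
    and dm[measurable]: "(\<lambda>(x, y). d x y) \<in> borel_measurable (M \<Otimes>\<^sub>M M)"
    and C: "(\<integral>\<^sup>+x. \<integral>\<^sup>+y. ennreal (cosh (d x y)) \<partial>M \<partial>M) \<le> ennreal C"
  shows "(\<integral>\<^sup>+x. F x \<partial>M) * (\<integral>\<^sup>+x. inverse (F x) \<partial>M) \<le> ennreal C"
proof -
  interpret prob_space M by fact
  let ?a = "(\<integral>\<^sup>+x. F x \<partial>M) * (\<integral>\<^sup>+x. inverse (F x) \<partial>M)"
  have [measurable]: "(\<lambda>p. cosh (d (fst p) (snd p))) \<in> borel_measurable (M \<Otimes>\<^sub>M M)"
    using dm unfolding cosh_def by (simp add: split_beta')
  have cm: "(\<lambda>y. cosh (d x y)) \<in> borel_measurable M" if "x \<in> space M" for x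
    using measurable_compose[OF measurable_Pair1'[OF that] dm] unfolding cosh_def by simp
  have 1: "?a = (\<integral>\<^sup>+x. \<integral>\<^sup>+y. F x * inverse (F y) \<partial>M \<partial>M)"
    by (simp add: nn_integral_cmult nn_integral_multc)
  have 2: "?a = (\<integral>\<^sup>+x. \<integral>\<^sup>+y. F y * inverse (F x) \<partial>M \<partial>M)"
    by (simp add: nn_integral_cmult nn_integral_multc mult.commute)
  \<comment> \<open>Symmetrising over two independent copies \<open>x\<close> and \<open>y\<close>
    produces a ratio plus its inverse, which is controlled by the increment \<open>d x y\<close>
    alone.\<close>
  have "?a + ?a = (\<integral>\<^sup>+x. \<integral>\<^sup>+y. F x * inverse (F y) + F y * inverse (F x) \<partial>M \<partial>M)"
    by (subst (1) 1, subst 2) (simp add: nn_integral_add)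
  also have "\<dots> \<le> (\<integral>\<^sup>+x. \<integral>\<^sup>+y. ennreal (2 * cosh (d x y)) \<partial>M \<partial>M)"
    by (intro nn_integral_mono ennreal_ratio_add_inverse_le) (metis d sym)+
  also have "\<dots> = (\<integral>\<^sup>+x. \<integral>\<^sup>+y. 2 * ennreal (cosh (d x y)) \<partial>M \<partial>M)"
    by (simp add: ennreal_mult')
  also have "\<dots> = (\<integral>\<^sup>+x. 2 * (\<integral>\<^sup>+y. ennreal (cosh (d x y)) \<partial>M) \<partial>M)"
    by (intro nn_integral_cong nn_integral_cmult measurable_compose[OF _ measurable_ennreal] cm)
  also have "\<dots> = 2 * (\<integral>\<^sup>+x. \<integral>\<^sup>+y. ennreal (cosh (d x y)) \<partial>M \<partial>M)"
    by (intro nn_integral_cmult) measurable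
  also have "\<dots> \<le> 2 * ennreal C" using C by (rule mult_left_mono) simp
  finally have "2 * ?a \<le> 2 * ennreal C" by (simp add: mult_2)
  then show ?thesis by (subst (asm) ennreal_mult_le_mult_iff) auto
qed

text \<open>Induction on the coordinates. Integrating out coordinate \<open>i\<close> gives
  \<open>a X\<close>, and the one-coordinate bound replaces the integral of the inverse by
  \<open>C i * inverse (a X)\<close>. The increment bounds in the other coordinates pass under the
  integral, so \<open>a\<close> satisfies the hypotheses again.\<close>

lemma nn_integral_mult_inverse_PiM_le:
  assumes "finite I" and M: "\<And>i. prob_space (M i)"
    and F: "F \<in> borel_measurable (PiM I M)"
    and d: "\<And>x i y. x \<in> space (PiM I M) \<Longrightarrow> i \<in> I \<Longrightarrow> y \<in> space (M i) \<Longrightarrow>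
        F x \<le> ennreal (exp (d i (x i) y)) * F (x(i := y))"
    and sym: "\<And>i x y. d i x y = d i y x"
    and dm: "\<And>i. (\<lambda>(x, y). d i x y) \<in> borel_measurable (M i \<Otimes>\<^sub>M M i)"
    and C: "\<And>i. (\<integral>\<^sup>+x. \<integral>\<^sup>+y. ennreal (cosh (d i x y)) \<partial>M i \<partial>M i) \<le> ennreal (C i)"
    and C0: "\<And>i. 0 < C i"
  shows "(\<integral>\<^sup>+x. F x \<partial>PiM I M) * (\<integral>\<^sup>+x. inverse (F x) \<partial>PiM I M) \<le> ennreal (\<Prod>i\<in>I. C i)"
  using assms(1) F d
proof (induction I arbitrary: F)
  case empty
  interpret product_sigma_finite M using M by (simp add: product_sigma_finite_def prob_space_imp_sigma_finite)
  have "a * inverse a \<le> 1" for a :: ennreal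
  proof -
    consider "a = 0" | "a = \<top>" | r where "0 < r" "a = ennreal r"
      by (cases a) (auto simp: less_le)
    then show ?thesis by cases (auto simp: inverse_ennreal ennreal_mult'[symmetric])
  qed
  then show ?case by (simp add: nn_integral_empty)
next
  case (insert i I)
  interpret product_sigma_finite M using M by (simp add: product_sigma_finite_def prob_space_imp_sigma_finite)
  interpret Mi: prob_space "M i" by (rule M)
  note F[measurable] = insert.prems(1)
  define a where "a X = (\<integral>\<^sup>+y. F (X(i := y)) \<partial>M i)" for X
  have upd: "X(i := y) \<in> space (PiM (insert i I) M)" if "X \<in> space (PiM I M)" "y \<in> space (M i)" for X y
    using that insert(2) by (auto simp: space_PiM PiE_def extensional_def Pi_def)
  have Fupd: "(\<lambda>y. F (X(i := y))) \<in> borel_measurable (M i)" if X: "X \<in> space (PiM I M)" for X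
  proof (rule measurable_compose[OF _ F])
    show "(\<lambda>y. X(i := y)) \<in> measurable (M i) (PiM (insert i I) M)"
      by (rule measurable_fun_upd[where J=I]) (use X in auto)
  qed
  have am: "a \<in> borel_measurable (PiM I M)" unfolding a_def
    by (intro sigma_finite_measure.borel_measurable_nn_integral[OF prob_space_imp_sigma_finite[OF M]]) measurable
  have ab: "(\<integral>\<^sup>+y. inverse (F (X(i := y))) \<partial>M i) \<le> ennreal (C i) * inverse (a X)" if X: "X \<in> space (PiM I M)" for X
  proof -
    let ?b = "\<integral>\<^sup>+y. inverse (F (X(i := y))) \<partial>M i"
    have *: "a X * ?b \<le> ennreal (C i)"
      unfolding a_def
    proof (rule nn_integral_mult_inverse_le[OF M Fupd[OF X] _ sym dm C])
      fix x y assume xy: "x \<in> space (M i)" "y \<in> space (M i)"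
      show "F (X(i := x)) \<le> ennreal (exp (d i x y)) * F (X(i := y))"
        using insert.prems(2)[OF upd[OF X xy(1)], of i y] xy by (simp only: fun_upd_same fun_upd_upd insertI1)
    qed
    then show ?thesis using C0[of i] by (rule ennreal_le_mult_inverse)
  qed
  have IH: "(\<integral>\<^sup>+X. a X \<partial>PiM I M) * (\<integral>\<^sup>+X. inverse (a X) \<partial>PiM I M) \<le> ennreal (\<Prod>i\<in>I. C i)"
  proof (rule insert.IH[OF am])
    fix X j y assume X: "X \<in> space (PiM I M)" and j: "j \<in> I" and y: "y \<in> space (M j)"
    have ij: "i \<noteq> j" using insert j by auto
    have Xy: "X(j := y) \<in> space (PiM I M)" using X y j by (auto simp: space_PiM PiE_def extensional_def Pi_def)
    have "a X \<le> (\<integral>\<^sup>+z. ennreal (exp (d j (X j) y)) * F ((X(j := y))(i := z)) \<partial>M i)"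
      unfolding a_def
    proof (intro nn_integral_mono)
      fix z assume z: "z \<in> space (M i)"
      have "F (X(i := z)) \<le> ennreal (exp (d j ((X(i := z)) j) y)) * F ((X(i := z))(j := y))"
        by (rule insert.prems(2)[OF upd[OF X z] insertI2[OF j] y])
      then show "F (X(i := z)) \<le> ennreal (exp (d j (X j) y)) * F ((X(j := y))(i := z))"
        by (simp only: fun_upd_twist[OF ij] fun_upd_other[OF ij[symmetric]])
    qed
    also have "\<dots> = ennreal (exp (d j (X j) y)) * a (X(j := y))"
      unfolding a_def by (intro nn_integral_cmult Fupd Xy)
    finally show "a X \<le> ennreal (exp (d j (X j) y)) * a (X(j := y))" .
  qed
  have "(\<integral>\<^sup>+x. F x \<partial>PiM (insert i I) M) = (\<integral>\<^sup>+X. a X \<partial>PiM I M)"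
    unfolding a_def using insert by (intro product_nn_integral_insert) auto
  moreover have "(\<integral>\<^sup>+x. inverse (F x) \<partial>PiM (insert i I) M) = (\<integral>\<^sup>+X. \<integral>\<^sup>+y. inverse (F (X(i := y))) \<partial>M i \<partial>PiM I M)"
    using insert by (intro product_nn_integral_insert) auto
  moreover have "\<dots> \<le> (\<integral>\<^sup>+X. ennreal (C i) * inverse (a X) \<partial>PiM I M)"
    by (intro nn_integral_mono ab)
  moreover have "\<dots> = ennreal (C i) * (\<integral>\<^sup>+X. inverse (a X) \<partial>PiM I M)"
    using am by (intro nn_integral_cmult) auto
  ultimately have "(\<integral>\<^sup>+x. F x \<partial>PiM (insert i I) M) * (\<integral>\<^sup>+x. inverse (F x) \<partial>PiM (insert i I) M)
      \<le> (\<integral>\<^sup>+X. a X \<partial>PiM I M) * (ennreal (C i) * (\<integral>\<^sup>+X. inverse (a X) \<partial>PiM I M))"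
    by (metis mult_left_mono zero_le)
  also have "\<dots> = ennreal (C i) * ((\<integral>\<^sup>+X. a X \<partial>PiM I M) * (\<integral>\<^sup>+X. inverse (a X) \<partial>PiM I M))"
    by (simp add: mult_ac)
  also have "\<dots> \<le> ennreal (C i) * ennreal (\<Prod>i\<in>I. C i)" using IH by (rule mult_left_mono) simp
  also have "\<dots> = ennreal (\<Prod>i\<in>insert i I. C i)"
    using insert(1,2) C0 by (simp add: ennreal_mult' less_imp_le prod_nonneg)
  finally show ?case .
qed

lemma nn_integral_exp_std_gauss: "(\<integral>\<^sup>+y. ennreal (exp (k * y)) \<partial>std_gauss) = ennreal (exp (k\<^sup>2 / 2))"
  using integral_exp_std_gauss[of k] integrable_exp_std_gauss[of k] by (subst nn_integral_eq_integral) auto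

text \<open>The hypothesis is a Lipschitz condition on \<open>ln F\<close>, written multiplicatively
  so that zero and infinity are permitted.\<close>

lemma exp_moments_gauss:
  fixes c :: "'i \<Rightarrow> real"
  assumes I: "finite I" and F[measurable]: "F \<in> borel_measurable (gauss I)"
    and lip: "\<And>Y i y. i \<in> I \<Longrightarrow> F Y \<le> ennreal (exp (c i * \<bar>Y i - y\<bar>)) * F (Y(i := y))"
  shows "(\<integral>\<^sup>+x. F x \<partial>gauss I) * (\<integral>\<^sup>+x. inverse (F x) \<partial>gauss I) \<le> ennreal (exp (\<Sum>i\<in>I. (c i)\<^sup>2))"
proof -
  \<comment> \<open>For independent standard Gaussian \<open>x\<close> and \<open>y\<close> the
    difference has variance 2, so the mean of \<open>cosh\<close> is
    \<open>exp ((c i)\<^sup>2)\<close>.\<close>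
  have C: "(\<integral>\<^sup>+x. \<integral>\<^sup>+y. ennreal (cosh (c i * \<bar>x - y\<bar>)) \<partial>std_gauss \<partial>std_gauss) \<le> ennreal (exp ((c i)\<^sup>2))" for i
  proof -
    have e: "ennreal (cosh (c i * \<bar>x - y\<bar>)) = ennreal (1/2) * (ennreal (exp (c i * x)) * ennreal (exp (- c i * y)) + ennreal (exp (- c i * x)) * ennreal (exp (c i * y)))" for x y
    proof -
      have "cosh (c i * \<bar>x - y\<bar>) = cosh \<bar>c i * (x - y)\<bar>" by (metis abs_mult abs_abs cosh_real_abs)
      also have "\<dots> = cosh (c i * (x - y))" by (simp add: cosh_real_abs)
      also have "\<dots> = 1/2 * (exp (c i * x) * exp (- c i * y) + exp (- c i * x) * exp (c i * y))"
        by (simp add: cosh_def exp_add[symmetric] algebra_simps)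
      finally have "ennreal (cosh (c i * \<bar>x - y\<bar>)) = ennreal (1/2 * (exp (c i * x) * exp (- c i * y) + exp (- c i * x) * exp (c i * y)))" by simp
      also have "\<dots> = ennreal (1/2) * (ennreal (exp (c i * x)) * ennreal (exp (- c i * y)) + ennreal (exp (- c i * x)) * ennreal (exp (c i * y)))"
        by (subst ennreal_mult', simp, subst ennreal_plus, simp, simp, simp add: ennreal_mult')
      finally show ?thesis .
    qed
    have "(\<integral>\<^sup>+x. \<integral>\<^sup>+y. ennreal (cosh (c i * \<bar>x - y\<bar>)) \<partial>std_gauss \<partial>std_gauss) =
      ennreal (1/2) * (ennreal (exp ((c i)\<^sup>2 / 2)) * ennreal (exp ((c i)\<^sup>2 / 2)) + ennreal (exp ((c i)\<^sup>2 / 2)) * ennreal (exp ((c i)\<^sup>2 / 2)))"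
      unfolding e using nn_integral_exp_std_gauss[of "c i"] nn_integral_exp_std_gauss[of "- c i"]
      by (simp add: nn_integral_cmult nn_integral_multc nn_integral_add del: ennreal_plus)
    also have "\<dots> = ennreal (exp ((c i)\<^sup>2))"
    proof -
      have "ennreal (1/2) * (ennreal r + ennreal r) = ennreal r" if "0 \<le> r" for r
      proof -
        have "ennreal (1/2) * (ennreal r + ennreal r) = ennreal (1/2 * (r + r))"
          using that by (subst ennreal_mult', simp, subst ennreal_plus) auto
        then show ?thesis by simp
      qed
      then show ?thesis by (simp add: ennreal_mult'[symmetric] exp_add[symmetric] del: ennreal_plus)
    qed
    finally show ?thesis by simp
  qed
  have "(\<integral>\<^sup>+x. F x \<partial>gauss I) * (\<integral>\<^sup>+x. inverse (F x) \<partial>gauss I) \<le> ennreal (\<Prod>i\<in>I. exp ((c i)\<^sup>2))"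
    by (rule nn_integral_mult_inverse_PiM_le[where d="\<lambda>i x y. c i * \<bar>x - y\<bar>"])
      (use lip C I in \<open>auto simp: prob_space_std_gauss abs_minus_commute\<close>)
  then show ?thesis using I by (simp add: exp_sum)
qed

text \<open>Planted data are a signal plus independent noise, and the two sources of randomness are
  treated in turn. Given \<open>\<sigma>\<close>, the Gaussian bound replaces the mean of
  \<open>exp (- f)\<close> by a multiple of \<open>inverse (a \<sigma>)\<close>. Then
  \<open>a\<close> is a function of independent sites that changes by a factor of at most
  \<open>exp B\<close> per site, which costs \<open>cosh B \<le> exp (B\<^sup>2)\<close>.\<close>

lemma exp_moments_planted:
  fixes f :: "('i \<Rightarrow> real) \<Rightarrow> real" and c :: "'i \<Rightarrow> real" and B :: real
  assumes I: "finite I" and J: "finite J" and Ms: "\<And>j. prob_space (Ms j)"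
    and f[measurable]: "f \<in> borel_measurable (gauss I)"
    and w[measurable]: "\<And>i. i \<in> I \<Longrightarrow> (\<lambda>\<sigma>. w \<sigma> i) \<in> borel_measurable (PiM J Ms)"
    and lip: "\<And>Y i y. i \<in> I \<Longrightarrow> \<bar>f Y - f (Y(i := y))\<bar> \<le> c i * \<bar>Y i - y\<bar>"
    and bd: "\<And>Y \<sigma> j x. j \<in> J \<Longrightarrow> \<bar>f (\<lambda>i\<in>I. Y i + w \<sigma> i) - f (\<lambda>i\<in>I. Y i + w (\<sigma>(j := x)) i)\<bar> \<le> B"
  shows "(\<integral>\<^sup>+\<sigma>. \<integral>\<^sup>+Y. ennreal (cm_dens I (w \<sigma>) Y) * ennreal (exp (f Y)) \<partial>gauss I \<partial>PiM J Ms) *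
      (\<integral>\<^sup>+\<sigma>. \<integral>\<^sup>+Y. ennreal (cm_dens I (w \<sigma>) Y) * ennreal (exp (- f Y)) \<partial>gauss I \<partial>PiM J Ms)
    \<le> ennreal (exp ((\<Sum>i\<in>I. (c i)\<^sup>2) + card J * B\<^sup>2))"
proof -
  let ?S = "PiM J Ms"
  interpret S: prob_space ?S by (intro prob_space_PiM Ms)
  let ?sh = "\<lambda>\<sigma> Y. \<lambda>i\<in>I. Y i + w \<sigma> i"
  define C1 where "C1 = exp (\<Sum>i\<in>I. (c i)\<^sup>2)"
  define a where "a \<sigma> = (\<integral>\<^sup>+Y. ennreal (exp (f (?sh \<sigma> Y))) \<partial>gauss I)" for \<sigma>
  have shm[measurable]: "(\<lambda>p. ?sh (fst p) (snd p)) \<in> measurable (?S \<Otimes>\<^sub>M gauss I) (gauss I)" by measurable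
  have fm[measurable]: "(\<lambda>p. f (?sh (fst p) (snd p))) \<in> borel_measurable (?S \<Otimes>\<^sub>M gauss I)"
    by (rule measurable_compose[OF shm f])
  have fm1[measurable]: "(\<lambda>Y. f (?sh \<sigma> Y)) \<in> borel_measurable (gauss I)" for \<sigma> by measurable
  have gp: "sigma_finite_measure (gauss I)" by (intro prob_space_imp_sigma_finite prob_space_gauss)
  have am[measurable]: "a \<in> borel_measurable ?S" unfolding a_def
    by (intro sigma_finite_measure.borel_measurable_nn_integral[OF gp]) (simp add: split_beta')
  have 1: "(\<integral>\<^sup>+\<sigma>. \<integral>\<^sup>+Y. ennreal (cm_dens I (w \<sigma>) Y) * ennreal (exp (f Y)) \<partial>gauss I \<partial>?S) = (\<integral>\<^sup>+\<sigma>. a \<sigma> \<partial>?S)"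
    unfolding a_def by (intro nn_integral_cong nn_integral_cm_dens_mult I) measurable
  have 2: "(\<integral>\<^sup>+Y. ennreal (cm_dens I (w \<sigma>) Y) * ennreal (exp (- f Y)) \<partial>gauss I) \<le> ennreal C1 * inverse (a \<sigma>)" for \<sigma>
  proof -
    have "(\<integral>\<^sup>+Y. ennreal (cm_dens I (w \<sigma>) Y) * ennreal (exp (- f Y)) \<partial>gauss I) = (\<integral>\<^sup>+Y. ennreal (exp (- f (?sh \<sigma> Y))) \<partial>gauss I)"
      by (intro nn_integral_cm_dens_mult I) measurable
    also have "\<dots> = (\<integral>\<^sup>+Y. inverse (ennreal (exp (f (?sh \<sigma> Y)))) \<partial>gauss I)" (is "_ = ?b")
      by (simp add: inverse_ennreal exp_minus)
    also have "?b \<le> ennreal C1 * inverse (a \<sigma>)"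
    proof -
      have *: "a \<sigma> * ?b \<le> ennreal C1" unfolding a_def C1_def
      proof (rule exp_moments_gauss[OF I])
        fix Y i y assume i: "i \<in> I"
        have "?sh \<sigma> (Y(i := y)) = (?sh \<sigma> Y)(i := y + w \<sigma> i)" using i by auto
        then have "\<bar>f (?sh \<sigma> Y) - f (?sh \<sigma> (Y(i := y)))\<bar> \<le> c i * \<bar>Y i - y\<bar>"
          using lip[OF i, of "?sh \<sigma> Y" "y + w \<sigma> i"] i by simp
        then have "f (?sh \<sigma> Y) \<le> c i * \<bar>Y i - y\<bar> + f (?sh \<sigma> (Y(i := y)))" by linarith
        then have "exp (f (?sh \<sigma> Y)) \<le> exp (c i * \<bar>Y i - y\<bar>) * exp (f (?sh \<sigma> (Y(i := y))))" unfolding exp_add[symmetric] by simp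
        then show "ennreal (exp (f (?sh \<sigma> Y))) \<le> ennreal (exp (c i * \<bar>Y i - y\<bar>)) * ennreal (exp (f (?sh \<sigma> (Y(i := y)))))"
          by (simp add: ennreal_mult'[symmetric])
      qed measurable
      then show ?thesis by (rule ennreal_le_mult_inverse) (simp add: C1_def)
    qed
    finally show ?thesis .
  qed
  have 3: "(\<integral>\<^sup>+\<sigma>. a \<sigma> \<partial>?S) * (\<integral>\<^sup>+\<sigma>. inverse (a \<sigma>) \<partial>?S) \<le> ennreal (\<Prod>j\<in>J. exp (B\<^sup>2))"
  proof (rule nn_integral_mult_inverse_PiM_le[OF J Ms am, where d="\<lambda>_ _ _. B"])
    fix \<sigma> j x assume j: "j \<in> J" and "\<sigma> \<in> space ?S" "x \<in> space (Ms j)"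
    have "a \<sigma> \<le> (\<integral>\<^sup>+Y. ennreal (exp B) * ennreal (exp (f (?sh (\<sigma>(j := x)) Y))) \<partial>gauss I)"
      unfolding a_def
    proof (intro nn_integral_mono)
      fix Y
      have "f (?sh \<sigma> Y) \<le> B + f (?sh (\<sigma>(j := x)) Y)" using bd[OF j, of Y \<sigma> x] by linarith
      then show "ennreal (exp (f (?sh \<sigma> Y))) \<le> ennreal (exp B) * ennreal (exp (f (?sh (\<sigma>(j := x)) Y)))"
        by (simp add: ennreal_mult'[symmetric] exp_add[symmetric])
    qed
    also have "\<dots> = ennreal (exp B) * a (\<sigma>(j := x))" unfolding a_def by (intro nn_integral_cmult) measurable
    finally show "a \<sigma> \<le> ennreal (exp B) * a (\<sigma>(j := x))" .
  next
    fix j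
    interpret prob_space "Ms j" by (rule Ms)
    show "(\<integral>\<^sup>+x. \<integral>\<^sup>+y. ennreal (cosh B) \<partial>Ms j \<partial>Ms j) \<le> ennreal (exp (B\<^sup>2))"
      using cosh_le_exp_square[of B] by (simp add: prob_space.emeasure_space_1[OF Ms] ennreal_leI)
  qed auto
  have "(\<integral>\<^sup>+\<sigma>. a \<sigma> \<partial>?S) * (\<integral>\<^sup>+\<sigma>. \<integral>\<^sup>+Y. ennreal (cm_dens I (w \<sigma>) Y) * ennreal (exp (- f Y)) \<partial>gauss I \<partial>?S)
     \<le> (\<integral>\<^sup>+\<sigma>. a \<sigma> \<partial>?S) * (\<integral>\<^sup>+\<sigma>. ennreal C1 * inverse (a \<sigma>) \<partial>?S)"
    by (intro mult_left_mono nn_integral_mono 2) auto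
  also have "\<dots> = ennreal C1 * ((\<integral>\<^sup>+\<sigma>. a \<sigma> \<partial>?S) * (\<integral>\<^sup>+\<sigma>. inverse (a \<sigma>) \<partial>?S))"
    by (subst nn_integral_cmult) (auto simp: mult_ac)
  also have "\<dots> \<le> ennreal C1 * ennreal (\<Prod>j\<in>J. exp (B\<^sup>2))" using 3 by (rule mult_left_mono) simp
  also have "\<dots> = ennreal (exp ((\<Sum>i\<in>I. (c i)\<^sup>2) + card J * B\<^sup>2))"
    by (simp add: C1_def ennreal_mult'[symmetric] exp_add exp_of_nat_mult)
  finally show ?thesis unfolding 1 .
qed

section \<open>Log-likelihoods under the null and the planted law\<close>

lemma cm_dens_mono_factor:
  assumes "finite I" "(\<Sum>i\<in>I. u i * (Y i - Y' i)) \<le> d"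
  shows "cm_dens I u Y \<le> exp d * cm_dens I u Y'"
proof -
  have "(\<Sum>i\<in>I. u i * Y i) \<le> d + (\<Sum>i\<in>I. u i * Y' i)"
    using assms(2) by (simp add: right_diff_distrib sum_subtractf)
  then show ?thesis unfolding cm_dens_def exp_add[symmetric] by simp
qed

lemma ln_mix_lik_le_add:
  assumes bf: "bounded_feat I M c v" and "\<And>\<tau>. (\<Sum>i\<in>I. v \<tau> i * (Y i - Y' i)) \<le> d"
  shows "ln (mix_lik I M v Y) \<le> d + ln (mix_lik I M v Y')"
proof -
  have "mix_lik I M v Y \<le> (\<integral>\<tau>. exp d * cm_dens I (v \<tau>) Y' \<partial>M)"
    unfolding mix_lik_def using bounded_featD[OF bf] assms(2)
    by (intro integral_mono cm_dens_feat_integrable[OF bf] integrable_mult_right cm_dens_mono_factor) auto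
  then have "mix_lik I M v Y \<le> exp d * mix_lik I M v Y'" by (simp add: mix_lik_def)
  then have "ln (mix_lik I M v Y) \<le> ln (exp d * mix_lik I M v Y')"
    using mix_lik_pos[OF bf, of Y] mix_lik_pos[OF bf, of Y'] by simp
  then show ?thesis using mix_lik_pos[OF bf, of Y'] by (simp add: ln_mult)
qed

text \<open>Changing \<open>Y i\<close> changes every density in the mixture by a factor of at most
  \<open>exp (cc i * \<bar>Y i - y\<bar>)\<close>, and therefore also their average.\<close>

lemma ln_mix_lik_lipschitz:
  fixes cc :: "'i \<Rightarrow> real"
  assumes bf: "bounded_feat I M c v" and cc: "\<And>\<tau> i. i \<in> I \<Longrightarrow> \<bar>v \<tau> i\<bar> \<le> cc i" and i: "i \<in> I"
  shows "\<bar>ln (mix_lik I M v Y) - ln (mix_lik I M v (Y(i := y)))\<bar> \<le> cc i * \<bar>Y i - y\<bar>"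
proof -
  note fin = bounded_featD(1)[OF bf]
  have s: "(\<Sum>j\<in>I. v \<tau> j * (Y j - (Y(i := y)) j)) = v \<tau> i * (Y i - y)" for \<tau>
    using fin i by (subst sum.remove[of _ i]) (auto intro!: sum.neutral)
  have s': "(\<Sum>j\<in>I. v \<tau> j * ((Y(i := y)) j - Y j)) = v \<tau> i * (y - Y i)" for \<tau>
    using fin i by (subst sum.remove[of _ i]) (auto intro!: sum.neutral)
  have b: "v \<tau> i * (Y i - y) \<le> cc i * \<bar>Y i - y\<bar>" "v \<tau> i * (y - Y i) \<le> cc i * \<bar>Y i - y\<bar>" for \<tau>
  proof -
    have *: "\<bar>v \<tau> i * (Y i - y)\<bar> \<le> cc i * \<bar>Y i - y\<bar>"
      unfolding abs_mult by (intro mult_right_mono cc i) auto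
    show "v \<tau> i * (Y i - y) \<le> cc i * \<bar>Y i - y\<bar>" using * by linarith
    have "v \<tau> i * (y - Y i) = - (v \<tau> i * (Y i - y))" by (simp add: algebra_simps)
    then show "v \<tau> i * (y - Y i) \<le> cc i * \<bar>Y i - y\<bar>" using * by linarith
  qed
  have "ln (mix_lik I M v Y) \<le> cc i * \<bar>Y i - y\<bar> + ln (mix_lik I M v (Y(i := y)))"
    by (rule ln_mix_lik_le_add[OF bf]) (use s b in simp)
  moreover have "ln (mix_lik I M v (Y(i := y))) \<le> cc i * \<bar>Y i - y\<bar> + ln (mix_lik I M v Y)"
    by (rule ln_mix_lik_le_add[OF bf]) (use s' b in simp)
  ultimately show ?thesis by linarith
qed

text \<open>Planted data can be drawn by first choosing \<open>\<sigma>\<close>; averaging over this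
  choice produces the density \<open>mix_lik\<close>.\<close>

lemma nn_integral_cm_dens_mix_lik:
  assumes bf: "bounded_feat I S c w" and [measurable]: "f \<in> borel_measurable (gauss I)"
  shows "(\<integral>\<^sup>+\<sigma>. \<integral>\<^sup>+Y. ennreal (cm_dens I (w \<sigma>) Y) * ennreal (f Y) \<partial>gauss I \<partial>S)
      = (\<integral>\<^sup>+Y. ennreal (mix_lik I S w Y) * ennreal (f Y) \<partial>gauss I)"
proof -
  interpret S: prob_space S by (rule bounded_featD[OF bf])
  interpret G: prob_space "gauss I" by (rule prob_space_gauss)
  interpret P: pair_prob_space "gauss I" S ..
  note [measurable] = cm_dens_feat_measurable[OF bf]
  have "(\<integral>\<^sup>+\<sigma>. \<integral>\<^sup>+Y. ennreal (cm_dens I (w \<sigma>) Y) * ennreal (f Y) \<partial>gauss I \<partial>S)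
     = (\<integral>\<^sup>+Y. \<integral>\<^sup>+\<sigma>. ennreal (cm_dens I (w \<sigma>) Y) * ennreal (f Y) \<partial>S \<partial>gauss I)"
    by (intro P.Fubini'[of "\<lambda>Y \<sigma>. ennreal (cm_dens I (w \<sigma>) Y) * ennreal (f Y)"]) (simp add: split_beta')
  also have "\<dots> = (\<integral>\<^sup>+Y. ennreal (mix_lik I S w Y) * ennreal (f Y) \<partial>gauss I)"
    unfolding mix_lik_def
    by (intro nn_integral_cong) (simp add: nn_integral_multc cm_dens_feat_measurable1[OF bf]
        nn_integral_eq_integral[OF cm_dens_feat_integrable[OF bf]])
  finally show ?thesis .
qed

lemma integrable_gauss_const: "integrable (gauss I) (\<lambda>_. r :: real)"
proof -
  interpret G: prob_space "gauss I" by (rule prob_space_gauss)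
  show ?thesis by simp
qed

text \<open>Concentration under the planted law of \<open>w\<close> bounds the product of the
  planted means of \<open>exp f\<close> and \<open>exp (- f)\<close>, where \<open>f\<close> is
  \<open>s\<close> times the log-likelihood of \<open>v\<close>. Jensen bounds the first factor
  below by the planted mean of \<open>f\<close>, and the second by a null mean, because the planted
  mean of \<open>exp (- f)\<close> is the null mean of \<open>exp (ln L - f)\<close>. The parameter
  \<open>s\<close> stays free: the error is quadratic in it, the gain linear.\<close>

lemma mix_lik_transfer_planted:
  fixes cc :: "'i \<Rightarrow> real" and B :: real
  assumes bf: "bounded_feat I M c v" and bw: "bounded_feat I (PiM J Ms) c' w" and J: "finite J" and Ms: "\<And>j. prob_space (Ms j)"
    and cc: "\<And>\<tau> i. i \<in> I \<Longrightarrow> \<bar>v \<tau> i\<bar> \<le> cc i"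
    and B: "\<And>\<sigma> j x \<tau>. j \<in> J \<Longrightarrow> \<bar>\<Sum>i\<in>I. v \<tau> i * (w \<sigma> i - w (\<sigma>(j := x)) i)\<bar> \<le> B"
    and s: "0 \<le> s"
  shows "null_ent I (PiM J Ms) w - s * null_ent I M v + s * (\<integral>Y. mix_lik I (PiM J Ms) w Y * ln (mix_lik I M v Y) \<partial>gauss I)
      \<le> s\<^sup>2 * ((\<Sum>i\<in>I. (cc i)\<^sup>2) + card J * B\<^sup>2)"
proof -
  note fin = bounded_featD(1)[OF bf]
  let ?S = "PiM J Ms"
  let ?L = "mix_lik I ?S w"
  define f where "f Y = s * ln (mix_lik I M v Y)" for Y
  note [measurable] = mix_lik_measurable[OF bf] mix_lik_measurable[OF bw]
  have fm[measurable]: "f \<in> borel_measurable (gauss I)" unfolding f_def by measurable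
  have ed: "exp_dominated I (\<lambda>Y. Y) (\<lambda>Y. ?L Y * exp (f Y))" "exp_dominated I (\<lambda>Y. Y) (\<lambda>Y. ?L Y * exp (- f Y))"
    unfolding f_def using exp_dominated_exp_ln_mix_lik[OF bf, of _ s] exp_dominated_exp_ln_mix_lik[OF bf, of _ "- s"]
    by (auto intro!: exp_dominated_mult exp_dominated_mix_lik[OF bw])
  have ints: "integrable (gauss I) (\<lambda>Y. ?L Y * exp (f Y))" "integrable (gauss I) (\<lambda>Y. ?L Y * exp (- f Y))"
    by (intro exp_dominated_integrable fin ed; measurable)+
  have Lp: "0 < ?L Y" for Y by (rule mix_lik_pos[OF bw])
  have nn: "(\<integral>\<^sup>+\<sigma>. \<integral>\<^sup>+Y. ennreal (cm_dens I (w \<sigma>) Y) * ennreal (exp (g Y)) \<partial>gauss I \<partial>?S) = ennreal (\<integral>Y. ?L Y * exp (g Y) \<partial>gauss I)"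
    if "integrable (gauss I) (\<lambda>Y. ?L Y * exp (g Y))" "g \<in> borel_measurable (gauss I)" for g
  proof -
    have "(\<lambda>Y. exp (g Y)) \<in> borel_measurable (gauss I)" using that(2) by measurable
    from nn_integral_cm_dens_mix_lik[OF bw this]
    have "(\<integral>\<^sup>+\<sigma>. \<integral>\<^sup>+Y. ennreal (cm_dens I (w \<sigma>) Y) * ennreal (exp (g Y)) \<partial>gauss I \<partial>?S) = (\<integral>\<^sup>+Y. ennreal (?L Y * exp (g Y)) \<partial>gauss I)"
      using Lp by (simp add: ennreal_mult' less_imp_le)
    also have "\<dots> = ennreal (\<integral>Y. ?L Y * exp (g Y) \<partial>gauss I)"
      using that Lp by (intro nn_integral_eq_integral) (auto simp: less_imp_le)
    finally show ?thesis .
  qed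
  have "(\<integral>\<^sup>+\<sigma>. \<integral>\<^sup>+Y. ennreal (cm_dens I (w \<sigma>) Y) * ennreal (exp (f Y)) \<partial>gauss I \<partial>?S) *
      (\<integral>\<^sup>+\<sigma>. \<integral>\<^sup>+Y. ennreal (cm_dens I (w \<sigma>) Y) * ennreal (exp (- f Y)) \<partial>gauss I \<partial>?S)
    \<le> ennreal (exp ((\<Sum>i\<in>I. (s * cc i)\<^sup>2) + card J * (s * B)\<^sup>2))"
  proof (rule exp_moments_planted[where c="\<lambda>i. s * cc i" and B="s * B" and f=f and w=w and Ms=Ms, OF fin J Ms fm])
    show "(\<lambda>\<sigma>. w \<sigma> i) \<in> borel_measurable ?S" if "i \<in> I" for i using bounded_featD(4)[OF bw that] .
  next
    fix Y i y assume "i \<in> I"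
    from mult_left_mono[OF ln_mix_lik_lipschitz[OF bf cc this, of Y y] s]
    show "\<bar>f Y - f (Y(i := y))\<bar> \<le> s * cc i * \<bar>Y i - y\<bar>"
      unfolding f_def right_diff_distrib[symmetric] abs_mult using s by (simp add: mult.assoc)
  next
    fix Y \<sigma> j x assume j: "j \<in> J"
    let ?Y1 = "\<lambda>i\<in>I. Y i + w \<sigma> i" and ?Y2 = "\<lambda>i\<in>I. Y i + w (\<sigma>(j := x)) i"
    have e: "(\<Sum>i\<in>I. v \<tau> i * (?Y1 i - ?Y2 i)) = (\<Sum>i\<in>I. v \<tau> i * (w \<sigma> i - w (\<sigma>(j := x)) i))"
      "(\<Sum>i\<in>I. v \<tau> i * (?Y2 i - ?Y1 i)) = - (\<Sum>i\<in>I. v \<tau> i * (w \<sigma> i - w (\<sigma>(j := x)) i))" for \<tau>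
      by (auto simp: sum_negf[symmetric] algebra_simps intro!: sum.cong)
    have "ln (mix_lik I M v ?Y1) \<le> B + ln (mix_lik I M v ?Y2)"
      by (rule ln_mix_lik_le_add[OF bf]) (unfold e, use B[OF j] in \<open>simp add: abs_le_iff\<close>)
    moreover have "ln (mix_lik I M v ?Y2) \<le> B + ln (mix_lik I M v ?Y1)"
      by (rule ln_mix_lik_le_add[OF bf]) (unfold e, use B[OF j] in \<open>simp add: abs_le_iff minus_le_iff\<close>)
    ultimately have "\<bar>ln (mix_lik I M v ?Y1) - ln (mix_lik I M v ?Y2)\<bar> \<le> B" by linarith
    from mult_left_mono[OF this s] show "\<bar>f ?Y1 - f ?Y2\<bar> \<le> s * B"
      unfolding f_def right_diff_distrib[symmetric] abs_mult using s by simp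
  qed
  then have "ennreal (\<integral>Y. ?L Y * exp (f Y) \<partial>gauss I) * ennreal (\<integral>Y. ?L Y * exp (- f Y) \<partial>gauss I)
     \<le> ennreal (exp ((\<Sum>i\<in>I. (s * cc i)\<^sup>2) + card J * (s * B)\<^sup>2))"
    using nn[OF ints(1) fm] nn[OF ints(2)] by simp
  then have le: "(\<integral>Y. ?L Y * exp (f Y) \<partial>gauss I) * (\<integral>Y. ?L Y * exp (- f Y) \<partial>gauss I)
     \<le> exp (s\<^sup>2 * ((\<Sum>i\<in>I. (cc i)\<^sup>2) + card J * B\<^sup>2))"
    using Lp by (simp add: ennreal_mult'[symmetric] power_mult_distrib sum_distrib_left algebra_simps
        integral_nonneg less_imp_le)
  have "exp (\<integral>Y. ?L Y * f Y \<partial>gauss I) \<le> (\<integral>Y. ?L Y * exp (f Y) \<partial>gauss I)"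
  proof (rule exp_integral_le_weighted[OF integrable_mix_lik[OF bw] integral_mix_lik[OF bw] less_imp_le[OF Lp] _ ints(1)])
    show "integrable (gauss I) (\<lambda>Y. ?L Y * f Y)"
      unfolding f_def by (intro exp_dominated_integrable fin exp_dominated_mult exp_dominated_const exp_dominated_mix_lik[OF bw] exp_dominated_ln_mix_lik[OF bf]) measurable
  qed
  moreover have "exp (\<integral>Y. 1 * (ln (?L Y) - f Y) \<partial>gauss I) \<le> (\<integral>Y. 1 * exp (ln (?L Y) - f Y) \<partial>gauss I)"
  proof (rule exp_integral_le_weighted)
    show "integrable (gauss I) (\<lambda>Y. 1 * (ln (?L Y) - f Y))"
      unfolding f_def by (intro exp_dominated_integrable fin exp_dominated_mult exp_dominated_diff exp_dominated_const exp_dominated_ln_mix_lik[OF bw] exp_dominated_ln_mix_lik[OF bf]) measurable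
    show "integrable (gauss I) (\<lambda>Y. 1 * exp (ln (?L Y) - f Y))"
      using ints(2) Lp by (simp add: exp_diff exp_minus divide_inverse)
  qed (use integrable_gauss_const in auto)
  ultimately have "exp (\<integral>Y. ?L Y * f Y \<partial>gauss I) * exp (\<integral>Y. ln (?L Y) - f Y \<partial>gauss I)
      \<le> (\<integral>Y. ?L Y * exp (f Y) \<partial>gauss I) * (\<integral>Y. exp (ln (?L Y) - f Y) \<partial>gauss I)"
    by (intro mult_mono) (auto intro!: integral_nonneg simp: Lp less_imp_le)
  also have "(\<integral>Y. exp (ln (?L Y) - f Y) \<partial>gauss I) = (\<integral>Y. ?L Y * exp (- f Y) \<partial>gauss I)"
    using Lp by (simp add: exp_diff exp_minus divide_inverse)
  also note le
  finally have "(\<integral>Y. ?L Y * f Y \<partial>gauss I) + (\<integral>Y. ln (?L Y) - f Y \<partial>gauss I)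
     \<le> s\<^sup>2 * ((\<Sum>i\<in>I. (cc i)\<^sup>2) + card J * B\<^sup>2)" by (simp add: exp_add[symmetric])
  moreover have "(\<integral>Y. ?L Y * f Y \<partial>gauss I) = s * (\<integral>Y. ?L Y * ln (mix_lik I M v Y) \<partial>gauss I)"
    unfolding f_def by (simp add: mult.left_commute)
  moreover have "(\<integral>Y. ln (?L Y) - f Y \<partial>gauss I) = null_ent I ?S w - s * null_ent I M v"
    unfolding f_def null_ent_def using integrable_ln_mix_lik[OF bw] integrable_ln_mix_lik[OF bf] by simp
  ultimately show ?thesis by simp
qed

text \<open>The converse change of law. Both \<open>exp f\<close> and \<open>exp (- f)\<close> are
  integrated under pure noise, so only Gaussian concentration enters and no oscillation over sites.
  The null mean of \<open>exp f\<close> is written as the planted mean of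
  \<open>exp (f - ln L)\<close>, which charges the planted entropy of \<open>w\<close>.\<close>

lemma mix_lik_transfer_null:
  fixes cc :: "'i \<Rightarrow> real"
  assumes bf: "bounded_feat I M c v" and bw: "bounded_feat I M' c' w"
    and cc: "\<And>\<tau> i. i \<in> I \<Longrightarrow> \<bar>v \<tau> i\<bar> \<le> cc i" and s: "0 \<le> s"
  shows "s * (\<integral>Y. mix_lik I M' w Y * ln (mix_lik I M v Y) \<partial>gauss I) - planted_ent I M' w - s * null_ent I M v
      \<le> s\<^sup>2 * (\<Sum>i\<in>I. (cc i)\<^sup>2)"
proof -
  note fin = bounded_featD(1)[OF bf]
  let ?L = "mix_lik I M' w"
  define f where "f Y = s * ln (mix_lik I M v Y)" for Y
  note [measurable] = mix_lik_measurable[OF bf] mix_lik_measurable[OF bw]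
  have fm[measurable]: "f \<in> borel_measurable (gauss I)" unfolding f_def by measurable
  have ints: "integrable (gauss I) (\<lambda>Y. exp (f Y))" "integrable (gauss I) (\<lambda>Y. exp (- f Y))"
    unfolding f_def using exp_dominated_exp_ln_mix_lik[OF bf, of _ s] exp_dominated_exp_ln_mix_lik[OF bf, of _ "- s"]
    by (auto intro!: exp_dominated_integrable fin)
  have fi: "integrable (gauss I) f" unfolding f_def using integrable_ln_mix_lik[OF bf] by simp
  have Lp: "0 < ?L Y" for Y by (rule mix_lik_pos[OF bw])
  have "(\<integral>\<^sup>+Y. ennreal (exp (f Y)) \<partial>gauss I) * (\<integral>\<^sup>+Y. inverse (ennreal (exp (f Y))) \<partial>gauss I) \<le> ennreal (exp (\<Sum>i\<in>I. (s * cc i)\<^sup>2))"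
  proof (rule exp_moments_gauss[OF fin])
    fix Y i y assume "i \<in> I"
    from mult_left_mono[OF ln_mix_lik_lipschitz[OF bf cc this, of Y y] s]
    have "\<bar>f Y - f (Y(i := y))\<bar> \<le> s * cc i * \<bar>Y i - y\<bar>"
      unfolding f_def right_diff_distrib[symmetric] abs_mult using s by (simp add: mult.assoc)
    then have "f Y \<le> s * cc i * \<bar>Y i - y\<bar> + f (Y(i := y))" by linarith
    then show "ennreal (exp (f Y)) \<le> ennreal (exp (s * cc i * \<bar>Y i - y\<bar>)) * ennreal (exp (f (Y(i := y))))"
      by (simp add: ennreal_mult'[symmetric] exp_add[symmetric])
  qed measurable
  then have le: "(\<integral>Y. exp (f Y) \<partial>gauss I) * (\<integral>Y. exp (- f Y) \<partial>gauss I) \<le> exp (s\<^sup>2 * (\<Sum>i\<in>I. (cc i)\<^sup>2))"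
    using nn_integral_eq_integral[OF ints(1)] nn_integral_eq_integral[OF ints(2)]
    by (simp add: inverse_ennreal exp_minus ennreal_mult'[symmetric] power_mult_distrib sum_distrib_left)
  have "exp (\<integral>Y. ?L Y * (f Y - ln (?L Y)) \<partial>gauss I) \<le> (\<integral>Y. ?L Y * exp (f Y - ln (?L Y)) \<partial>gauss I)"
  proof (rule exp_integral_le_weighted[OF integrable_mix_lik[OF bw] integral_mix_lik[OF bw] less_imp_le[OF Lp]])
    show "integrable (gauss I) (\<lambda>Y. ?L Y * (f Y - ln (?L Y)))"
      unfolding f_def by (intro exp_dominated_integrable fin exp_dominated_mult exp_dominated_diff exp_dominated_const exp_dominated_mix_lik[OF bw] exp_dominated_ln_mix_lik[OF bw] exp_dominated_ln_mix_lik[OF bf]) measurable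
    show "integrable (gauss I) (\<lambda>Y. ?L Y * exp (f Y - ln (?L Y)))"
      using ints(1) Lp by (simp add: exp_diff less_imp_neq[symmetric])
  qed
  moreover have "(\<integral>Y. ?L Y * exp (f Y - ln (?L Y)) \<partial>gauss I) = (\<integral>Y. exp (f Y) \<partial>gauss I)"
    using Lp by (simp add: exp_diff less_imp_neq[symmetric])
  moreover have "exp (\<integral>Y. 1 * (- f Y) \<partial>gauss I) \<le> (\<integral>Y. 1 * exp (- f Y) \<partial>gauss I)"
    by (rule exp_integral_le_weighted) (use ints fi integrable_gauss_const in auto)
  ultimately have "exp (\<integral>Y. ?L Y * (f Y - ln (?L Y)) \<partial>gauss I) * exp (\<integral>Y. - f Y \<partial>gauss I)
      \<le> (\<integral>Y. exp (f Y) \<partial>gauss I) * (\<integral>Y. exp (- f Y) \<partial>gauss I)"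
    by (intro mult_mono) auto
  also note le
  finally have "(\<integral>Y. ?L Y * (f Y - ln (?L Y)) \<partial>gauss I) + (\<integral>Y. - f Y \<partial>gauss I) \<le> s\<^sup>2 * (\<Sum>i\<in>I. (cc i)\<^sup>2)"
    by (simp add: exp_add[symmetric])
  moreover have "(\<integral>Y. ?L Y * (f Y - ln (?L Y)) \<partial>gauss I) = s * (\<integral>Y. ?L Y * ln (mix_lik I M v Y) \<partial>gauss I) - planted_ent I M' w"
  proof -
    have "(\<integral>Y. ?L Y * (f Y - ln (?L Y)) \<partial>gauss I) = (\<integral>Y. s * (?L Y * ln (mix_lik I M v Y)) - ?L Y * ln (?L Y) \<partial>gauss I)"
      unfolding f_def by (simp add: right_diff_distrib mult.left_commute)
    also have "\<dots> = s * (\<integral>Y. ?L Y * ln (mix_lik I M v Y) \<partial>gauss I) - planted_ent I M' w"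
      unfolding planted_ent_def
      by (subst Bochner_Integration.integral_diff)
        (auto intro!: integrable_mult_right integrable_mix_lik_ln_mix_lik[OF bw] exp_dominated_integrable fin exp_dominated_mult exp_dominated_mix_lik[OF bw] exp_dominated_ln_mix_lik[OF bf])
    finally show ?thesis .
  qed
  moreover have "(\<integral>Y. - f Y \<partial>gauss I) = - s * null_ent I M v" unfolding f_def null_ent_def by simp
  ultimately show ?thesis by simp
qed

text \<open>A coupling splices two independent configurations into a new one with the same law; it
  expresses that the parts read off from the two arguments are independent.\<close>

definition coupling :: "'s measure \<Rightarrow> ('s \<times> 's \<Rightarrow> 's) \<Rightarrow> bool" where
  "coupling M sp \<longleftrightarrow> sp \<in> measurable (M \<Otimes>\<^sub>M M) M \<and> distr (M \<Otimes>\<^sub>M M) M sp = M"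

lemma integral_coupling:
  fixes f :: "'s \<Rightarrow> real"
  assumes "coupling M sp" "prob_space M" "integrable M f"
  shows "(\<integral>\<sigma>. f \<sigma> \<partial>M) = (\<integral>\<sigma>. \<integral>\<tau>. f (sp (\<sigma>, \<tau>)) \<partial>M \<partial>M)"
    and "integrable (M \<Otimes>\<^sub>M M) (\<lambda>p. f (sp p))"
proof -
  interpret prob_space M by fact
  interpret P: pair_prob_space M M ..
  have sp: "sp \<in> measurable (M \<Otimes>\<^sub>M M) M" "distr (M \<Otimes>\<^sub>M M) M sp = M" using assms(1) by (auto simp: coupling_def)
  have i: "integrable (distr (M \<Otimes>\<^sub>M M) M sp) f" using assms(3) sp by simp
  show i2: "integrable (M \<Otimes>\<^sub>M M) (\<lambda>p. f (sp p))" using i sp(1) assms(3) by (subst (asm) integrable_distr_eq) auto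
  have "(\<integral>\<sigma>. f \<sigma> \<partial>M) = (\<integral>p. f (sp p) \<partial>(M \<Otimes>\<^sub>M M))"
    using integral_distr[OF sp(1) borel_measurable_integrable[OF assms(3)]] sp(2) by simp
  also have "\<dots> = (\<integral>\<sigma>. \<integral>\<tau>. f (sp (\<sigma>, \<tau>)) \<partial>M \<partial>M)" using P.integral_fst'[OF i2] by simp
  finally show "(\<integral>\<sigma>. f \<sigma> \<partial>M) = (\<integral>\<sigma>. \<integral>\<tau>. f (sp (\<sigma>, \<tau>)) \<partial>M \<partial>M)" .
qed

lemma l1_norm_shift_le:
  assumes "finite I" "\<And>i. i \<in> I \<Longrightarrow> \<bar>u i\<bar> \<le> c"
  shows "l1_norm I (\<lambda>i\<in>I. Y i + u i) \<le> l1_norm I Y + c * card I"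
proof -
  have "l1_norm I (\<lambda>i\<in>I. Y i + u i) \<le> (\<Sum>i\<in>I. \<bar>Y i\<bar> + c)"
    unfolding l1_norm_def using assms by (intro sum_mono) (auto intro: order_trans[OF abs_triangle_ineq])
  then show ?thesis by (simp add: l1_norm_def sum.distrib mult.commute)
qed

lemma exp_dominated_shift:
  assumes "finite I" "\<And>z i. i \<in> I \<Longrightarrow> \<bar>u z i\<bar> \<le> c" "exp_dominated I (\<lambda>Y. Y) f"
  shows "exp_dominated I n (\<lambda>z. f (\<lambda>i\<in>I. n z i + u z i))"
proof -
  obtain K k where 1: "0 \<le> K" "0 \<le> k" "\<And>z. \<bar>f z\<bar> \<le> K * exp (k * l1_norm I z)" using assms(3) unfolding exp_dominated_def by auto
  show ?thesis
  proof (rule exp_dominatedI[of _ "K * exp (k * (c * card I))" k])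
    fix z
    note 1(3)[of "\<lambda>i\<in>I. n z i + u z i"]
    also have "K * exp (k * l1_norm I (\<lambda>i\<in>I. n z i + u z i)) \<le> K * exp (k * (l1_norm I (n z) + c * card I))"
      using 1 l1_norm_shift_le[of I "u z" c "n z"] assms by (intro mult_left_mono iffD2[OF exp_le_cancel_iff]) auto
    also have "\<dots> = K * exp (k * (c * card I)) * exp (k * l1_norm I (n z))" by (simp add: exp_add distrib_left)
    finally show "\<bar>f (\<lambda>i\<in>I. n z i + u z i)\<bar> \<le> K * exp (k * (c * card I)) * exp (k * l1_norm I (n z))" .
  qed (use 1 in auto)
qed

lemma exp_dominated_shift_minus:
  assumes "finite I" "\<And>z i. i \<in> I \<Longrightarrow> \<bar>u z i\<bar> \<le> c" "exp_dominated I (\<lambda>Y. Y) f"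
  shows "exp_dominated I n (\<lambda>z. f (\<lambda>i\<in>I. n z i - u z i))"
  using exp_dominated_shift[of I "\<lambda>z i. - u z i" c f n] assms by simp

lemma exp_dominated_integral_bounded:
  assumes "finite I" "exp_dominated I fst (\<lambda>(Y, \<sigma>). f Y \<sigma>)"
  obtains B where "\<And>\<sigma>. \<bar>\<integral>Y. f Y \<sigma> \<partial>gauss I\<bar> \<le> B"
proof -
  obtain K k where 1: "0 \<le> K" "0 \<le> k" "\<And>Y \<sigma>. \<bar>f Y \<sigma>\<bar> \<le> K * exp (k * l1_norm I Y)" using assms(2) unfolding exp_dominated_def by auto
  have i: "integrable (gauss I) (\<lambda>Y. K * exp (k * l1_norm I Y))" using integrable_exp_l1_norm[OF assms(1)] by simp
  have "\<bar>\<integral>Y. f Y \<sigma> \<partial>gauss I\<bar> \<le> (\<integral>Y. K * exp (k * l1_norm I Y) \<partial>gauss I)" for \<sigma>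
  proof (cases "integrable (gauss I) (\<lambda>Y. f Y \<sigma>)")
    case True
    have "\<bar>\<integral>Y. f Y \<sigma> \<partial>gauss I\<bar> \<le> (\<integral>Y. \<bar>f Y \<sigma>\<bar> \<partial>gauss I)" by (rule integral_abs_bound)
    also have "\<dots> \<le> (\<integral>Y. K * exp (k * l1_norm I Y) \<partial>gauss I)" using 1 True i by (intro integral_mono) auto
    finally show ?thesis .
  next
    case False then show ?thesis using 1 by (simp add: not_integrable_integral_eq integral_nonneg)
  qed
  then show ?thesis by (rule that)
qed

text \<open>Once the signal \<open>u\<close> is known, \<open>w\<close> is seen in the recentred
  data \<open>Y - u\<close>.\<close>

lemma cm_dens_add_shift: "cm_dens I (\<lambda>i. u i + w i) Y = cm_dens I u Y * cm_dens I w (\<lambda>i\<in>I. Y i - u i)"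
  using cm_dens_shift[of I w Y "\<lambda>i. - u i"] by (simp add: cm_dens_add sum_negf mult_ac)

section \<open>Likelihoods of a sum of two independent signals\<close>

context
  fixes I :: "'i set" and M :: "'s measure" and c :: real and v1 v2 :: "'s \<Rightarrow> 'i \<Rightarrow> real" and sp :: "'s \<times> 's \<Rightarrow> 's"
  assumes b1: "bounded_feat I M c v1" and b2: "bounded_feat I M c v2" and sp: "coupling M sp"
    and sp1: "\<And>\<sigma> \<tau> i. \<sigma> \<in> space M \<Longrightarrow> \<tau> \<in> space M \<Longrightarrow> i \<in> I \<Longrightarrow> v1 (sp (\<sigma>, \<tau>)) i = v1 \<sigma> i"
    and sp2: "\<And>\<sigma> \<tau> i. \<sigma> \<in> space M \<Longrightarrow> \<tau> \<in> space M \<Longrightarrow> i \<in> I \<Longrightarrow> v2 (sp (\<sigma>, \<tau>)) i = v2 \<tau> i"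
begin

lemma bounded_feat_add: "bounded_feat I M (2 * c) (\<lambda>\<sigma> i. v1 \<sigma> i + v2 \<sigma> i)"
proof -
  have "\<bar>v1 \<sigma> i + v2 \<sigma> i\<bar> \<le> 2 * c" if "i \<in> I" for \<sigma> i
    using bounded_featD(5)[OF b1 that, of \<sigma>] bounded_featD(5)[OF b2 that, of \<sigma>] by linarith
  then show ?thesis
    using bounded_featD(1-4)[OF b1] bounded_featD(4)[OF b2] unfolding bounded_feat_def by auto
qed

interpretation M: prob_space M by (rule bounded_featD[OF b1])

text \<open>Independence enters through the coupling: the two signals may be read off from two
  independent configurations.\<close>

lemma mix_lik_add: "mix_lik I M (\<lambda>\<sigma> i. v1 \<sigma> i + v2 \<sigma> i) Y = (\<integral>\<sigma>. \<integral>\<tau>. cm_dens I (\<lambda>i. v1 \<sigma> i + v2 \<tau> i) Y \<partial>M \<partial>M)"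
proof -
  have "mix_lik I M (\<lambda>\<sigma> i. v1 \<sigma> i + v2 \<sigma> i) Y = (\<integral>\<sigma>. \<integral>\<tau>. cm_dens I (\<lambda>i. v1 (sp (\<sigma>, \<tau>)) i + v2 (sp (\<sigma>, \<tau>)) i) Y \<partial>M \<partial>M)"
    unfolding mix_lik_def using cm_dens_feat_integrable[OF bounded_feat_add]
    by (intro integral_coupling[OF sp M.prob_space_axioms]) auto
  also have "\<dots> = (\<integral>\<sigma>. \<integral>\<tau>. cm_dens I (\<lambda>i. v1 \<sigma> i + v2 \<tau> i) Y \<partial>M \<partial>M)"
    by (intro Bochner_Integration.integral_cong refl cm_dens_cong) (auto simp: sp1 sp2)
  finally show ?thesis .
qed

lemma mix_lik_add': "mix_lik I M (\<lambda>\<sigma> i. v1 \<sigma> i + v2 \<sigma> i) Y = (\<integral>\<sigma>. cm_dens I (v1 \<sigma>) Y * mix_lik I M v2 (\<lambda>i\<in>I. Y i - v1 \<sigma> i) \<partial>M)"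
  unfolding mix_lik_add by (simp add: cm_dens_add_shift mix_lik_def)

lemma shift_measurable2:
  "(\<lambda>z. \<lambda>i\<in>I. fst z i + r * v1 (snd z) i) \<in> measurable (gauss I \<Otimes>\<^sub>M M) (gauss I)"
  "(\<lambda>\<sigma>. \<lambda>i\<in>I. Y i + r * v1 \<sigma> i) \<in> measurable M (gauss I)"
proof -
  have [measurable]: "(\<lambda>z. v1 (snd z) i) \<in> borel_measurable (gauss I \<Otimes>\<^sub>M M)" if "i \<in> I" for i
    using measurable_compose[OF measurable_snd bounded_featD(4)[OF b1 that]] .
  show "(\<lambda>z. \<lambda>i\<in>I. fst z i + r * v1 (snd z) i) \<in> measurable (gauss I \<Otimes>\<^sub>M M) (gauss I)" by measurable
  note [measurable] = bounded_featD(4)[OF b1]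
  show "(\<lambda>\<sigma>. \<lambda>i\<in>I. Y i + r * v1 \<sigma> i) \<in> measurable M (gauss I)" by measurable
qed

text \<open>The model contains both signals while the data contain only \<open>v1\<close>. By Jensen
  under the posterior of \<open>v1\<close>, \<open>ln (L / L1)\<close> is at least the posterior
  mean of the log-likelihood of \<open>v2\<close> at the residual \<open>Y - v1 \<sigma>\<close>.
  Averaged over the planted law of \<open>v1\<close>, this residual is pure noise, which gives
  \<open>null_ent I M v2\<close>.\<close>

lemma mix_lik_ln_add_ge:
  "(\<integral>Y. mix_lik I M v1 Y * ln (mix_lik I M (\<lambda>\<sigma> i. v1 \<sigma> i + v2 \<sigma> i) Y) \<partial>gauss I) \<ge> planted_ent I M v1 + null_ent I M v2"
proof -
  note fin = bounded_featD(1)[OF b1]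
  let ?L1 = "mix_lik I M v1" and ?L = "mix_lik I M (\<lambda>\<sigma> i. v1 \<sigma> i + v2 \<sigma> i)"
  let ?X = "\<lambda>\<sigma> Y. ln (mix_lik I M v2 (\<lambda>i\<in>I. Y i - v1 \<sigma> i))"
  have sh: "(\<lambda>z. \<lambda>i\<in>I. fst z i - v1 (snd z) i) \<in> measurable (gauss I \<Otimes>\<^sub>M M) (gauss I)"
    using shift_measurable2(1)[of "-1"] by simp
  have sh1: "(\<lambda>\<sigma>. \<lambda>i\<in>I. Y i - v1 \<sigma> i) \<in> measurable M (gauss I)" for Y
    using shift_measurable2(2)[of Y "-1"] by simp
  note [measurable] = mix_lik_measurable[OF b1] mix_lik_measurable[OF b2] mix_lik_measurable[OF bounded_feat_add]
    measurable_compose[OF sh mix_lik_measurable[OF b2]] measurable_compose[OF sh1 mix_lik_measurable[OF b2]]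
    cm_dens_feat_measurable[OF b1] cm_dens_feat_measurable1[OF b1]
  have edX: "exp_dominated I fst (\<lambda>z. ?X (snd z) (fst z))"
    by (rule exp_dominated_shift_minus[where c=c]) (use fin bounded_featD[OF b1] exp_dominated_ln_mix_lik[OF b2] in auto)
  have edgX: "exp_dominated I fst (\<lambda>(Y, \<sigma>). cm_dens I (v1 \<sigma>) Y * ?X \<sigma> Y)"
    unfolding split_beta' by (intro exp_dominated_mult edX exp_dominated_cm_dens[where c=c] fin) (use bounded_featD[OF b1] in auto)
  have pw: "?L1 Y * ln (?L1 Y) + (\<integral>\<sigma>. cm_dens I (v1 \<sigma>) Y * ?X \<sigma> Y \<partial>M) \<le> ?L1 Y * ln (?L Y)" for Y
  proof -
    have L1p: "0 < ?L1 Y" by (rule mix_lik_pos[OF b1])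
    have Lp: "0 < ?L Y" by (rule mix_lik_pos[OF bounded_feat_add])
    obtain K k where K: "\<And>z. \<bar>cm_dens I (v1 (snd z)) (fst z) * ?X (snd z) (fst z)\<bar> \<le> K * exp (k * l1_norm I (fst z))"
      using edgX unfolding exp_dominated_def split_beta' by auto
    have i1: "integrable M (\<lambda>\<sigma>. cm_dens I (v1 \<sigma>) Y * ?X \<sigma> Y)"
      by (rule M.integrable_const_bound[where B="K * exp (k * l1_norm I Y)"]) (use K[of "(Y, _)"] in auto)
    have "exp_dominated I fst (\<lambda>z. cm_dens I (v1 (snd z)) (fst z) * mix_lik I M v2 (\<lambda>i\<in>I. fst z i - v1 (snd z) i))"
      by (intro exp_dominated_mult exp_dominated_cm_dens[where c=c] fin exp_dominated_shift_minus[where c=c]) (use bounded_featD[OF b1] exp_dominated_mix_lik[OF b2] in auto)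
    then obtain K' k' where K': "\<And>z. \<bar>cm_dens I (v1 (snd z)) (fst z) * mix_lik I M v2 (\<lambda>i\<in>I. fst z i - v1 (snd z) i)\<bar> \<le> K' * exp (k' * l1_norm I (fst z))"
      unfolding exp_dominated_def by auto
    have i2: "integrable M (\<lambda>\<sigma>. cm_dens I (v1 \<sigma>) Y * mix_lik I M v2 (\<lambda>i\<in>I. Y i - v1 \<sigma> i))"
      by (rule M.integrable_const_bound[where B="K' * exp (k' * l1_norm I Y)"]) (use K'[of "(Y, _)"] in auto)
    have "exp (\<integral>\<sigma>. cm_dens I (v1 \<sigma>) Y / ?L1 Y * ?X \<sigma> Y \<partial>M) \<le> (\<integral>\<sigma>. cm_dens I (v1 \<sigma>) Y / ?L1 Y * exp (?X \<sigma> Y) \<partial>M)"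
    proof (rule exp_integral_le_weighted)
      show "integrable M (\<lambda>\<sigma>. cm_dens I (v1 \<sigma>) Y / ?L1 Y)" using cm_dens_feat_integrable[OF b1] by simp
      show "(\<integral>\<sigma>. cm_dens I (v1 \<sigma>) Y / ?L1 Y \<partial>M) = 1" using L1p by (simp add: mix_lik_def)
      show "integrable M (\<lambda>\<sigma>. cm_dens I (v1 \<sigma>) Y / ?L1 Y * ?X \<sigma> Y)" using i1 by simp
      show "integrable M (\<lambda>\<sigma>. cm_dens I (v1 \<sigma>) Y / ?L1 Y * exp (?X \<sigma> Y))" using i2 mix_lik_pos[OF b2] by simp
    qed (use L1p in auto)
    also have "\<dots> = ?L Y / ?L1 Y" using mix_lik_pos[OF b2] by (simp add: mix_lik_add')
    finally have "ln (exp (\<integral>\<sigma>. cm_dens I (v1 \<sigma>) Y / ?L1 Y * ?X \<sigma> Y \<partial>M)) \<le> ln (?L Y / ?L1 Y)"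
      using L1p Lp by (subst ln_le_cancel_iff) auto
    then have "(\<integral>\<sigma>. cm_dens I (v1 \<sigma>) Y * ?X \<sigma> Y \<partial>M) / ?L1 Y \<le> ln (?L Y) - ln (?L1 Y)"
      using L1p Lp by (simp add: ln_div)
    then show ?thesis using L1p by (simp add: field_simps)
  qed
  \<comment> \<open>After the integrals are exchanged, the Cameron-Martin shift by
    \<open>v1 \<sigma>\<close> cancels the subtraction.\<close>
  have sw: "(\<integral>Y. \<integral>\<sigma>. cm_dens I (v1 \<sigma>) Y * ?X \<sigma> Y \<partial>M \<partial>gauss I) = null_ent I M v2"
  proof -
    have "(\<integral>Y. \<integral>\<sigma>. cm_dens I (v1 \<sigma>) Y * ?X \<sigma> Y \<partial>M \<partial>gauss I) = (\<integral>\<sigma>. \<integral>Y. cm_dens I (v1 \<sigma>) Y * ?X \<sigma> Y \<partial>gauss I \<partial>M)"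
      by (intro exp_dominated_swap fin M.prob_space_axioms edgX) (simp add: split_beta')
    also have "\<dots> = (\<integral>\<sigma>. null_ent I M v2 \<partial>M)"
    proof (intro Bochner_Integration.integral_cong refl)
      fix \<sigma>
      have "(\<integral>Y. cm_dens I (v1 \<sigma>) Y * ?X \<sigma> Y \<partial>gauss I) = (\<integral>Y. ?X \<sigma> (\<lambda>i\<in>I. Y i + v1 \<sigma> i) \<partial>gauss I)"
        by (intro integral_cm_dens_mult fin borel_measurable_ln measurable_compose[OF _ mix_lik_measurable[OF b2]]) measurable
      also have "\<dots> = null_ent I M v2" unfolding null_ent_def
      proof (intro Bochner_Integration.integral_cong refl arg_cong[where f="\<lambda>y. ln (mix_lik I M v2 y)"])
        fix Y assume "Y \<in> space (gauss I)"
        then show "(\<lambda>i\<in>I. (\<lambda>i\<in>I. Y i + v1 \<sigma> i) i - v1 \<sigma> i) = Y"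
          by (auto simp: space_PiM PiE_def extensional_def)
      qed
      finally show "(\<integral>Y. cm_dens I (v1 \<sigma>) Y * ?X \<sigma> Y \<partial>gauss I) = null_ent I M v2" .
    qed
    finally show ?thesis by (simp add: M.prob_space)
  qed
  have mI: "(\<lambda>Y. \<integral>\<sigma>. cm_dens I (v1 \<sigma>) Y * ?X \<sigma> Y \<partial>M) \<in> borel_measurable (gauss I)"
    by (intro M.borel_measurable_lebesgue_integral) (simp add: split_beta')
  have iI: "integrable (gauss I) (\<lambda>Y. \<integral>\<sigma>. cm_dens I (v1 \<sigma>) Y * ?X \<sigma> Y \<partial>M)"
    by (intro exp_dominated_integrable fin mI exp_dominated_integral M.prob_space_axioms edgX)
  have "planted_ent I M v1 + null_ent I M v2 = (\<integral>Y. ?L1 Y * ln (?L1 Y) + (\<integral>\<sigma>. cm_dens I (v1 \<sigma>) Y * ?X \<sigma> Y \<partial>M) \<partial>gauss I)"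
    using iI integrable_mix_lik_ln_mix_lik[OF b1] by (simp add: planted_ent_def sw)
  also have "\<dots> \<le> (\<integral>Y. ?L1 Y * ln (?L Y) \<partial>gauss I)"
  proof (intro integral_mono pw)
    show "integrable (gauss I) (\<lambda>Y. ?L1 Y * ln (?L1 Y) + (\<integral>\<sigma>. cm_dens I (v1 \<sigma>) Y * ?X \<sigma> Y \<partial>M))"
      using iI integrable_mix_lik_ln_mix_lik[OF b1] by simp
    show "integrable (gauss I) (\<lambda>Y. ?L1 Y * ln (?L Y))"
      by (intro exp_dominated_integrable fin exp_dominated_mult exp_dominated_mix_lik[OF b1] exp_dominated_ln_mix_lik[OF bounded_feat_add]) measurable
  qed
  finally show ?thesis .
qed

text \<open>The bound for data planted with \<open>v1\<close> is carried back to pure noise by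
  concentration. For tensor features the last sum is \<open>O(N)\<close>, so if the planted entropy
  of \<open>v1\<close> is \<open>o(N)\<close>, a small \<open>s\<close> makes the total loss small
  relative to \<open>N\<close>.\<close>

lemma null_ent_add_ge:
  fixes cc :: "'i \<Rightarrow> real"
  assumes cc: "\<And>\<tau> i. i \<in> I \<Longrightarrow> \<bar>v1 \<tau> i + v2 \<tau> i\<bar> \<le> cc i" and s: "0 < s"
  shows "null_ent I M (\<lambda>\<sigma> i. v1 \<sigma> i + v2 \<sigma> i) \<ge> null_ent I M v2 - planted_ent I M v1 / s - s * (\<Sum>i\<in>I. (cc i)\<^sup>2)"
proof -
  let ?E = "\<integral>Y. mix_lik I M v1 Y * ln (mix_lik I M (\<lambda>\<sigma> i. v1 \<sigma> i + v2 \<sigma> i) Y) \<partial>gauss I"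
  have "s * ?E - planted_ent I M v1 - s * null_ent I M (\<lambda>\<sigma> i. v1 \<sigma> i + v2 \<sigma> i) \<le> s\<^sup>2 * (\<Sum>i\<in>I. (cc i)\<^sup>2)"
    using s by (intro mix_lik_transfer_null[OF bounded_feat_add b1 cc]) auto
  moreover have "s * null_ent I M v2 \<le> s * ?E" using mix_lik_ln_add_ge planted_ent_nonneg[OF b1] s by (intro mult_left_mono) auto
  ultimately have "s * null_ent I M v2 - planted_ent I M v1 - s\<^sup>2 * (\<Sum>i\<in>I. (cc i)\<^sup>2) \<le> s * null_ent I M (\<lambda>\<sigma> i. v1 \<sigma> i + v2 \<sigma> i)" by linarith
  then show ?thesis using s by (simp add: field_simps power2_eq_square)
qed

text \<open>A deterministic shift \<open>u\<close> of the data multiplies each density by the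
  exponential of its inner product with \<open>u\<close>. Jensen under the posterior bounds the gain
  in \<open>ln\<close> below by the posterior mean of this inner product, and the planted average of
  a posterior mean is the prior mean.\<close>

lemma integral_mix_lik_ln_shift_ge:
  assumes u: "\<And>i. i \<in> I \<Longrightarrow> \<bar>u i\<bar> \<le> c"
  shows "(\<integral>Y. mix_lik I M v1 Y * ln (mix_lik I M v1 (\<lambda>i\<in>I. Y i + u i)) \<partial>gauss I) \<ge> planted_ent I M v1 + (\<integral>\<tau>. (\<Sum>i\<in>I. u i * v1 \<tau> i) \<partial>M)"
proof -
  note fin = bounded_featD(1)[OF b1]
  let ?L1 = "mix_lik I M v1"
  let ?k = "\<lambda>\<tau>. \<Sum>i\<in>I. u i * v1 \<tau> i"
  have km[measurable]: "?k \<in> borel_measurable M" using bounded_featD(4)[OF b1] by measurable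
  have kb: "\<bar>?k \<tau>\<bar> \<le> card I * (c * c)" for \<tau>
  proof -
    have "\<bar>?k \<tau>\<bar> \<le> (\<Sum>i\<in>I. \<bar>u i * v1 \<tau> i\<bar>)" by (rule sum_abs)
    also have "\<dots> \<le> (\<Sum>i\<in>I. c * c)" using u bounded_featD[OF b1] by (intro sum_mono) (auto simp: abs_mult intro!: mult_mono)
    finally show ?thesis by simp
  qed
  note [measurable] = mix_lik_measurable[OF b1] cm_dens_feat_measurable[OF b1] cm_dens_feat_measurable1[OF b1]
  have pw: "?L1 Y * ln (?L1 Y) + (\<integral>\<tau>. cm_dens I (v1 \<tau>) Y * ?k \<tau> \<partial>M) \<le> ?L1 Y * ln (?L1 (\<lambda>i\<in>I. Y i + u i))" for Y
  proof -
    have L1p: "0 < ?L1 Y" and Lp: "0 < ?L1 (\<lambda>i\<in>I. Y i + u i)" by (rule mix_lik_pos[OF b1])+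
    have gb: "cm_dens I (v1 \<tau>) Y \<le> exp (c * l1_norm I Y)" for \<tau> using cm_dens_bounds(1)[of I "v1 \<tau>" c Y] bounded_featD[OF b1] by auto
    have i1: "integrable M (\<lambda>\<tau>. cm_dens I (v1 \<tau>) Y * ?k \<tau>)"
      by (rule M.integrable_const_bound[where B="exp (c * l1_norm I Y) * (card I * (c * c))"])
        (auto simp: abs_mult intro!: AE_I2 mult_mono gb kb)
    have e: "cm_dens I (v1 \<tau>) (\<lambda>i\<in>I. Y i + u i) = cm_dens I (v1 \<tau>) Y * exp (?k \<tau>)" for \<tau>
      by (simp add: cm_dens_shift mult.commute)
    have i2: "integrable M (\<lambda>\<tau>. cm_dens I (v1 \<tau>) Y * exp (?k \<tau>))"
      using cm_dens_feat_integrable[OF b1, of "\<lambda>i\<in>I. Y i + u i"] by (simp add: e)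
    have "exp (\<integral>\<tau>. cm_dens I (v1 \<tau>) Y / ?L1 Y * ?k \<tau> \<partial>M) \<le> (\<integral>\<tau>. cm_dens I (v1 \<tau>) Y / ?L1 Y * exp (?k \<tau>) \<partial>M)"
    proof (rule exp_integral_le_weighted)
      show "integrable M (\<lambda>\<tau>. cm_dens I (v1 \<tau>) Y / ?L1 Y)" using cm_dens_feat_integrable[OF b1] by simp
      show "(\<integral>\<tau>. cm_dens I (v1 \<tau>) Y / ?L1 Y \<partial>M) = 1" using L1p by (simp add: mix_lik_def)
    qed (use L1p i1 i2 in auto)
    also have "\<dots> = ?L1 (\<lambda>i\<in>I. Y i + u i) / ?L1 Y" by (simp add: mix_lik_def e)
    finally have "ln (exp (\<integral>\<tau>. cm_dens I (v1 \<tau>) Y / ?L1 Y * ?k \<tau> \<partial>M)) \<le> ln (?L1 (\<lambda>i\<in>I. Y i + u i) / ?L1 Y)"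
      using L1p Lp by (subst ln_le_cancel_iff) auto
    then have "(\<integral>\<tau>. cm_dens I (v1 \<tau>) Y * ?k \<tau> \<partial>M) / ?L1 Y \<le> ln (?L1 (\<lambda>i\<in>I. Y i + u i)) - ln (?L1 Y)"
      using L1p Lp by (simp add: ln_div)
    then show ?thesis using L1p by (simp add: field_simps)
  qed
  have edk: "exp_dominated I fst (\<lambda>(Y, \<tau>). cm_dens I (v1 \<tau>) Y * ?k \<tau>)"
    unfolding split_beta'
    by (intro exp_dominated_mult exp_dominated_cm_dens[where c=c] fin exp_dominated_bounded[where K="card I * (c * c)"] kb) (use bounded_featD[OF b1] in auto)
  have iI: "integrable (gauss I) (\<lambda>Y. \<integral>\<tau>. cm_dens I (v1 \<tau>) Y * ?k \<tau> \<partial>M)"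
    by (intro exp_dominated_integrable fin exp_dominated_integral M.prob_space_axioms edk M.borel_measurable_lebesgue_integral) (simp add: split_beta')
  have sw: "(\<integral>Y. \<integral>\<tau>. cm_dens I (v1 \<tau>) Y * ?k \<tau> \<partial>M \<partial>gauss I) = (\<integral>\<tau>. ?k \<tau> \<partial>M)"
    by (subst exp_dominated_swap[OF fin M.prob_space_axioms _ edk]) (simp_all add: split_beta' integral_cm_dens fin)
  have "planted_ent I M v1 + (\<integral>\<tau>. ?k \<tau> \<partial>M) = (\<integral>Y. ?L1 Y * ln (?L1 Y) + (\<integral>\<tau>. cm_dens I (v1 \<tau>) Y * ?k \<tau> \<partial>M) \<partial>gauss I)"
    using iI integrable_mix_lik_ln_mix_lik[OF b1] by (simp add: planted_ent_def sw)
  also have "\<dots> \<le> (\<integral>Y. ?L1 Y * ln (?L1 (\<lambda>i\<in>I. Y i + u i)) \<partial>gauss I)"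
  proof (intro integral_mono pw)
    show "integrable (gauss I) (\<lambda>Y. ?L1 Y * ln (?L1 Y) + (\<integral>\<tau>. cm_dens I (v1 \<tau>) Y * ?k \<tau> \<partial>M))"
      using iI integrable_mix_lik_ln_mix_lik[OF b1] by simp
    show "integrable (gauss I) (\<lambda>Y. ?L1 Y * ln (?L1 (\<lambda>i\<in>I. Y i + u i)))"
      by (intro exp_dominated_integrable fin exp_dominated_mult exp_dominated_mix_lik[OF b1] exp_dominated_shift[where c=c and n="\<lambda>Y. Y" and u="\<lambda>_. u"] u exp_dominated_ln_mix_lik[OF b1]
          borel_measurable_times borel_measurable_ln measurable_compose[OF shift_measurable mix_lik_measurable[OF b1]]) measurable
  qed
  finally show ?thesis .
qed

text \<open>The likelihood of \<open>v1\<close> alone is tested on data that also contain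
  \<open>v2\<close>. Given its configuration, \<open>v2\<close> is a deterministic shift, so the
  previous bound applies and only the prior mean of the covariance between independent copies of the
  two signals remains.\<close>

lemma mix_lik_add_ln_ge:
  "(\<integral>Y. mix_lik I M (\<lambda>\<sigma> i. v1 \<sigma> i + v2 \<sigma> i) Y * ln (mix_lik I M v1 Y) \<partial>gauss I)
     \<ge> planted_ent I M v1 + (\<integral>\<sigma>. \<integral>\<tau>. (\<Sum>i\<in>I. v2 \<sigma> i * v1 \<tau> i) \<partial>M \<partial>M)"
proof -
  note fin = bounded_featD(1)[OF b1]
  let ?L1 = "mix_lik I M v1"
  interpret P: pair_prob_space M M ..
  let ?N = "M \<Otimes>\<^sub>M M"
  let ?f = "\<lambda>Y p. cm_dens I (\<lambda>i. v1 (fst p) i + v2 (snd p) i) Y * ln (?L1 Y)"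
  have vm[measurable]: "(\<lambda>p. v1 (fst p) i) \<in> borel_measurable ?N" "(\<lambda>p. v2 (snd p) i) \<in> borel_measurable ?N"
    "(\<lambda>p. v1 (snd p) i) \<in> borel_measurable ?N"
    "(\<lambda>p. v2 (fst p) i) \<in> borel_measurable ?N"
     if "i \<in> I" for i
    using measurable_compose[OF measurable_fst bounded_featD(4)[OF b1 that]] measurable_compose[OF measurable_snd bounded_featD(4)[OF b2 that]]
     measurable_compose[OF measurable_snd bounded_featD(4)[OF b1 that]] measurable_compose[OF measurable_fst bounded_featD(4)[OF b2 that]] by auto
  note [measurable] = mix_lik_measurable[OF b1] bounded_featD(4)[OF b1] bounded_featD(4)[OF b2]
  have gm[measurable]: "(\<lambda>z. cm_dens I (\<lambda>i. v1 (fst (snd z)) i + v2 (snd (snd z)) i) (fst z)) \<in> borel_measurable (gauss I \<Otimes>\<^sub>M ?N)"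
    by (intro cm_dens_joint_measurable fin borel_measurable_add measurable_compose[OF measurable_snd vm(1)] measurable_compose[OF measurable_snd vm(2)]) measurable
  have bd: "\<bar>v1 \<sigma> i + v2 \<tau> i\<bar> \<le> 2 * c" if "i \<in> I" for \<sigma> \<tau> i
    using bounded_featD(5)[OF b1 that, of \<sigma>] bounded_featD(5)[OF b2 that, of \<tau>] by linarith
  have ed: "exp_dominated I fst (\<lambda>(Y, p). ?f Y p)" unfolding split_beta'
    by (intro exp_dominated_mult exp_dominated_cm_dens[where c="2 * c"] fin exp_dominated_ln_mix_lik[OF b1] bd)
  have "(\<integral>Y. mix_lik I M (\<lambda>\<sigma> i. v1 \<sigma> i + v2 \<sigma> i) Y * ln (?L1 Y) \<partial>gauss I) = (\<integral>Y. \<integral>p. ?f Y p \<partial>?N \<partial>gauss I)"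
  proof (intro Bochner_Integration.integral_cong refl)
    fix Y
    have "(\<lambda>p. cm_dens I (\<lambda>i. v1 (fst p) i + v2 (snd p) i) Y) \<in> borel_measurable ?N"
      by (intro cm_dens_joint_measurable fin) measurable
    then have "integrable ?N (\<lambda>p. cm_dens I (\<lambda>i. v1 (fst p) i + v2 (snd p) i) Y)"
      by (intro P.integrable_const_bound[where B="exp (2 * c * l1_norm I Y)"]) (auto intro!: AE_I2 cm_dens_bounds fin bd)
    from P.integral_fst'[OF this]
    show "mix_lik I M (\<lambda>\<sigma> i. v1 \<sigma> i + v2 \<sigma> i) Y * ln (?L1 Y) = (\<integral>p. ?f Y p \<partial>?N)"
      by (simp add: mix_lik_add)
  qed
  also have "\<dots> = (\<integral>p. \<integral>Y. ?f Y p \<partial>gauss I \<partial>?N)"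
    by (intro exp_dominated_swap fin P.prob_space_axioms ed) (simp add: split_beta')
  \<comment> \<open>The data are shifted by both signals, and the shift by \<open>v1\<close> is then
    turned back into a density, so that only \<open>v2\<close> still moves the argument of
    \<open>ln\<close>.\<close>
  also have "\<dots> = (\<integral>p. \<integral>Y. cm_dens I (v1 (fst p)) Y * ln (?L1 (\<lambda>i\<in>I. Y i + v2 (snd p) i)) \<partial>gauss I \<partial>?N)"
  proof (rule Bochner_Integration.integral_cong[OF refl])
    fix p
    have "(\<integral>Y. ?f Y p \<partial>gauss I) = (\<integral>Y. ln (?L1 (\<lambda>i\<in>I. Y i + (v1 (fst p) i + v2 (snd p) i))) \<partial>gauss I)"
      by (intro integral_cm_dens_mult fin) measurable
    also have "\<dots> = (\<integral>Y. cm_dens I (v1 (fst p)) Y * ln (?L1 (\<lambda>i\<in>I. Y i + v2 (snd p) i)) \<partial>gauss I)"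
    proof -
      have m: "(\<lambda>Y. ln (?L1 (\<lambda>i\<in>I. Y i + v2 (snd p) i))) \<in> borel_measurable (gauss I)"
        by (intro borel_measurable_ln measurable_compose[OF shift_measurable mix_lik_measurable[OF b1]])
      have e: "(\<lambda>i\<in>I. Y i + (v1 (fst p) i + v2 (snd p) i)) = (\<lambda>i\<in>I. (\<lambda>i\<in>I. Y i + v1 (fst p) i) i + v2 (snd p) i)" for Y
        by (auto simp: add.assoc)
      show ?thesis unfolding integral_cm_dens_mult[OF fin m] by (simp only: e)
    qed
    finally show "(\<integral>Y. ?f Y p \<partial>gauss I) = (\<integral>Y. cm_dens I (v1 (fst p)) Y * ln (?L1 (\<lambda>i\<in>I. Y i + v2 (snd p) i)) \<partial>gauss I)" .
  qed
  also have "\<dots> = (\<integral>\<tau>. \<integral>\<sigma>. \<integral>Y. cm_dens I (v1 \<sigma>) Y * ln (?L1 (\<lambda>i\<in>I. Y i + v2 \<tau> i)) \<partial>gauss I \<partial>M \<partial>M)"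
  proof -
    let ?h = "\<lambda>p Y. cm_dens I (v1 (fst p)) Y * ln (?L1 (\<lambda>i\<in>I. Y i + v2 (snd p) i))"
    have e: "exp_dominated I fst (\<lambda>(Y, p). ?h p Y)" unfolding split_beta'
      by (intro exp_dominated_mult exp_dominated_cm_dens[where c=c] fin exp_dominated_shift[where c=c] exp_dominated_ln_mix_lik[OF b1]) (use bounded_featD[OF b1] bounded_featD[OF b2] in auto)
    obtain B where B: "\<And>p. \<bar>\<integral>Y. ?h p Y \<partial>gauss I\<bar> \<le> B" using exp_dominated_integral_bounded[OF fin e] by blast
    have sfG: "sigma_finite_measure (gauss I)" by (intro prob_space_imp_sigma_finite prob_space_gauss)
    have vm2: "(\<lambda>z. v1 (fst (fst z)) i) \<in> borel_measurable (?N \<Otimes>\<^sub>M gauss I)" "(\<lambda>z. v2 (snd (fst z)) i) \<in> borel_measurable (?N \<Otimes>\<^sub>M gauss I)" if "i \<in> I" for i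
      using measurable_compose[OF measurable_fst vm(1)[OF that]] measurable_compose[OF measurable_fst vm(2)[OF that]] by auto
    have m1: "(\<lambda>z. cm_dens I (v1 (fst (fst z))) (snd z)) \<in> borel_measurable (?N \<Otimes>\<^sub>M gauss I)"
      by (intro cm_dens_joint_measurable fin vm2) measurable
    have m2: "(\<lambda>z. \<lambda>i\<in>I. snd z i + v2 (snd (fst z)) i) \<in> measurable (?N \<Otimes>\<^sub>M gauss I) (gauss I)"
      using vm2 by measurable
    have m: "(\<lambda>p. \<integral>Y. ?h p Y \<partial>gauss I) \<in> borel_measurable ?N"
      by (intro sigma_finite_measure.borel_measurable_lebesgue_integral[OF sfG])
        (simp add: split_beta' borel_measurable_times m1 borel_measurable_ln measurable_compose[OF m2 mix_lik_measurable[OF b1]])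
    have "integrable ?N (\<lambda>p. \<integral>Y. ?h p Y \<partial>gauss I)"
      by (rule P.integrable_const_bound[where B=B, OF _ m]) (use B in auto)
    from P.integral_snd[of "\<lambda>x y. \<integral>Y. ?h (x, y) Y \<partial>gauss I"] this show ?thesis by (simp add: split_beta')
  qed
  also have "\<dots> = (\<integral>\<tau>. \<integral>Y. ?L1 Y * ln (?L1 (\<lambda>i\<in>I. Y i + v2 \<tau> i)) \<partial>gauss I \<partial>M)"
  proof (intro Bochner_Integration.integral_cong refl)
    fix \<tau>
    have e: "exp_dominated I fst (\<lambda>(Y, \<sigma>). cm_dens I (v1 \<sigma>) Y * ln (?L1 (\<lambda>i\<in>I. Y i + v2 \<tau> i)))" unfolding split_beta'
      by (intro exp_dominated_mult exp_dominated_cm_dens[where c=c] fin exp_dominated_shift[where c=c and u="\<lambda>_. v2 \<tau>"] exp_dominated_ln_mix_lik[OF b1]) (use bounded_featD[OF b1] bounded_featD[OF b2] in auto)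
    have m: "(\<lambda>z. ln (?L1 (\<lambda>i\<in>I. fst z i + v2 \<tau> i))) \<in> borel_measurable (gauss I \<Otimes>\<^sub>M M)"
      by (intro borel_measurable_ln measurable_compose[OF measurable_fst measurable_compose[OF shift_measurable mix_lik_measurable[OF b1]]])
    show "(\<integral>\<sigma>. \<integral>Y. cm_dens I (v1 \<sigma>) Y * ln (?L1 (\<lambda>i\<in>I. Y i + v2 \<tau> i)) \<partial>gauss I \<partial>M) = (\<integral>Y. ?L1 Y * ln (?L1 (\<lambda>i\<in>I. Y i + v2 \<tau> i)) \<partial>gauss I)"
      by (subst exp_dominated_swap[OF fin M.prob_space_axioms _ e, symmetric])
        (simp_all add: split_beta' mix_lik_def[of I M v1, symmetric] borel_measurable_times cm_dens_feat_measurable[OF b1] m)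
  qed
  also have "\<dots> \<ge> (\<integral>\<tau>. planted_ent I M v1 + (\<integral>\<tau>'. (\<Sum>i\<in>I. v2 \<tau> i * v1 \<tau>' i) \<partial>M) \<partial>M)"
  proof (intro integral_mono integral_mix_lik_ln_shift_ge)
    have kb: "\<bar>\<Sum>i\<in>I. v2 \<sigma> i * v1 \<tau> i\<bar> \<le> card I * (c * c)" for \<sigma> \<tau>
    proof -
      have "\<bar>\<Sum>i\<in>I. v2 \<sigma> i * v1 \<tau> i\<bar> \<le> (\<Sum>i\<in>I. \<bar>v2 \<sigma> i * v1 \<tau> i\<bar>)" by (rule sum_abs)
      also have "\<dots> \<le> (\<Sum>i\<in>I. c * c)" using bounded_featD[OF b2] bounded_featD[OF b1] by (intro sum_mono) (auto simp: abs_mult intro!: mult_mono)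
      finally show ?thesis by simp
    qed
    have "integrable M (\<lambda>\<sigma>. \<integral>\<tau>. (\<Sum>i\<in>I. v2 \<sigma> i * v1 \<tau> i) \<partial>M)"
      by (rule M.integrable_const_bound[where B="card I * (c * c)"])
        (use M.abs_integral_le[OF kb] in \<open>auto intro!: M.borel_measurable_lebesgue_integral simp: split_beta'\<close>)
    then show "integrable M (\<lambda>\<tau>. planted_ent I M v1 + (\<integral>\<tau>'. (\<Sum>i\<in>I. v2 \<tau> i * v1 \<tau>' i) \<partial>M))" by simp
    have e: "exp_dominated I fst (\<lambda>(Y, \<tau>). ?L1 Y * ln (?L1 (\<lambda>i\<in>I. Y i + v2 \<tau> i)))" unfolding split_beta'
      by (intro exp_dominated_mult exp_dominated_mix_lik[OF b1] fin exp_dominated_shift[where c=c] exp_dominated_ln_mix_lik[OF b1]) (use bounded_featD[OF b2] in auto)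
    obtain B where B: "\<And>\<tau>. \<bar>\<integral>Y. ?L1 Y * ln (?L1 (\<lambda>i\<in>I. Y i + v2 \<tau> i)) \<partial>gauss I\<bar> \<le> B" using exp_dominated_integral_bounded[OF fin e] by blast
    have sfG: "sigma_finite_measure (gauss I)" by (intro prob_space_imp_sigma_finite prob_space_gauss)
    have vm3: "(\<lambda>z. v2 (fst z) i) \<in> borel_measurable (M \<Otimes>\<^sub>M gauss I)" if "i \<in> I" for i
      using measurable_compose[OF measurable_fst bounded_featD(4)[OF b2 that]] .
    have m2: "(\<lambda>z. \<lambda>i\<in>I. snd z i + v2 (fst z) i) \<in> measurable (M \<Otimes>\<^sub>M gauss I) (gauss I)"
      using vm3 by measurable
    have "(\<lambda>\<tau>. \<integral>Y. ?L1 Y * ln (?L1 (\<lambda>i\<in>I. Y i + v2 \<tau> i)) \<partial>gauss I) \<in> borel_measurable M"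
      by (intro sigma_finite_measure.borel_measurable_lebesgue_integral[OF sfG])
        (simp add: split_beta' borel_measurable_times borel_measurable_ln measurable_compose[OF m2 mix_lik_measurable[OF b1]] measurable_compose[OF measurable_snd mix_lik_measurable[OF b1]])
    then show "integrable M (\<lambda>\<tau>. \<integral>Y. ?L1 Y * ln (?L1 (\<lambda>i\<in>I. Y i + v2 \<tau> i)) \<partial>gauss I)"
      by (intro M.integrable_const_bound[where B=B]) (use B in auto)
    show "\<bar>v2 \<tau> i\<bar> \<le> c" if "i \<in> I" for \<tau> i using bounded_featD(5)[OF b2 that] .
  qed
  moreover have "(\<integral>\<tau>. planted_ent I M v1 + (\<integral>\<tau>'. (\<Sum>i\<in>I. v2 \<tau> i * v1 \<tau>' i) \<partial>M) \<partial>M) = planted_ent I M v1 + (\<integral>\<sigma>. \<integral>\<tau>. (\<Sum>i\<in>I. v2 \<sigma> i * v1 \<tau> i) \<partial>M \<partial>M)"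
  proof -
    have kb: "\<bar>\<Sum>i\<in>I. v2 \<sigma> i * v1 \<tau> i\<bar> \<le> card I * (c * c)" for \<sigma> \<tau>
    proof -
      have "\<bar>\<Sum>i\<in>I. v2 \<sigma> i * v1 \<tau> i\<bar> \<le> (\<Sum>i\<in>I. \<bar>v2 \<sigma> i * v1 \<tau> i\<bar>)" by (rule sum_abs)
      also have "\<dots> \<le> (\<Sum>i\<in>I. c * c)" using bounded_featD[OF b2] bounded_featD[OF b1] by (intro sum_mono) (auto simp: abs_mult intro!: mult_mono)
      finally show ?thesis by simp
    qed
    have "integrable M (\<lambda>\<sigma>. \<integral>\<tau>. (\<Sum>i\<in>I. v2 \<sigma> i * v1 \<tau> i) \<partial>M)"
      by (rule M.integrable_const_bound[where B="card I * (c * c)"])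
        (use M.abs_integral_le[OF kb] in \<open>auto intro!: M.borel_measurable_lebesgue_integral simp: split_beta'\<close>)
    then show ?thesis by (simp add: M.prob_space)
  qed
  ultimately show ?thesis by linarith
qed

end

section \<open>Splitting the signal\<close>

text \<open>The error is expressed through squares and fourth powers because those are the moments
  of \<open>L - 1\<close> estimated below; \<open>\<eta>\<close> is left free to balance
  them.\<close>

lemma mult_ln_expansion:
  fixes x \<eta> :: real
  assumes x: "- 1 < x" and \<eta>: "0 < \<eta>" "\<eta> \<le> 1"
  shows "\<bar>(1 + x) * ln (1 + x) - x - x\<^sup>2 / 2\<bar> \<le> \<eta> * x\<^sup>2 + 5 * x ^ 4 / \<eta>"
proof (cases "\<bar>x\<bar> \<le> 1 / 2")
  case True
  let ?f = "\<lambda>x::real. (1 + x) * ln (1 + x) - x - x\<^sup>2 / 2"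
  have "norm (?f x - ?f 0) \<le> (2 * x\<^sup>2) * norm (x - 0)"
  proof (rule field_differentiable_bound[where S="{- \<bar>x\<bar>..\<bar>x\<bar>}" and f'="\<lambda>t. ln (1 + t) - t"])
    fix t assume t: "t \<in> {- \<bar>x\<bar>..\<bar>x\<bar>}"
    then have t2: "\<bar>t\<bar> \<le> 1 / 2" "\<bar>t\<bar> \<le> \<bar>x\<bar>" using True by auto
    show "(?f has_field_derivative ln (1 + t) - t) (at t within {- \<bar>x\<bar>..\<bar>x\<bar>})"
    proof -
      have "1 + t > 0" using t2 by auto
      then show ?thesis
        by (auto intro!: derivative_eq_intros simp: distrib_left distrib_right) (simp add: field_simps)
    qed
    have "\<bar>ln (1 + t) - t\<bar> \<le> 2 * t\<^sup>2" by (rule abs_ln_one_plus_x_minus_x_bound) (use t2 in auto)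
    also have "\<dots> \<le> 2 * x\<^sup>2" using t2(2) by (simp add: abs_le_square_iff)
    finally show "norm (ln (1 + t) - t) \<le> 2 * x\<^sup>2" by simp
  qed auto
  then have 1: "\<bar>?f x\<bar> \<le> 2 * (x\<^sup>2 * \<bar>x\<bar>)" by simp
  \<comment> \<open>The arithmetic-geometric mean inequality splits the cubic Taylor error into a
    square and a fourth power.\<close>
  have "0 \<le> (\<eta> * \<bar>x\<bar> - x\<^sup>2)\<^sup>2" by simp
  then have "2 * (x\<^sup>2 * \<bar>x\<bar>) * \<eta> \<le> \<eta> * \<eta> * x\<^sup>2 + x ^ 4"
    by (simp add: power2_diff power_mult_distrib power2_eq_square power4_eq_xxxx algebra_simps)
  then have "2 * (x\<^sup>2 * \<bar>x\<bar>) \<le> \<eta> * x\<^sup>2 + x ^ 4 / \<eta>" using \<eta> by (simp add: field_simps)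
  moreover have "x ^ 4 / \<eta> \<le> 5 * x ^ 4 / \<eta>" using \<eta> by (intro divide_right_mono) auto
  ultimately show ?thesis using 1 by linarith
next
  case False
  have l1: "ln (1 + x) \<le> x" using ln_le_minus_one[of "1 + x"] x by simp
  have u: "(1 + x) * ln (1 + x) \<le> (1 + x) * x" using l1 x by (intro mult_left_mono) auto
  have "ln (1 / (1 + x)) \<le> 1 / (1 + x) - 1" using x by (intro ln_le_minus_one) simp
  then have "1 - 1 / (1 + x) \<le> ln (1 + x)" using x by (simp add: ln_div)
  then have "(1 + x) * (1 - 1 / (1 + x)) \<le> (1 + x) * ln (1 + x)" using x by (intro mult_left_mono) auto
  moreover have "(1 + x) * (1 - 1 / (1 + x)) = x" using x by (simp add: right_diff_distrib)
  ultimately have l: "x \<le> (1 + x) * ln (1 + x)" by simp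
  \<comment> \<open>Away from 0 the whole error is at most \<open>x\<^sup>2\<close>, which the
    fourth power dominates since \<open>\<bar>x\<bar>\<close> exceeds 1/2.\<close>
  have "\<bar>(1 + x) * ln (1 + x) - x - x\<^sup>2 / 2\<bar> \<le> x\<^sup>2"
    using u l by (simp add: abs_le_iff power2_eq_square algebra_simps)
  also have "\<dots> \<le> 5 * x ^ 4 / \<eta>"
  proof -
    have "(1/2)\<^sup>2 \<le> \<bar>x\<bar>\<^sup>2" using False by (intro power_mono) auto
    then have "1 \<le> 4 * x\<^sup>2" by (simp add: power2_eq_square)
    then have "x\<^sup>2 * 1 \<le> x\<^sup>2 * (4 * x\<^sup>2)" by (intro mult_left_mono) auto
    moreover have "x\<^sup>2 * (4 * x\<^sup>2) = 4 * x ^ 4" by (simp add: power2_eq_square power4_eq_xxxx)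
    moreover have "0 \<le> x ^ 4" by simp
    ultimately have "x\<^sup>2 \<le> 5 * x ^ 4" by linarith
    also have "\<dots> \<le> 5 * x ^ 4 / \<eta>" using \<eta> using \<eta> by (simp add: le_divide_eq mult_left_le)
    finally show ?thesis .
  qed
  also have "\<dots> \<le> \<eta> * x\<^sup>2 + 5 * x ^ 4 / \<eta>" using \<eta> by simp
  finally show ?thesis .
qed

lemma abs_exp_expansion:
  fixes y :: real
  assumes "\<bar>y\<bar> \<le> 1" shows "\<bar>exp y - 1 - y\<bar> \<le> y\<^sup>2"
proof -
  have "1 + y \<le> exp y" by (rule exp_ge_add_one_self)
  moreover have "exp y \<le> 1 + y + y\<^sup>2"
  proof (cases "0 \<le> y")
    case True then show ?thesis using exp_bound[of y] assms by auto
  next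
    case False
    have "1 + (- y) + (- y)\<^sup>2 / 2 \<le> exp (- y)" using exp_lower_Taylor_quadratic[of "- y"] False by simp
    then have "exp y * (1 - y + y\<^sup>2 / 2) \<le> 1" by (simp add: exp_minus field_simps)
    moreover have "1 \<le> (1 + y + y\<^sup>2) * (1 - y + y\<^sup>2 / 2)"
    proof -
      have "(1 + y + y\<^sup>2) * (1 - y + y\<^sup>2 / 2) = 1 + y\<^sup>2 * ((1 - y + y\<^sup>2) / 2)"
        by (simp add: field_simps power2_eq_square)
      moreover have "0 \<le> y\<^sup>2 * ((1 - y + y\<^sup>2) / 2)" using False by (intro mult_nonneg_nonneg) auto
      ultimately show ?thesis by linarith
    qed
    ultimately have "exp y * (1 - y + y\<^sup>2 / 2) \<le> (1 + y + y\<^sup>2) * (1 - y + y\<^sup>2 / 2)" by linarith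
    moreover have "0 < 1 - y + y\<^sup>2 / 2" using False by (simp add: add_pos_nonneg)
    ultimately show ?thesis by (simp add: mult_le_cancel_right)
  qed
  ultimately show ?thesis unfolding abs_le_iff using zero_le_power2[of y] by linarith
qed

lemma (in prob_space) square_integral_le:
  fixes f :: "'a \<Rightarrow> real"
  assumes "integrable M f" "integrable M (\<lambda>x. (f x)\<^sup>2)"
  shows "(\<integral>x. f x \<partial>M)\<^sup>2 \<le> (\<integral>x. (f x)\<^sup>2 \<partial>M)"
proof -
  let ?m = "\<integral>x. f x \<partial>M"
  have "0 \<le> (\<integral>x. (f x - ?m)\<^sup>2 \<partial>M)" by (intro integral_nonneg_AE) auto
  also have "\<dots> = (\<integral>x. (f x)\<^sup>2 - 2 * ?m * f x + ?m\<^sup>2 \<partial>M)"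
    by (simp add: power2_diff algebra_simps)
  also have "\<dots> = (\<integral>x. (f x)\<^sup>2 \<partial>M) - ?m\<^sup>2"
    using assms by (simp add: prob_space power2_eq_square)
  finally show ?thesis by simp
qed

lemma integral_cm_dens_power:
  assumes "finite I"
  shows "(\<integral>Y. cm_dens I u Y ^ n \<partial>gauss I) = exp (((real n)\<^sup>2 - real n) / 2 * (\<Sum>i\<in>I. (u i)\<^sup>2))"
proof -
  have "cm_dens I u Y ^ n = cm_dens I (\<lambda>i. real n * u i) Y * exp (((real n)\<^sup>2 - real n) / 2 * (\<Sum>i\<in>I. (u i)\<^sup>2))" for Y
    by (simp add: cm_dens_def exp_of_nat_mult[symmetric] exp_add[symmetric] power_mult_distrib
        sum_distrib_left[symmetric] mult.assoc field_simps)
  then show ?thesis by (simp add: integral_cm_dens assms)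
qed

section \<open>Entropy of a weak signal, of squared norm at most \<open>\<kappa>\<close>\<close>

context
  fixes I :: "'i set" and M :: "'s measure" and c :: real and w :: "'s \<Rightarrow> 'i \<Rightarrow> real" and \<kappa> :: real
  assumes bw: "bounded_feat I M c w" and \<kappa>: "\<And>\<sigma>. (\<Sum>i\<in>I. (w \<sigma> i)\<^sup>2) \<le> \<kappa>"
begin

interpretation M: prob_space M by (rule bounded_featD[OF bw])

text \<open>The arithmetic-geometric mean inequality in each coordinate.\<close>

lemma kernel_bound: "\<bar>\<Sum>i\<in>I. w \<sigma> i * w \<tau> i\<bar> \<le> \<kappa>"
proof -
  have "2 * \<bar>\<Sum>i\<in>I. w \<sigma> i * w \<tau> i\<bar> \<le> (\<Sum>i\<in>I. 2 * \<bar>w \<sigma> i * w \<tau> i\<bar>)"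
    unfolding sum_distrib_left[symmetric] using sum_abs[of "\<lambda>i. w \<sigma> i * w \<tau> i" I] by simp
  also have "\<dots> \<le> (\<Sum>i\<in>I. (w \<sigma> i)\<^sup>2 + (w \<tau> i)\<^sup>2)"
  proof (intro sum_mono)
    fix i
    have "0 \<le> (\<bar>w \<sigma> i\<bar> - \<bar>w \<tau> i\<bar>)\<^sup>2" by simp
    then show "2 * \<bar>w \<sigma> i * w \<tau> i\<bar> \<le> (w \<sigma> i)\<^sup>2 + (w \<tau> i)\<^sup>2" by (simp add: power2_diff abs_mult mult.assoc)
  qed
  also have "\<dots> \<le> 2 * \<kappa>" using \<kappa>[of \<sigma>] \<kappa>[of \<tau>] by (simp add: sum.distrib)
  finally show ?thesis by simp
qed

lemma kernel_measurable [measurable]: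
  "(\<lambda>p. \<Sum>i\<in>I. w (fst p) i * w (snd p) i) \<in> borel_measurable (M \<Otimes>\<^sub>M M)"
  "(\<lambda>\<tau>. \<Sum>i\<in>I. w \<sigma> i * w \<tau> i) \<in> borel_measurable M"
proof -
  have "(\<lambda>p. w (fst p) i) \<in> borel_measurable (M \<Otimes>\<^sub>M M)" "(\<lambda>p. w (snd p) i) \<in> borel_measurable (M \<Otimes>\<^sub>M M)" if "i \<in> I" for i
    using measurable_compose[OF measurable_fst bounded_featD(4)[OF bw that]] measurable_compose[OF measurable_snd bounded_featD(4)[OF bw that]] by auto
  then show "(\<lambda>p. \<Sum>i\<in>I. w (fst p) i * w (snd p) i) \<in> borel_measurable (M \<Otimes>\<^sub>M M)" by measurable
  show "(\<lambda>\<tau>. \<Sum>i\<in>I. w \<sigma> i * w \<tau> i) \<in> borel_measurable M" using bounded_featD(4)[OF bw] by measurable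
qed

lemma integral_mix_lik_square: "(\<integral>Y. (mix_lik I M w Y)\<^sup>2 \<partial>gauss I) = (\<integral>\<sigma>. \<integral>\<tau>. exp (\<Sum>i\<in>I. w \<sigma> i * w \<tau> i) \<partial>M \<partial>M)"
proof -
  note fin = bounded_featD(1)[OF bw]
  note [measurable] = mix_lik_measurable[OF bw] cm_dens_feat_measurable[OF bw] cm_dens_feat_measurable1[OF bw]
  have edg: "exp_dominated I fst (\<lambda>z. cm_dens I (w (snd z)) (fst z))"
    by (intro exp_dominated_cm_dens[where c=c] fin) (use bounded_featD[OF bw] in auto)
  have mm: "(\<lambda>z. mix_lik I M w (fst z)) \<in> borel_measurable (gauss I \<Otimes>\<^sub>M M)"
    by (rule measurable_compose[OF measurable_fst mix_lik_measurable[OF bw]])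
  have "(\<integral>Y. (mix_lik I M w Y)\<^sup>2 \<partial>gauss I) = (\<integral>Y. \<integral>\<sigma>. cm_dens I (w \<sigma>) Y * mix_lik I M w Y \<partial>M \<partial>gauss I)"
    by (simp add: mix_lik_def power2_eq_square)
  also have "\<dots> = (\<integral>\<sigma>. \<integral>Y. cm_dens I (w \<sigma>) Y * mix_lik I M w Y \<partial>gauss I \<partial>M)"
    by (rule exp_dominated_swap[OF fin M.prob_space_axioms]) (auto simp: split_beta' mm intro!: exp_dominated_mult edg exp_dominated_mix_lik[OF bw])
  also have "\<dots> = (\<integral>\<sigma>. \<integral>\<tau>. exp (\<Sum>i\<in>I. w \<sigma> i * w \<tau> i) \<partial>M \<partial>M)"
  proof (rule Bochner_Integration.integral_cong[OF refl])
    fix \<sigma>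
    have ed1: "exp_dominated I (\<lambda>Y. fst Y) (\<lambda>z. cm_dens I (w \<sigma>) (fst z))"
      by (intro exp_dominated_cm_dens[where u="\<lambda>_. w \<sigma>" and c=c] fin) (use bounded_featD[OF bw] in auto)
    have m1: "(\<lambda>z. cm_dens I (w \<sigma>) (fst z)) \<in> borel_measurable (gauss I \<Otimes>\<^sub>M M)" by measurable
    have "(\<integral>Y. cm_dens I (w \<sigma>) Y * mix_lik I M w Y \<partial>gauss I) = (\<integral>Y. \<integral>\<tau>. cm_dens I (w \<sigma>) Y * cm_dens I (w \<tau>) Y \<partial>M \<partial>gauss I)"
      by (simp add: mix_lik_def)
    also have "\<dots> = (\<integral>\<tau>. \<integral>Y. cm_dens I (w \<sigma>) Y * cm_dens I (w \<tau>) Y \<partial>gauss I \<partial>M)"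
      by (rule exp_dominated_swap[OF fin M.prob_space_axioms]) (auto simp: split_beta' m1 intro!: exp_dominated_mult edg ed1)
    also have "\<dots> = (\<integral>\<tau>. exp (\<Sum>i\<in>I. w \<sigma> i * w \<tau> i) \<partial>M)" by (simp add: integral_cm_dens_cm_dens fin)
    finally show "(\<integral>Y. cm_dens I (w \<sigma>) Y * mix_lik I M w Y \<partial>gauss I) = (\<integral>\<tau>. exp (\<Sum>i\<in>I. w \<sigma> i * w \<tau> i) \<partial>M)" .
  qed
  finally show ?thesis .
qed

lemma integrable_mix_lik_power: "integrable (gauss I) (\<lambda>Y. mix_lik I M w Y ^ n)"
  by (intro exp_dominated_integrable bounded_featD(1)[OF bw] exp_dominated_power exp_dominated_mix_lik[OF bw] borel_measurable_power mix_lik_measurable[OF bw])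

lemma integrable_exp_kernel: "integrable M (\<lambda>\<sigma>. \<integral>\<tau>. exp (\<Sum>i\<in>I. w \<sigma> i * w \<tau> i) \<partial>M)" "integrable M (\<lambda>\<tau>. exp (\<Sum>i\<in>I. w \<sigma> i * w \<tau> i))"
  "integrable M (\<lambda>\<sigma>. \<integral>\<tau>. (\<Sum>i\<in>I. w \<sigma> i * w \<tau> i) \<partial>M)" "integrable M (\<lambda>\<tau>. (\<Sum>i\<in>I. w \<sigma> i * w \<tau> i))"
proof -
  have eb: "\<bar>exp (\<Sum>i\<in>I. w \<sigma> i * w \<tau> i)\<bar> \<le> exp \<kappa>" for \<sigma> \<tau> using kernel_bound[of \<sigma> \<tau>] by (simp add: abs_le_iff)
  show "integrable M (\<lambda>\<sigma>. \<integral>\<tau>. exp (\<Sum>i\<in>I. w \<sigma> i * w \<tau> i) \<partial>M)"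
    by (rule M.integrable_const_bound[where B="exp \<kappa>"])
      (use M.abs_integral_le[OF eb] in \<open>auto intro!: M.borel_measurable_lebesgue_integral simp: split_beta'\<close>)
  show "integrable M (\<lambda>\<sigma>. \<integral>\<tau>. (\<Sum>i\<in>I. w \<sigma> i * w \<tau> i) \<partial>M)"
    by (rule M.integrable_const_bound[where B="\<kappa>"])
      (use M.abs_integral_le[OF kernel_bound] in \<open>auto intro!: M.borel_measurable_lebesgue_integral simp: split_beta'\<close>)
  show "integrable M (\<lambda>\<tau>. exp (\<Sum>i\<in>I. w \<sigma> i * w \<tau> i))"
    by (rule M.integrable_const_bound[where B="exp \<kappa>"]) (use eb in auto)
  show "integrable M (\<lambda>\<tau>. (\<Sum>i\<in>I. w \<sigma> i * w \<tau> i))"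
    by (rule M.integrable_const_bound[where B="\<kappa>"]) (use kernel_bound in auto)
qed

text \<open>The tangent of \<open>ln\<close> at \<open>exp \<kappa>\<close> bounds the entropy by
  the second moment of the likelihood, which is at most \<open>exp \<kappa>\<close>.\<close>

lemma planted_ent_le: "planted_ent I M w \<le> \<kappa>"
proof -
  let ?L = "mix_lik I M w"
  have pw: "?L Y * ln (?L Y) \<le> (\<kappa> - 1) * ?L Y + exp (- \<kappa>) * (?L Y)\<^sup>2" for Y
  proof -
    have p: "0 < ?L Y" by (rule mix_lik_pos[OF bw])
    have "ln (?L Y * exp (- \<kappa>)) \<le> ?L Y * exp (- \<kappa>) - 1" using p by (intro ln_le_minus_one) simp
    then have "ln (?L Y) \<le> \<kappa> - 1 + exp (- \<kappa>) * ?L Y" using p by (simp add: ln_mult mult.commute)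
    then have "?L Y * ln (?L Y) \<le> ?L Y * (\<kappa> - 1 + exp (- \<kappa>) * ?L Y)" using p by (intro mult_left_mono) auto
    then show ?thesis by (simp add: power2_eq_square algebra_simps)
  qed
  have "planted_ent I M w \<le> (\<integral>Y. (\<kappa> - 1) * ?L Y + exp (- \<kappa>) * (?L Y)\<^sup>2 \<partial>gauss I)"
    unfolding planted_ent_def using integrable_mix_lik[OF bw] integrable_mix_lik_power[of 2]
    by (intro integral_mono pw integrable_mix_lik_ln_mix_lik[OF bw]) auto
  also have "\<dots> = \<kappa> - 1 + exp (- \<kappa>) * (\<integral>Y. (?L Y)\<^sup>2 \<partial>gauss I)"
    using integrable_mix_lik[OF bw] integrable_mix_lik_power[of 2] by (simp add: integral_mix_lik[OF bw])
  also have "(\<integral>Y. (?L Y)\<^sup>2 \<partial>gauss I) \<le> exp \<kappa>"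
  proof -
    have eb: "\<bar>exp (\<Sum>i\<in>I. w \<sigma> i * w \<tau> i)\<bar> \<le> exp \<kappa>" for \<sigma> \<tau> using kernel_bound[of \<sigma> \<tau>] by (simp add: abs_le_iff)
    show ?thesis unfolding integral_mix_lik_square using M.abs_integral_le[OF M.abs_integral_le[OF eb]] by (simp add: abs_le_iff)
  qed
  finally have "planted_ent I M w \<le> \<kappa> - 1 + exp (- \<kappa>) * exp \<kappa>" by (simp add: mult_left_mono)
  then show ?thesis by (simp add: exp_minus)
qed

text \<open>\<open>L * ln L\<close> is expanded around \<open>L = 1\<close>: the linear term has
  mean 0, the second moment of \<open>L - 1\<close> is the mean covariance up to
  \<open>\<kappa>\<^sup>2\<close>, and the remainder is of order \<open>\<kappa> powr (3/2)\<close>.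
  An error of smaller order than \<open>\<kappa>\<close> is what a summation over many small steps
  requires.\<close>

lemma planted_ent_expansion:
  assumes \<kappa>0: "0 < \<kappa>" "\<kappa> \<le> 1 / 6"
  shows "\<bar>planted_ent I M w - (\<integral>\<sigma>. \<integral>\<tau>. (\<Sum>i\<in>I. w \<sigma> i * w \<tau> i) \<partial>M \<partial>M) / 2\<bar> \<le> 400 * \<kappa> * sqrt \<kappa>"
proof -
  note fin = bounded_featD(1)[OF bw]
  let ?L = "mix_lik I M w"
  let ?K = "\<integral>\<sigma>. \<integral>\<tau>. (\<Sum>i\<in>I. w \<sigma> i * w \<tau> i) \<partial>M \<partial>M"
  \<comment> \<open>The second and fourth moments of \<open>L - 1\<close> are of order
    \<open>\<kappa>\<close> and \<open>\<kappa>\<^sup>2\<close>; this choice gives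
    \<open>\<eta> * S\<close> and \<open>Q / \<eta>\<close> the same order.\<close>
  define \<eta> where "\<eta> = sqrt \<kappa>"
  have \<eta>: "0 < \<eta>" "\<eta> \<le> 1" "\<kappa> = \<eta> * \<eta>" using \<kappa>0 by (auto simp: \<eta>_def)
  define S where "S = (\<integral>Y. (?L Y - 1)\<^sup>2 \<partial>gauss I)"
  define Q where "Q = (\<integral>Y. (?L Y - 1) ^ 4 \<partial>gauss I)"
  have iL: "integrable (gauss I) ?L" by (rule integrable_mix_lik[OF bw])
  have [measurable]: "?L \<in> borel_measurable (gauss I)" by (rule mix_lik_measurable[OF bw])
  have ip: "integrable (gauss I) (\<lambda>Y. (?L Y - 1) ^ n)" for n
    by (intro exp_dominated_integrable fin exp_dominated_power exp_dominated_diff exp_dominated_mix_lik[OF bw] exp_dominated_const) measurable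
  have S1: "S = (\<integral>\<sigma>. \<integral>\<tau>. exp (\<Sum>i\<in>I. w \<sigma> i * w \<tau> i) \<partial>M \<partial>M) - 1"
  proof -
    have "S = (\<integral>Y. (?L Y)\<^sup>2 - 2 * ?L Y + 1 \<partial>gauss I)" unfolding S_def by (simp add: power2_diff algebra_simps)
    also have "\<dots> = (\<integral>Y. (?L Y)\<^sup>2 \<partial>gauss I) - 1"
      using iL integrable_mix_lik_power[of 2] by (simp add: integral_mix_lik[OF bw] integrable_gauss_const)
    finally show ?thesis by (simp add: integral_mix_lik_square)
  qed
  have S2: "\<bar>S - ?K\<bar> \<le> \<kappa>\<^sup>2"
  proof -
    have b: "\<bar>exp (\<Sum>i\<in>I. w \<sigma> i * w \<tau> i) - 1 - (\<Sum>i\<in>I. w \<sigma> i * w \<tau> i)\<bar> \<le> \<kappa>\<^sup>2" for \<sigma> \<tau>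
    proof -
      have "\<bar>exp (\<Sum>i\<in>I. w \<sigma> i * w \<tau> i) - 1 - (\<Sum>i\<in>I. w \<sigma> i * w \<tau> i)\<bar> \<le> (\<Sum>i\<in>I. w \<sigma> i * w \<tau> i)\<^sup>2"
        using kernel_bound[of \<sigma> \<tau>] \<kappa>0 by (intro abs_exp_expansion) linarith
      also have "\<dots> \<le> \<kappa>\<^sup>2" using kernel_bound[of \<sigma> \<tau>] by (metis abs_ge_zero power2_abs power_mono)
      finally show ?thesis .
    qed
    have "S - ?K = (\<integral>\<sigma>. \<integral>\<tau>. exp (\<Sum>i\<in>I. w \<sigma> i * w \<tau> i) - 1 - (\<Sum>i\<in>I. w \<sigma> i * w \<tau> i) \<partial>M \<partial>M)"
      using integrable_exp_kernel by (simp add: S1 M.prob_space)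
    then show ?thesis using M.abs_integral_le[OF M.abs_integral_le[OF b]] by simp
  qed
  have K: "\<bar>?K\<bar> \<le> \<kappa>" by (intro M.abs_integral_le kernel_bound)
  have Qb: "Q \<le> 78 * \<kappa>\<^sup>2"
  proof -
    let ?d = "\<lambda>\<sigma> Y. cm_dens I (w \<sigma>) Y - 1"
    have di: "integrable M (\<lambda>\<sigma>. ?d \<sigma> Y ^ n)" for Y n
    proof (rule M.integrable_const_bound[where B="(exp (c * l1_norm I Y) + 1) ^ n"])
      have "\<bar>?d \<sigma> Y\<bar> \<le> exp (c * l1_norm I Y) + 1" for \<sigma>
        proof -
        have "cm_dens I (w \<sigma>) Y \<le> exp (c * l1_norm I Y)" using cm_dens_bounds(1)[of I "w \<sigma>" c Y] bounded_featD[OF bw] by auto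
        then show ?thesis using cm_dens_pos(1)[of I "w \<sigma>" Y] by linarith
      qed
      then show "AE \<sigma> in M. norm (?d \<sigma> Y ^ n) \<le> (exp (c * l1_norm I Y) + 1) ^ n"
        by (auto simp: power_abs intro!: power_mono)
      show "(\<lambda>\<sigma>. ?d \<sigma> Y ^ n) \<in> borel_measurable M" using cm_dens_feat_measurable1[OF bw] by measurable
    qed
    \<comment> \<open>Jensen for the square, applied twice, passes the fourth power to a single
      density, whose moments are explicit.\<close>
    have pw: "(?L Y - 1) ^ 4 \<le> (\<integral>\<sigma>. ?d \<sigma> Y ^ 4 \<partial>M)" for Y
    proof -
      have "?L Y - 1 = (\<integral>\<sigma>. ?d \<sigma> Y \<partial>M)" unfolding mix_lik_def using cm_dens_feat_integrable[OF bw] by (simp add: M.prob_space)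
      then have "(?L Y - 1)\<^sup>2 \<le> (\<integral>\<sigma>. (?d \<sigma> Y)\<^sup>2 \<partial>M)" using M.square_integral_le[of "\<lambda>\<sigma>. ?d \<sigma> Y"] di[of Y 1] di[of Y 2] by simp
      then have "((?L Y - 1)\<^sup>2)\<^sup>2 \<le> (\<integral>\<sigma>. (?d \<sigma> Y)\<^sup>2 \<partial>M)\<^sup>2" by (intro power_mono) auto
      also have "\<dots> \<le> (\<integral>\<sigma>. ((?d \<sigma> Y)\<^sup>2)\<^sup>2 \<partial>M)" using M.square_integral_le[of "\<lambda>\<sigma>. (?d \<sigma> Y)\<^sup>2"] di[of Y 2] di[of Y 4] by (simp flip: power_mult)
      finally show ?thesis by (simp flip: power_mult)
    qed
    have md: "(\<lambda>z. ?d (snd z) (fst z) ^ 4) \<in> borel_measurable (gauss I \<Otimes>\<^sub>M M)" using cm_dens_feat_measurable[OF bw] by measurable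
    have ed: "exp_dominated I fst (\<lambda>(Y, \<sigma>). ?d \<sigma> Y ^ 4)" unfolding split_beta'
      by (intro exp_dominated_power exp_dominated_diff exp_dominated_const exp_dominated_cm_dens[where c=c] fin) (use bounded_featD[OF bw] in auto)
    have mi: "(\<lambda>Y. \<integral>\<sigma>. ?d \<sigma> Y ^ 4 \<partial>M) \<in> borel_measurable (gauss I)"
      using md by (intro M.borel_measurable_lebesgue_integral) (simp add: split_beta')
    have "Q \<le> (\<integral>Y. \<integral>\<sigma>. ?d \<sigma> Y ^ 4 \<partial>M \<partial>gauss I)" unfolding Q_def
      by (intro integral_mono ip pw exp_dominated_integrable fin mi exp_dominated_integral M.prob_space_axioms ed)
    also have "\<dots> = (\<integral>\<sigma>. \<integral>Y. ?d \<sigma> Y ^ 4 \<partial>gauss I \<partial>M)"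
      using md by (intro exp_dominated_swap fin M.prob_space_axioms ed) (simp add: split_beta')
    also have "\<dots> \<le> 78 * \<kappa>\<^sup>2"
    proof -
      have "\<bar>\<integral>Y. ?d \<sigma> Y ^ 4 \<partial>gauss I\<bar> \<le> 78 * \<kappa>\<^sup>2" for \<sigma>
      proof -
        define k where "k = (\<Sum>i\<in>I. (w \<sigma> i)\<^sup>2)"
        have k: "0 \<le> k" "k \<le> \<kappa>" using \<kappa>[of \<sigma>] by (auto simp: k_def sum_nonneg)
        let ?g = "cm_dens I (w \<sigma>)"
        have gi: "integrable (gauss I) (\<lambda>Y. ?g Y ^ n)" for n
          by (intro exp_dominated_integrable fin exp_dominated_power exp_dominated_cm_dens[where u="\<lambda>_. w \<sigma>" and c=c and n="\<lambda>Y. Y"]) (use bounded_featD[OF bw] in auto)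
        have g1: "(\<integral>Y. ?g Y \<partial>gauss I) = 1" by (rule integral_cm_dens[OF fin])
        have "(\<integral>Y. ?d \<sigma> Y ^ 4 \<partial>gauss I) = (\<integral>Y. ?g Y ^ 4 - 4 * ?g Y ^ 3 + 6 * ?g Y ^ 2 - 4 * ?g Y + 1 \<partial>gauss I)"
          by (intro Bochner_Integration.integral_cong refl) (simp add: power4_eq_xxxx power3_eq_cube power2_eq_square algebra_simps)
        also have "\<dots> = exp (6 * k) - 4 * exp (3 * k) + 6 * exp k - 3"
          using gi[of 4] gi[of 3] gi[of 2] gi[of 1] by (simp add: integral_cm_dens_power fin g1 k_def[symmetric] integrable_gauss_const)
        \<comment> \<open>Constant and linear terms in \<open>k\<close> cancel;
          \<open>78 = 6\<^sup>2 + 4 * 3\<^sup>2 + 6\<close>, and \<open>\<kappa> \<le> 1 / 6\<close>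
          keeps all exponents at most 1.\<close>
        also have "\<bar>\<dots>\<bar> \<le> 78 * \<kappa>\<^sup>2"
        proof -
          have "\<bar>exp (6 * k) - 1 - 6 * k\<bar> \<le> (6 * k)\<^sup>2" "\<bar>exp (3 * k) - 1 - 3 * k\<bar> \<le> (3 * k)\<^sup>2" "\<bar>exp k - 1 - k\<bar> \<le> k\<^sup>2"
            using abs_exp_expansion[of "6 * k"] abs_exp_expansion[of "3 * k"] abs_exp_expansion[of k] k \<kappa>0 by auto
          moreover have "k\<^sup>2 \<le> \<kappa>\<^sup>2" using k by (intro power_mono)
          ultimately show ?thesis unfolding power_mult_distrib by (simp add: abs_le_iff)
        qed
        finally show ?thesis by simp
      qed
      then have "\<bar>\<integral>\<sigma>. \<integral>Y. ?d \<sigma> Y ^ 4 \<partial>gauss I \<partial>M\<bar> \<le> 78 * \<kappa>\<^sup>2" by (rule M.abs_integral_le)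
      then show ?thesis by linarith
    qed
    finally show ?thesis .
  qed
  have main: "\<bar>planted_ent I M w - S / 2\<bar> \<le> \<eta> * S + 5 * Q / \<eta>"
  proof -
    have i1: "integrable (gauss I) (\<lambda>Y. ?L Y * ln (?L Y) - (?L Y - 1) - (?L Y - 1)\<^sup>2 / 2)"
      using integrable_mix_lik_ln_mix_lik[OF bw] ip[of 1] ip[of 2] by simp
    have e: "planted_ent I M w - S / 2 = (\<integral>Y. ?L Y * ln (?L Y) - (?L Y - 1) - (?L Y - 1)\<^sup>2 / 2 \<partial>gauss I)"
      using integrable_mix_lik_ln_mix_lik[OF bw] ip[of 1] ip[of 2] iL
      by (simp add: planted_ent_def S_def integral_mix_lik[OF bw] integrable_gauss_const)
    have "\<bar>planted_ent I M w - S / 2\<bar> \<le> (\<integral>Y. \<bar>?L Y * ln (?L Y) - (?L Y - 1) - (?L Y - 1)\<^sup>2 / 2\<bar> \<partial>gauss I)" unfolding e by (rule integral_abs_bound)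
    also have "\<dots> \<le> (\<integral>Y. \<eta> * (?L Y - 1)\<^sup>2 + 5 * (?L Y - 1) ^ 4 / \<eta> \<partial>gauss I)"
    proof (rule integral_mono)
      fix Y
      show "\<bar>?L Y * ln (?L Y) - (?L Y - 1) - (?L Y - 1)\<^sup>2 / 2\<bar> \<le> \<eta> * (?L Y - 1)\<^sup>2 + 5 * (?L Y - 1) ^ 4 / \<eta>"
        using mult_ln_expansion[of "?L Y - 1" \<eta>] \<eta> mix_lik_pos[OF bw, of Y] by simp
    qed (use i1 ip[of 2] ip[of 4] in auto)
    also have "\<dots> = \<eta> * S + 5 * Q / \<eta>" unfolding S_def Q_def using ip[of 2] ip[of 4] by simp
    finally show ?thesis .
  qed
  have \<kappa>2: "\<kappa>\<^sup>2 \<le> \<kappa>" using \<kappa>0 by (simp add: power2_eq_square mult_left_le)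
  have Sb: "S \<le> 2 * \<kappa>" using S2 K \<kappa>2 by linarith
  have "\<kappa>\<^sup>2 / \<eta> = \<kappa> * \<eta>" using \<eta> by (simp add: power2_eq_square field_simps)
  moreover have "5 * Q / \<eta> \<le> 5 * (78 * \<kappa>\<^sup>2) / \<eta>" using Qb \<eta> by (intro divide_right_mono mult_left_mono) auto
  ultimately have "5 * Q / \<eta> \<le> 390 * (\<kappa> * \<eta>)" by simp
  moreover have "\<eta> * S \<le> \<eta> * (2 * \<kappa>)" using Sb \<eta> by (intro mult_left_mono) auto
  moreover have "\<kappa>\<^sup>2 \<le> \<kappa> * \<eta>"
  proof -
    have "\<kappa> * (\<eta> * \<eta>) \<le> \<kappa> * (\<eta> * 1)" using \<eta> \<kappa>0 by (intro mult_left_mono) auto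
    then show ?thesis using \<eta>(3) by (simp add: power2_eq_square)
  qed
  moreover have "0 \<le> \<kappa> * \<eta>" using \<kappa>0 \<eta> by simp
  moreover have "\<eta> * (2 * \<kappa>) = 2 * (\<kappa> * \<eta>)" by simp
  \<comment> \<open>The contributions are 390, 2 and 1/2 times
    \<open>\<kappa> * \<eta>\<close>.\<close>
  ultimately have "\<bar>planted_ent I M w - ?K / 2\<bar> \<le> 400 * (\<kappa> * \<eta>)" using main S2 by linarith
  then show ?thesis by (simp add: \<eta>_def mult.assoc)
qed

end

section \<open>Independence, relabelling and additivity\<close>

lemma distr_pair_snd_prob:
  assumes "prob_space M" "prob_space N"
  shows "distr (M \<Otimes>\<^sub>M N) N snd = N"
proof (rule measure_eqI)
  interpret M: prob_space M by fact
  interpret N: prob_space N by fact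
  fix A assume A: "A \<in> sets (distr (M \<Otimes>\<^sub>M N) N snd)"
  then have "snd -` A \<inter> space (M \<Otimes>\<^sub>M N) = space M \<times> A"
    using sets.sets_into_space[of A N] by (auto simp: space_pair_measure)
  then show "emeasure (distr (M \<Otimes>\<^sub>M N) N snd) A = emeasure N A"
    using A by (simp add: emeasure_distr N.emeasure_pair_measure_Times M.emeasure_space_1)
qed simp

text \<open>Independence of disjoint blocks of coordinates: \<open>distr_PiM_pair\<close> with one
  of the two projections in each coordinate.\<close>

lemma coupling_PiM_splice:
  assumes I: "finite I" and M: "\<And>i. prob_space (M i)"
  shows "coupling (PiM I M) (\<lambda>(x, y). \<lambda>i\<in>I. if i \<in> B then x i else y i)"
proof -
  let ?h = "\<lambda>i. if i \<in> B then fst else snd :: 'b \<times> 'b \<Rightarrow> 'b"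
  have d: "distr (M i \<Otimes>\<^sub>M M i) (M i) (?h i) = M i" for i
    using prob_space.distr_pair_fst[OF M, of "M i" i] distr_pair_snd_prob[OF M M, of i i] by simp
  have "distr (PiM I M \<Otimes>\<^sub>M PiM I M) (PiM I M) (\<lambda>(x,y). \<lambda>i\<in>I. ?h i (x i, y i)) = PiM I M"
    by (rule distr_PiM_pair[OF I M M M _ d]) auto
  moreover have "(\<lambda>(x,y). \<lambda>i\<in>I. ?h i (x i, y i)) = (\<lambda>(x, y). \<lambda>i\<in>I. if i \<in> B then x i else y i)"
    by (auto simp: fun_eq_iff)
  moreover have "(\<lambda>p. \<lambda>i\<in>I. if i \<in> B then fst p i else snd p i) \<in> measurable (PiM I M \<Otimes>\<^sub>M PiM I M) (PiM I M)"
  proof (rule measurable_restrict)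
    fix i assume "i \<in> I"
    then show "(\<lambda>p. if i \<in> B then fst p i else snd p i) \<in> measurable (PiM I M \<Otimes>\<^sub>M PiM I M) (M i)"
      by (cases "i \<in> B") auto
  qed
  ultimately show ?thesis unfolding coupling_def by (simp add: split_beta')
qed

text \<open>Features that factor through \<open>q\<close> see only its distribution. This identifies
  a block of sites, or one row of the vector model, with a scalar model.\<close>

lemma mix_lik_cong:
  assumes "M = distr N M q" "q \<in> measurable N M" "bounded_feat I M c v" "\<And>\<sigma> i. \<sigma> \<in> space N \<Longrightarrow> i \<in> I \<Longrightarrow> w \<sigma> i = v (q \<sigma>) i"
  shows "mix_lik I N w = mix_lik I M v"
proof
  fix Y
  have "mix_lik I M v Y = (\<integral>\<sigma>. cm_dens I (v (q \<sigma>)) Y \<partial>N)"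
    unfolding mix_lik_def by (subst assms(1), subst integral_distr[OF assms(2) cm_dens_feat_measurable1[OF assms(3)]]) simp
  also have "\<dots> = mix_lik I N w Y"
    unfolding mix_lik_def using assms(4) by (intro Bochner_Integration.integral_cong refl cm_dens_cong) auto
  finally show "mix_lik I N w Y = mix_lik I M v Y" by simp
qed

lemma planted_ent_cong:
  assumes "M = distr N M q" "q \<in> measurable N M" "bounded_feat I M c v" "\<And>\<sigma> i. \<sigma> \<in> space N \<Longrightarrow> i \<in> I \<Longrightarrow> w \<sigma> i = v (q \<sigma>) i"
  shows "planted_ent I N w = planted_ent I M v" "null_ent I N w = null_ent I M v"
  using mix_lik_cong[OF assms] by (auto simp: planted_ent_def null_ent_def)

text \<open>Observations without signal contribute the factor 1 to every density, so they can be
  discarded and the others relabelled.\<close>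

lemma planted_ent_reindex:
  assumes bf: "bounded_feat I M c v" and g: "inj_on g J" "g ` J \<subseteq> I" and z: "\<And>\<sigma> i. i \<in> I - g ` J \<Longrightarrow> v \<sigma> i = 0"
  shows "planted_ent I M v = planted_ent J M (\<lambda>\<sigma> j. v \<sigma> (g j))"
proof -
  have fI: "finite I" by (rule bounded_featD[OF bf])
  then have fJ: "finite J" using g by (metis finite_imageD finite_subset)
  have bJ: "bounded_feat J M c (\<lambda>\<sigma> j. v \<sigma> (g j))" using bf g fJ unfolding bounded_feat_def by auto
  let ?t = "\<lambda>Y. \<lambda>j\<in>J. Y (g j)"
  have d: "distr (gauss I) (gauss J) ?t = gauss J"
    using distr_PiM_reindex[of I "\<lambda>_. std_gauss" g J] g prob_space_std_gauss by auto
  have tm: "?t \<in> measurable (gauss I) (gauss J)" using g by (intro measurable_restrict) auto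
  have L: "mix_lik I M v Y = mix_lik J M (\<lambda>\<sigma> j. v \<sigma> (g j)) (?t Y)" for Y
  proof -
    have s: "(\<Sum>i\<in>I. f i) = (\<Sum>j\<in>J. f (g j))" if "\<And>i. i \<in> I - g ` J \<Longrightarrow> f i = 0" for f :: "'a \<Rightarrow> real"
    proof -
      have "(\<Sum>i\<in>I. f i) = (\<Sum>i\<in>g ` J. f i)" using fI g that by (intro sum.mono_neutral_right) auto
      then show ?thesis using g by (simp add: sum.reindex)
    qed
    have "cm_dens I (v \<sigma>) Y = cm_dens J (\<lambda>j. v \<sigma> (g j)) (?t Y)" for \<sigma>
      unfolding cm_dens_def using s[of "\<lambda>i. v \<sigma> i * Y i"] s[of "\<lambda>i. (v \<sigma> i)\<^sup>2"] z by simp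
    then show ?thesis by (simp add: mix_lik_def)
  qed
  have m: "(\<lambda>Y. mix_lik J M (\<lambda>\<sigma> j. v \<sigma> (g j)) Y * ln (mix_lik J M (\<lambda>\<sigma> j. v \<sigma> (g j)) Y)) \<in> borel_measurable (gauss J)"
    by (intro borel_measurable_times borel_measurable_ln mix_lik_measurable[OF bJ])
  show ?thesis unfolding planted_ent_def L using integral_distr[OF tm m] by (simp add: d)
qed

text \<open>The signals are independent and are seen in disjoint, hence independent, noise
  coordinates; the likelihood is a product of independent factors and relative entropies
  add.\<close>

lemma planted_ent_add_disjoint:
  assumes b1: "bounded_feat I M c v1" and b2: "bounded_feat I M c v2" and sp: "coupling M sp"
    and sp1: "\<And>\<sigma> \<tau> i. \<sigma> \<in> space M \<Longrightarrow> \<tau> \<in> space M \<Longrightarrow> i \<in> I \<Longrightarrow> v1 (sp (\<sigma>, \<tau>)) i = v1 \<sigma> i"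
    and sp2: "\<And>\<sigma> \<tau> i. \<sigma> \<in> space M \<Longrightarrow> \<tau> \<in> space M \<Longrightarrow> i \<in> I \<Longrightarrow> v2 (sp (\<sigma>, \<tau>)) i = v2 \<tau> i"
    and z1: "\<And>\<sigma> i. i \<in> I \<Longrightarrow> i \<notin> B \<Longrightarrow> v1 \<sigma> i = 0" and z2: "\<And>\<sigma> i. i \<in> I \<Longrightarrow> i \<in> B \<Longrightarrow> v2 \<sigma> i = 0"
  shows "planted_ent I M (\<lambda>\<sigma> i. v1 \<sigma> i + v2 \<sigma> i) = planted_ent I M v1 + planted_ent I M v2"
proof -
  note fin = bounded_featD(1)[OF b1]
  let ?L1 = "mix_lik I M v1" and ?L2 = "mix_lik I M v2"
  let ?s = "\<lambda>(x, y). \<lambda>i\<in>I. if i \<in> B then x i else y i"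
  \<comment> \<open>The same splicing, now for the noise, separates the two factors under the
    integral.\<close>
  have sG: "coupling (gauss I) ?s" by (rule coupling_PiM_splice[OF fin prob_space_std_gauss])
  have L: "mix_lik I M (\<lambda>\<sigma> i. v1 \<sigma> i + v2 \<sigma> i) Y = ?L1 Y * ?L2 Y" for Y
  proof -
    have c0: "(\<Sum>i\<in>I. v1 \<sigma> i * v2 \<tau> i) = 0" for \<sigma> \<tau> using z1 z2 by (intro sum.neutral) (metis mult_zero_left mult_zero_right)
    have "mix_lik I M (\<lambda>\<sigma> i. v1 \<sigma> i + v2 \<sigma> i) Y = (\<integral>\<sigma>. \<integral>\<tau>. cm_dens I (\<lambda>i. v1 \<sigma> i + v2 \<tau> i) Y \<partial>M \<partial>M)"
      by (rule mix_lik_add[OF b1 b2 sp]) (auto simp: sp1 sp2)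
    also have "\<dots> = (\<integral>\<sigma>. \<integral>\<tau>. cm_dens I (v1 \<sigma>) Y * cm_dens I (v2 \<tau>) Y \<partial>M \<partial>M)"
      by (simp add: cm_dens_add c0)
    finally show ?thesis unfolding mix_lik_def[of I M v1] mix_lik_def[of I M v2] by simp
  qed
  have L1s: "?L1 (?s (Y, Y')) = ?L1 Y" for Y Y'
  proof -
    have "cm_dens I (v1 \<sigma>) (?s (Y, Y')) = cm_dens I (v1 \<sigma>) Y" for \<sigma>
      unfolding cm_dens_def using z1 by (auto intro!: sum.cong arg_cong[where f=exp])
    then show ?thesis by (simp add: mix_lik_def)
  qed
  have L2s: "?L2 (?s (Y, Y')) = ?L2 Y'" for Y Y'
  proof -
    have "cm_dens I (v2 \<sigma>) (?s (Y, Y')) = cm_dens I (v2 \<sigma>) Y'" for \<sigma>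
      unfolding cm_dens_def using z2 by (auto intro!: sum.cong arg_cong[where f=exp])
    then show ?thesis by (simp add: mix_lik_def)
  qed
  note m = mix_lik_measurable[OF b1] mix_lik_measurable[OF b2]
  have i1: "integrable (gauss I) (\<lambda>Y. (?L1 Y * ln (?L1 Y)) * ?L2 Y)"
    by (intro exp_dominated_integrable fin exp_dominated_mult exp_dominated_mix_lik[OF b1] exp_dominated_mix_lik[OF b2] exp_dominated_ln_mix_lik[OF b1] borel_measurable_times borel_measurable_ln m)
  have i2: "integrable (gauss I) (\<lambda>Y. ?L1 Y * (?L2 Y * ln (?L2 Y)))"
    by (intro exp_dominated_integrable fin exp_dominated_mult exp_dominated_mix_lik[OF b1] exp_dominated_mix_lik[OF b2] exp_dominated_ln_mix_lik[OF b2] borel_measurable_times borel_measurable_ln m)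
  have "planted_ent I M (\<lambda>\<sigma> i. v1 \<sigma> i + v2 \<sigma> i) = (\<integral>Y. (?L1 Y * ln (?L1 Y)) * ?L2 Y + ?L1 Y * (?L2 Y * ln (?L2 Y)) \<partial>gauss I)"
    unfolding planted_ent_def L using mix_lik_pos[OF b1] mix_lik_pos[OF b2]
    by (intro Bochner_Integration.integral_cong refl) (simp add: ln_mult_pos algebra_simps)
  also have "\<dots> = (\<integral>Y. (?L1 Y * ln (?L1 Y)) * ?L2 Y \<partial>gauss I) + (\<integral>Y. ?L1 Y * (?L2 Y * ln (?L2 Y)) \<partial>gauss I)"
    using i1 i2 by simp
  also have "(\<integral>Y. (?L1 Y * ln (?L1 Y)) * ?L2 Y \<partial>gauss I) = planted_ent I M v1"
    unfolding integral_coupling(1)[OF sG prob_space_gauss i1] L1s L2s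
    by (simp add: planted_ent_def integral_mix_lik[OF b2])
  also have "(\<integral>Y. ?L1 Y * (?L2 Y * ln (?L2 Y)) \<partial>gauss I) = planted_ent I M v2"
    unfolding integral_coupling(1)[OF sG prob_space_gauss i2] L1s L2s
    by (simp add: planted_ent_def integral_mix_lik[OF b1])
  finally show ?thesis .
qed

text \<open>\<open>tilt\<close> is the posterior, and \<open>planted_pair\<close> the planted average of \<open>h\<close> over two posterior samples.\<close>

definition tilt :: "'i set \<Rightarrow> 's measure \<Rightarrow> ('s \<Rightarrow> 'i \<Rightarrow> real) \<Rightarrow> ('i \<Rightarrow> real) \<Rightarrow> 's measure" where
  "tilt I M v Y = density M (\<lambda>\<sigma>. ennreal (cm_dens I (v \<sigma>) Y / mix_lik I M v Y))"

text \<open>Not normalised: two posterior samples call for division by the squared likelihood, of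
  which the planted weight cancels one factor, so \<open>planted_pair\<close> divides only
  once.\<close>

definition pair_lik :: "'i set \<Rightarrow> 's measure \<Rightarrow> ('s \<Rightarrow> 'i \<Rightarrow> real) \<Rightarrow> ('s \<Rightarrow> 's \<Rightarrow> real) \<Rightarrow> ('i \<Rightarrow> real) \<Rightarrow> real" where
  "pair_lik I M v h Y = (\<integral>\<sigma>. \<integral>\<tau>. h \<sigma> \<tau> * (cm_dens I (v \<sigma>) Y * cm_dens I (v \<tau>) Y) \<partial>M \<partial>M)"

definition planted_pair :: "'i set \<Rightarrow> 's measure \<Rightarrow> ('s \<Rightarrow> 'i \<Rightarrow> real) \<Rightarrow> ('s \<Rightarrow> 's \<Rightarrow> real) \<Rightarrow> real" where
  "planted_pair I M v h = (\<integral>Y. pair_lik I M v h Y / mix_lik I M v Y \<partial>gauss I)"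

definition bounded_ker :: "'s measure \<Rightarrow> real \<Rightarrow> ('s \<Rightarrow> 's \<Rightarrow> real) \<Rightarrow> bool" where
  "bounded_ker M B h \<longleftrightarrow> (\<lambda>p. h (fst p) (snd p)) \<in> borel_measurable (M \<Otimes>\<^sub>M M) \<and> (\<forall>\<sigma> \<tau>. \<bar>h \<sigma> \<tau>\<bar> \<le> B)"

lemma bounded_kerD: "bounded_ker M B h \<Longrightarrow> (\<lambda>p. h (fst p) (snd p)) \<in> borel_measurable (M \<Otimes>\<^sub>M M)"
  "bounded_ker M B h \<Longrightarrow> \<bar>h \<sigma> \<tau>\<bar> \<le> B"
  by (auto simp: bounded_ker_def)

section \<open>Averages over two posterior samples\<close>

context
  fixes I :: "'i set" and M :: "'s measure" and c :: real and v :: "'s \<Rightarrow> 'i \<Rightarrow> real"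
  assumes bf: "bounded_feat I M c v"
begin

interpretation M: prob_space M by (rule bounded_featD[OF bf])

lemma prob_space_tilt: "prob_space (tilt I M v Y)"
proof
  have p: "0 < mix_lik I M v Y" by (rule mix_lik_pos[OF bf])
  have m: "(\<lambda>\<sigma>. ennreal (cm_dens I (v \<sigma>) Y / mix_lik I M v Y)) \<in> borel_measurable M"
    using cm_dens_feat_measurable1[OF bf] by measurable
  have "emeasure (tilt I M v Y) (space (tilt I M v Y)) = (\<integral>\<^sup>+\<sigma>. ennreal (cm_dens I (v \<sigma>) Y / mix_lik I M v Y) \<partial>M)"
    unfolding tilt_def using m by (simp add: emeasure_density cong: nn_integral_cong)
  also have "\<dots> = ennreal (\<integral>\<sigma>. cm_dens I (v \<sigma>) Y / mix_lik I M v Y \<partial>M)"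
    using cm_dens_feat_integrable[OF bf] p by (intro nn_integral_eq_integral) (auto simp: less_imp_le)
  also have "\<dots> = 1" using p by (simp add: mix_lik_def)
  finally show "emeasure (tilt I M v Y) (space (tilt I M v Y)) = 1" .
qed

lemma integral_tilt:
  fixes f :: "'s \<Rightarrow> real"
  assumes "f \<in> borel_measurable M"
  shows "(\<integral>\<sigma>. f \<sigma> \<partial>tilt I M v Y) = (\<integral>\<sigma>. cm_dens I (v \<sigma>) Y * f \<sigma> \<partial>M) / mix_lik I M v Y"
proof -
  have p: "0 < mix_lik I M v Y" by (rule mix_lik_pos[OF bf])
  have "(\<integral>\<sigma>. f \<sigma> \<partial>tilt I M v Y) = (\<integral>\<sigma>. cm_dens I (v \<sigma>) Y / mix_lik I M v Y * f \<sigma> \<partial>M)"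
    unfolding tilt_def using p assms cm_dens_feat_measurable1[OF bf]
    by (subst integral_density) (auto simp: less_imp_le)
  then show ?thesis by simp
qed

lemma sets_tilt [simp]: "sets (tilt I M v Y) = sets M" "space (tilt I M v Y) = space M"
  by (simp_all add: tilt_def)

lemma cm_dens_pair_bound: "\<bar>h\<bar> \<le> B \<Longrightarrow> \<bar>h * (cm_dens I (v \<sigma>) Y * cm_dens I (v \<tau>) Y)\<bar> \<le> B * exp (2 * c * l1_norm I Y)"
proof -
  assume h: "\<bar>h\<bar> \<le> B"
  have "cm_dens I (v \<sigma>) Y * cm_dens I (v \<tau>) Y \<le> exp (c * l1_norm I Y) * exp (c * l1_norm I Y)"
    using bounded_featD(1,5)[OF bf] by (intro mult_mono cm_dens_bounds) auto
  then show ?thesis using h cm_dens_pos(1)[of I "v \<sigma>" Y] cm_dens_pos(1)[of I "v \<tau>" Y]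
    by (auto simp: abs_mult exp_add[symmetric] mult.assoc intro!: mult_mono)
qed

lemma cm_dens_pair_measurable:
  "(\<lambda>z. cm_dens I (v (snd (fst z))) (fst (fst z)) * cm_dens I (v (snd z)) (fst (fst z))) \<in> borel_measurable ((gauss I \<Otimes>\<^sub>M M) \<Otimes>\<^sub>M M)"
proof -
  have 1: "(\<lambda>z. cm_dens I (v (snd (fst z))) (fst (fst z))) \<in> borel_measurable ((gauss I \<Otimes>\<^sub>M M) \<Otimes>\<^sub>M M)"
    using measurable_compose[OF measurable_fst cm_dens_feat_measurable[OF bf]] .
  have "(\<lambda>z. (fst (fst z), snd z)) \<in> measurable ((gauss I \<Otimes>\<^sub>M M) \<Otimes>\<^sub>M M) (gauss I \<Otimes>\<^sub>M M)" by measurable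
  from measurable_compose[OF this cm_dens_feat_measurable[OF bf]]
  have 2: "(\<lambda>z. cm_dens I (v (snd z)) (fst (fst z))) \<in> borel_measurable ((gauss I \<Otimes>\<^sub>M M) \<Otimes>\<^sub>M M)" by simp
  show ?thesis using 1 2 by (rule borel_measurable_times)
qed

lemma ker_measurable3:
  assumes "bounded_ker M B h"
  shows "(\<lambda>z. h (snd (fst z)) (snd z)) \<in> borel_measurable ((gauss I \<Otimes>\<^sub>M M) \<Otimes>\<^sub>M M)"
proof -
  have "(\<lambda>z. (snd (fst z), snd z)) \<in> measurable ((gauss I \<Otimes>\<^sub>M M) \<Otimes>\<^sub>M M) (M \<Otimes>\<^sub>M M)" by measurable
  from measurable_compose[OF this bounded_kerD(1)[OF assms]] show ?thesis by simp
qed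

lemma pair_lik_inner_measurable:
  assumes "bounded_ker M B h"
  shows "(\<lambda>p. \<integral>\<tau>. h (snd p) \<tau> * (cm_dens I (v (snd p)) (fst p) * cm_dens I (v \<tau>) (fst p)) \<partial>M) \<in> borel_measurable (gauss I \<Otimes>\<^sub>M M)"
  by (rule M.borel_measurable_lebesgue_integral)
    (unfold split_beta', rule borel_measurable_times[OF ker_measurable3[OF assms] cm_dens_pair_measurable])

lemma pair_lik_measurable:
  assumes "bounded_ker M B h"
  shows "pair_lik I M v h \<in> borel_measurable (gauss I)"
  unfolding pair_lik_def
  by (rule M.borel_measurable_lebesgue_integral) (use pair_lik_inner_measurable[OF assms] in \<open>simp add: split_beta'\<close>)

lemma abs_pair_lik_le:
  assumes "bounded_ker M B h"
  shows "\<bar>pair_lik I M v h Y\<bar> \<le> B * exp (2 * c * l1_norm I Y)"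
  unfolding pair_lik_def by (intro M.abs_integral_le cm_dens_pair_bound bounded_kerD(2)[OF assms])

lemma integrable_planted_pair:
  assumes "bounded_ker M B h"
  shows "integrable (gauss I) (\<lambda>Y. pair_lik I M v h Y / mix_lik I M v Y)"
proof -
  have "exp_dominated I (\<lambda>Y. Y) (pair_lik I M v h)"
    by (rule exp_dominatedI[of _ B "2 * c"]) (use abs_pair_lik_le[OF assms] bounded_featD(3)[OF bf] in auto)
  from exp_dominated_mult[OF this exp_dominated_inverse_mix_lik[OF bf]]
  show ?thesis
    using pair_lik_measurable[OF assms] mix_lik_measurable[OF bf] by (intro exp_dominated_integrable bounded_featD(1)[OF bf]) auto
qed

lemma pair_lik_slice_measurable:
  assumes "bounded_ker M B h" "\<sigma> \<in> space M"
  shows "(\<lambda>\<tau>. h \<sigma> \<tau>) \<in> borel_measurable M"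
  using measurable_compose[OF measurable_Pair1'[OF assms(2)] bounded_kerD(1)[OF assms(1)]] by simp

lemma pair_lik_integrable:
  assumes "bounded_ker M B h"
  shows "integrable M (\<lambda>\<sigma>. \<integral>\<tau>. h \<sigma> \<tau> * (cm_dens I (v \<sigma>) Y * cm_dens I (v \<tau>) Y) \<partial>M)"
    "\<sigma> \<in> space M \<Longrightarrow> integrable M (\<lambda>\<tau>. h \<sigma> \<tau> * (cm_dens I (v \<sigma>) Y * cm_dens I (v \<tau>) Y))"
proof -
  have "(\<lambda>p. h (fst p) (snd p) * (cm_dens I (v (fst p)) Y * cm_dens I (v (snd p)) Y)) \<in> borel_measurable (M \<Otimes>\<^sub>M M)"
    by (intro borel_measurable_times bounded_kerD(1)[OF assms] measurable_compose[OF measurable_fst cm_dens_feat_measurable1[OF bf]]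
      measurable_compose[OF measurable_snd cm_dens_feat_measurable1[OF bf]])
  then have "(\<lambda>\<sigma>. \<integral>\<tau>. h \<sigma> \<tau> * (cm_dens I (v \<sigma>) Y * cm_dens I (v \<tau>) Y) \<partial>M) \<in> borel_measurable M"
    by (intro M.borel_measurable_lebesgue_integral) (simp add: split_beta')
  then show "integrable M (\<lambda>\<sigma>. \<integral>\<tau>. h \<sigma> \<tau> * (cm_dens I (v \<sigma>) Y * cm_dens I (v \<tau>) Y) \<partial>M)"
    using M.abs_integral_le[OF cm_dens_pair_bound[OF bounded_kerD(2)[OF assms]]]
    by (intro M.integrable_const_bound[where B="B * exp (2 * c * l1_norm I Y)"]) auto
  show "integrable M (\<lambda>\<tau>. h \<sigma> \<tau> * (cm_dens I (v \<sigma>) Y * cm_dens I (v \<tau>) Y))" if "\<sigma> \<in> space M"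
    using cm_dens_pair_bound[OF bounded_kerD(2)[OF assms]] pair_lik_slice_measurable[OF assms that] cm_dens_feat_measurable1[OF bf]
    by (intro M.integrable_const_bound[where B="B * exp (2 * c * l1_norm I Y)"]) auto
qed

lemma pair_lik_mono:
  assumes "bounded_ker M B h" "bounded_ker M B' h'" "\<And>\<sigma> \<tau>. h \<sigma> \<tau> \<le> h' \<sigma> \<tau>"
  shows "pair_lik I M v h Y \<le> pair_lik I M v h' Y"
  unfolding pair_lik_def
  by (intro integral_mono pair_lik_integrable[OF assms(1)] pair_lik_integrable[OF assms(2)] mult_right_mono assms(3)) auto

lemma planted_pair_mono:
  assumes "bounded_ker M B h" "bounded_ker M B' h'" "\<And>\<sigma> \<tau>. h \<sigma> \<tau> \<le> h' \<sigma> \<tau>"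
  shows "planted_pair I M v h \<le> planted_pair I M v h'"
  unfolding planted_pair_def
  by (intro integral_mono integrable_planted_pair[OF assms(1)] integrable_planted_pair[OF assms(2)] divide_right_mono pair_lik_mono[OF assms] less_imp_le[OF mix_lik_pos[OF bf]])

lemma pair_lik_lin:
  assumes "bounded_ker M B h" "bounded_ker M B' h'"
  shows "pair_lik I M v (\<lambda>\<sigma> \<tau>. r * h \<sigma> \<tau> + s * h' \<sigma> \<tau>) Y = r * pair_lik I M v h Y + s * pair_lik I M v h' Y"
proof -
  have "pair_lik I M v (\<lambda>\<sigma> \<tau>. r * h \<sigma> \<tau> + s * h' \<sigma> \<tau>) Y =
    (\<integral>\<sigma>. r * (\<integral>\<tau>. h \<sigma> \<tau> * (cm_dens I (v \<sigma>) Y * cm_dens I (v \<tau>) Y) \<partial>M) + s * (\<integral>\<tau>. h' \<sigma> \<tau> * (cm_dens I (v \<sigma>) Y * cm_dens I (v \<tau>) Y) \<partial>M) \<partial>M)"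
    unfolding pair_lik_def
  proof (rule Bochner_Integration.integral_cong[OF refl])
    fix \<sigma> assume s: "\<sigma> \<in> space M"
    show "(\<integral>\<tau>. (r * h \<sigma> \<tau> + s * h' \<sigma> \<tau>) * (cm_dens I (v \<sigma>) Y * cm_dens I (v \<tau>) Y) \<partial>M) =
      r * (\<integral>\<tau>. h \<sigma> \<tau> * (cm_dens I (v \<sigma>) Y * cm_dens I (v \<tau>) Y) \<partial>M) + s * (\<integral>\<tau>. h' \<sigma> \<tau> * (cm_dens I (v \<sigma>) Y * cm_dens I (v \<tau>) Y) \<partial>M)"
      using pair_lik_integrable(2)[OF assms(1) s] pair_lik_integrable(2)[OF assms(2) s]
      by (simp add: distrib_right mult.assoc)
  qed
  then show ?thesis unfolding pair_lik_def using pair_lik_integrable(1)[OF assms(1)] pair_lik_integrable(1)[OF assms(2)] by simp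
qed

lemma planted_pair_lin:
  assumes "bounded_ker M B h" "bounded_ker M B' h'"
  shows "planted_pair I M v (\<lambda>\<sigma> \<tau>. r * h \<sigma> \<tau> + s * h' \<sigma> \<tau>) = r * planted_pair I M v h + s * planted_pair I M v h'"
  unfolding planted_pair_def pair_lik_lin[OF assms]
  using integrable_planted_pair[OF assms(1)] integrable_planted_pair[OF assms(2)]
  by (simp add: add_divide_distrib times_divide_eq_right[symmetric] del: times_divide_eq_right)

end

section \<open>Gaussian rotation and the chain rule for the planted entropy\<close>

context
  fixes I :: "'i set" and M :: "'s measure" and c :: real and g :: "'s \<Rightarrow> 'i \<Rightarrow> real" and a b :: "'i \<Rightarrow> real" and \<kappa> :: real
  assumes bg: "bounded_feat I M c g" and ab: "\<And>i. (a i)\<^sup>2 + (b i)\<^sup>2 = 1"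
    and \<kappa>: "\<And>\<sigma>. (\<Sum>i\<in>I. (b i * g \<sigma> i)\<^sup>2) \<le> \<kappa>"
begin

interpretation M: prob_space M by (rule bounded_featD[OF bg])

abbreviation (input) "ga \<equiv> \<lambda>\<sigma> i. a i * g \<sigma> i"
abbreviation (input) "gb \<equiv> \<lambda>\<sigma> i. b i * g \<sigma> i"

lemma bounded_feat_ab: "bounded_feat I M c ga" "bounded_feat I M c gb"
proof -
  have a1: "\<bar>a i\<bar> \<le> 1" "\<bar>b i\<bar> \<le> 1" for i
  proof -
    have "(a i)\<^sup>2 \<le> 1" "(b i)\<^sup>2 \<le> 1"
      using ab[of i] zero_le_power2[of "a i"] zero_le_power2[of "b i"] by linarith+
    then show "\<bar>a i\<bar> \<le> 1" "\<bar>b i\<bar> \<le> 1" by (simp_all add: abs_square_le_1)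
  qed
  have "\<bar>a i * g \<sigma> i\<bar> \<le> c" "\<bar>b i * g \<sigma> i\<bar> \<le> c" if "i \<in> I" for \<sigma> i
    using mult_mono[OF a1(1)[of i] bounded_featD(5)[OF bg that, of \<sigma>]] mult_mono[OF a1(2)[of i] bounded_featD(5)[OF bg that, of \<sigma>]]
    by (auto simp: abs_mult)
  then show "bounded_feat I M c ga" "bounded_feat I M c gb" using bounded_featD[OF bg] unfolding bounded_feat_def by auto
qed

lemma bounded_feat_tilt: "bounded_feat I (tilt I M ga Y) c gb"
  using prob_space_tilt[OF bounded_feat_ab(1), of Y] bounded_featD[OF bounded_feat_ab(2)] sets_tilt[OF bounded_feat_ab(1), of Y]
  unfolding bounded_feat_def by (auto simp: measurable_def)

text \<open>The chain rule for relative entropy. By rotation invariance, data of full strength are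
  equivalent to two independent observations of strengths \<open>a\<close> and \<open>b\<close>;
  after the first one, the prior for the second is the posterior \<open>tilt\<close>.\<close>

lemma planted_ent_split:
  "planted_ent I M g = planted_ent I M ga + (\<integral>Y. mix_lik I M ga Y * planted_ent I (tilt I M ga Y) gb \<partial>gauss I)"
  "integrable (gauss I) (\<lambda>Y. mix_lik I M ga Y * planted_ent I (tilt I M ga Y) gb)"
proof -
  note fin = bounded_featD(1)[OF bg]
  let ?G = "gauss I \<Otimes>\<^sub>M gauss I"
  let ?rot = "\<lambda>(x, y). \<lambda>i\<in>I. a i * x i + b i * y i"
  let ?\<Phi> = "\<lambda>Y. mix_lik I M g Y * ln (mix_lik I M g Y)"
  interpret G: prob_space "gauss I" by (rule prob_space_gauss)
  interpret P: pair_prob_space "gauss I" "gauss I" ..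
  have d: "distr ?G (gauss I) ?rot = gauss I"
  proof -
    have "distr ?G (gauss I) (\<lambda>(x, y). \<lambda>i\<in>I. (\<lambda>(x, y). a i * x + b i * y) (x i, y i)) = gauss I"
      by (rule distr_PiM_pair[OF fin prob_space_std_gauss prob_space_std_gauss prob_space_std_gauss _ distr_std_gauss_rotate[OF ab]]) measurable
    then show ?thesis by simp
  qed
  have rm: "?rot \<in> measurable ?G (gauss I)" by measurable
  have \<Phi>m: "?\<Phi> \<in> borel_measurable (gauss I)" by (intro borel_measurable_times borel_measurable_ln mix_lik_measurable[OF bg])
  have i1: "integrable ?G (\<lambda>p. ?\<Phi> (?rot p))"
    using integrable_mix_lik_ln_mix_lik[OF bg] by (subst (asm) d[symmetric], subst (asm) integrable_distr_eq[OF rm]) (auto simp: d \<Phi>m)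
  \<comment> \<open>The exponent is linear in the data and \<open>a\<^sup>2 + b\<^sup>2 = 1\<close>
    splits the squared norm, so each density factorises; the likelihood of the first observation
    normalises the posterior.\<close>
  have key: "mix_lik I M g (?rot (Y, Y')) = mix_lik I M ga Y * mix_lik I (tilt I M ga Y) gb Y'" for Y Y'
  proof -
    have e: "cm_dens I (g \<sigma>) (?rot (Y, Y')) = cm_dens I (ga \<sigma>) Y * cm_dens I (gb \<sigma>) Y'" for \<sigma>
    proof -
      have s: "(\<Sum>i\<in>I. (g \<sigma> i)\<^sup>2) = (\<Sum>i\<in>I. (a i * g \<sigma> i)\<^sup>2) + (\<Sum>i\<in>I. (b i * g \<sigma> i)\<^sup>2)"
        unfolding sum.distrib[symmetric] power_mult_distrib distrib_right[symmetric] ab by simp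
      show ?thesis unfolding cm_dens_def exp_add[symmetric] s
        by (simp add: distrib_left sum.distrib algebra_simps add_divide_distrib)
    qed
    show ?thesis
      using mix_lik_pos[OF bounded_feat_ab(1), of Y]
      by (simp only: mix_lik_def[of I M g] e)
        (simp add: mix_lik_def[of I "tilt I M ga Y"] integral_tilt[OF bounded_feat_ab(1) cm_dens_feat_measurable1[OF bounded_feat_ab(2)]])
  qed
  have inner: "(\<integral>Y'. ?\<Phi> (?rot (Y, Y')) \<partial>gauss I) = mix_lik I M ga Y * ln (mix_lik I M ga Y) + mix_lik I M ga Y * planted_ent I (tilt I M ga Y) gb" for Y
  proof -
    let ?x = "mix_lik I M ga Y" and ?y = "mix_lik I (tilt I M ga Y) gb"
    have "(\<integral>Y'. ?\<Phi> (?rot (Y, Y')) \<partial>gauss I) = (\<integral>Y'. (?x * ln ?x) * ?y Y' + ?x * (?y Y' * ln (?y Y')) \<partial>gauss I)"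
      unfolding key using mix_lik_pos[OF bounded_feat_ab(1), of Y] mix_lik_pos[OF bounded_feat_tilt]
      by (intro Bochner_Integration.integral_cong refl) (simp add: ln_mult_pos algebra_simps)
    also have "\<dots> = (?x * ln ?x) + ?x * planted_ent I (tilt I M ga Y) gb"
      using integrable_mix_lik[OF bounded_feat_tilt] integrable_mix_lik_ln_mix_lik[OF bounded_feat_tilt] by (simp add: planted_ent_def integral_mix_lik[OF bounded_feat_tilt])
    finally show ?thesis .
  qed
  have i2: "integrable (gauss I) (\<lambda>Y. mix_lik I M ga Y * ln (mix_lik I M ga Y) + mix_lik I M ga Y * planted_ent I (tilt I M ga Y) gb)"
    using P.integrable_fst'[OF i1] unfolding inner .
  show i3: "integrable (gauss I) (\<lambda>Y. mix_lik I M ga Y * planted_ent I (tilt I M ga Y) gb)"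
    using Bochner_Integration.integrable_diff[OF i2 integrable_mix_lik_ln_mix_lik[OF bounded_feat_ab(1)]] by simp
  have "planted_ent I M g = (\<integral>Y. ?\<Phi> Y \<partial>distr ?G (gauss I) ?rot)" by (simp add: planted_ent_def d)
  also have "\<dots> = (\<integral>p. ?\<Phi> (?rot p) \<partial>?G)" by (rule integral_distr[OF rm \<Phi>m])
  also have "\<dots> = (\<integral>Y. (\<integral>Y'. ?\<Phi> (?rot (Y, Y')) \<partial>gauss I) \<partial>gauss I)" by (rule P.integral_fst'[OF i1, symmetric])
  also have "\<dots> = planted_ent I M ga + (\<integral>Y. mix_lik I M ga Y * planted_ent I (tilt I M ga Y) gb \<partial>gauss I)"
    unfolding inner using i3 integrable_mix_lik_ln_mix_lik[OF bounded_feat_ab(1)] by (simp add: planted_ent_def)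
  finally show "planted_ent I M g = planted_ent I M ga + (\<integral>Y. mix_lik I M ga Y * planted_ent I (tilt I M ga Y) gb \<partial>gauss I)" .
qed

text \<open>The posterior entropy in the chain rule lies between 0 and \<open>\<kappa>\<close>,
  whatever the posterior is.\<close>

lemma planted_ent_step_bounds: "planted_ent I M ga \<le> planted_ent I M g" "planted_ent I M g \<le> planted_ent I M ga + \<kappa>"
proof -
  have p: "0 \<le> mix_lik I M ga Y" for Y using mix_lik_pos[OF bounded_feat_ab(1)] by (simp add: less_imp_le)
  have "0 \<le> (\<integral>Y. mix_lik I M ga Y * planted_ent I (tilt I M ga Y) gb \<partial>gauss I)"
    by (intro integral_nonneg_AE AE_I2 mult_nonneg_nonneg p planted_ent_nonneg[OF bounded_feat_tilt])
  then show "planted_ent I M ga \<le> planted_ent I M g" unfolding planted_ent_split(1) by simp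
  have "(\<integral>Y. mix_lik I M ga Y * planted_ent I (tilt I M ga Y) gb \<partial>gauss I) \<le> (\<integral>Y. mix_lik I M ga Y * \<kappa> \<partial>gauss I)"
  proof (rule integral_mono[OF planted_ent_split(2)])
    show "integrable (gauss I) (\<lambda>Y. mix_lik I M ga Y * \<kappa>)" using integrable_mix_lik[OF bounded_feat_ab(1)] by simp
    fix Y show "mix_lik I M ga Y * planted_ent I (tilt I M ga Y) gb \<le> mix_lik I M ga Y * \<kappa>"
      by (rule mult_left_mono[OF planted_ent_le[OF bounded_feat_tilt \<kappa>] p])
  qed
  then show "planted_ent I M g \<le> planted_ent I M ga + \<kappa>" unfolding planted_ent_split(1) by (simp add: integral_mix_lik[OF bounded_feat_ab(1)])
qed

lemma bounded_ker_gb: "bounded_ker M \<kappa> (\<lambda>\<sigma> \<tau>. \<Sum>i\<in>I. gb \<sigma> i * gb \<tau> i)"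
  unfolding bounded_ker_def using kernel_bound[OF bounded_feat_ab(2) \<kappa>] kernel_measurable(1)[OF bounded_feat_ab(2) \<kappa>] by simp

text \<open>A discrete form of the relation between entropy and signal strength: the weak-signal
  expansion is applied to the posterior after the first observation and then averaged over the
  planted law.\<close>

lemma planted_ent_step:
  assumes "0 < \<kappa>" "\<kappa> \<le> 1 / 6"
  shows "\<bar>planted_ent I M g - planted_ent I M ga - planted_pair I M ga (\<lambda>\<sigma> \<tau>. \<Sum>i\<in>I. gb \<sigma> i * gb \<tau> i) / 2\<bar> \<le> 400 * \<kappa> * sqrt \<kappa>"
proof -
  let ?K = "\<lambda>\<sigma> \<tau>. \<Sum>i\<in>I. gb \<sigma> i * gb \<tau> i"
  let ?L = "mix_lik I M ga" and ?N = "pair_lik I M ga ?K"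
  have p: "0 < ?L Y" for Y by (rule mix_lik_pos[OF bounded_feat_ab(1)])
  \<comment> \<open>Each of the two posterior samples brings one normalisation
    \<open>?L Y\<close>.\<close>
  have t: "(\<integral>\<sigma>. \<integral>\<tau>. ?K \<sigma> \<tau> \<partial>tilt I M ga Y \<partial>tilt I M ga Y) = ?N Y / (?L Y)\<^sup>2" for Y
  proof -
    have m1: "(\<lambda>\<sigma>. \<integral>\<tau>. ?K \<sigma> \<tau> \<partial>tilt I M ga Y) \<in> borel_measurable (tilt I M ga Y)"
      using borel_measurable_integrable[OF integrable_exp_kernel(3)[OF bounded_feat_tilt \<kappa>]] .
    then have m: "(\<lambda>\<sigma>. \<integral>\<tau>. ?K \<sigma> \<tau> \<partial>tilt I M ga Y) \<in> borel_measurable M"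
      by (simp add: measurable_def sets_tilt[OF bounded_feat_ab(1)])
    have "(\<integral>\<sigma>. \<integral>\<tau>. ?K \<sigma> \<tau> \<partial>tilt I M ga Y \<partial>tilt I M ga Y) = (\<integral>\<sigma>. cm_dens I (ga \<sigma>) Y * (\<integral>\<tau>. ?K \<sigma> \<tau> \<partial>tilt I M ga Y) \<partial>M) / ?L Y"
      by (rule integral_tilt[OF bounded_feat_ab(1) m])
    also have "\<dots> = (\<integral>\<sigma>. cm_dens I (ga \<sigma>) Y * ((\<integral>\<tau>. cm_dens I (ga \<tau>) Y * ?K \<sigma> \<tau> \<partial>M) / ?L Y) \<partial>M) / ?L Y"
      by (simp only: integral_tilt[OF bounded_feat_ab(1) kernel_measurable(2)[OF bounded_feat_ab(2) \<kappa>]])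
    also have "(\<integral>\<sigma>. cm_dens I (ga \<sigma>) Y * ((\<integral>\<tau>. cm_dens I (ga \<tau>) Y * ?K \<sigma> \<tau> \<partial>M) / ?L Y) \<partial>M) / ?L Y = ?N Y / (?L Y)\<^sup>2"
      by (simp add: pair_lik_def power2_eq_square mult_ac flip: integral_mult_right_zero)
    finally show ?thesis .
  qed
  \<comment> \<open>The expansion for the posterior is multiplied by \<open>?L Y\<close>, the
    density of the planted law of the first observation.\<close>
  have pw: "\<bar>?L Y * planted_ent I (tilt I M ga Y) gb - ?N Y / ?L Y / 2\<bar> \<le> ?L Y * (400 * \<kappa> * sqrt \<kappa>)" for Y
  proof -
    have "\<bar>planted_ent I (tilt I M ga Y) gb - ?N Y / (?L Y)\<^sup>2 / 2\<bar> \<le> 400 * \<kappa> * sqrt \<kappa>"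
      using planted_ent_expansion[OF bounded_feat_tilt \<kappa> assms] unfolding t .
    then have "?L Y * \<bar>planted_ent I (tilt I M ga Y) gb - ?N Y / (?L Y)\<^sup>2 / 2\<bar> \<le> ?L Y * (400 * \<kappa> * sqrt \<kappa>)"
      using p[of Y] by (intro mult_left_mono) auto
    moreover have "?L Y * \<bar>planted_ent I (tilt I M ga Y) gb - ?N Y / (?L Y)\<^sup>2 / 2\<bar> = \<bar>?L Y * (planted_ent I (tilt I M ga Y) gb - ?N Y / (?L Y)\<^sup>2 / 2)\<bar>"
      using p[of Y] by (simp add: abs_mult)
    moreover have "?L Y * (planted_ent I (tilt I M ga Y) gb - ?N Y / (?L Y)\<^sup>2 / 2) = ?L Y * planted_ent I (tilt I M ga Y) gb - ?N Y / ?L Y / 2"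
      using p[of Y] by (simp add: right_diff_distrib power2_eq_square)
    ultimately show ?thesis by simp
  qed
  have iN: "integrable (gauss I) (\<lambda>Y. ?N Y / ?L Y / 2)" by (rule integrable_divide[OF integrable_planted_pair[OF bounded_feat_ab(1) bounded_ker_gb]])
  have e: "planted_ent I M g - planted_ent I M ga - planted_pair I M ga ?K / 2 = (\<integral>Y. ?L Y * planted_ent I (tilt I M ga Y) gb - ?N Y / ?L Y / 2 \<partial>gauss I)"
    unfolding Bochner_Integration.integral_diff[OF planted_ent_split(2) iN] integral_divide_zero planted_pair_def
    by (simp add: planted_ent_split(1))
  have "\<bar>\<integral>Y. ?L Y * planted_ent I (tilt I M ga Y) gb - ?N Y / ?L Y / 2 \<partial>gauss I\<bar> \<le> (\<integral>Y. \<bar>?L Y * planted_ent I (tilt I M ga Y) gb - ?N Y / ?L Y / 2\<bar> \<partial>gauss I)"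
    by (rule integral_abs_bound)
  also have "\<dots> \<le> (\<integral>Y. ?L Y * (400 * \<kappa> * sqrt \<kappa>) \<partial>gauss I)"
  proof (rule integral_mono)
    show "integrable (gauss I) (\<lambda>Y. \<bar>?L Y * planted_ent I (tilt I M ga Y) gb - ?N Y / ?L Y / 2\<bar>)"
      by (intro integrable_abs Bochner_Integration.integrable_diff planted_ent_split(2) iN)
    show "integrable (gauss I) (\<lambda>Y. ?L Y * (400 * \<kappa> * sqrt \<kappa>))" using integrable_mix_lik[OF bounded_feat_ab(1)] by simp
  qed (rule pw)
  also have "\<dots> = 400 * \<kappa> * sqrt \<kappa>" using integrable_mix_lik[OF bounded_feat_ab(1)] by (simp add: integral_mix_lik[OF bounded_feat_ab(1)])
  finally show ?thesis unfolding e .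
qed

end

section \<open>Suppression of negative overlaps\<close>

lemma exp_dominated_swap2:
  assumes fin: "finite I" and M: "prob_space M"
    and m: "(\<lambda>z. F (fst (fst z)) (snd (fst z)) (snd z)) \<in> borel_measurable ((gauss I \<Otimes>\<^sub>M M) \<Otimes>\<^sub>M M)"
    and b: "\<And>Y \<sigma> \<tau>. \<bar>F Y \<sigma> \<tau>\<bar> \<le> K * exp (k * l1_norm I Y)" and k: "0 \<le> k"
  shows "(\<integral>Y. \<integral>\<sigma>. \<integral>\<tau>. F Y \<sigma> \<tau> \<partial>M \<partial>M \<partial>gauss I) = (\<integral>\<sigma>. \<integral>\<tau>. \<integral>Y. F Y \<sigma> \<tau> \<partial>gauss I \<partial>M \<partial>M)"
proof -
  interpret M: prob_space M by fact
  have m1: "(\<lambda>(Y, \<sigma>). \<integral>\<tau>. F Y \<sigma> \<tau> \<partial>M) \<in> borel_measurable (gauss I \<Otimes>\<^sub>M M)"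
    unfolding split_beta' by (rule M.borel_measurable_lebesgue_integral) (use m in \<open>simp add: split_beta'\<close>)
  have "(\<integral>Y. \<integral>\<sigma>. \<integral>\<tau>. F Y \<sigma> \<tau> \<partial>M \<partial>M \<partial>gauss I) = (\<integral>\<sigma>. \<integral>Y. \<integral>\<tau>. F Y \<sigma> \<tau> \<partial>M \<partial>gauss I \<partial>M)"
    by (intro exp_dominated_swap fin M m1 exp_dominatedI[of _ K k] k) (use M.abs_integral_le[OF b] in auto)
  also have "\<dots> = (\<integral>\<sigma>. \<integral>\<tau>. \<integral>Y. F Y \<sigma> \<tau> \<partial>gauss I \<partial>M \<partial>M)"
  proof (rule Bochner_Integration.integral_cong[OF refl])
    fix \<sigma> assume s: "\<sigma> \<in> space M"
    have "(\<lambda>p. ((fst p, \<sigma>), snd p)) \<in> measurable (gauss I \<Otimes>\<^sub>M M) ((gauss I \<Otimes>\<^sub>M M) \<Otimes>\<^sub>M M)" using s by measurable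
    from measurable_compose[OF this m]
    show "(\<integral>Y. \<integral>\<tau>. F Y \<sigma> \<tau> \<partial>M \<partial>gauss I) = (\<integral>\<tau>. \<integral>Y. F Y \<sigma> \<tau> \<partial>gauss I \<partial>M)"
      by (intro exp_dominated_swap fin M exp_dominatedI[of _ K k] k) (use b in \<open>auto simp: split_beta'\<close>)
  qed
  finally show ?thesis .
qed

text \<open>Under the planted law negative overlaps are suppressed without any perturbation of the model:
  compare the posterior normalisation with the likelihood in which the features \<open>v\<close> are reduced
  to \<open>v0\<close>; on the support of \<open>h\<close> the reduction only increases the covariance.\<close>

lemma planted_pair_le_prior:
  assumes bv: "bounded_feat I M c v" and b0: "bounded_feat I M c v0" and sp: "coupling M sp"
    and red: "\<And>\<sigma> \<tau>. (\<Sum>i\<in>I. v \<sigma> i * v0 \<tau> i) = (\<Sum>i\<in>I. v0 \<sigma> i * v0 \<tau> i)"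
    and h: "bounded_ker M B h" and h0: "\<And>\<sigma> \<tau>. 0 \<le> h \<sigma> \<tau>"
    and supp: "\<And>\<sigma> \<tau>. h \<sigma> \<tau> \<noteq> 0 \<Longrightarrow> (\<Sum>i\<in>I. v \<sigma> i * v \<tau> i) \<le> (\<Sum>i\<in>I. v0 \<sigma> i * v0 \<tau> i)"
    and sp0: "\<And>\<sigma> \<tau> i. \<sigma> \<in> space M \<Longrightarrow> \<tau> \<in> space M \<Longrightarrow> i \<in> I \<Longrightarrow> v0 (sp (\<sigma>, \<tau>)) i = v0 \<tau> i"
    and sph: "\<And>\<sigma> \<tau> \<rho>. \<sigma> \<in> space M \<Longrightarrow> \<tau> \<in> space M \<Longrightarrow> h (sp (\<sigma>, \<tau>)) \<rho> = h \<sigma> \<rho>"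
       "\<And>\<sigma> \<tau> \<rho>. \<sigma> \<in> space M \<Longrightarrow> \<tau> \<in> space M \<Longrightarrow> h \<rho> (sp (\<sigma>, \<tau>)) = h \<rho> \<sigma>"
  shows "2 * planted_pair I M v h \<le> 1 + (\<integral>\<sigma>. \<integral>\<tau>. (h \<sigma> \<tau>)\<^sup>2 \<partial>M \<partial>M)"
proof -
  note fin = bounded_featD(1)[OF bv]
  interpret M: prob_space M by (rule bounded_featD[OF bv])
  let ?Z = "mix_lik I M v" and ?L = "mix_lik I M v0" and ?h2 = "\<lambda>\<sigma> \<tau>. (h \<sigma> \<tau>)\<^sup>2"
  have Zp: "0 < ?Z Y" and Lp: "0 < ?L Y" for Y by (rule mix_lik_pos[OF bv] mix_lik_pos[OF b0])+
  have h2: "bounded_ker M (B\<^sup>2) ?h2" using h unfolding bounded_ker_def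
    by (auto simp: abs_le_square_iff[symmetric] intro: order_trans[OF _ abs_ge_self])
  have one: "bounded_ker M 1 (\<lambda>_ _. 1)" by (simp add: bounded_ker_def)
  have N1: "pair_lik I M v (\<lambda>_ _. 1) Y = (?Z Y)\<^sup>2" for Y
    by (simp add: pair_lik_def mix_lik_def power2_eq_square)
  \<comment> \<open>The normalisation \<open>?Z\<close> is exchanged for the likelihood
    \<open>?L\<close> of \<open>v0\<close> by the arithmetic-geometric mean inequality. The extra
    term is \<open>?L\<close> itself, since two unrestricted samples contribute
    \<open>(?Z Y)\<^sup>2\<close>, and it has null mean 1.\<close>
  have pw: "2 * (pair_lik I M v h Y / ?Z Y) \<le> pair_lik I M v ?h2 Y / ?L Y + ?L Y" for Y
  proof -
    have q: "2 * h \<sigma> \<tau> / ?Z Y \<le> ?h2 \<sigma> \<tau> / ?L Y + ?L Y / (?Z Y)\<^sup>2 * 1" for \<sigma> \<tau>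
    proof -
      have "0 \<le> (h \<sigma> \<tau> * ?Z Y - ?L Y)\<^sup>2 / (?L Y * (?Z Y)\<^sup>2)" using Lp[of Y] by simp
      also have "\<dots> = ?h2 \<sigma> \<tau> / ?L Y + ?L Y / (?Z Y)\<^sup>2 - 2 * h \<sigma> \<tau> / ?Z Y"
        using Lp[of Y] Zp[of Y] by (simp add: power2_eq_square field_simps)
      finally show ?thesis by simp
    qed
    have "pair_lik I M v (\<lambda>\<sigma> \<tau>. (2 / ?Z Y) * h \<sigma> \<tau> + 0 * 1) Y \<le> pair_lik I M v (\<lambda>\<sigma> \<tau>. (1 / ?L Y) * ?h2 \<sigma> \<tau> + (?L Y / (?Z Y)\<^sup>2) * 1) Y"
    proof (rule pair_lik_mono[OF bv])
      show "bounded_ker M (\<bar>2 / ?Z Y\<bar> * B) (\<lambda>\<sigma> \<tau>. (2 / ?Z Y) * h \<sigma> \<tau> + 0 * 1)"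
        using h Zp[of Y] unfolding bounded_ker_def by (auto simp: abs_mult intro!: divide_right_mono)
      show "bounded_ker M (\<bar>1 / ?L Y\<bar> * B\<^sup>2 + \<bar>?L Y / (?Z Y)\<^sup>2\<bar>) (\<lambda>\<sigma> \<tau>. (1 / ?L Y) * ?h2 \<sigma> \<tau> + (?L Y / (?Z Y)\<^sup>2) * 1)"
        unfolding bounded_ker_def
      proof (intro conjI allI)
        show "(\<lambda>p. 1 / ?L Y * ?h2 (fst p) (snd p) + ?L Y / (?Z Y)\<^sup>2 * 1) \<in> borel_measurable (M \<Otimes>\<^sub>M M)"
          using bounded_kerD(1)[OF h2] by measurable
        fix \<sigma> \<tau>
        have "\<bar>?h2 \<sigma> \<tau>\<bar> \<le> B\<^sup>2" by (rule bounded_kerD(2)[OF h2])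
        then have "\<bar>1 / ?L Y * ?h2 \<sigma> \<tau>\<bar> \<le> \<bar>1 / ?L Y\<bar> * B\<^sup>2" unfolding abs_mult by (intro mult_left_mono) auto
        then show "\<bar>1 / ?L Y * ?h2 \<sigma> \<tau> + ?L Y / (?Z Y)\<^sup>2 * 1\<bar> \<le> \<bar>1 / ?L Y\<bar> * B\<^sup>2 + \<bar>?L Y / (?Z Y)\<^sup>2\<bar>"
          using abs_triangle_ineq[of "1 / ?L Y * ?h2 \<sigma> \<tau>" "?L Y / (?Z Y)\<^sup>2 * 1"] by simp
      qed
      show "(2 / ?Z Y) * h \<sigma> \<tau> + 0 * 1 \<le> (1 / ?L Y) * ?h2 \<sigma> \<tau> + (?L Y / (?Z Y)\<^sup>2) * 1" for \<sigma> \<tau> using q[of \<sigma> \<tau>] by simp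
    qed
    also have "pair_lik I M v (\<lambda>\<sigma> \<tau>. (1 / ?L Y) * ?h2 \<sigma> \<tau> + (?L Y / (?Z Y)\<^sup>2) * 1) Y = (1 / ?L Y) * pair_lik I M v ?h2 Y + (?L Y / (?Z Y)\<^sup>2) * (?Z Y)\<^sup>2"
      by (simp only: pair_lik_lin[OF bv h2 one] N1)
    also have "pair_lik I M v (\<lambda>\<sigma> \<tau>. (2 / ?Z Y) * h \<sigma> \<tau> + 0 * 1) Y = (2 / ?Z Y) * pair_lik I M v h Y"
      by (subst pair_lik_lin[OF bv h one]) simp
    finally show ?thesis using Zp[of Y] by simp
  qed
  have iN2: "integrable (gauss I) (\<lambda>Y. pair_lik I M w ?h2 Y / ?L Y)" if bw: "bounded_feat I M c w" for w
  proof -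
    have "exp_dominated I (\<lambda>Y. Y) (pair_lik I M w ?h2)"
      by (rule exp_dominatedI[of _ "B\<^sup>2" "2 * c"]) (use abs_pair_lik_le[OF bw h2] bounded_featD(3)[OF bv] in auto)
    from exp_dominated_mult[OF this exp_dominated_inverse_mix_lik[OF b0]]
    show ?thesis using pair_lik_measurable[OF bw h2] mix_lik_measurable[OF b0] by (intro exp_dominated_integrable fin) auto
  qed
  \<comment> \<open>Under a shift of the data by \<open>u\<close>, \<open>?L\<close> depends on
    \<open>u\<close> only through its inner products with the features \<open>v0\<close>; by
    \<open>red\<close> these agree for \<open>v \<sigma>\<close> and
    \<open>v0 \<sigma>\<close>.\<close>
  have ratio: "(\<integral>Y. cm_dens I u Y * (1 / ?L Y) \<partial>gauss I) = (\<integral>Y. cm_dens I u' Y * (1 / ?L Y) \<partial>gauss I)"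
    if "\<And>\<rho>. (\<Sum>i\<in>I. u i * v0 \<rho> i) = (\<Sum>i\<in>I. u' i * v0 \<rho> i)" for u u'
  proof -
    have m: "(\<lambda>Y. 1 / ?L Y) \<in> borel_measurable (gauss I)" using mix_lik_measurable[OF b0] by simp
    have "?L (\<lambda>i\<in>I. Y i + u i) = ?L (\<lambda>i\<in>I. Y i + u' i)" for Y
      unfolding mix_lik_def cm_dens_shift using that by (simp add: mult.commute[of "v0 _ _"])
    then show ?thesis unfolding integral_cm_dens_mult[OF fin m] by simp
  qed
  \<comment> \<open>Both pairs of features shift \<open>?L\<close> alike, so only the covariance
    factors differ, and on the support of \<open>h\<close> the one for \<open>v0\<close> is at least
    as large.\<close>
  have step: "(h \<sigma> \<tau>)\<^sup>2 * (\<integral>Y. cm_dens I (v \<sigma>) Y * cm_dens I (v \<tau>) Y * (1 / ?L Y) \<partial>gauss I)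
      \<le> (h \<sigma> \<tau>)\<^sup>2 * (\<integral>Y. cm_dens I (v0 \<sigma>) Y * cm_dens I (v0 \<tau>) Y * (1 / ?L Y) \<partial>gauss I)" for \<sigma> \<tau>
  proof (cases "h \<sigma> \<tau> = 0")
    case False
    have e: "cm_dens I u Y * cm_dens I u' Y = exp (\<Sum>i\<in>I. u i * u' i) * cm_dens I (\<lambda>i. u i + u' i) Y" for u u' Y
      by (simp add: cm_dens_add exp_minus field_simps)
    have r: "(\<integral>Y. cm_dens I (\<lambda>i. v \<sigma> i + v \<tau> i) Y * (1 / ?L Y) \<partial>gauss I) = (\<integral>Y. cm_dens I (\<lambda>i. v0 \<sigma> i + v0 \<tau> i) Y * (1 / ?L Y) \<partial>gauss I)"
      by (rule ratio) (simp add: distrib_right sum.distrib red)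
    have n: "0 \<le> (\<integral>Y. cm_dens I (\<lambda>i. v0 \<sigma> i + v0 \<tau> i) Y * (1 / ?L Y) \<partial>gauss I)"
      using Lp by (intro integral_nonneg_AE) (auto simp: less_imp_le)
    have "(\<integral>Y. cm_dens I (v \<sigma>) Y * cm_dens I (v \<tau>) Y * (1 / ?L Y) \<partial>gauss I) = exp (\<Sum>i\<in>I. v \<sigma> i * v \<tau> i) * (\<integral>Y. cm_dens I (\<lambda>i. v0 \<sigma> i + v0 \<tau> i) Y * (1 / ?L Y) \<partial>gauss I)"
      unfolding e mult.assoc by (simp only: integral_mult_right_zero r)
    also have "\<dots> \<le> exp (\<Sum>i\<in>I. v0 \<sigma> i * v0 \<tau> i) * (\<integral>Y. cm_dens I (\<lambda>i. v0 \<sigma> i + v0 \<tau> i) Y * (1 / ?L Y) \<partial>gauss I)"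
      using supp[OF False] n by (intro mult_right_mono) auto
    also have "\<dots> = (\<integral>Y. cm_dens I (v0 \<sigma>) Y * cm_dens I (v0 \<tau>) Y * (1 / ?L Y) \<partial>gauss I)"
      unfolding e mult.assoc by (simp only: integral_mult_right_zero)
    finally show ?thesis by (intro mult_left_mono) auto
  qed simp
  \<comment> \<open>Fubini, together with the boundedness and measurability in the two
    configurations that monotonicity of the outer integrals requires.\<close>
  have sw: "(\<integral>Y. pair_lik I M w ?h2 Y / ?L Y \<partial>gauss I) = (\<integral>\<sigma>. \<integral>\<tau>. (h \<sigma> \<tau>)\<^sup>2 * (\<integral>Y. cm_dens I (w \<sigma>) Y * cm_dens I (w \<tau>) Y * (1 / ?L Y) \<partial>gauss I) \<partial>M \<partial>M)"
    and bd: "\<exists>D. \<forall>\<sigma> \<tau>. \<bar>\<integral>Y. (h \<sigma> \<tau>)\<^sup>2 * (cm_dens I (w \<sigma>) Y * cm_dens I (w \<tau>) Y) * (1 / ?L Y) \<partial>gauss I\<bar> \<le> D"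
    and ms: "(\<lambda>p. \<integral>Y. (h (fst p) (snd p))\<^sup>2 * (cm_dens I (w (fst p)) Y * cm_dens I (w (snd p)) Y) * (1 / ?L Y) \<partial>gauss I) \<in> borel_measurable (M \<Otimes>\<^sub>M M)"
    if bw: "bounded_feat I M c w" for w
  proof -
    let ?F = "\<lambda>Y \<sigma> \<tau>. (h \<sigma> \<tau>)\<^sup>2 * (cm_dens I (w \<sigma>) Y * cm_dens I (w \<tau>) Y) * (1 / ?L Y)"
    have m: "(\<lambda>z. ?F (fst (fst z)) (snd (fst z)) (snd z)) \<in> borel_measurable ((gauss I \<Otimes>\<^sub>M M) \<Otimes>\<^sub>M M)"
    proof (rule borel_measurable_times[OF borel_measurable_times[OF ker_measurable3[OF bw h2] cm_dens_pair_measurable[OF bw]]])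
      have "(\<lambda>Y. 1 / ?L Y) \<in> borel_measurable (gauss I)" using mix_lik_measurable[OF b0] by simp
      from measurable_compose[OF measurable_fst measurable_compose[OF measurable_fst this]]
      show "(\<lambda>z. 1 / ?L (fst (fst z))) \<in> borel_measurable ((gauss I \<Otimes>\<^sub>M M) \<Otimes>\<^sub>M M)" .
    qed
    have "exp_dominated I fst (\<lambda>z. (h (fst (snd z)) (snd (snd z)))\<^sup>2 * (cm_dens I (w (fst (snd z))) (fst z) * cm_dens I (w (snd (snd z))) (fst z)) * (1 / ?L (fst z)))"
      by (intro exp_dominated_mult exp_dominated_cm_dens[where c=c] fin exp_dominated_inverse_mix_lik[OF b0] exp_dominated_bounded[where K="B\<^sup>2"] bounded_kerD(2)[OF h2])
        (use bounded_featD[OF bw] in auto)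
    then have ed: "exp_dominated I fst (\<lambda>(Y, p). ?F Y (fst p) (snd p))" by (simp add: split_beta')
    then obtain K k where K: "0 \<le> k" "\<And>Y \<sigma> \<tau>. \<bar>?F Y \<sigma> \<tau>\<bar> \<le> K * exp (k * l1_norm I Y)" unfolding exp_dominated_def by auto
    have "(\<integral>Y. pair_lik I M w ?h2 Y / ?L Y \<partial>gauss I) = (\<integral>Y. \<integral>\<sigma>. \<integral>\<tau>. ?F Y \<sigma> \<tau> \<partial>M \<partial>M \<partial>gauss I)"
      by (simp add: pair_lik_def)
    also have "\<dots> = (\<integral>\<sigma>. \<integral>\<tau>. \<integral>Y. ?F Y \<sigma> \<tau> \<partial>gauss I \<partial>M \<partial>M)" by (rule exp_dominated_swap2[OF fin M.prob_space_axioms m K(2) K(1)])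
    also have "\<dots> = (\<integral>\<sigma>. \<integral>\<tau>. (h \<sigma> \<tau>)\<^sup>2 * (\<integral>Y. cm_dens I (w \<sigma>) Y * cm_dens I (w \<tau>) Y * (1 / ?L Y) \<partial>gauss I) \<partial>M \<partial>M)"
      by (simp only: mult.assoc integral_mult_right_zero)
    finally show "(\<integral>Y. pair_lik I M w ?h2 Y / ?L Y \<partial>gauss I) = (\<integral>\<sigma>. \<integral>\<tau>. (h \<sigma> \<tau>)\<^sup>2 * (\<integral>Y. cm_dens I (w \<sigma>) Y * cm_dens I (w \<tau>) Y * (1 / ?L Y) \<partial>gauss I) \<partial>M \<partial>M)" .
    obtain D where "\<And>p. \<bar>\<integral>Y. ?F Y (fst p) (snd p) \<partial>gauss I\<bar> \<le> D" using exp_dominated_integral_bounded[OF fin ed] by blast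
    then show "\<exists>D. \<forall>\<sigma> \<tau>. \<bar>\<integral>Y. ?F Y \<sigma> \<tau> \<partial>gauss I\<bar> \<le> D" by (metis fst_conv snd_conv)
    have sfG: "sigma_finite_measure (gauss I)" by (intro prob_space_imp_sigma_finite prob_space_gauss)
    have "(\<lambda>z. ((snd z, fst (fst z)), snd (fst z))) \<in> measurable ((M \<Otimes>\<^sub>M M) \<Otimes>\<^sub>M gauss I) ((gauss I \<Otimes>\<^sub>M M) \<Otimes>\<^sub>M M)" by measurable
    from measurable_compose[OF this m]
    show "(\<lambda>p. \<integral>Y. ?F Y (fst p) (snd p) \<partial>gauss I) \<in> borel_measurable (M \<Otimes>\<^sub>M M)"
      by (intro sigma_finite_measure.borel_measurable_lebesgue_integral[OF sfG]) (simp add: split_beta')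
  qed
  have le: "(\<integral>Y. pair_lik I M v ?h2 Y / ?L Y \<partial>gauss I) \<le> (\<integral>Y. pair_lik I M v0 ?h2 Y / ?L Y \<partial>gauss I)"
  proof -
    have ii: "integrable M (\<lambda>\<sigma>. \<integral>\<tau>. (h \<sigma> \<tau>)\<^sup>2 * (\<integral>Y. cm_dens I (w \<sigma>) Y * cm_dens I (w \<tau>) Y * (1 / ?L Y) \<partial>gauss I) \<partial>M)"
      "\<sigma> \<in> space M \<Longrightarrow> integrable M (\<lambda>\<tau>. (h \<sigma> \<tau>)\<^sup>2 * (\<integral>Y. cm_dens I (w \<sigma>) Y * cm_dens I (w \<tau>) Y * (1 / ?L Y) \<partial>gauss I))"
      if bw: "bounded_feat I M c w" for w \<sigma>
    proof -
      have eq: "(h \<sigma> \<tau>)\<^sup>2 * (\<integral>Y. cm_dens I (w \<sigma>) Y * cm_dens I (w \<tau>) Y * (1 / ?L Y) \<partial>gauss I) = (\<integral>Y. (h \<sigma> \<tau>)\<^sup>2 * (cm_dens I (w \<sigma>) Y * cm_dens I (w \<tau>) Y) * (1 / ?L Y) \<partial>gauss I)" for \<sigma> \<tau>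
        by (simp only: mult.assoc integral_mult_right_zero)
      obtain D where D: "\<And>\<sigma> \<tau>. \<bar>\<integral>Y. (h \<sigma> \<tau>)\<^sup>2 * (cm_dens I (w \<sigma>) Y * cm_dens I (w \<tau>) Y) * (1 / ?L Y) \<partial>gauss I\<bar> \<le> D" using bd[OF bw] by auto
      show "integrable M (\<lambda>\<sigma>. \<integral>\<tau>. (h \<sigma> \<tau>)\<^sup>2 * (\<integral>Y. cm_dens I (w \<sigma>) Y * cm_dens I (w \<tau>) Y * (1 / ?L Y) \<partial>gauss I) \<partial>M)"
        unfolding eq using M.abs_integral_le[OF D] ms[OF bw]
        by (intro M.integrable_const_bound[where B=D]) (auto intro!: M.borel_measurable_lebesgue_integral simp: split_beta')
      show "integrable M (\<lambda>\<tau>. (h \<sigma> \<tau>)\<^sup>2 * (\<integral>Y. cm_dens I (w \<sigma>) Y * cm_dens I (w \<tau>) Y * (1 / ?L Y) \<partial>gauss I))" if "\<sigma> \<in> space M"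
        unfolding eq using D measurable_compose[OF measurable_Pair1'[OF that] ms[OF bw]]
        by (intro M.integrable_const_bound[where B=D]) auto
    qed
    show ?thesis unfolding sw[OF bv] sw[OF b0]
      by (intro integral_mono step ii[OF bv] ii[OF b0])
  qed
  \<comment> \<open>\<open>h\<close> and \<open>v0\<close> read independent parts of the
    configuration, so the two densities average out separately and leave the prior second moment of
    \<open>h\<close>.\<close>
  have fac: "pair_lik I M v0 ?h2 Y = (?L Y)\<^sup>2 * (\<integral>\<sigma>. \<integral>\<tau>. (h \<sigma> \<tau>)\<^sup>2 \<partial>M \<partial>M)" for Y
  proof -
    let ?g = "\<lambda>\<sigma>. cm_dens I (v0 \<sigma>) Y"
    have gs: "?g (sp (\<sigma>, \<tau>)) = ?g \<tau>" if "\<sigma> \<in> space M" "\<tau> \<in> space M" for \<sigma> \<tau>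
      by (intro cm_dens_cong sp0 that refl)
    \<comment> \<open>For a function \<open>f\<close> of the part that is independent of
      \<open>v0\<close>, the coupling separates \<open>f\<close> from the density.\<close>
    have in1: "(\<integral>\<tau>. f \<tau> * ?g \<tau> \<partial>M) = (\<integral>\<tau>. f \<tau> \<partial>M) * ?L Y"
      if f: "f \<in> borel_measurable M" "\<And>\<tau>. \<bar>f \<tau>\<bar> \<le> D" "\<And>\<sigma> \<tau>. \<sigma> \<in> space M \<Longrightarrow> \<tau> \<in> space M \<Longrightarrow> f (sp (\<sigma>, \<tau>)) = f \<sigma>" for f :: "'b \<Rightarrow> real" and D
    proof -
      have i: "integrable M (\<lambda>\<tau>. f \<tau> * ?g \<tau>)"
        using f(2) cm_dens_bounds(1)[OF fin bounded_featD(5)[OF b0]]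
        by (intro M.integrable_const_bound[where B="D * exp (c * l1_norm I Y)"] borel_measurable_times f(1) cm_dens_feat_measurable1[OF b0])
          (auto simp: abs_mult intro!: AE_I2 mult_mono order_trans[OF abs_ge_zero f(2)])
      have "(\<integral>\<tau>. f \<tau> * ?g \<tau> \<partial>M) = (\<integral>\<sigma>. \<integral>\<tau>. f (sp (\<sigma>, \<tau>)) * ?g (sp (\<sigma>, \<tau>)) \<partial>M \<partial>M)"
        by (rule integral_coupling(1)[OF sp M.prob_space_axioms i])
      also have "\<dots> = (\<integral>\<sigma>. \<integral>\<tau>. f \<sigma> * ?g \<tau> \<partial>M \<partial>M)"
        by (intro Bochner_Integration.integral_cong refl) (simp add: f(3) gs)
      finally show ?thesis by (simp add: mix_lik_def)
    qed
    have m2: "(\<lambda>\<sigma>. \<integral>\<tau>. (h \<sigma> \<tau>)\<^sup>2 \<partial>M) \<in> borel_measurable M"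
      using bounded_kerD(1)[OF h2] by (intro M.borel_measurable_lebesgue_integral) (simp add: split_beta')
    have "pair_lik I M v0 ?h2 Y = (\<integral>\<sigma>. ?g \<sigma> * (\<integral>\<tau>. (h \<sigma> \<tau>)\<^sup>2 * ?g \<tau> \<partial>M) \<partial>M)"
      unfolding pair_lik_def by (simp add: mult_ac flip: integral_mult_right_zero)
    also have "\<dots> = (\<integral>\<sigma>. ?g \<sigma> * ((\<integral>\<tau>. (h \<sigma> \<tau>)\<^sup>2 \<partial>M) * ?L Y) \<partial>M)"
    proof (rule Bochner_Integration.integral_cong[OF refl])
      fix \<sigma> assume s: "\<sigma> \<in> space M"
      show "?g \<sigma> * (\<integral>\<tau>. (h \<sigma> \<tau>)\<^sup>2 * ?g \<tau> \<partial>M) = ?g \<sigma> * ((\<integral>\<tau>. (h \<sigma> \<tau>)\<^sup>2 \<partial>M) * ?L Y)"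
      proof -
        have "(\<integral>\<tau>. (h \<sigma> \<tau>)\<^sup>2 * ?g \<tau> \<partial>M) = (\<integral>\<tau>. (h \<sigma> \<tau>)\<^sup>2 \<partial>M) * ?L Y"
          by (rule in1[OF pair_lik_slice_measurable[OF b0 h2 s] bounded_kerD(2)[OF h2]]) (simp add: sph)
        then show ?thesis by simp
      qed
    qed
    also have "\<dots> = (\<integral>\<sigma>. (\<integral>\<tau>. (h \<sigma> \<tau>)\<^sup>2 \<partial>M) * ?g \<sigma> \<partial>M) * ?L Y"
      by (simp add: mult_ac flip: integral_mult_right_zero)
    also have "(\<integral>\<sigma>. (\<integral>\<tau>. (h \<sigma> \<tau>)\<^sup>2 \<partial>M) * ?g \<sigma> \<partial>M) = (\<integral>\<sigma>. \<integral>\<tau>. (h \<sigma> \<tau>)\<^sup>2 \<partial>M \<partial>M) * ?L Y"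
      by (rule in1[OF m2 M.abs_integral_le[OF bounded_kerD(2)[OF h2]]]) (simp add: sph)
    finally show ?thesis by (simp add: power2_eq_square mult_ac)
  qed
  have "2 * planted_pair I M v h = (\<integral>Y. 2 * (pair_lik I M v h Y / ?Z Y) \<partial>gauss I)" by (simp only: planted_pair_def integral_mult_right_zero)
  also have "\<dots> \<le> (\<integral>Y. pair_lik I M v ?h2 Y / ?L Y + ?L Y \<partial>gauss I)"
  proof (rule integral_mono)
    show "integrable (gauss I) (\<lambda>Y. 2 * (pair_lik I M v h Y / ?Z Y))" by (rule integrable_mult_right[OF integrable_planted_pair[OF bv h]])
    show "integrable (gauss I) (\<lambda>Y. pair_lik I M v ?h2 Y / ?L Y + ?L Y)"
      by (intro Bochner_Integration.integrable_add iN2 bv integrable_mix_lik[OF b0])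
  qed (rule pw)
  also have "\<dots> = (\<integral>Y. pair_lik I M v ?h2 Y / ?L Y \<partial>gauss I) + 1"
    using iN2[OF bv] integrable_mix_lik[OF b0] by (simp add: integral_mix_lik[OF b0])
  also have "\<dots> \<le> (\<integral>Y. pair_lik I M v0 ?h2 Y / ?L Y \<partial>gauss I) + 1" using le by simp
  also have "(\<integral>Y. pair_lik I M v0 ?h2 Y / ?L Y \<partial>gauss I) = (\<integral>Y. ?L Y * (\<integral>\<sigma>. \<integral>\<tau>. (h \<sigma> \<tau>)\<^sup>2 \<partial>M \<partial>M) \<partial>gauss I)"
    unfolding fac using Lp by (intro Bochner_Integration.integral_cong refl) (simp add: power2_eq_square less_imp_neq[symmetric])
  also have "\<dots> = (\<integral>\<sigma>. \<integral>\<tau>. (h \<sigma> \<tau>)\<^sup>2 \<partial>M \<partial>M)" using integrable_mix_lik[OF b0] by (simp add: integral_mix_lik[OF b0])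
  finally show ?thesis by simp
qed

section \<open>Tensor features and one spike\<close>

text \<open>Makes the spin bound hold everywhere, as \<open>bounded_feat\<close> demands, while
  agreeing with the identity almost surely.\<close>

definition clip :: "real \<Rightarrow> real \<Rightarrow> real" where
  "clip B x = max (- B) (min B x)"

lemma abs_clip_le: "0 \<le> B \<Longrightarrow> \<bar>clip B x\<bar> \<le> B"
  by (auto simp: clip_def)

lemma clip_eq: "\<bar>x\<bar> \<le> B \<Longrightarrow> clip B x = x"
  by (auto simp: clip_def)

lemma clip_measurable [measurable]: "clip B \<in> borel_measurable borel"
  unfolding clip_def by measurable

definition tfeat :: "nat \<Rightarrow> nat \<Rightarrow> (nat \<Rightarrow> real) \<Rightarrow> (nat \<Rightarrow> nat) \<Rightarrow> real" where
  "tfeat p N s i = real N powr (- (real p - 1) / 2) * (\<Prod>j<p. s (i j))"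

text \<open>The argument is the unnormalised overlap, because that is the quantity which adds over
  blocks of sites.\<close>

definition tker :: "nat \<Rightarrow> nat \<Rightarrow> real \<Rightarrow> real" where
  "tker p N x = real N * (x / real N) ^ p"

lemma finite_tensor_idx [simp]: "finite (tensor_idx p N)"
  by (simp add: tensor_idx_def finite_PiE)

lemma tensor_idx_less: "i \<in> tensor_idx p N \<Longrightarrow> j < p \<Longrightarrow> i j < N"
  by (auto simp: tensor_idx_def)

lemma tfeat_cong: "i \<in> tensor_idx r N \<Longrightarrow> (\<And>k. k < N \<Longrightarrow> s k = s' k) \<Longrightarrow> tfeat r N s i = tfeat r N s' i"
  unfolding tfeat_def using tensor_idx_less by (intro arg_cong2[where f="(*)"] refl prod.cong) auto

lemma card_tensor_idx: "card (tensor_idx p N) = N ^ p"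
  by (simp add: tensor_idx_def card_PiE)

lemma sum_tensor_prod: "(\<Sum>i\<in>tensor_idx p N. \<Prod>j<p. f (i j)) = (\<Sum>k<N. f k :: real) ^ p"
  unfolding tensor_idx_def by (subst prod_sum_PiE[symmetric]) auto

lemma powr_scale_square:
  assumes "0 < N" "1 \<le> p"
  shows "real N powr (- (real p - 1) / 2) * real N powr (- (real p - 1) / 2) = real N / real N ^ p"
proof -
  have "real N powr (- (real p - 1) / 2) * real N powr (- (real p - 1) / 2) = real N powr (1 - real p)"
    by (subst powr_add[symmetric]) simp
  also have "\<dots> = real N / real N ^ p" using assms by (simp add: powr_diff powr_realpow)
  finally show ?thesis .
qed

lemma tfeat_inner:
  assumes "1 \<le> p"
  shows "(\<Sum>i\<in>tensor_idx p N. tfeat p N s i * tfeat p N s' i) = tker p N (\<Sum>k<N. s k * s' k)"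
proof (cases "N = 0")
  case True
  \<comment> \<open>Without sites there are no indices because \<open>p\<close> is positive; both
    sides are 0.\<close>
  then have "tensor_idx p N = {}" using assms by (auto simp: tensor_idx_def PiE_eq_empty_iff intro!: exI[of _ 0])
  then show ?thesis using True by (simp add: tker_def)
next
  case False
  have "(\<Sum>i\<in>tensor_idx p N. tfeat p N s i * tfeat p N s' i) =
      (\<Sum>i\<in>tensor_idx p N. (real N powr (- (real p - 1) / 2) * real N powr (- (real p - 1) / 2)) * (\<Prod>j<p. s (i j) * s' (i j)))"
    by (simp add: tfeat_def prod.distrib mult_ac)
  also have "\<dots> = real N / real N ^ p * (\<Sum>k<N. s k * s' k) ^ p"
    unfolding sum_distrib_left[symmetric] powr_scale_square[OF _ assms, of N, simplified, OF False[simplified]]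
    using sum_tensor_prod[where f="\<lambda>k. s k * s' k" and p=p and N=N] powr_scale_square[of N p] False assms by simp
  finally show ?thesis by (simp add: tker_def power_divide)
qed

lemma tfeat_abs_le:
  assumes "\<And>k. \<bar>s k\<bar> \<le> B" "1 \<le> p"
  shows "\<bar>tfeat p N s i\<bar> \<le> real N powr (- (real p - 1) / 2) * B ^ p"
proof -
  have "\<bar>\<Prod>j<p. s (i j)\<bar> = (\<Prod>j<p. \<bar>s (i j)\<bar>)" by (simp add: abs_prod)
  also have "\<dots> \<le> (\<Prod>j<p. B)" using assms by (intro prod_mono) auto
  finally show ?thesis by (simp add: tfeat_def abs_mult mult_left_mono)
qed

lemma tfeat_abs_le':
  assumes "\<And>k. \<bar>s k\<bar> \<le> B" "1 \<le> p"
  shows "\<bar>tfeat p N s i\<bar> \<le> B ^ p"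
proof -
  have "real N powr (- (real p - 1) / 2) \<le> 1"
  proof (cases "N = 0")
    case False
    then have "real N powr (- (real p - 1) / 2) \<le> real N powr 0" using assms(2) by (intro powr_mono) auto
    then show ?thesis using False by simp
  qed simp
  moreover have "0 \<le> B" using assms(1)[of 0] by linarith
  ultimately have "real N powr (- (real p - 1) / 2) * B ^ p \<le> 1 * B ^ p" by (intro mult_right_mono) auto
  then show ?thesis using tfeat_abs_le[of s B p N i, OF assms] by linarith
qed

lemma tker_abs_le:
  assumes "\<bar>x\<bar> \<le> real N * b" "0 \<le> b"
  shows "\<bar>tker p N x\<bar> \<le> real N * b ^ p"
proof (cases "N = 0")
  case False
  then have "\<bar>x / real N\<bar> \<le> b" using assms by (simp add: divide_le_eq mult.commute)
  then have "\<bar>x / real N\<bar> ^ p \<le> b ^ p" by (intro power_mono) auto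
  then show ?thesis by (simp add: tker_def abs_mult power_abs mult_left_mono del: abs_divide)
qed (simp add: tker_def)

lemma sum_sq_le:
  fixes s s' :: "'k \<Rightarrow> real"
  assumes "\<And>k. \<bar>s k\<bar> \<le> B" "\<And>k. \<bar>s' k\<bar> \<le> B"
  shows "\<bar>\<Sum>k\<in>A. s k * s' k\<bar> \<le> real (card A) * B\<^sup>2"
proof -
  have "0 \<le> B" using assms(1)[of undefined] by linarith
  then have "\<bar>\<Sum>k\<in>A. s k * s' k\<bar> \<le> (\<Sum>k\<in>A. B * B)"
    using assms by (intro order_trans[OF sum_abs] sum_mono) (auto simp: abs_mult intro!: mult_mono)
  then show ?thesis by (simp add: power2_eq_square)
qed

section \<open>Convexity of the overlap kernel\<close>

lemma tker_convex:
  assumes "0 < n" "0 < m" and c: "convex_on S (\<lambda>x. x ^ p)" "x / real n \<in> S" "y / real m \<in> S"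
  shows "tker p (n + m) (x + y) \<le> tker p n x + tker p m y"
proof -
  let ?l = "real n / real (n + m)" and ?l' = "real m / real (n + m)"
  have l: "?l + ?l' = 1" "0 \<le> ?l" "0 \<le> ?l'" using assms by (auto simp: add_divide_distrib[symmetric])
  have "(?l * (x / real n) + ?l' * (y / real m)) ^ p \<le> ?l * (x / real n) ^ p + ?l' * (y / real m) ^ p"
  proof -
    have "(u * x' + v * y') ^ p \<le> u * x' ^ p + v * y' ^ p"
      if "x' \<in> S" "y' \<in> S" "0 \<le> u" "0 \<le> v" "u + v = 1" for u v x' y'
      using c(1) that unfolding convex_on_def by auto
    from this[OF c(2,3) l(2,3,1)] show ?thesis .
  qed
  moreover have "?l * (x / real n) + ?l' * (y / real m) = (x + y) / real (n + m)"
    using assms by (simp add: add_divide_distrib)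
  ultimately have "real (n + m) * ((x + y) / real (n + m)) ^ p \<le> real (n + m) * (?l * (x / real n) ^ p + ?l' * (y / real m) ^ p)"
    by (intro mult_left_mono) auto
  also have "\<dots> = tker p n x + tker p m y" using assms by (simp add: tker_def distrib_left del: of_nat_add)
  finally show ?thesis by (simp add: tker_def)
qed

text \<open>The price for odd \<open>p\<close>, where the power is convex only on nonnegative
  arguments; it is 0 for even \<open>p\<close>. The scaling keeps its moments under a centred prior
  bounded in \<open>n\<close>.\<close>

definition neg_square :: "nat \<Rightarrow> nat \<Rightarrow> real \<Rightarrow> real" where
  "neg_square p n x = (if odd p \<and> x < 0 then x\<^sup>2 / real n else 0)"

text \<open>For \<open>x < 0\<close> the number \<open>z = - x / n\<close> lies between 0 and
  \<open>b\<close>, so \<open>z ^ p \<le> b ^ (p - 2) * z\<^sup>2\<close>.\<close>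

lemma tker_pos_part_le:
  assumes "odd p" "2 \<le> p" "0 < n" "\<bar>x\<bar> \<le> real n * b" "0 \<le> b"
  shows "tker p n (max 0 x) \<le> tker p n x + b ^ (p - 2) * neg_square p n x"
proof (cases "x < 0")
  case True
  define z where "z = - x / real n"
  have "- x \<le> b * real n" using True assms(4) by (simp add: mult.commute)
  then have "z \<le> b" unfolding z_def using assms(3) by (subst pos_divide_le_eq) auto
  moreover have "0 \<le> z" unfolding z_def using True by (intro divide_nonneg_nonneg) auto
  ultimately have z: "0 \<le> z" "z \<le> b" by auto
  have p2: "p = (p - 2) + 2" using assms by simp
  have "z ^ p = z ^ (p - 2) * z\<^sup>2" by (subst p2) (simp add: power_add power2_eq_square)
  also have "\<dots> \<le> b ^ (p - 2) * z\<^sup>2" using z by (intro mult_right_mono power_mono) auto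
  finally have "real n * z ^ p \<le> real n * (b ^ (p - 2) * z\<^sup>2)" by (intro mult_left_mono) auto
  moreover have "tker p n x = - (real n * z ^ p)"
  proof -
    have "x / real n = - z" by (simp add: z_def)
    then show ?thesis using assms(1) by (simp add: tker_def)
  qed
  moreover have "real n * (b ^ (p - 2) * z\<^sup>2) = b ^ (p - 2) * neg_square p n x"
    using True assms by (simp add: neg_square_def z_def power2_eq_square)
  moreover have "tker p n (max 0 x) = 0" using True assms by (auto simp: tker_def)
  ultimately show ?thesis by simp
next
  case False
  then show ?thesis by (simp add: neg_square_def)
qed

text \<open>The comparison between the covariance of the whole tensor and those of the blocks. For
  odd \<open>p\<close> both overlaps are replaced by their positive parts, which can only raise the
  left side, and the negative parts are paid for by \<open>neg_square\<close>.\<close>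

lemma tker_add_le:
  assumes p: "3 \<le> p" and nm: "0 < n" "0 < m" and b: "\<bar>x\<bar> \<le> real n * b" "\<bar>y\<bar> \<le> real m * b" "0 \<le> b"
  shows "tker p (n + m) (x + y) \<le> tker p n x + tker p m y + b ^ (p - 2) * (neg_square p n x + neg_square p m y)"
proof (cases "even p")
  case True
  then show ?thesis using tker_convex[OF nm convex_power_even[OF True], of x y] by (simp add: neg_square_def)
next
  case False
  have "((x + y) / real (n + m)) ^ p \<le> ((max 0 x + max 0 y) / real (n + m)) ^ p"
    using False by (intro power_mono_odd divide_right_mono) auto
  then have "tker p (n + m) (x + y) \<le> tker p (n + m) (max 0 x + max 0 y)"
    unfolding tker_def by (intro mult_left_mono) auto
  also have "\<dots> \<le> tker p n (max 0 x) + tker p m (max 0 y)"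
    by (rule tker_convex[OF nm convex_power_odd]) (use False in auto)
  also have "\<dots> \<le> (tker p n x + b ^ (p - 2) * neg_square p n x) + (tker p m y + b ^ (p - 2) * neg_square p m y)"
    using False p nm b by (intro add_mono tker_pos_part_le) auto
  finally show ?thesis by (simp add: distrib_left)
qed

text \<open>Even moments are bounded through \<open>cosh\<close> because Hoeffding's lemma controls
  exponential moments of both signs. Squaring \<open>y\<^sup>2 / 2 \<le> exp \<bar>y\<bar>\<close>
  at \<open>y = x / 2\<close> gives 64, which \<open>exp \<bar>x\<bar> \<le> 2 * cosh x\<close>
  doubles to 128.\<close>

lemma square_le_cosh: "(x::real)\<^sup>2 \<le> 4 * cosh x" and power4_le_cosh: "x ^ 4 \<le> 128 * cosh x"
proof -
  have c: "exp \<bar>y\<bar> \<le> 2 * cosh y" for y :: real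
  proof -
    have "2 * cosh \<bar>y\<bar> = exp \<bar>y\<bar> + exp (- \<bar>y\<bar>)" by (simp add: cosh_def)
    then have "exp \<bar>y\<bar> \<le> 2 * cosh \<bar>y\<bar>" using exp_gt_zero[of "- \<bar>y\<bar>"] by linarith
    then show ?thesis by simp
  qed
  have q: "y\<^sup>2 / 2 \<le> exp \<bar>y\<bar>" for y :: real
    using exp_lower_Taylor_quadratic[of "\<bar>y\<bar>"] abs_ge_zero[of y] by simp
  show "x\<^sup>2 \<le> 4 * cosh x" using c[of x] q[of x] by linarith
  have "((x / 2)\<^sup>2 / 2)\<^sup>2 \<le> (exp \<bar>x / 2\<bar>)\<^sup>2" using q[of "x / 2"] by (intro power_mono) auto
  also have "(exp \<bar>x / 2\<bar>)\<^sup>2 = exp \<bar>x\<bar>" by (simp add: power2_eq_square exp_add[symmetric])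
  also have "((x / 2)\<^sup>2 / 2)\<^sup>2 = x ^ 4 / 64" by (simp add: power2_eq_square power4_eq_xxxx)
  finally show "x ^ 4 \<le> 128 * cosh x" using c[of x] by linarith
qed

section \<open>One spike under a centred bounded prior\<close>

definition scalar_feat :: "real \<Rightarrow> nat \<Rightarrow> nat \<Rightarrow> real \<Rightarrow> (nat \<Rightarrow> real) \<Rightarrow> (nat \<Rightarrow> nat) \<Rightarrow> real" where
  "scalar_feat B p N \<beta> \<sigma> i = \<beta> * tfeat p N (\<lambda>k. clip B (\<sigma> k)) i"

definition scalar_ent :: "real measure \<Rightarrow> real \<Rightarrow> nat \<Rightarrow> nat \<Rightarrow> real \<Rightarrow> real" where
  "scalar_ent \<mu> B p N \<beta> = planted_ent (tensor_idx p N) (PiM {..<N} (\<lambda>_. \<mu>)) (scalar_feat B p N \<beta>)"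

context
  fixes \<mu> :: "real measure" and B :: real
  assumes \<mu>: "prob_space \<mu>" and s\<mu>: "sets \<mu> = sets borel" and B: "1 \<le> B" and centered: "(\<integral>x. clip B x \<partial>\<mu>) = 0"
begin

interpretation \<mu>: prob_space \<mu> by (rule \<mu>)

lemma clip_coord_measurable:
  assumes "k \<in> J" shows "(\<lambda>\<sigma>. clip B (\<sigma> k)) \<in> borel_measurable (PiM J (\<lambda>_. \<mu>))"
proof -
  have "(\<lambda>\<sigma>. \<sigma> k) \<in> measurable (PiM J (\<lambda>_. \<mu>)) \<mu>" using assms by measurable
  moreover have "clip B \<in> borel_measurable \<mu>" using clip_measurable s\<mu> by (simp cong: measurable_cong_sets)
  ultimately show ?thesis by (rule measurable_compose)
qed

lemma nn_integral_cosh_le: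
  assumes J: "finite J"
  shows "(\<integral>\<^sup>+\<sigma>. ennreal (cosh (\<Sum>k\<in>J. t k * clip B (\<sigma> k))) \<partial>PiM J (\<lambda>_. \<mu>)) \<le> ennreal (exp (B\<^sup>2 / 2 * (\<Sum>k\<in>J. (t k)\<^sup>2)))"
proof -
  interpret P: product_sigma_finite "\<lambda>_. \<mu>" by (simp add: product_sigma_finite_def prob_space_imp_sigma_finite \<mu>)
  have cm[measurable]: "clip B \<in> borel_measurable \<mu>" using clip_measurable s\<mu> by (simp cong: measurable_cong_sets)
  have one: "(\<integral>\<^sup>+x. ennreal (exp (r * clip B x)) \<partial>\<mu>) \<le> ennreal (exp (B\<^sup>2 / 2 * r\<^sup>2))" for r
  proof -
    \<comment> \<open>Hoeffding's lemma on an interval of length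
      \<open>2 * \<bar>r\<bar> * B\<close>; this is where the centring of the spins enters.\<close>
    have i: "interval_bounded_random_variable \<mu> (\<lambda>x. r * clip B x) (- \<bar>r\<bar> * B) (\<bar>r\<bar> * B)"
    proof (unfold_locales)
      have "\<bar>r * clip B x\<bar> \<le> \<bar>r\<bar> * B" for x using abs_clip_le[of B x] B by (simp add: abs_mult mult_left_mono)
      then show "AE x in \<mu>. r * clip B x \<in> {- \<bar>r\<bar> * B..\<bar>r\<bar> * B}" by (auto simp: abs_le_iff minus_le_iff)
    qed measurable
    have "(\<integral>\<^sup>+x. ennreal (exp (1 * (r * clip B x))) \<partial>\<mu>) \<le> ennreal (exp (1\<^sup>2 * (\<bar>r\<bar> * B - - \<bar>r\<bar> * B)\<^sup>2 / 8))"
      by (rule interval_bounded_random_variable.Hoeffdings_lemma_nn_integral_0[OF i]) (use centered in auto)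
    also have "1\<^sup>2 * (\<bar>r\<bar> * B - - \<bar>r\<bar> * B)\<^sup>2 / 8 = B\<^sup>2 / 2 * r\<^sup>2"
      by (simp add: power2_eq_square algebra_simps)
    finally show ?thesis by simp
  qed
  have e: "(\<integral>\<^sup>+\<sigma>. ennreal (exp (\<Sum>k\<in>J. t k * clip B (\<sigma> k))) \<partial>PiM J (\<lambda>_. \<mu>)) \<le> ennreal (exp (B\<^sup>2 / 2 * (\<Sum>k\<in>J. (t k)\<^sup>2)))" for t
  proof -
    have "(\<integral>\<^sup>+\<sigma>. ennreal (exp (\<Sum>k\<in>J. t k * clip B (\<sigma> k))) \<partial>PiM J (\<lambda>_. \<mu>)) = (\<integral>\<^sup>+\<sigma>. (\<Prod>k\<in>J. ennreal (exp (t k * clip B (\<sigma> k)))) \<partial>PiM J (\<lambda>_. \<mu>))"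
      using J by (simp add: exp_sum prod_ennreal)
    also have "\<dots> = (\<Prod>k\<in>J. \<integral>\<^sup>+x. ennreal (exp (t k * clip B x)) \<partial>\<mu>)"
      by (intro P.product_nn_integral_prod J) measurable
    also have "\<dots> \<le> (\<Prod>k\<in>J. ennreal (exp (B\<^sup>2 / 2 * (t k)\<^sup>2)))" by (intro prod_mono_ennreal one)
    also have "\<dots> = ennreal (exp (B\<^sup>2 / 2 * (\<Sum>k\<in>J. (t k)\<^sup>2)))" using J by (simp add: prod_ennreal exp_sum sum_distrib_left)
    finally show ?thesis .
  qed
  have m: "(\<lambda>\<sigma>. exp (\<Sum>k\<in>J. r k * clip B (\<sigma> k))) \<in> borel_measurable (PiM J (\<lambda>_. \<mu>))" for r
    using clip_coord_measurable by measurable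
  let ?E = "ennreal (exp (B\<^sup>2 / 2 * (\<Sum>k\<in>J. (t k)\<^sup>2)))"
  have "(\<integral>\<^sup>+\<sigma>. ennreal (cosh (\<Sum>k\<in>J. t k * clip B (\<sigma> k))) \<partial>PiM J (\<lambda>_. \<mu>)) =
     (\<integral>\<^sup>+\<sigma>. ennreal (1/2) * (ennreal (exp (\<Sum>k\<in>J. t k * clip B (\<sigma> k))) + ennreal (exp (\<Sum>k\<in>J. - t k * clip B (\<sigma> k)))) \<partial>PiM J (\<lambda>_. \<mu>))"
  proof (rule nn_integral_cong)
    fix \<sigma>
    have "cosh (\<Sum>k\<in>J. t k * clip B (\<sigma> k)) = 1/2 * (exp (\<Sum>k\<in>J. t k * clip B (\<sigma> k)) + exp (\<Sum>k\<in>J. - t k * clip B (\<sigma> k)))"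
      by (simp add: cosh_def sum_negf)
    then show "ennreal (cosh (\<Sum>k\<in>J. t k * clip B (\<sigma> k))) = ennreal (1/2) * (ennreal (exp (\<Sum>k\<in>J. t k * clip B (\<sigma> k))) + ennreal (exp (\<Sum>k\<in>J. - t k * clip B (\<sigma> k))))"
      by (simp only:) (subst ennreal_mult', simp, subst ennreal_plus, simp_all)
  qed
  also have "\<dots> = ennreal (1/2) * ((\<integral>\<^sup>+\<sigma>. ennreal (exp (\<Sum>k\<in>J. t k * clip B (\<sigma> k))) \<partial>PiM J (\<lambda>_. \<mu>)) + (\<integral>\<^sup>+\<sigma>. ennreal (exp (\<Sum>k\<in>J. - t k * clip B (\<sigma> k))) \<partial>PiM J (\<lambda>_. \<mu>)))"
    using m[of t] m[of "\<lambda>k. - t k"] by (subst nn_integral_cmult, measurable) (subst nn_integral_add, measurable)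
  also have "\<dots> \<le> ennreal (1/2) * (?E + ?E)"
    using e[of t] e[of "\<lambda>k. - t k"] by (intro mult_left_mono add_mono) auto
  also have "\<dots> = ennreal (1/2 * (exp (B\<^sup>2 / 2 * (\<Sum>k\<in>J. (t k)\<^sup>2)) + exp (B\<^sup>2 / 2 * (\<Sum>k\<in>J. (t k)\<^sup>2))))"
    by (subst ennreal_mult', simp, subst ennreal_plus) auto
  finally show ?thesis by simp
qed

lemma integral_le_cosh:
  assumes J: "finite J" and "f \<in> borel_measurable (PiM J (\<lambda>_. \<mu>))" "0 \<le> C"
    and le: "\<And>\<sigma>. f \<sigma> \<le> C * cosh (\<Sum>k\<in>J. t k * clip B (\<sigma> k))"
  shows "(\<integral>\<sigma>. f \<sigma> \<partial>PiM J (\<lambda>_. \<mu>)) \<le> C * exp (B\<^sup>2 / 2 * (\<Sum>k\<in>J. (t k)\<^sup>2))"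
proof (rule integral_real_bounded)
  have m: "(\<lambda>\<sigma>. cosh (\<Sum>k\<in>J. t k * clip B (\<sigma> k))) \<in> borel_measurable (PiM J (\<lambda>_. \<mu>))"
    unfolding cosh_def using clip_coord_measurable by measurable
  have "(\<integral>\<^sup>+\<sigma>. ennreal (f \<sigma>) \<partial>PiM J (\<lambda>_. \<mu>)) \<le> (\<integral>\<^sup>+\<sigma>. ennreal C * ennreal (cosh (\<Sum>k\<in>J. t k * clip B (\<sigma> k))) \<partial>PiM J (\<lambda>_. \<mu>))"
    using le assms(3) by (intro nn_integral_mono) (simp add: ennreal_mult'[symmetric] ennreal_leI)
  also have "\<dots> = ennreal C * (\<integral>\<^sup>+\<sigma>. ennreal (cosh (\<Sum>k\<in>J. t k * clip B (\<sigma> k))) \<partial>PiM J (\<lambda>_. \<mu>))"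
    using m by (intro nn_integral_cmult) measurable
  also have "\<dots> \<le> ennreal C * ennreal (exp (B\<^sup>2 / 2 * (\<Sum>k\<in>J. (t k)\<^sup>2)))"
    by (intro mult_left_mono nn_integral_cosh_le J) auto
  finally show "(\<integral>\<^sup>+\<sigma>. ennreal (f \<sigma>) \<partial>PiM J (\<lambda>_. \<mu>)) \<le> ennreal (C * exp (B\<^sup>2 / 2 * (\<Sum>k\<in>J. (t k)\<^sup>2)))"
    using assms(3) by (simp add: ennreal_mult')
qed (use assms in auto)

lemma sum_squares_scaled_le:
  assumes "finite J" "K \<subseteq> J" "\<And>k. \<bar>s k\<bar> \<le> B" "card K \<le> n" "0 < n"
  shows "(\<Sum>k\<in>J. (if k \<in> K then s k / sqrt (real n) else 0)\<^sup>2) \<le> B\<^sup>2"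
proof -
  have "(\<Sum>k\<in>J. (if k \<in> K then s k / sqrt (real n) else 0)\<^sup>2) = (\<Sum>k\<in>K. (s k)\<^sup>2 / real n)"
    using assms(1,2) by (intro sum.mono_neutral_cong_right) (auto simp: power_divide)
  also have "\<dots> \<le> (\<Sum>k\<in>K. B\<^sup>2 / real n)"
    using assms(3) B by (intro sum_mono divide_right_mono) (auto simp: abs_le_square_iff[symmetric])
  also have "\<dots> = real (card K) / real n * B\<^sup>2" by simp
  also have "\<dots> \<le> 1 * B\<^sup>2" using assms(4,5) by (intro mult_right_mono) auto
  finally show ?thesis by simp
qed

text \<open>Divided by \<open>sqrt n\<close>, the overlap with a fixed bounded vector has
  coefficients of squared norm at most \<open>B\<^sup>2\<close>, which gives
  \<open>exp (B ^ 4 / 2)\<close> uniformly in \<open>n\<close>. The set \<open>K\<close> may be a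
  block of a larger configuration.\<close>

lemma moment_le:
  assumes J: "finite J" "K \<subseteq> J" and s: "\<And>k. \<bar>s k\<bar> \<le> B" and n: "card K \<le> n" "0 < n"
  shows "(\<integral>\<sigma>. (\<Sum>k\<in>K. clip B (\<sigma> k) * s k)\<^sup>2 / real n \<partial>PiM J (\<lambda>_. \<mu>)) \<le> 4 * exp (B ^ 4 / 2)"
    "(\<integral>\<sigma>. (\<Sum>k\<in>K. clip B (\<sigma> k) * s k) ^ 4 / (real n)\<^sup>2 \<partial>PiM J (\<lambda>_. \<mu>)) \<le> 128 * exp (B ^ 4 / 2)"
proof -
  let ?t = "\<lambda>k. if k \<in> K then s k / sqrt (real n) else 0"
  let ?X = "\<lambda>\<sigma>. \<Sum>k\<in>K. clip B (\<sigma> k) * s k"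
  have Xm[measurable]: "?X \<in> borel_measurable (PiM J (\<lambda>_. \<mu>))"
    by (intro borel_measurable_sum borel_measurable_times clip_coord_measurable borel_measurable_const) (use J(2) in auto)
  have X: "(\<Sum>k\<in>J. ?t k * clip B (\<sigma> k)) = ?X \<sigma> / sqrt (real n)" for \<sigma>
  proof -
    have "(\<Sum>k\<in>J. ?t k * clip B (\<sigma> k)) = (\<Sum>k\<in>K. clip B (\<sigma> k) * s k / sqrt (real n))"
      using J by (intro sum.mono_neutral_cong_right) (auto simp: mult.commute)
    then show ?thesis by (simp add: sum_divide_distrib)
  qed
  have ex: "exp (B\<^sup>2 / 2 * (\<Sum>k\<in>J. (?t k)\<^sup>2)) \<le> exp (B ^ 4 / 2)"
  proof -
    have "B\<^sup>2 / 2 * (\<Sum>k\<in>J. (?t k)\<^sup>2) \<le> B\<^sup>2 / 2 * B\<^sup>2"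
      using sum_squares_scaled_le[OF J s n] by (intro mult_left_mono) auto
    also have "\<dots> = B ^ 4 / 2" by (simp add: power2_eq_square power4_eq_xxxx)
    finally show ?thesis by simp
  qed
  have "(\<integral>\<sigma>. (?X \<sigma>)\<^sup>2 / real n \<partial>PiM J (\<lambda>_. \<mu>)) \<le> 4 * exp (B\<^sup>2 / 2 * (\<Sum>k\<in>J. (?t k)\<^sup>2))"
  proof (rule integral_le_cosh[OF J(1)])
    show "(?X \<sigma>)\<^sup>2 / real n \<le> 4 * cosh (\<Sum>k\<in>J. ?t k * clip B (\<sigma> k))" for \<sigma>
      unfolding X using square_le_cosh[of "?X \<sigma> / sqrt (real n)"] n by (simp add: power_divide)
  qed auto
  then show "(\<integral>\<sigma>. (?X \<sigma>)\<^sup>2 / real n \<partial>PiM J (\<lambda>_. \<mu>)) \<le> 4 * exp (B ^ 4 / 2)"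
    by (rule order_trans[OF _ mult_left_mono[OF ex]]) simp
  have "(\<integral>\<sigma>. (?X \<sigma>) ^ 4 / (real n)\<^sup>2 \<partial>PiM J (\<lambda>_. \<mu>)) \<le> 128 * exp (B\<^sup>2 / 2 * (\<Sum>k\<in>J. (?t k)\<^sup>2))"
  proof (rule integral_le_cosh[OF J(1)])
    have s4: "sqrt (real n) ^ 4 = (real n)\<^sup>2" using power_mult[of "sqrt (real n)" 2 2] by simp
    show "(?X \<sigma>) ^ 4 / (real n)\<^sup>2 \<le> 128 * cosh (\<Sum>k\<in>J. ?t k * clip B (\<sigma> k))" for \<sigma>
      unfolding X using power4_le_cosh[of "?X \<sigma> / sqrt (real n)"] by (simp add: power_divide s4)
  qed auto
  then show "(\<integral>\<sigma>. (?X \<sigma>) ^ 4 / (real n)\<^sup>2 \<partial>PiM J (\<lambda>_. \<mu>)) \<le> 128 * exp (B ^ 4 / 2)"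
    by (rule order_trans[OF _ mult_left_mono[OF ex]]) simp
qed

lemma prob_space_PiM_mu: "prob_space (PiM J (\<lambda>_. \<mu>))" by (intro prob_space_PiM \<mu>)

text \<open>Stated with a relabelling \<open>z\<close> of the sites and a switch \<open>Q\<close>,
  so that it also covers the second block and configurations with some spins set to 0.\<close>

lemma tfeat_clip_measurable:
  assumes "i \<in> tensor_idx p N" "\<And>k. k < N \<Longrightarrow> z k \<in> J \<or> \<not> Q k"
  shows "(\<lambda>\<sigma>. tfeat p N (\<lambda>k. if Q k then clip B (\<sigma> (z k)) else 0) i) \<in> borel_measurable (PiM J (\<lambda>_. \<mu>))"
  unfolding tfeat_def
proof (intro borel_measurable_times borel_measurable_const borel_measurable_prod)
  fix j assume "j \<in> {..<p}"
  then have "i j < N" using assms(1) tensor_idx_less by auto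
  then show "(\<lambda>\<sigma>. if Q (i j) then clip B (\<sigma> (z (i j))) else 0) \<in> borel_measurable (PiM J (\<lambda>_. \<mu>))"
    using assms(2)[of "i j"] clip_coord_measurable[of "z (i j)" J] by (cases "Q (i j)") auto
qed

lemma bounded_feat_scalar_feat:
  assumes "1 \<le> p" shows "bounded_feat (tensor_idx p N) (PiM {..<N} (\<lambda>_. \<mu>)) (\<bar>\<beta>\<bar> * B ^ p) (scalar_feat B p N \<beta>)"
  unfolding bounded_feat_def
proof (intro conjI ballI allI)
  fix \<sigma> i
  show "\<bar>scalar_feat B p N \<beta> \<sigma> i\<bar> \<le> \<bar>\<beta>\<bar> * B ^ p"
    unfolding scalar_feat_def abs_mult using B assms by (intro mult_left_mono tfeat_abs_le' abs_clip_le) auto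
next
  fix i assume "i \<in> tensor_idx p N"
  from tfeat_clip_measurable[OF this, of "\<lambda>k. k" "{..<N}" "\<lambda>_. True"]
  show "(\<lambda>\<sigma>. scalar_feat B p N \<beta> \<sigma> i) \<in> borel_measurable (PiM {..<N} (\<lambda>_. \<mu>))" unfolding scalar_feat_def by simp
qed (use B prob_space_PiM_mu in auto)

lemma scalar_ent_nonneg: "1 \<le> p \<Longrightarrow> 0 \<le> scalar_ent \<mu> B p N \<beta>"
  unfolding scalar_ent_def by (rule planted_ent_nonneg[OF bounded_feat_scalar_feat])

lemma sum_clip_le: "\<bar>\<Sum>k\<in>A. clip B (\<sigma> k) * clip B (\<tau> k)\<bar> \<le> real (card A) * B\<^sup>2"
  using B by (intro sum_sq_le abs_clip_le) auto

text \<open>Lowering \<open>\<beta>\<close> to \<open>\<beta>'\<close> amounts to keeping the first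
  of two observations, of relative strengths \<open>\<beta>' / \<beta>\<close> and
  \<open>sqrt (1 - (\<beta>' / \<beta>)\<^sup>2)\<close>. The chain rule yields monotonicity and a
  Lipschitz bound in \<open>\<beta>\<^sup>2\<close>.\<close>

lemma scalar_ent_scale:
  assumes p: "1 \<le> p" and "0 < \<beta>'" "\<beta>' \<le> \<beta>"
  shows "scalar_ent \<mu> B p N \<beta>' \<le> scalar_ent \<mu> B p N \<beta>" "scalar_ent \<mu> B p N \<beta> \<le> scalar_ent \<mu> B p N \<beta>' + (\<beta>\<^sup>2 - \<beta>'\<^sup>2) * (real N * B ^ (2 * p))"
proof -
  let ?a = "\<lambda>_::nat \<Rightarrow> nat. \<beta>' / \<beta>" and ?b = "\<lambda>_::nat \<Rightarrow> nat. sqrt (1 - (\<beta>' / \<beta>)\<^sup>2)"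
  have r: "(\<beta>' / \<beta>)\<^sup>2 \<le> 1" using assms by (simp add: power_le_one)
  then have ab: "(?a i)\<^sup>2 + (?b i)\<^sup>2 = 1" for i by simp
  have \<kappa>: "(\<Sum>i\<in>tensor_idx p N. (?b i * scalar_feat B p N \<beta> \<sigma> i)\<^sup>2) \<le> (\<beta>\<^sup>2 - \<beta>'\<^sup>2) * (real N * B ^ (2 * p))" for \<sigma>
  proof -
    have "(\<Sum>i\<in>tensor_idx p N. (?b i * scalar_feat B p N \<beta> \<sigma> i)\<^sup>2) = (1 - (\<beta>' / \<beta>)\<^sup>2) * \<beta>\<^sup>2 * (\<Sum>i\<in>tensor_idx p N. tfeat p N (\<lambda>k. clip B (\<sigma> k)) i * tfeat p N (\<lambda>k. clip B (\<sigma> k)) i)"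
      unfolding scalar_feat_def power_mult_distrib sum_distrib_left using r by (simp add: power2_eq_square[of "tfeat _ _ _ _"] mult.assoc)
    also have "\<dots> = (\<beta>\<^sup>2 - \<beta>'\<^sup>2) * tker p N (\<Sum>k<N. clip B (\<sigma> k) * clip B (\<sigma> k))"
      unfolding tfeat_inner[OF p] using assms by (simp add: power_divide field_simps)
    also have "\<dots> \<le> (\<beta>\<^sup>2 - \<beta>'\<^sup>2) * (real N * (B\<^sup>2) ^ p)"
    proof (rule mult_left_mono)
      have "\<bar>tker p N (\<Sum>k<N. clip B (\<sigma> k) * clip B (\<sigma> k))\<bar> \<le> real N * (B\<^sup>2) ^ p"
        using sum_clip_le[of \<sigma> \<sigma> "{..<N}"] by (intro tker_abs_le) auto
      then show "tker p N (\<Sum>k<N. clip B (\<sigma> k) * clip B (\<sigma> k)) \<le> real N * (B\<^sup>2) ^ p" by linarith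
      show "0 \<le> \<beta>\<^sup>2 - \<beta>'\<^sup>2" using assms by (simp add: power_mono)
    qed
    finally show ?thesis by (simp add: power_mult)
  qed
  have e: "(\<lambda>\<sigma> i. ?a i * scalar_feat B p N \<beta> \<sigma> i) = scalar_feat B p N \<beta>'"
    using assms by (auto simp: scalar_feat_def fun_eq_iff)
  note st = planted_ent_step_bounds[where a="?a" and b="?b", OF bounded_feat_scalar_feat[OF p] ab \<kappa>, unfolded e]
  show "scalar_ent \<mu> B p N \<beta>' \<le> scalar_ent \<mu> B p N \<beta>" "scalar_ent \<mu> B p N \<beta> \<le> scalar_ent \<mu> B p N \<beta>' + (\<beta>\<^sup>2 - \<beta>'\<^sup>2) * (real N * B ^ (2 * p))"
    unfolding scalar_ent_def using st by auto
qed

end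

text \<open>The first component of an index tells the tensor on all sites (0) from those on the two blocks (1 and 2);
  the observations are independent, of signal strength \<open>u\<close> and \<open>w\<close>.\<close>

definition interp_idx :: "nat \<Rightarrow> nat \<Rightarrow> nat \<Rightarrow> (nat \<times> (nat \<Rightarrow> nat)) set" where
  "interp_idx p n m = Pair 0 ` tensor_idx p (n + m) \<union> (Pair 1 ` tensor_idx p n \<union> Pair 2 ` tensor_idx p m)"

definition interp_feat :: "nat \<Rightarrow> nat \<Rightarrow> nat \<Rightarrow> real \<Rightarrow> real \<Rightarrow> real \<Rightarrow> (nat \<Rightarrow> real) \<Rightarrow> nat \<times> (nat \<Rightarrow> nat) \<Rightarrow> real" where
  "interp_feat p n m \<beta> u w s q = (if fst q = 0 then u * (\<beta> * tfeat p (n + m) s (snd q))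
     else if fst q = 1 then w * (\<beta> * tfeat p n s (snd q))
     else w * (\<beta> * tfeat p m (\<lambda>k. s (n + k)) (snd q)))"

section \<open>Interpolation between the whole tensor and two blocks\<close>

lemma finite_interp_idx [simp]: "finite (interp_idx p n m)" by (simp add: interp_idx_def)

lemma sum_interp_idx:
  fixes f :: "nat \<times> (nat \<Rightarrow> nat) \<Rightarrow> real"
  shows "(\<Sum>q\<in>interp_idx p n m. f q) = (\<Sum>i\<in>tensor_idx p (n + m). f (0, i)) + ((\<Sum>i\<in>tensor_idx p n. f (1, i)) + (\<Sum>i\<in>tensor_idx p m. f (2, i)))"
proof -
  have r: "(\<Sum>q\<in>Pair l ` T. f q) = (\<Sum>i\<in>T. f (l, i))" for l T
    by (subst sum.reindex) (auto simp: inj_on_def)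
  show ?thesis unfolding interp_idx_def
    by (subst sum.union_disjoint, simp, simp, force, subst sum.union_disjoint, simp, simp, force) (simp add: r)
qed

definition left_prod :: "nat \<Rightarrow> (nat \<Rightarrow> real) \<Rightarrow> (nat \<Rightarrow> real) \<Rightarrow> real" where
  "left_prod n s s' = (\<Sum>k<n. s k * s' k)"

definition right_prod :: "nat \<Rightarrow> nat \<Rightarrow> (nat \<Rightarrow> real) \<Rightarrow> (nat \<Rightarrow> real) \<Rightarrow> real" where
  "right_prod n m s s' = (\<Sum>k<m. s (n + k) * s' (n + k))"

lemma ovl_add: "(\<Sum>k<n + m. s k * s' k) = left_prod n s s' + right_prod n m s s'"
  unfolding left_prod_def right_prod_def by (induction m) auto

definition interp_ker :: "nat \<Rightarrow> nat \<Rightarrow> nat \<Rightarrow> real \<Rightarrow> real \<Rightarrow> real \<Rightarrow> real \<Rightarrow> real \<Rightarrow> real" where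
  "interp_ker p n m \<beta> u w x y = \<beta>\<^sup>2 * (u\<^sup>2 * tker p (n + m) (x + y) + w\<^sup>2 * (tker p n x + tker p m y))"

lemma interp_feat_inner:
  assumes "1 \<le> p"
  shows "(\<Sum>q\<in>interp_idx p n m. interp_feat p n m \<beta> u w s q * interp_feat p n m \<beta> u w s' q) = interp_ker p n m \<beta> u w (left_prod n s s') (right_prod n m s s')"
proof -
  have e: "(\<Sum>i\<in>T. r * (\<beta> * f i) * (r * (\<beta> * g i))) = \<beta>\<^sup>2 * (r\<^sup>2 * (\<Sum>i\<in>T. f i * g i))" for r T and f g :: "(nat \<Rightarrow> nat) \<Rightarrow> real"
    unfolding sum_distrib_left by (intro sum.cong refl) (simp add: power2_eq_square)
  show ?thesis
    unfolding sum_interp_idx interp_feat_def interp_ker_def using assms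
    by (simp add: e tfeat_inner ovl_add) (simp add: left_prod_def right_prod_def distrib_left)
qed

lemma interp_feat_scale: "(if fst q = 0 then a0 else a1) * interp_feat p n m \<beta> u w s q = interp_feat p n m \<beta> (a0 * u) (a1 * w) s q"
  by (simp add: interp_feat_def)

lemma interp_feat_abs_le:
  assumes "1 \<le> p" "\<And>k. \<bar>s k\<bar> \<le> B" "\<bar>u\<bar> \<le> 1" "\<bar>w\<bar> \<le> 1"
  shows "\<bar>interp_feat p n m \<beta> u w s q\<bar> \<le> \<bar>\<beta>\<bar> * B ^ p"
proof -
  have "\<bar>r * (\<beta> * x)\<bar> \<le> \<bar>\<beta>\<bar> * B ^ p" if "\<bar>r\<bar> \<le> 1" "\<bar>x\<bar> \<le> B ^ p" for r x
  proof -
    have "\<bar>r\<bar> * (\<bar>\<beta>\<bar> * \<bar>x\<bar>) \<le> 1 * (\<bar>\<beta>\<bar> * B ^ p)" using that by (intro mult_mono mult_nonneg_nonneg) auto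
    then show ?thesis by (simp add: abs_mult)
  qed
  then show ?thesis unfolding interp_feat_def using tfeat_abs_le'[OF _ assms(1)] assms(2-4) by auto
qed

lemma tker_mono:
  assumes "odd p" "x \<le> y" shows "tker p N x \<le> tker p N y"
  unfolding tker_def using assms by (intro mult_left_mono power_mono_odd divide_right_mono) auto

context
  fixes \<mu> :: "real measure" and B :: real and p n m :: nat and \<beta> :: real
  assumes \<mu>: "prob_space \<mu>" and s\<mu>: "sets \<mu> = sets borel" and B: "1 \<le> B" and centered: "(\<integral>x. clip B x \<partial>\<mu>) = 0"
    and p: "3 \<le> p" and n: "0 < n" and m: "0 < m" and \<beta>: "0 < \<beta>"
begin

abbreviation (input) "MM \<equiv> PiM {..<n + m} (\<lambda>_. \<mu>)"
abbreviation (input) "cl \<equiv> \<lambda>\<sigma> k. clip B (\<sigma> k)"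
text \<open>Spins at sites where \<open>Q\<close> fails are set to 0; this gives the reduced
  features, in which one block is silenced.\<close>

abbreviation (input) "zcl \<equiv> \<lambda>Q \<sigma> k. if Q k then clip B (\<sigma> k) else 0"
abbreviation (input) "FF \<equiv> interp_feat p n m \<beta>"
abbreviation (input) "II \<equiv> interp_idx p n m"
abbreviation (input) "c0 \<equiv> \<bar>\<beta>\<bar> * B ^ p"

lemma p1: "1 \<le> p" using p by simp

lemma bounded_feat_zfeat:
  assumes "\<bar>u\<bar> \<le> 1" "\<bar>w\<bar> \<le> 1"
  shows "bounded_feat II MM c0 (\<lambda>\<sigma>. FF u w (zcl Q \<sigma>))"
  unfolding bounded_feat_def
proof (intro conjI ballI allI)
  show "\<bar>FF u w (zcl Q \<sigma>) q\<bar> \<le> c0" for \<sigma> q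
    by (intro interp_feat_abs_le p1 assms) (use abs_clip_le[of B] B in auto)
  fix q assume q: "q \<in> II"
  note t = tfeat_clip_measurable[OF \<mu> s\<mu> B centered]
  consider i where "q = (0, i)" "i \<in> tensor_idx p (n + m)" | i where "q = (1, i)" "i \<in> tensor_idx p n"
    | i where "q = (2, i)" "i \<in> tensor_idx p m" using q by (auto simp: interp_idx_def)
  then show "(\<lambda>\<sigma>. FF u w (zcl Q \<sigma>) q) \<in> borel_measurable MM"
  proof cases
    case 1 then show ?thesis using t[of i p "n + m" "\<lambda>k. k" "{..<n + m}" Q] by (simp add: interp_feat_def)
  next
    case 2 then show ?thesis using t[of i p n "\<lambda>k. k" "{..<n + m}" Q] by (simp add: interp_feat_def)
  next
    case 3 then show ?thesis using t[of i p m "\<lambda>k. n + k" "{..<n + m}" "\<lambda>k. Q (n + k)"] by (simp add: interp_feat_def)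
  qed
qed (use B prob_space_PiM_mu[OF \<mu> s\<mu> B centered] in auto)

lemma bounded_feat_interp_feat: "\<bar>u\<bar> \<le> 1 \<Longrightarrow> \<bar>w\<bar> \<le> 1 \<Longrightarrow> bounded_feat II MM c0 (\<lambda>\<sigma>. FF u w (cl \<sigma>))"
  using bounded_feat_zfeat[of u w "\<lambda>_. True"] by simp

lemma ovl_bounds: "\<bar>left_prod n (cl \<sigma>) (cl \<tau>)\<bar> \<le> real n * B\<^sup>2" "\<bar>right_prod n m (cl \<sigma>) (cl \<tau>)\<bar> \<le> real m * B\<^sup>2"
  unfolding left_prod_def right_prod_def using B
  by (auto intro!: order_trans[OF sum_sq_le[where B=B]] abs_clip_le)

lemma interp_ker_le:
  assumes "\<bar>x\<bar> \<le> real n * B\<^sup>2" "\<bar>y\<bar> \<le> real m * B\<^sup>2"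
  shows "interp_ker p n m \<beta> u w x y \<le> \<beta>\<^sup>2 * ((u\<^sup>2 + w\<^sup>2) * (real (n + m) * B ^ (2 * p)))"
proof -
  have "\<bar>tker p (n + m) (x + y)\<bar> \<le> real (n + m) * (B\<^sup>2) ^ p"
    using assms by (intro tker_abs_le) (auto simp: distrib_right intro: order_trans[OF abs_triangle_ineq])
  then have 1: "tker p (n + m) (x + y) \<le> real (n + m) * B ^ (2 * p)" by (simp add: power_mult)
  have "\<bar>tker p n x\<bar> \<le> real n * (B\<^sup>2) ^ p" "\<bar>tker p m y\<bar> \<le> real m * (B\<^sup>2) ^ p"
    using assms by (auto intro!: tker_abs_le)
  then have 2: "tker p n x + tker p m y \<le> real (n + m) * B ^ (2 * p)" by (simp add: power_mult distrib_right)
  have "u\<^sup>2 * tker p (n + m) (x + y) + w\<^sup>2 * (tker p n x + tker p m y) \<le> u\<^sup>2 * (real (n + m) * B ^ (2 * p)) + w\<^sup>2 * (real (n + m) * B ^ (2 * p))"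
    by (intro add_mono mult_left_mono 1 2) auto
  then show ?thesis unfolding interp_ker_def distrib_right by (intro mult_left_mono) auto
qed

definition interp_ent :: "real \<Rightarrow> real \<Rightarrow> real" where
  "interp_ent u w = planted_ent II MM (\<lambda>\<sigma>. FF u w (cl \<sigma>))"

definition interp_pair :: "real \<Rightarrow> real \<Rightarrow> ((nat \<Rightarrow> real) \<Rightarrow> (nat \<Rightarrow> real) \<Rightarrow> real) \<Rightarrow> real" where
  "interp_pair u w h = planted_pair II MM (\<lambda>\<sigma>. FF u w (cl \<sigma>)) h"

definition interp_cov :: "real \<Rightarrow> real \<Rightarrow> (nat \<Rightarrow> real) \<Rightarrow> (nat \<Rightarrow> real) \<Rightarrow> real" where
  "interp_cov u w \<sigma> \<tau> = interp_ker p n m \<beta> u w (left_prod n (cl \<sigma>) (cl \<tau>)) (right_prod n m (cl \<sigma>) (cl \<tau>))"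

text \<open>The two kinds of observation are weakened separately, by \<open>a0\<close> and
  \<open>a1\<close>; \<open>\<kappa>\<close> bounds the squared norm of the signal that is split
  off.\<close>

lemma interp_ent_step:
  assumes uw: "\<bar>u\<bar> \<le> 1" "\<bar>w\<bar> \<le> 1" and ab: "a0\<^sup>2 + b0\<^sup>2 = 1" "a1\<^sup>2 + b1\<^sup>2 = 1"
    and \<kappa>: "\<beta>\<^sup>2 * (((b0 * u)\<^sup>2 + (b1 * w)\<^sup>2) * (real (n + m) * B ^ (2 * p))) = \<kappa>" "0 < \<kappa>" "\<kappa> \<le> 1 / 6"
  shows "\<bar>interp_ent u w - interp_ent (a0 * u) (a1 * w) - interp_pair (a0 * u) (a1 * w) (interp_cov (b0 * u) (b1 * w)) / 2\<bar> \<le> 400 * \<kappa> * sqrt \<kappa>"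
    and "bounded_ker MM \<kappa> (interp_cov (b0 * u) (b1 * w))"
proof -
  let ?a = "\<lambda>q::nat \<times> (nat \<Rightarrow> nat). if fst q = 0 then a0 else a1" and ?b = "\<lambda>q::nat \<times> (nat \<Rightarrow> nat). if fst q = 0 then b0 else b1"
  have ab': "(?a q)\<^sup>2 + (?b q)\<^sup>2 = 1" for q using ab by simp
  have k: "(\<Sum>q\<in>II. (?b q * FF u w (cl \<sigma>) q)\<^sup>2) \<le> \<kappa>" for \<sigma>
  proof -
    have "(\<Sum>q\<in>II. (?b q * FF u w (cl \<sigma>) q)\<^sup>2) = interp_ker p n m \<beta> (b0 * u) (b1 * w) (left_prod n (cl \<sigma>) (cl \<sigma>)) (right_prod n m (cl \<sigma>) (cl \<sigma>))"
      unfolding interp_feat_scale power2_eq_square by (rule interp_feat_inner[OF p1])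
    also have "\<dots> \<le> \<kappa>" using interp_ker_le[OF ovl_bounds(1)[of \<sigma> \<sigma>] ovl_bounds(2)[of \<sigma> \<sigma>], of "b0 * u" "b1 * w"] unfolding \<kappa>(1) .
    finally show ?thesis .
  qed
  have K: "(\<lambda>\<sigma> \<tau>. \<Sum>q\<in>II. FF (b0 * u) (b1 * w) (cl \<sigma>) q * FF (b0 * u) (b1 * w) (cl \<tau>) q) = interp_cov (b0 * u) (b1 * w)"
    unfolding interp_feat_inner[OF p1] interp_cov_def ..
  show "\<bar>interp_ent u w - interp_ent (a0 * u) (a1 * w) - interp_pair (a0 * u) (a1 * w) (interp_cov (b0 * u) (b1 * w)) / 2\<bar> \<le> 400 * \<kappa> * sqrt \<kappa>"
    using planted_ent_step[where a="?a" and b="?b", OF bounded_feat_interp_feat[OF uw] ab' k \<kappa>(2,3)]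
    unfolding interp_feat_scale K interp_ent_def interp_pair_def .
  show "bounded_ker MM \<kappa> (interp_cov (b0 * u) (b1 * w))"
    using bounded_ker_gb[where a="?a" and b="?b", OF bounded_feat_interp_feat[OF uw] ab' k]
    unfolding interp_feat_scale K .
qed

lemma cl_measurable2: "k < n + m \<Longrightarrow> (\<lambda>q. clip B (fst q k)) \<in> borel_measurable (MM \<Otimes>\<^sub>M MM)"
  "k < n + m \<Longrightarrow> (\<lambda>q. clip B (snd q k)) \<in> borel_measurable (MM \<Otimes>\<^sub>M MM)"
  using measurable_compose[OF measurable_fst clip_coord_measurable[OF \<mu> s\<mu> B centered, of k "{..<n + m}"]]
    measurable_compose[OF measurable_snd clip_coord_measurable[OF \<mu> s\<mu> B centered, of k "{..<n + m}"]] by auto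

lemma neg_square_measurable: "f \<in> borel_measurable Q \<Longrightarrow> (\<lambda>z. neg_square r N (f z)) \<in> borel_measurable Q"
  unfolding neg_square_def by (cases "odd r") auto

lemma neg_square_bounds:
  assumes "\<bar>x\<bar> \<le> real N * B\<^sup>2" "0 < N"
  shows "0 \<le> neg_square r N x" "\<bar>neg_square r N x\<bar> \<le> real N * B ^ 4" "(neg_square r N x)\<^sup>2 \<le> x ^ 4 / (real N)\<^sup>2"
proof -
  show 0: "0 \<le> neg_square r N x" by (simp add: neg_square_def)
  have "x\<^sup>2 \<le> (real N * B\<^sup>2)\<^sup>2" using assms(1) by (metis abs_ge_zero power2_abs power_mono)
  also have "\<dots> = real N * (real N * B ^ 4)" by (simp add: power2_eq_square power4_eq_xxxx)
  finally have "x\<^sup>2 / real N \<le> real N * B ^ 4" using assms(2) by (simp add: divide_le_eq mult.commute)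
  then show "\<bar>neg_square r N x\<bar> \<le> real N * B ^ 4" using 0 by (auto simp: neg_square_def)
  show "(neg_square r N x)\<^sup>2 \<le> x ^ 4 / (real N)\<^sup>2" by (auto simp: neg_square_def power_divide power_mult[symmetric])
qed

lemma bounded_ker_neg_square:
  "bounded_ker MM (real n * B ^ 4) (\<lambda>\<sigma> \<tau>. neg_square p n (left_prod n (cl \<sigma>) (cl \<tau>)))"
  "bounded_ker MM (real m * B ^ 4) (\<lambda>\<sigma> \<tau>. neg_square p m (right_prod n m (cl \<sigma>) (cl \<tau>)))"
  unfolding bounded_ker_def
  using neg_square_bounds(2)[OF ovl_bounds(1) n] neg_square_bounds(2)[OF ovl_bounds(2) m]
  by (auto intro!: neg_square_measurable borel_measurable_sum borel_measurable_times cl_measurable2 simp: left_prod_def right_prod_def)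

text \<open>An instance of \<open>planted_pair_le_prior\<close> with the block in question silenced.
  The constant depends on none of \<open>u\<close>, \<open>w\<close>, \<open>n\<close> and
  \<open>m\<close>, so the bound holds along the whole interpolation path.\<close>

lemma interp_pair_neg_square_le:
  assumes uw: "\<bar>u\<bar> \<le> 1" "\<bar>w\<bar> \<le> 1"
  shows "2 * interp_pair u w (\<lambda>\<sigma> \<tau>. neg_square p n (left_prod n (cl \<sigma>) (cl \<tau>))) \<le> 1 + 128 * exp (B ^ 4 / 2)"
    "2 * interp_pair u w (\<lambda>\<sigma> \<tau>. neg_square p m (right_prod n m (cl \<sigma>) (cl \<tau>))) \<le> 1 + 128 * exp (B ^ 4 / 2)"
proof -
  interpret M: prob_space MM by (rule prob_space_PiM_mu[OF \<mu> s\<mu> B centered])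
  let ?C = "128 * exp (B ^ 4 / 2)"
  let ?sp = "\<lambda>A. \<lambda>(x, y). \<lambda>k\<in>{..<n + m}. if k \<in> A then x k else (y k :: real)"
  have sp: "coupling MM (?sp A)" for A by (rule coupling_PiM_splice) (auto simp: \<mu>)
  have ent: "FF u w s q = FF u w s' q" if "q \<in> II" "\<And>k. k < n + m \<Longrightarrow> s k = s' k" for s s' q
  proof -
    have "(\<Prod>j<p. s (i j)) = (\<Prod>j<p. s' (i j))" if i: "i \<in> tensor_idx p N" "N \<le> n + m" for i N
      using \<open>\<And>k. k < n + m \<Longrightarrow> s k = s' k\<close> tensor_idx_less[OF i(1)] i(2) by (intro prod.cong refl) (meson less_le_trans lessThan_iff)
    moreover have "(\<Prod>j<p. s (n + i j)) = (\<Prod>j<p. s' (n + i j))" if i: "i \<in> tensor_idx p m" for i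
      using \<open>\<And>k. k < n + m \<Longrightarrow> s k = s' k\<close> tensor_idx_less[OF i(1)] by (intro prod.cong refl) auto
    ultimately show ?thesis using \<open>q \<in> II\<close> by (auto simp: interp_feat_def tfeat_def interp_idx_def)
  qed
  \<comment> \<open>The prior mean of the squared kernel is at most a fourth moment of an overlap
    divided by the squared block size.\<close>
  have second: "(\<integral>\<sigma>. \<integral>\<tau>. (h \<sigma> \<tau>)\<^sup>2 \<partial>MM \<partial>MM) \<le> ?C"
    if K: "K \<subseteq> {..<n + m}" "card K \<le> N" "0 < N" and h: "bounded_ker MM D h"
      and hb: "\<And>\<sigma> \<tau>. (h \<sigma> \<tau>)\<^sup>2 \<le> (\<Sum>k\<in>K. clip B (\<tau> k) * clip B (\<sigma> k)) ^ 4 / (real N)\<^sup>2" for K N D h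
  proof -
    have b: "(\<Sum>k\<in>K. clip B (\<tau> k) * clip B (\<sigma> k)) ^ 4 / (real N)\<^sup>2 \<le> (real (card K) * B\<^sup>2) ^ 4 / (real N)\<^sup>2" for \<sigma> \<tau>
    proof -
      have "\<bar>\<Sum>k\<in>K. clip B (\<tau> k) * clip B (\<sigma> k)\<bar> ^ 4 \<le> (real (card K) * B\<^sup>2) ^ 4"
        using B by (intro power_mono sum_sq_le abs_clip_le) auto
      then show ?thesis by (intro divide_right_mono) (auto simp: power_even_abs)
    qed
    have "\<bar>\<integral>\<tau>. (h \<sigma> \<tau>)\<^sup>2 \<partial>MM\<bar> \<le> ?C" for \<sigma>
    proof -
      have "(\<integral>\<tau>. (h \<sigma> \<tau>)\<^sup>2 \<partial>MM) \<le> (\<integral>\<tau>. (\<Sum>k\<in>K. clip B (\<tau> k) * clip B (\<sigma> k)) ^ 4 / (real N)\<^sup>2 \<partial>MM)"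
      proof (rule integral_mono_AE')
        have mm: "(\<lambda>\<tau>. \<Sum>k\<in>K. clip B (\<tau> k) * clip B (\<sigma> k)) \<in> borel_measurable MM"
          by (intro borel_measurable_sum borel_measurable_times borel_measurable_const clip_coord_measurable[OF \<mu> s\<mu> B centered]) (use K in auto)
        show "integrable MM (\<lambda>\<tau>. (\<Sum>k\<in>K. clip B (\<tau> k) * clip B (\<sigma> k)) ^ 4 / (real N)\<^sup>2)"
          using mm by (intro M.integrable_const_bound[where B="(real (card K) * B\<^sup>2) ^ 4 / (real N)\<^sup>2"]) (auto intro!: AE_I2 b)
      qed (use hb in auto)
      also have "\<dots> \<le> ?C"
        by (rule moment_le(2)[OF \<mu> s\<mu> B centered _ K(1) _ K(2,3)]) (use abs_clip_le[of B] B in auto)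
      finally show ?thesis by (simp add: integral_nonneg_AE abs_of_nonneg)
    qed
    then have "\<bar>\<integral>\<sigma>. \<integral>\<tau>. (h \<sigma> \<tau>)\<^sup>2 \<partial>MM \<partial>MM\<bar> \<le> ?C" by (rule M.abs_integral_le)
    then show ?thesis by linarith
  qed
  have z1: "left_prod n s (zcl (\<lambda>k. \<not> k < n) \<tau>) = 0" "left_prod n (zcl (\<lambda>k. \<not> k < n) \<tau>) s = 0"
      "right_prod n m s (zcl (\<lambda>k. \<not> k < n) \<tau>) = right_prod n m s (cl \<tau>)" "right_prod n m (zcl (\<lambda>k. \<not> k < n) \<tau>) s = right_prod n m (cl \<tau>) s" for s \<tau>
    by (auto simp: left_prod_def right_prod_def)
  have z2: "left_prod n s (zcl (\<lambda>k. k < n) \<tau>) = left_prod n s (cl \<tau>)" "left_prod n (zcl (\<lambda>k. k < n) \<tau>) s = left_prod n (cl \<tau>) s"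
      "right_prod n m s (zcl (\<lambda>k. k < n) \<tau>) = 0" "right_prod n m (zcl (\<lambda>k. k < n) \<tau>) s = 0" for s \<tau>
    by (auto simp: left_prod_def right_prod_def)
  have t0: "tker p N 0 = 0" for N using p by (simp add: tker_def)
  have "2 * interp_pair u w (\<lambda>\<sigma> \<tau>. neg_square p n (left_prod n (cl \<sigma>) (cl \<tau>))) \<le> 1 + (\<integral>\<sigma>. \<integral>\<tau>. (neg_square p n (left_prod n (cl \<sigma>) (cl \<tau>)))\<^sup>2 \<partial>MM \<partial>MM)"
    unfolding interp_pair_def
  proof (rule planted_pair_le_prior[OF bounded_feat_interp_feat[OF uw] bounded_feat_zfeat[OF uw, of "\<lambda>k. \<not> k < n"] sp[of "{..<n}"] _ bounded_ker_neg_square(1)])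
    show "(\<Sum>q\<in>II. FF u w (cl \<sigma>) q * FF u w (zcl (\<lambda>k. \<not> k < n) \<tau>) q) = (\<Sum>q\<in>II. FF u w (zcl (\<lambda>k. \<not> k < n) \<sigma>) q * FF u w (zcl (\<lambda>k. \<not> k < n) \<tau>) q)" for \<sigma> \<tau>
      unfolding interp_feat_inner[OF p1] z1 ..
    show "0 \<le> neg_square p n (left_prod n (cl \<sigma>) (cl \<tau>))" for \<sigma> \<tau> by (rule neg_square_bounds(1)[OF ovl_bounds(1) n])
    fix \<sigma> \<tau> assume "neg_square p n (left_prod n (cl \<sigma>) (cl \<tau>)) \<noteq> 0"
    then have o: "odd p" "left_prod n (cl \<sigma>) (cl \<tau>) \<le> 0" by (auto simp: neg_square_def split: if_splits)
    \<comment> \<open>For odd \<open>p\<close> the kernel is increasing, so setting a nonpositive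
      left overlap to 0 can only raise the covariance.\<close>
    show "(\<Sum>q\<in>II. FF u w (cl \<sigma>) q * FF u w (cl \<tau>) q) \<le> (\<Sum>q\<in>II. FF u w (zcl (\<lambda>k. \<not> k < n) \<sigma>) q * FF u w (zcl (\<lambda>k. \<not> k < n) \<tau>) q)"
      unfolding interp_feat_inner[OF p1] z1 interp_ker_def using o by (intro mult_left_mono add_mono tker_mono) auto
  next
    fix \<sigma> \<tau> :: "nat \<Rightarrow> real" and q assume "q \<in> II"
    then show "FF u w (zcl (\<lambda>k. \<not> k < n) (?sp {..<n} (\<sigma>, \<tau>))) q = FF u w (zcl (\<lambda>k. \<not> k < n) \<tau>) q"
      by (rule ent) auto
  qed (auto simp: left_prod_def intro!: arg_cong[where f="neg_square p n"] sum.cong)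
  also have "\<dots> \<le> 1 + ?C"
  proof (intro add_left_mono second[OF _ _ n bounded_ker_neg_square(1), of "{..<n}"])
    show "(neg_square p n (left_prod n (cl \<sigma>) (cl \<tau>)))\<^sup>2 \<le> (\<Sum>k<n. clip B (\<tau> k) * clip B (\<sigma> k)) ^ 4 / (real n)\<^sup>2" for \<sigma> \<tau>
      using neg_square_bounds(3)[OF ovl_bounds(1) n, of p \<sigma> \<tau>] by (simp add: left_prod_def mult.commute)
  qed auto
  finally show "2 * interp_pair u w (\<lambda>\<sigma> \<tau>. neg_square p n (left_prod n (cl \<sigma>) (cl \<tau>))) \<le> 1 + ?C" .
  have "2 * interp_pair u w (\<lambda>\<sigma> \<tau>. neg_square p m (right_prod n m (cl \<sigma>) (cl \<tau>))) \<le> 1 + (\<integral>\<sigma>. \<integral>\<tau>. (neg_square p m (right_prod n m (cl \<sigma>) (cl \<tau>)))\<^sup>2 \<partial>MM \<partial>MM)"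
    unfolding interp_pair_def
  proof (rule planted_pair_le_prior[OF bounded_feat_interp_feat[OF uw] bounded_feat_zfeat[OF uw, of "\<lambda>k. k < n"] sp[of "{n..}"] _ bounded_ker_neg_square(2)])
    show "(\<Sum>q\<in>II. FF u w (cl \<sigma>) q * FF u w (zcl (\<lambda>k. k < n) \<tau>) q) = (\<Sum>q\<in>II. FF u w (zcl (\<lambda>k. k < n) \<sigma>) q * FF u w (zcl (\<lambda>k. k < n) \<tau>) q)" for \<sigma> \<tau>
      unfolding interp_feat_inner[OF p1] z2 ..
    show "0 \<le> neg_square p m (right_prod n m (cl \<sigma>) (cl \<tau>))" for \<sigma> \<tau> by (rule neg_square_bounds(1)[OF ovl_bounds(2) m])
    fix \<sigma> \<tau> assume "neg_square p m (right_prod n m (cl \<sigma>) (cl \<tau>)) \<noteq> 0"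
    then have o: "odd p" "right_prod n m (cl \<sigma>) (cl \<tau>) \<le> 0" by (auto simp: neg_square_def split: if_splits)
    show "(\<Sum>q\<in>II. FF u w (cl \<sigma>) q * FF u w (cl \<tau>) q) \<le> (\<Sum>q\<in>II. FF u w (zcl (\<lambda>k. k < n) \<sigma>) q * FF u w (zcl (\<lambda>k. k < n) \<tau>) q)"
      unfolding interp_feat_inner[OF p1] z2 interp_ker_def using o by (intro mult_left_mono add_mono tker_mono) auto
  next
    fix \<sigma> \<tau> :: "nat \<Rightarrow> real" and q assume "q \<in> II"
    then show "FF u w (zcl (\<lambda>k. k < n) (?sp {n..} (\<sigma>, \<tau>))) q = FF u w (zcl (\<lambda>k. k < n) \<tau>) q"
      by (rule ent) auto
  qed (auto simp: right_prod_def intro!: arg_cong[where f="neg_square p m"] sum.cong)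
  also have "\<dots> \<le> 1 + ?C"
  proof (intro add_left_mono second[OF _ _ m bounded_ker_neg_square(2), of "{n..<n + m}"])
    have r: "(\<Sum>k\<in>{n..<n + m}. f k) = (\<Sum>k<m. f (n + k))" for f :: "nat \<Rightarrow> real"
      using sum.shift_bounds_nat_ivl[of f 0 n m] by (simp add: add.commute lessThan_atLeast0)
    show "(neg_square p m (right_prod n m (cl \<sigma>) (cl \<tau>)))\<^sup>2 \<le> (\<Sum>k\<in>{n..<n + m}. clip B (\<tau> k) * clip B (\<sigma> k)) ^ 4 / (real m)\<^sup>2" for \<sigma> \<tau>
      unfolding r using neg_square_bounds(3)[OF ovl_bounds(2) m, of p \<sigma> \<tau>] by (simp add: right_prod_def mult.commute)
  qed auto
  finally show "2 * interp_pair u w (\<lambda>\<sigma> \<tau>. neg_square p m (right_prod n m (cl \<sigma>) (cl \<tau>))) \<le> 1 + ?C" .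
qed

text \<open>Moving squared strength \<open>e\<^sup>2\<close> from the blocks to the whole tensor
  raises the mean covariance by at most a constant times \<open>e\<^sup>2\<close>:
  \<open>tker_add_le\<close> holds pointwise, and the preceding bound controls the averages of both
  negative parts.\<close>

lemma interp_pair_diff_le:
  assumes uw: "\<bar>u\<bar> \<le> 1" "\<bar>w\<bar> \<le> 1" and K: "bounded_ker MM D (interp_cov e 0)" "bounded_ker MM D' (interp_cov 0 e)"
  shows "interp_pair u w (interp_cov e 0) - interp_pair u w (interp_cov 0 e) \<le> \<beta>\<^sup>2 * e\<^sup>2 * (B\<^sup>2) ^ (p - 2) * (1 + 128 * exp (B ^ 4 / 2))"
proof -
  let ?h1 = "\<lambda>\<sigma> \<tau>. neg_square p n (left_prod n (cl \<sigma>) (cl \<tau>))" and ?h2 = "\<lambda>\<sigma> \<tau>. neg_square p m (right_prod n m (cl \<sigma>) (cl \<tau>))"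
  let ?r = "\<beta>\<^sup>2 * e\<^sup>2 * (B\<^sup>2) ^ (p - 2)"
  note bf = bounded_feat_interp_feat[OF uw]
  have h12: "bounded_ker MM (real n * B ^ 4 + real m * B ^ 4) (\<lambda>\<sigma> \<tau>. 1 * ?h1 \<sigma> \<tau> + 1 * ?h2 \<sigma> \<tau>)"
    unfolding bounded_ker_def
  proof (intro conjI allI)
    show "(\<lambda>q. 1 * ?h1 (fst q) (snd q) + 1 * ?h2 (fst q) (snd q)) \<in> borel_measurable (MM \<Otimes>\<^sub>M MM)"
      using bounded_kerD(1)[OF bounded_ker_neg_square(1)] bounded_kerD(1)[OF bounded_ker_neg_square(2)] by simp
    show "\<bar>1 * ?h1 \<sigma> \<tau> + 1 * ?h2 \<sigma> \<tau>\<bar> \<le> real n * B ^ 4 + real m * B ^ 4" for \<sigma> \<tau>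
      using bounded_kerD(2)[OF bounded_ker_neg_square(1), of \<sigma> \<tau>] bounded_kerD(2)[OF bounded_ker_neg_square(2), of \<sigma> \<tau>] by linarith
  qed
  have rhs: "bounded_ker MM (D' + ?r * (real n * B ^ 4 + real m * B ^ 4)) (\<lambda>\<sigma> \<tau>. 1 * interp_cov 0 e \<sigma> \<tau> + ?r * (1 * ?h1 \<sigma> \<tau> + 1 * ?h2 \<sigma> \<tau>))"
    unfolding bounded_ker_def
  proof (intro conjI allI)
    show "(\<lambda>q. 1 * interp_cov 0 e (fst q) (snd q) + ?r * (1 * ?h1 (fst q) (snd q) + 1 * ?h2 (fst q) (snd q))) \<in> borel_measurable (MM \<Otimes>\<^sub>M MM)"
      by (rule borel_measurable_add[OF borel_measurable_times[OF borel_measurable_const bounded_kerD(1)[OF K(2)]] borel_measurable_times[OF borel_measurable_const bounded_kerD(1)[OF h12]]])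
    fix \<sigma> \<tau>
    have "\<bar>?r * (1 * ?h1 \<sigma> \<tau> + 1 * ?h2 \<sigma> \<tau>)\<bar> \<le> ?r * (real n * B ^ 4 + real m * B ^ 4)"
      unfolding abs_mult[of ?r] using bounded_kerD(2)[OF h12, of \<sigma> \<tau>] B by (intro mult_mono) auto
    then show "\<bar>1 * interp_cov 0 e \<sigma> \<tau> + ?r * (1 * ?h1 \<sigma> \<tau> + 1 * ?h2 \<sigma> \<tau>)\<bar> \<le> D' + ?r * (real n * B ^ 4 + real m * B ^ 4)"
      using bounded_kerD(2)[OF K(2), of \<sigma> \<tau>] by linarith
  qed
  have "interp_pair u w (interp_cov e 0) \<le> interp_pair u w (\<lambda>\<sigma> \<tau>. 1 * interp_cov 0 e \<sigma> \<tau> + ?r * (1 * ?h1 \<sigma> \<tau> + 1 * ?h2 \<sigma> \<tau>))"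
    unfolding interp_pair_def
  proof (rule planted_pair_mono[OF bf K(1) rhs])
    fix \<sigma> \<tau>
    let ?x = "left_prod n (cl \<sigma>) (cl \<tau>)" and ?y = "right_prod n m (cl \<sigma>) (cl \<tau>)"
    have "tker p (n + m) (?x + ?y) \<le> tker p n ?x + tker p m ?y + (B\<^sup>2) ^ (p - 2) * (?h1 \<sigma> \<tau> + ?h2 \<sigma> \<tau>)"
      by (rule tker_add_le[OF p n m ovl_bounds]) simp
    then have "\<beta>\<^sup>2 * e\<^sup>2 * tker p (n + m) (?x + ?y) \<le> \<beta>\<^sup>2 * e\<^sup>2 * (tker p n ?x + tker p m ?y + (B\<^sup>2) ^ (p - 2) * (?h1 \<sigma> \<tau> + ?h2 \<sigma> \<tau>))"
      by (intro mult_left_mono) auto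
    then show "interp_cov e 0 \<sigma> \<tau> \<le> 1 * interp_cov 0 e \<sigma> \<tau> + ?r * (1 * ?h1 \<sigma> \<tau> + 1 * ?h2 \<sigma> \<tau>)"
      by (simp add: interp_cov_def interp_ker_def algebra_simps)
  qed
  also have "\<dots> = interp_pair u w (interp_cov 0 e) + ?r * (interp_pair u w ?h1 + interp_pair u w ?h2)"
    unfolding interp_pair_def planted_pair_lin[OF bf K(2) h12] planted_pair_lin[OF bf bounded_ker_neg_square] by simp
  also have "\<dots> \<le> interp_pair u w (interp_cov 0 e) + ?r * (1 + 128 * exp (B ^ 4 / 2))"
    using interp_pair_neg_square_le[OF uw] B by (intro add_left_mono mult_left_mono) auto
  finally show ?thesis by simp
qed

text \<open>Along the path the squared strengths are \<open>j / N\<close> and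
  \<open>1 - j / N\<close>, where \<open>N\<close> counts steps and not sites. Each step costs
  \<open>C / (2 * N)\<close> and an expansion error of order \<open>N powr (- 3/2)\<close>, so
  letting \<open>N\<close> grow leaves \<open>C / 2\<close>.\<close>

lemma interp_ent_interpolation: "interp_ent 1 0 \<le> interp_ent 0 1 + \<beta>\<^sup>2 * (B\<^sup>2) ^ (p - 2) * (1 + 128 * exp (B ^ 4 / 2)) / 2"
proof -
  \<comment> \<open>\<open>D\<close> bounds the squared norm of the signal at full strength; a
    single step splits off the fraction \<open>1 / N\<close> of it.\<close>
  define D where "D = \<beta>\<^sup>2 * (real (n + m) * B ^ (2 * p))"
  define C where "C = \<beta>\<^sup>2 * (B\<^sup>2) ^ (p - 2) * (1 + 128 * exp (B ^ 4 / 2))"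
  have D: "0 < D" using \<beta> B n by (simp add: D_def)
  have main: "interp_ent 1 0 \<le> interp_ent 0 1 + C / 2 + 800 * D * sqrt D / sqrt (real N)" if N: "0 < N" "6 * D \<le> real N" for N :: nat
  proof -
    define \<kappa> where "\<kappa> = D / real N"
    have \<kappa>: "0 < \<kappa>" "\<kappa> \<le> 1 / 6" using D N by (auto simp: \<kappa>_def divide_le_eq)
    define a where "a j = interp_ent (sqrt (real j / N)) (sqrt (real (N - j) / N))" for j
    have st: "a (Suc j) - a j \<le> C / N / 2 + 800 * \<kappa> * sqrt \<kappa>" if j: "j < N" for j
    proof -
      \<comment> \<open>Neighbouring points of the path are not ordered, so both are compared with
        the corner \<open>(?u, ?w')\<close> below them, from which each differs by squared strength
        \<open>1 / N\<close> in one component.\<close>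
      let ?u = "sqrt (real j / N)" and ?u' = "sqrt (real (Suc j) / N)"
      let ?w = "sqrt (real (N - j) / N)" and ?w' = "sqrt (real (N - Suc j) / N)" and ?e = "sqrt (1 / real N)"
      have jr: "real (N - j) = real N - real j" "real (N - Suc j) = real N - real j - 1" using j by auto
      have b: "\<bar>?u\<bar> \<le> 1" "\<bar>?u'\<bar> \<le> 1" "\<bar>?w\<bar> \<le> 1" "\<bar>?w'\<bar> \<le> 1" using j N by (auto simp: divide_le_eq)
      have e2: "\<beta>\<^sup>2 * ((?e\<^sup>2 + 0\<^sup>2) * (real (n + m) * B ^ (2 * p))) = \<kappa>" "\<beta>\<^sup>2 * ((0\<^sup>2 + ?e\<^sup>2) * (real (n + m) * B ^ (2 * p))) = \<kappa>"
        using N by (simp_all add: \<kappa>_def D_def)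
      have e3: "sqrt (1 / real (Suc j)) * ?u' = ?e" "sqrt (real j / real (Suc j)) * ?u' = ?u"
        by (simp_all add: real_sqrt_mult[symmetric] del: of_nat_Suc)
      have e4: "sqrt (1 / real (N - j)) * ?w = ?e" "sqrt (real (N - Suc j) / real (N - j)) * ?w = ?w'"
        using j by (simp_all add: real_sqrt_mult[symmetric] del: of_nat_diff)
      have q1: "(sqrt (real j / real (Suc j)))\<^sup>2 + (sqrt (1 / real (Suc j)))\<^sup>2 = 1" "1\<^sup>2 + 0\<^sup>2 = (1::real)"
        by (simp_all add: add_divide_distrib[symmetric])
      have q2: "\<beta>\<^sup>2 * (((sqrt (1 / real (Suc j)) * ?u')\<^sup>2 + (0 * ?w')\<^sup>2) * (real (n + m) * B ^ (2 * p))) = \<kappa>"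
        unfolding e3 using e2(1) by simp
      have 1: "\<bar>interp_ent ?u' ?w' - interp_ent ?u ?w' - interp_pair ?u ?w' (interp_cov ?e 0) / 2\<bar> \<le> 400 * \<kappa> * sqrt \<kappa>" "bounded_ker MM \<kappa> (interp_cov ?e 0)"
        using interp_ent_step[OF b(2,4) q1 q2 \<kappa>] unfolding e3 by simp_all
      have q3: "(sqrt (real (N - Suc j) / real (N - j)))\<^sup>2 + (sqrt (1 / real (N - j)))\<^sup>2 = 1"
        using j by (simp add: add_divide_distrib[symmetric] jr del: of_nat_diff)
      have q4: "\<beta>\<^sup>2 * (((0 * ?u)\<^sup>2 + (sqrt (1 / real (N - j)) * ?w)\<^sup>2) * (real (n + m) * B ^ (2 * p))) = \<kappa>"
        unfolding e4 using e2(2) by simp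
      have 2: "\<bar>interp_ent ?u ?w - interp_ent ?u ?w' - interp_pair ?u ?w' (interp_cov 0 ?e) / 2\<bar> \<le> 400 * \<kappa> * sqrt \<kappa>" "bounded_ker MM \<kappa> (interp_cov 0 ?e)"
        using interp_ent_step[OF b(1,3) q1(2) q3 q4 \<kappa>] unfolding e4 by simp_all
      have "interp_pair ?u ?w' (interp_cov ?e 0) - interp_pair ?u ?w' (interp_cov 0 ?e) \<le> \<beta>\<^sup>2 * ?e\<^sup>2 * (B\<^sup>2) ^ (p - 2) * (1 + 128 * exp (B ^ 4 / 2))"
        by (rule interp_pair_diff_le[OF b(1,4) 1(2) 2(2)])
      also have "\<dots> = C / N" using N by (simp add: C_def)
      finally have g: "interp_pair ?u ?w' (interp_cov ?e 0) - interp_pair ?u ?w' (interp_cov 0 ?e) \<le> C / N" .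
      have lin: "x - z \<le> d / 2 + 2 * e" if "\<bar>x - y - g1 / 2\<bar> \<le> e" "\<bar>z - y - g2 / 2\<bar> \<le> e" "g1 - g2 \<le> d"
        for x y z g1 g2 d e :: real using that by linarith
      show ?thesis unfolding a_def using lin[OF 1(1) 2(1) g] by (simp add: mult.assoc del: of_nat_Suc of_nat_diff)
    qed
    \<comment> \<open>Telescoping; with \<open>\<kappa> = D / N\<close> the expansion errors add up
      to order \<open>1 / sqrt N\<close>.\<close>
    have "a N - a 0 = (\<Sum>j<N. a (Suc j) - a j)" by (simp add: sum_lessThan_telescope)
    also have "\<dots> \<le> (\<Sum>j<N. C / N / 2 + 800 * \<kappa> * sqrt \<kappa>)" by (intro sum_mono st) auto
    also have "\<dots> = C / 2 + real N * (800 * \<kappa> * sqrt \<kappa>)" using N by (simp add: distrib_left)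
    also have "real N * (800 * \<kappa> * sqrt \<kappa>) = 800 * D * sqrt D / sqrt (real N)"
      using N by (simp add: \<kappa>_def real_sqrt_divide)
    finally show ?thesis using N by (simp add: a_def)
  qed
  have lim: "(\<lambda>N. interp_ent 0 1 + C / 2 + 800 * D * sqrt D / sqrt (real N)) \<longlonglongrightarrow> interp_ent 0 1 + C / 2 + 0"
    by (intro tendsto_add tendsto_const tendsto_divide_0[OF tendsto_const]
        filterlim_at_top_imp_at_infinity filterlim_compose[OF sqrt_at_top filterlim_real_sequentially])
  have ev: "\<forall>\<^sub>F N in sequentially. interp_ent 1 0 \<le> interp_ent 0 1 + C / 2 + 800 * D * sqrt D / sqrt (real N)"
  proof -
    obtain N0 :: nat where N0: "6 * D \<le> real N0" using real_arch_simple by blast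
    show ?thesis using eventually_ge_at_top[of "Suc N0"]
      by eventually_elim (rule main, use N0 in auto)
  qed
  show ?thesis using tendsto_lowerbound[OF lim ev] by (simp add: C_def)
qed

lemma distr_PiM_mu_reindex:
  assumes "inj_on f K" "f ` K \<subseteq> J"
  shows "PiM K (\<lambda>_. \<mu>) = distr (PiM J (\<lambda>_. \<mu>)) (PiM K (\<lambda>_. \<mu>)) (\<lambda>\<sigma>. \<lambda>k\<in>K. \<sigma> (f k))"
    "(\<lambda>\<sigma>. \<lambda>k\<in>K. \<sigma> (f k)) \<in> measurable (PiM J (\<lambda>_. \<mu>)) (PiM K (\<lambda>_. \<mu>))"
proof -
  show "PiM K (\<lambda>_. \<mu>) = distr (PiM J (\<lambda>_. \<mu>)) (PiM K (\<lambda>_. \<mu>)) (\<lambda>\<sigma>. \<lambda>k\<in>K. \<sigma> (f k))"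
    by (rule distr_PiM_reindex[of J "\<lambda>_. \<mu>" f K, symmetric]) (use assms \<mu> in auto)
  show "(\<lambda>\<sigma>. \<lambda>k\<in>K. \<sigma> (f k)) \<in> measurable (PiM J (\<lambda>_. \<mu>)) (PiM K (\<lambda>_. \<mu>))"
    using assms(2) by (intro measurable_restrict) auto
qed

text \<open>With \<open>w = 0\<close> the block observations are pure noise and can be
  discarded.\<close>

lemma interp_ent_full: "interp_ent 1 0 = scalar_ent \<mu> B p (n + m) \<beta>"
proof -
  have "interp_ent 1 0 = planted_ent (tensor_idx p (n + m)) MM (\<lambda>\<sigma> j. FF 1 0 (cl \<sigma>) (0, j))"
    unfolding interp_ent_def
    by (rule planted_ent_reindex[OF bounded_feat_interp_feat]) (auto simp: inj_on_def interp_idx_def interp_feat_def)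
  then show ?thesis
    by (simp add: scalar_ent_def interp_feat_def scalar_feat_def[abs_def])
qed

text \<open>With \<open>u = 0\<close> the tensor on all sites is pure noise. The blocks use disjoint
  sites and independent noise, so their entropies add; \<open>?v2\<close> also covers the indices
  with first component 0, where the feature vanishes.\<close>

lemma interp_ent_split: "interp_ent 0 1 = scalar_ent \<mu> B p n \<beta> + scalar_ent \<mu> B p m \<beta>"
proof -
  let ?v1 = "\<lambda>\<sigma> q. if fst q = 1 then FF 0 1 (cl \<sigma>) q else 0"
  let ?v2 = "\<lambda>\<sigma> q. if fst q \<noteq> 1 then FF 0 1 (cl \<sigma>) q else 0"
  let ?sp = "\<lambda>(x, y). \<lambda>k\<in>{..<n + m}. if k \<in> {..<n} then x k else (y k :: real)"
  have sp: "coupling MM ?sp" by (rule coupling_PiM_splice) (auto simp: \<mu>)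
  note bF = bounded_feat_interp_feat[of 0 1, simplified]
  have b1: "bounded_feat II MM c0 ?v1" and b2: "bounded_feat II MM c0 ?v2"
    using bounded_featD[OF bF] unfolding bounded_feat_def by auto
  have s1: "?v1 (?sp (\<sigma>, \<tau>)) q = ?v1 \<sigma> q" if "q \<in> II" for \<sigma> \<tau> :: "nat \<Rightarrow> real" and q
    using that by (auto simp: interp_feat_def interp_idx_def intro!: arg_cong2[where f="(*)"] tfeat_cong)
  have s2: "?v2 (?sp (\<sigma>, \<tau>)) q = ?v2 \<tau> q" if "q \<in> II" for \<sigma> \<tau> :: "nat \<Rightarrow> real" and q
    using that by (auto simp: interp_feat_def interp_idx_def intro!: arg_cong2[where f="(*)"] tfeat_cong)
  have "(\<lambda>\<sigma>. FF 0 1 (cl \<sigma>)) = (\<lambda>\<sigma> q. ?v1 \<sigma> q + ?v2 \<sigma> q)" by (auto simp: fun_eq_iff)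
  then have "interp_ent 0 1 = planted_ent II MM (\<lambda>\<sigma> q. ?v1 \<sigma> q + ?v2 \<sigma> q)" by (simp add: interp_ent_def)
  also have "\<dots> = planted_ent II MM ?v1 + planted_ent II MM ?v2"
    by (rule planted_ent_add_disjoint[OF b1 b2 sp, of "{q. fst q = 1}"]) (use s1 s2 in auto)
  also have "planted_ent II MM ?v1 = planted_ent (tensor_idx p n) MM (\<lambda>\<sigma> j. ?v1 \<sigma> (1, j))"
    by (rule planted_ent_reindex[OF b1]) (auto simp: inj_on_def interp_idx_def)
  also have "\<dots> = scalar_ent \<mu> B p n \<beta>" unfolding scalar_ent_def
    by (rule planted_ent_cong(1)[OF distr_PiM_mu_reindex[of "\<lambda>k. k" "{..<n}" "{..<n + m}"] bounded_feat_scalar_feat[OF \<mu> s\<mu> B centered p1]])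
      (auto simp: scalar_feat_def interp_feat_def intro!: tfeat_cong)
  also have "planted_ent II MM ?v2 = planted_ent (tensor_idx p m) MM (\<lambda>\<sigma> j. ?v2 \<sigma> (2, j))"
    by (rule planted_ent_reindex[OF b2]) (auto simp: inj_on_def interp_idx_def interp_feat_def)
  also have "\<dots> = scalar_ent \<mu> B p m \<beta>" unfolding scalar_ent_def
    by (rule planted_ent_cong(1)[OF distr_PiM_mu_reindex[of "\<lambda>k. n + k" "{..<m}" "{..<n + m}"] bounded_feat_scalar_feat[OF \<mu> s\<mu> B centered p1]])
      (auto simp: scalar_feat_def interp_feat_def intro!: tfeat_cong)
  finally show ?thesis .
qed

lemma scalar_ent_subadditive:
  "scalar_ent \<mu> B p (n + m) \<beta> \<le> scalar_ent \<mu> B p n \<beta> + scalar_ent \<mu> B p m \<beta> + \<beta>\<^sup>2 * (B\<^sup>2) ^ (p - 2) * (1 + 128 * exp (B ^ 4 / 2)) / 2"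
  using interp_ent_interpolation unfolding interp_ent_full interp_ent_split .

end

section \<open>Limits along subsequences\<close>

lemma limsup_eq_0_iff:
  fixes a :: "nat \<Rightarrow> real"
  assumes "\<And>N. a N \<le> 0"
  shows "limsup (\<lambda>N. ereal (a N)) = 0 \<longleftrightarrow> (\<forall>\<epsilon>>0. \<exists>\<^sub>F N in sequentially. - \<epsilon> < a N)"
proof -
  have le: "limsup (\<lambda>N. ereal (a N)) \<le> 0"
    by (intro Limsup_bounded always_eventually) (use assms in \<open>auto simp: zero_ereal_def\<close>)
  have "limsup (\<lambda>N. ereal (a N)) = 0 \<longleftrightarrow> 0 \<le> limsup (\<lambda>N. ereal (a N))" using le by auto
  also have "\<dots> \<longleftrightarrow> (\<forall>y<0. \<exists>\<^sub>F N in sequentially. y < ereal (a N))"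
  proof safe
    fix y :: ereal assume "0 \<le> limsup (\<lambda>N. ereal (a N))" "y < 0"
    then have "\<not> limsup (\<lambda>N. ereal (a N)) \<le> y" by auto
    then have "\<not> (\<forall>\<^sub>F N in sequentially. ereal (a N) \<le> y)" using Limsup_bounded[of "\<lambda>N. ereal (a N)" y sequentially] by auto
    then show "\<exists>\<^sub>F N in sequentially. y < ereal (a N)" by (simp add: frequently_def not_less)
  next
    assume *: "\<forall>y<0. \<exists>\<^sub>F N in sequentially. y < ereal (a N)"
    show "0 \<le> limsup (\<lambda>N. ereal (a N))"
    proof (rule ccontr)
      assume "\<not> 0 \<le> limsup (\<lambda>N. ereal (a N))"
      then obtain y where y: "limsup (\<lambda>N. ereal (a N)) < y" "y < 0" using dense not_le by metis
      have "\<forall>\<^sub>F N in sequentially. ereal (a N) < y" using y(1) by (rule Limsup_lessD)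
      then have "\<forall>\<^sub>F N in sequentially. \<not> y < ereal (a N)" by eventually_elim auto
      then show False using * y(2) by (auto simp: frequently_def)
    qed
  qed
  also have "\<dots> \<longleftrightarrow> (\<forall>\<epsilon>>0. \<exists>\<^sub>F N in sequentially. - \<epsilon> < a N)"
  proof safe
    fix \<epsilon> :: real assume H: "\<forall>y<0. \<exists>\<^sub>F N in sequentially. y < ereal (a N)" and "0 < \<epsilon>"
    then have "\<exists>\<^sub>F N in sequentially. ereal (- \<epsilon>) < ereal (a N)" using H[rule_format, of "ereal (- \<epsilon>)"] by simp
    then show "\<exists>\<^sub>F N in sequentially. - \<epsilon> < a N" by simp
  next
    fix y :: ereal assume *: "\<forall>\<epsilon>>0. \<exists>\<^sub>F N in sequentially. - \<epsilon> < a N" and y: "y < 0"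
    show "\<exists>\<^sub>F N in sequentially. y < ereal (a N)"
    proof (cases y)
      case (real r)
      then have "\<exists>\<^sub>F N in sequentially. - (- r) < a N" using y *[rule_format, of "- r"] by simp
      then show ?thesis using real by simp
    next
      case MInf then show ?thesis by simp
    qed (use y in auto)
  qed
  finally show ?thesis .
qed

text \<open>Fekete's argument with a bounded defect: one size \<open>m\<close> that is good and
  large enough to absorb \<open>C\<close> controls every large \<open>N\<close> by division with
  remainder.\<close>

lemma subadditive_frequently_imp_eventually:
  fixes a :: "nat \<Rightarrow> real" and C \<epsilon> :: real
  assumes a0: "\<And>N. 0 \<le> a N" and C: "0 \<le> C"
    and sub: "\<And>n m. 0 < n \<Longrightarrow> 0 < m \<Longrightarrow> a (n + m) \<le> a n + a m + C"
    and freq: "\<And>\<delta> :: real. 0 < \<delta> \<Longrightarrow> \<exists>\<^sub>F N in sequentially. a N < \<delta> * N"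
    and \<epsilon>: "0 < \<epsilon>"
  shows "\<forall>\<^sub>F N in sequentially. a N < \<epsilon> * N"
proof -
  \<comment> \<open>Sizes beyond \<open>m0\<close> satisfy
    \<open>C \<le> \<epsilon> / 3 * m\<close>, so the defect per block costs a second third of
    \<open>\<epsilon>\<close>; the last third pays for the remainder.\<close>
  obtain m0 :: nat where m0: "3 * C / \<epsilon> < m0" using reals_Archimedean2 by blast
  have "\<exists>\<^sub>F N in sequentially. a N < \<epsilon> / 3 * N \<and> Suc m0 \<le> N"
    using frequently_eventually_frequently[OF freq[of "\<epsilon> / 3"] eventually_ge_at_top[of "Suc m0"]] \<epsilon> by simp
  then obtain m where m: "a m < \<epsilon> / 3 * m" "Suc m0 \<le> m" by (auto dest: frequently_ex)
  have mC: "C \<le> \<epsilon> / 3 * m"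
  proof -
    have "3 * C / \<epsilon> \<le> real m" using m0 m(2) by linarith
    then show ?thesis using \<epsilon> by (simp add: field_simps)
  qed
  have ind: "a (q * m + r) \<le> q * (a m + C) + a r" if "0 < r" for q r
  proof (induction q)
    case (Suc q)
    have "a (m + (q * m + r)) \<le> a m + a (q * m + r) + C" using m that by (intro sub) auto
    also have "\<dots> \<le> a m + (q * (a m + C) + a r) + C" using Suc by simp
    finally show ?case by (simp add: algebra_simps)
  qed simp
  define R where "R = (\<Sum>r\<le>m. a r)"
  have R: "a r \<le> R" if "r \<le> m" for r
    unfolding R_def using that a0 by (intro member_le_sum) auto
  obtain n0 :: nat where n0: "3 * R / \<epsilon> < n0" using reals_Archimedean2 by blast
  show ?thesis
    using eventually_ge_at_top[of "Suc n0"]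
  proof eventually_elim
    case (elim N)
    \<comment> \<open>The remainder ranges from 1 to \<open>m\<close> instead of from 0 to
      \<open>m - 1\<close>, since subadditivity is only available for nonempty blocks.\<close>
    obtain q r where qr: "N = q * m + r" "0 < r" "r \<le> m"
    proof (cases "N mod m = 0")
      case True
      then have "N = (N div m - 1) * m + m" using elim m
        by (metis Suc_le_eq div_mult_mod_eq add.right_neutral mult_eq_if add.commute gr_implies_not0 mult_0)
      then show ?thesis using that[of "N div m - 1" m] m by auto
    next
      case False
      then show ?thesis using that[of "N div m" "N mod m"] m by (auto simp: less_imp_le)
    qed
    have "a N \<le> q * (a m + C) + a r" using ind[OF qr(2)] qr(1) by simp
    also have "\<dots> \<le> q * (\<epsilon> / 3 * m + \<epsilon> / 3 * m) + R"
      using m(1) mC R[OF qr(3)] by (intro add_mono mult_left_mono) auto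
    also have "\<dots> \<le> 2 / 3 * \<epsilon> * N + R"
    proof -
      have "real (q * m) \<le> real N" using qr(1) by simp
      then have "\<epsilon> * (real q * real m) \<le> \<epsilon> * N" using \<epsilon> by (intro mult_left_mono) auto
      then show ?thesis by (simp add: algebra_simps)
    qed
    also have "\<dots> < \<epsilon> * N"
    proof -
      have "3 * R / \<epsilon> < real N" using n0 elim by linarith
      then have "3 * R < \<epsilon> * N" using \<epsilon> by (simp add: field_simps)
      then show ?thesis by simp
    qed
    finally show ?case .
  qed
qed

text \<open>Deduced from \<open>distr_PiM_pair\<close> with a second factor that the map
  ignores.\<close>

lemma distr_PiM_map:
  assumes "finite I" "prob_space M" "prob_space N" "h \<in> measurable M N" "distr M N h = N"
  shows "distr (PiM I (\<lambda>_. M)) (PiM I (\<lambda>_. N)) (\<lambda>x. \<lambda>i\<in>I. h (x i)) = PiM I (\<lambda>_. N)"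
proof -
  let ?P = "PiM I (\<lambda>_. M)"
  have P: "prob_space ?P" using assms by (intro prob_space_PiM)
  have f: "distr (M \<Otimes>\<^sub>M M) M fst = M" using prob_space.distr_pair_fst[OF assms(2)] .
  have "distr (M \<Otimes>\<^sub>M M) N (\<lambda>p. h (fst p)) = distr (distr (M \<Otimes>\<^sub>M M) M fst) N h"
    using assms(4) by (subst distr_distr) (auto simp: comp_def)
  then have d: "distr (M \<Otimes>\<^sub>M M) N (\<lambda>p. h (fst p)) = N" unfolding f assms(5) .
  have m: "(\<lambda>x. \<lambda>i\<in>I. h (x i)) \<in> measurable ?P (PiM I (\<lambda>_. N))"
    by (intro measurable_restrict measurable_compose[OF _ assms(4)]) auto
  have "PiM I (\<lambda>_. N) = distr (?P \<Otimes>\<^sub>M ?P) (PiM I (\<lambda>_. N)) (\<lambda>(x, y). \<lambda>i\<in>I. (\<lambda>p. h (fst p)) (x i, y i))"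
    by (rule distr_PiM_pair[OF assms(1) assms(2) assms(2) assms(3) _ d, symmetric])
      (intro measurable_compose[OF measurable_fst assms(4)])
  also have "\<dots> = distr (distr (?P \<Otimes>\<^sub>M ?P) ?P fst) (PiM I (\<lambda>_. N)) (\<lambda>x. \<lambda>i\<in>I. h (x i))"
    using m by (subst distr_distr) (auto simp: comp_def split_beta')
  also have "distr (?P \<Otimes>\<^sub>M ?P) ?P fst = ?P" by (rule prob_space.distr_pair_fst[OF P])
  finally show ?thesis by (rule sym)
qed

text \<open>Division by \<open>b\<close> moves both numbers into the unit ball, where the power is
  \<open>p\<close>-Lipschitz.\<close>

lemma abs_power_diff_le:
  fixes x y :: real
  assumes "\<bar>x\<bar> \<le> b" "\<bar>y\<bar> \<le> b" "1 \<le> b" "1 \<le> p"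
  shows "\<bar>x ^ p - y ^ p\<bar> \<le> p * b ^ p * \<bar>x - y\<bar>"
proof -
  have "norm ((x / b) ^ p - (y / b) ^ p) \<le> p * norm (x / b - y / b)"
    using assms by (intro norm_power_diff) auto
  then have "\<bar>x ^ p - y ^ p\<bar> / b ^ p \<le> p * \<bar>x - y\<bar> / b"
    using assms(3) by (simp add: power_divide diff_divide_distrib[symmetric] abs_divide)
  also have "\<dots> \<le> p * \<bar>x - y\<bar> / 1" using assms(3) by (intro divide_left_mono) auto
  finally show ?thesis using assms(3) by (simp add: pos_divide_le_eq mult_ac)
qed

text \<open>The kernel itself can be of size \<open>N\<close>, yet a bounded change of the
  unnormalised overlap alters it only by a constant; hence the oscillation per site is
  bounded.\<close>

lemma tker_diff_le:
  assumes "\<bar>x\<bar> \<le> real N * b" "\<bar>y\<bar> \<le> real N * b" "1 \<le> b" "1 \<le> p" "\<bar>x - y\<bar> \<le> d"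
  shows "\<bar>tker p N x - tker p N y\<bar> \<le> p * b ^ p * d"
proof (cases "N = 0")
  case True
  then show ?thesis using assms by (simp add: tker_def)
next
  case False
  have "\<bar>x / N\<bar> \<le> b" "\<bar>y / N\<bar> \<le> b" using assms False by (auto simp: divide_le_eq mult.commute)
  then have "\<bar>(x / N) ^ p - (y / N) ^ p\<bar> \<le> p * b ^ p * \<bar>x / N - y / N\<bar>" using assms by (intro abs_power_diff_le) auto
  then have "real N * \<bar>(x / N) ^ p - (y / N) ^ p\<bar> \<le> real N * (p * b ^ p * \<bar>x / N - y / N\<bar>)" by (intro mult_left_mono) auto
  also have "\<dots> = p * b ^ p * \<bar>x - y\<bar>" using False by (simp add: diff_divide_distrib[symmetric])
  also have "\<dots> \<le> p * b ^ p * d" using assms by (intro mult_left_mono) auto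
  finally show ?thesis by (simp add: tker_def right_diff_distrib[symmetric] abs_mult)
qed

text \<open>Used for independent centred configurations, where the squared overlap divided by
  \<open>N\<close> has bounded mean: their mean covariance is \<open>O(1)\<close> and not
  \<open>O(N)\<close>.\<close>

lemma tker_abs_le_square:
  assumes "\<bar>x\<bar> \<le> real N * b" "2 \<le> p" "0 < N" "0 \<le> b"
  shows "\<bar>tker p N x\<bar> \<le> b ^ (p - 2) * (x\<^sup>2 / real N)"
proof -
  define z where "z = \<bar>x / N\<bar>"
  have z: "0 \<le> z" "z \<le> b" using assms by (auto simp: z_def divide_le_eq mult.commute)
  have p2: "p = (p - 2) + 2" using assms by simp
  have "z ^ p = z ^ (p - 2) * z\<^sup>2" by (subst p2) (simp add: power_add power2_eq_square)
  also have "\<dots> \<le> b ^ (p - 2) * z\<^sup>2" using z by (intro mult_right_mono power_mono) auto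
  finally have "real N * z ^ p \<le> real N * (b ^ (p - 2) * z\<^sup>2)" by (intro mult_left_mono) auto
  also have "\<dots> = b ^ (p - 2) * (x\<^sup>2 / real N)" using assms by (simp add: z_def power_divide power2_eq_square)
  finally show ?thesis by (simp add: tker_def abs_mult power_abs z_def)
qed

section \<open>Several spikes\<close>

definition vec_feat :: "real \<Rightarrow> nat \<Rightarrow> nat \<Rightarrow> ('k::finite \<Rightarrow> real) \<Rightarrow> (nat \<Rightarrow> 'k \<Rightarrow> real) \<Rightarrow> (nat \<Rightarrow> nat) \<Rightarrow> real" where
  "vec_feat B p N b \<sigma> i = (\<Sum>r\<in>UNIV. b r * tfeat p N (\<lambda>k. clip B (\<sigma> k r)) i)"

abbreviation conf :: "('k::finite \<Rightarrow> real measure) \<Rightarrow> nat \<Rightarrow> (nat \<Rightarrow> 'k \<Rightarrow> real) measure" where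
  "conf \<mu> N \<equiv> PiM {..<N} (\<lambda>_. PiM UNIV \<mu>)"

definition vec_null_ent :: "('k::finite \<Rightarrow> real measure) \<Rightarrow> real \<Rightarrow> nat \<Rightarrow> nat \<Rightarrow> ('k \<Rightarrow> real) \<Rightarrow> real" where
  "vec_null_ent \<mu> B p N b = null_ent (tensor_idx p N) (conf \<mu> N) (vec_feat B p N b)"

text \<open>Switches rows off by setting their inverse temperature to 0, so that all submodels live
  on the same configurations and the same data.\<close>

definition only :: "'k set \<Rightarrow> ('k \<Rightarrow> real) \<Rightarrow> 'k \<Rightarrow> real" where
  "only S b r = (if r \<in> S then b r else 0)"

text \<open>Bounds the change of the covariance between row \<open>r\<close> and all rows when one
  site of the latter is replaced: each overlap moves by at most \<open>2 * B\<^sup>2\<close>, and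
  \<open>tker_diff_le\<close> with \<open>b = B\<^sup>2\<close> supplies the other factor.\<close>

definition site_osc :: "real \<Rightarrow> nat \<Rightarrow> ('k::finite \<Rightarrow> real) \<Rightarrow> 'k \<Rightarrow> real" where
  "site_osc B p b r = \<bar>b r\<bar> * (\<Sum>r'\<in>UNIV. \<bar>b r'\<bar>) * (p * (B\<^sup>2) ^ p * (2 * B\<^sup>2))"

lemma Xfield_eq: "Xfield p N Y s = (\<Sum>i\<in>tensor_idx p N. tfeat p N s i * Y i)"
  by (simp add: Xfield_def tfeat_def sum_distrib_left mult_ac)

lemma overlap_tker: "real N * overlap N s s' ^ p = tker p N (\<Sum>k<N. s k * s' k)"
  by (simp add: overlap_def tker_def)

lemma vec_feat_inner:
  assumes "1 \<le> p"
  shows "(\<Sum>i\<in>tensor_idx p N. vec_feat B p N b \<sigma> i * vec_feat B p N b' \<tau> i)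
    = (\<Sum>r\<in>UNIV. \<Sum>r'\<in>UNIV. b r * b' r' * tker p N (\<Sum>k<N. clip B (\<sigma> k r) * clip B (\<tau> k r')))"
proof -
  have "(\<Sum>i\<in>tensor_idx p N. vec_feat B p N b \<sigma> i * vec_feat B p N b' \<tau> i) =
    (\<Sum>i\<in>tensor_idx p N. \<Sum>r\<in>UNIV. \<Sum>r'\<in>UNIV. b r * b' r' * (tfeat p N (\<lambda>k. clip B (\<sigma> k r)) i * tfeat p N (\<lambda>k. clip B (\<tau> k r')) i))"
    unfolding vec_feat_def by (simp add: sum_product mult_ac)
  also have "\<dots> = (\<Sum>r\<in>UNIV. \<Sum>i\<in>tensor_idx p N. \<Sum>r'\<in>UNIV. b r * b' r' * (tfeat p N (\<lambda>k. clip B (\<sigma> k r)) i * tfeat p N (\<lambda>k. clip B (\<tau> k r')) i))"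
    by (rule sum.swap)
  also have "\<dots> = (\<Sum>r\<in>UNIV. \<Sum>r'\<in>UNIV. \<Sum>i\<in>tensor_idx p N. b r * b' r' * (tfeat p N (\<lambda>k. clip B (\<sigma> k r)) i * tfeat p N (\<lambda>k. clip B (\<tau> k r')) i))"
    by (intro sum.cong refl sum.swap)
  finally show ?thesis by (simp add: sum_distrib_left[symmetric] tfeat_inner[OF assms])
qed

text \<open>There are \<open>N ^ p\<close> coordinates, each with a squared bound of order
  \<open>N powr (1 - p)\<close>, so the cost of Gaussian concentration is linear in
  \<open>N\<close>.\<close>

lemma sum_tfeat_bound_square:
  assumes "1 \<le> p"
  shows "(\<Sum>i\<in>tensor_idx p N. (r * (real N powr (- (real p - 1) / 2) * B ^ p))\<^sup>2) = r\<^sup>2 * B ^ (2 * p) * N"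
proof (cases "N = 0")
  case True
  then show ?thesis by simp
next
  case False
  have "(\<Sum>i\<in>tensor_idx p N. (r * (real N powr (- (real p - 1) / 2) * B ^ p))\<^sup>2) = real (N ^ p) * (r\<^sup>2 * ((real N powr (- (real p - 1) / 2) * real N powr (- (real p - 1) / 2)) * B ^ (2 * p)))"
    by (simp add: card_tensor_idx power_mult_distrib power2_eq_square[of "_ powr _"] power_mult[symmetric] mult.commute[of p 2])
  then show ?thesis using False unfolding powr_scale_square[OF False[unfolded neq0_conv] assms] by simp
qed

section \<open>The vector model as a mixture likelihood\<close>

locale vector_model =
  fixes \<mu> :: "'k::finite \<Rightarrow> real measure" and B :: real and p :: nat
  assumes \<mu>: "\<And>r. prob_space (\<mu> r)" and s\<mu>: "\<And>r. sets (\<mu> r) = sets borel" and B: "1 \<le> B"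
    and centered: "\<And>r. (\<integral>x. clip B x \<partial>\<mu> r) = 0" and bounded: "\<And>r. AE x in \<mu> r. \<bar>x\<bar> \<le> B"
    and p: "3 \<le> p"
begin

lemma p_ge_1: "1 \<le> p" using p by simp

lemma prob_space_site: "prob_space (PiM UNIV \<mu>)" by (intro prob_space_PiM \<mu>)

lemma prob_space_conf: "prob_space (conf \<mu> N)" by (intro prob_space_PiM prob_space_site)

lemma clip_row_measurable:
  assumes "k < N" shows "(\<lambda>\<sigma>. clip B (\<sigma> k r)) \<in> borel_measurable (conf \<mu> N)"
proof -
  have 1: "(\<lambda>\<sigma>. \<sigma> k) \<in> measurable (conf \<mu> N) (PiM UNIV \<mu>)"
    using measurable_component_singleton[of k "{..<N}" "\<lambda>_. PiM UNIV \<mu>"] assms by simp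
  have 2: "(\<lambda>x. x r) \<in> measurable (PiM UNIV \<mu>) (\<mu> r)" by measurable
  have 3: "clip B \<in> borel_measurable (\<mu> r)" using clip_measurable s\<mu>[of r] by (simp cong: measurable_cong_sets)
  show ?thesis by (rule measurable_compose[OF measurable_compose[OF 1 2] 3])
qed

lemma tfeat_row_measurable:
  assumes "i \<in> tensor_idx p N" shows "(\<lambda>\<sigma>. tfeat p N (\<lambda>k. clip B (\<sigma> k r)) i) \<in> borel_measurable (conf \<mu> N)"
  unfolding tfeat_def using tensor_idx_less[OF assms]
  by (intro borel_measurable_times borel_measurable_const borel_measurable_prod clip_row_measurable) auto

lemma vec_feat_abs_le:
  "\<bar>vec_feat B p N b \<sigma> i\<bar> \<le> (\<Sum>r\<in>UNIV. \<bar>b r\<bar>) * (real N powr (- (real p - 1) / 2) * B ^ p)"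
proof -
  have "\<bar>vec_feat B p N b \<sigma> i\<bar> \<le> (\<Sum>r\<in>UNIV. \<bar>b r\<bar> * \<bar>tfeat p N (\<lambda>k. clip B (\<sigma> k r)) i\<bar>)"
    unfolding vec_feat_def by (rule order_trans[OF sum_abs]) (simp add: abs_mult)
  also have "\<dots> \<le> (\<Sum>r\<in>UNIV. \<bar>b r\<bar> * (real N powr (- (real p - 1) / 2) * B ^ p))"
    using B by (intro sum_mono mult_left_mono tfeat_abs_le p_ge_1 abs_clip_le) auto
  finally show ?thesis by (simp add: sum_distrib_right)
qed

lemma bounded_feat_vec_feat:
  "bounded_feat (tensor_idx p N) (conf \<mu> N) ((\<Sum>r\<in>UNIV. \<bar>b r\<bar>) * (real N powr (- (real p - 1) / 2) * B ^ p)) (vec_feat B p N b)"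
  unfolding bounded_feat_def
proof (intro conjI ballI allI vec_feat_abs_le prob_space_conf finite_tensor_idx)
  show "0 \<le> (\<Sum>r\<in>UNIV. \<bar>b r\<bar>) * (real N powr (- (real p - 1) / 2) * B ^ p)"
    using B by (intro mult_nonneg_nonneg sum_nonneg) auto
  fix i assume i: "i \<in> tensor_idx p N"
  show "(\<lambda>\<sigma>. vec_feat B p N b \<sigma> i) \<in> borel_measurable (conf \<mu> N)"
    unfolding vec_feat_def
    by (intro borel_measurable_sum borel_measurable_times borel_measurable_const tfeat_row_measurable i)
qed

text \<open>The splitting lemmas ask for one constant that serves both parts of the signal.\<close>

lemma bounded_feat_vec_feat_mono:
  assumes "(\<Sum>r\<in>UNIV. \<bar>b r\<bar>) \<le> C"
  shows "bounded_feat (tensor_idx p N) (conf \<mu> N) (C * (real N powr (- (real p - 1) / 2) * B ^ p)) (vec_feat B p N b)"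
proof -
  have "(\<Sum>r\<in>UNIV. \<bar>b r\<bar>) * (real N powr (- (real p - 1) / 2) * B ^ p) \<le> C * (real N powr (- (real p - 1) / 2) * B ^ p)"
    using assms B by (intro mult_right_mono) auto
  then show ?thesis using bounded_feat_vec_feat[of N b] unfolding bounded_feat_def by (meson order_trans)
qed

lemma AE_conf_bounded: "AE \<sigma> in conf \<mu> N. \<forall>k<N. \<forall>r. \<bar>\<sigma> k r\<bar> \<le> B"
proof -
  have "AE x in PiM UNIV \<mu>. \<bar>x r\<bar> \<le> B" for r
    by (rule AE_PiM_component[of UNIV \<mu>]) (use \<mu> bounded in auto)
  then have "AE x in PiM UNIV \<mu>. \<forall>r. \<bar>x r\<bar> \<le> B" by (simp add: AE_all_countable)
  then have "AE \<sigma> in conf \<mu> N. \<forall>r. \<bar>\<sigma> k r\<bar> \<le> B" if "k < N" for k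
    by (intro AE_PiM_component[of "{..<N}" "\<lambda>_. PiM UNIV \<mu>" k "\<lambda>x. \<forall>r. \<bar>x r\<bar> \<le> B"]) (use prob_space_site that in auto)
  then have "AE \<sigma> in conf \<mu> N. \<forall>k\<in>{..<N}. \<forall>r. \<bar>\<sigma> k r\<bar> \<le> B" by (intro AE_finite_allI) auto
  then show ?thesis by (rule eventually_mono) auto
qed

text \<open>All rows share the same \<open>Y\<close>, so the rows add up to a single feature, and
  the double sum in the Hamiltonian is its squared norm.\<close>

lemma vec_H_eq:
  assumes "\<forall>k<N. \<forall>r. \<bar>\<sigma> k r\<bar> \<le> B"
  shows "exp (vec_H p N Y \<beta> \<sigma>) = cm_dens (tensor_idx p N) (vec_feat B p N (\<lambda>r. \<beta> $ r) \<sigma>) Y"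
proof -
  let ?s = "\<lambda>r k. clip B (\<sigma> k r)"
  have X: "Xfield p N Y (\<lambda>i. \<sigma> i r) = (\<Sum>i\<in>tensor_idx p N. tfeat p N (?s r) i * Y i)" for r
    unfolding Xfield_eq using assms by (intro sum.cong refl arg_cong2[where f="(*)"] tfeat_cong) (auto simp: clip_eq)
  have O: "real N * overlap N (\<lambda>i. \<sigma> i r) (\<lambda>i. \<sigma> i r') ^ p = tker p N (\<Sum>k<N. ?s r k * ?s r' k)" for r r'
    unfolding overlap_tker using assms by (intro arg_cong[where f="tker p N"] sum.cong refl) (auto simp: clip_eq)
  have "(\<Sum>r\<in>UNIV. \<beta> $ r * Xfield p N Y (\<lambda>i. \<sigma> i r)) = (\<Sum>i\<in>tensor_idx p N. vec_feat B p N (\<lambda>r. \<beta> $ r) \<sigma> i * Y i)"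
    unfolding X vec_feat_def sum_distrib_left sum_distrib_right by (subst sum.swap) (simp add: mult_ac)
  moreover have "(\<Sum>r\<in>UNIV. \<Sum>r'\<in>UNIV. \<beta> $ r * \<beta> $ r' / 2 * real N * overlap N (\<lambda>i. \<sigma> i r) (\<lambda>i. \<sigma> i r') ^ p)
      = (\<Sum>i\<in>tensor_idx p N. (vec_feat B p N (\<lambda>r. \<beta> $ r) \<sigma> i)\<^sup>2) / 2"
    unfolding power2_eq_square vec_feat_inner[OF p_ge_1] mult.assoc[of _ "real N"] O by (simp add: sum_divide_distrib)
  ultimately show ?thesis by (simp add: vec_H_def cm_dens_def)
qed

lemma vec_FN_eq: "vec_FN p \<mu> \<beta> N Y = ln (mix_lik (tensor_idx p N) (conf \<mu> N) (vec_feat B p N (\<lambda>r. \<beta> $ r)) Y) / N"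
proof -
  have m1: "(\<lambda>\<sigma>. cm_dens (tensor_idx p N) (vec_feat B p N (\<lambda>r. \<beta> $ r) \<sigma>) Y) \<in> borel_measurable (conf \<mu> N)"
    by (rule cm_dens_feat_measurable1[OF bounded_feat_vec_feat])
  have row: "(\<lambda>\<sigma>. \<sigma> k r) \<in> borel_measurable (conf \<mu> N)" if "k < N" for k r
  proof -
    have "(\<lambda>\<sigma>. \<sigma> k) \<in> measurable (conf \<mu> N) (PiM UNIV \<mu>)"
      using measurable_component_singleton[of k "{..<N}" "\<lambda>_. PiM UNIV \<mu>"] that by simp
    moreover have "(\<lambda>x. x r) \<in> borel_measurable (PiM UNIV \<mu>)"
      using measurable_component_singleton[of r UNIV \<mu>] s\<mu>[of r] by (simp cong: measurable_cong_sets)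
    ultimately show ?thesis by (rule measurable_compose)
  qed
  have m2: "(\<lambda>\<sigma>. exp (vec_H p N Y \<beta> \<sigma>)) \<in> borel_measurable (conf \<mu> N)"
    unfolding vec_H_def Xfield_def overlap_def
    by (intro measurable_compose[OF _ borel_measurable_exp] borel_measurable_diff borel_measurable_sum borel_measurable_times borel_measurable_const
        borel_measurable_power borel_measurable_prod row) (auto dest: tensor_idx_less)
  have "(\<integral>\<sigma>. exp (vec_H p N Y \<beta> \<sigma>) \<partial>conf \<mu> N) = mix_lik (tensor_idx p N) (conf \<mu> N) (vec_feat B p N (\<lambda>r. \<beta> $ r)) Y"
    unfolding mix_lik_def by (rule integral_cong_AE[OF m2 m1]) (use AE_conf_bounded in eventually_elim, rule vec_H_eq)
  then show ?thesis by (simp add: vec_FN_def)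
qed

lemma vec_F_eq: "vec_F p \<mu> \<beta> = limsup (\<lambda>N. ereal (vec_null_ent \<mu> B p N (\<lambda>r. \<beta> $ r) / N))"
  unfolding vec_F_def vec_FN_eq gauss_tensor_def vec_null_ent_def null_ent_def by simp

lemma row_distr:
  "PiM {..<N} (\<lambda>_. \<mu> r) = distr (conf \<mu> N) (PiM {..<N} (\<lambda>_. \<mu> r)) (\<lambda>\<sigma>. \<lambda>k\<in>{..<N}. \<sigma> k r)"
  "(\<lambda>\<sigma>. \<lambda>k\<in>{..<N}. \<sigma> k r) \<in> measurable (conf \<mu> N) (PiM {..<N} (\<lambda>_. \<mu> r))"
proof -
  have d: "distr (PiM UNIV \<mu>) (\<mu> r) (\<lambda>x. x r) = \<mu> r" by (rule distr_PiM_component) (auto simp: \<mu>)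
  show "PiM {..<N} (\<lambda>_. \<mu> r) = distr (conf \<mu> N) (PiM {..<N} (\<lambda>_. \<mu> r)) (\<lambda>\<sigma>. \<lambda>k\<in>{..<N}. \<sigma> k r)"
    by (rule distr_PiM_map[OF _ prob_space_site \<mu> _ d, symmetric]) auto
  show "(\<lambda>\<sigma>. \<lambda>k\<in>{..<N}. \<sigma> k r) \<in> measurable (conf \<mu> N) (PiM {..<N} (\<lambda>_. \<mu> r))"
  proof (rule measurable_restrict)
    fix k assume k: "k \<in> {..<N}"
    have 1: "(\<lambda>\<sigma>. \<sigma> k) \<in> measurable (conf \<mu> N) (PiM UNIV \<mu>)"
      using measurable_component_singleton[of k "{..<N}" "\<lambda>_. PiM UNIV \<mu>"] k by simp
    have 2: "(\<lambda>x. x r) \<in> measurable (PiM UNIV \<mu>) (\<mu> r)" by measurable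
    show "(\<lambda>\<sigma>. \<sigma> k r) \<in> measurable (conf \<mu> N) (\<mu> r)" by (rule measurable_compose[OF 1 2])
  qed
qed

lemma vec_feat_only: "vec_feat B p N (only {r} b) \<sigma> i = b r * tfeat p N (\<lambda>k. clip B (\<sigma> k r)) i"
  unfolding vec_feat_def only_def by (subst sum.remove[of _ r]) (auto intro!: sum.neutral)

text \<open>With one row switched on, the model is a function of that row, whose law is the scalar
  prior; scalar statements can thus be read inside the vector model.\<close>

lemma vec_only_scalar:
  "planted_ent (tensor_idx p N) (conf \<mu> N) (vec_feat B p N (only {r} b)) = scalar_ent (\<mu> r) B p N (b r)"
  "vec_null_ent \<mu> B p N (only {r} b) = null_ent (tensor_idx p N) (PiM {..<N} (\<lambda>_. \<mu> r)) (scalar_feat B p N (b r))"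
  unfolding scalar_ent_def vec_null_ent_def
  by (rule planted_ent_cong[OF row_distr bounded_feat_scalar_feat[OF \<mu> s\<mu> B centered p_ge_1]];
      auto simp: vec_feat_only scalar_feat_def intro!: tfeat_cong)+

lemma scalar_FN_eq:
  "scalar_FN p (\<mu> r) b N Y = ln (mix_lik (tensor_idx p N) (PiM {..<N} (\<lambda>_. \<mu> r)) (scalar_feat B p N b) Y) / N"
proof -
  let ?M = "PiM {..<N} (\<lambda>_. \<mu> r)"
  have bd: "AE \<sigma> in ?M. \<forall>k<N. \<bar>\<sigma> k\<bar> \<le> B"
  proof -
    have "AE \<sigma> in ?M. \<bar>\<sigma> k\<bar> \<le> B" if "k < N" for k
      by (rule AE_PiM_component[of "{..<N}" "\<lambda>_. \<mu> r" k "\<lambda>x. \<bar>x\<bar> \<le> B"]) (use \<mu> bounded that in auto)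
    then have "AE \<sigma> in ?M. \<forall>k\<in>{..<N}. \<bar>\<sigma> k\<bar> \<le> B" by (intro AE_finite_allI) auto
    then show ?thesis by (rule eventually_mono) auto
  qed
  have eq: "exp (b * Xfield p N Y \<sigma> - b\<^sup>2 * real N / 2 * overlap N \<sigma> \<sigma> ^ p) = cm_dens (tensor_idx p N) (scalar_feat B p N b \<sigma>) Y"
    if "\<forall>k<N. \<bar>\<sigma> k\<bar> \<le> B" for \<sigma>
  proof -
    have X: "Xfield p N Y \<sigma> = (\<Sum>i\<in>tensor_idx p N. tfeat p N (\<lambda>k. clip B (\<sigma> k)) i * Y i)"
      unfolding Xfield_eq using that by (intro sum.cong refl arg_cong2[where f="(*)"] tfeat_cong) (auto simp: clip_eq)
    have O: "real N * overlap N \<sigma> \<sigma> ^ p = tker p N (\<Sum>k<N. clip B (\<sigma> k) * clip B (\<sigma> k))"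
      unfolding overlap_tker using that by (intro arg_cong[where f="tker p N"] sum.cong refl) (auto simp: clip_eq)
    have "(\<Sum>i\<in>tensor_idx p N. (scalar_feat B p N b \<sigma> i)\<^sup>2) = b\<^sup>2 * (real N * overlap N \<sigma> \<sigma> ^ p)"
      unfolding O tfeat_inner[OF p_ge_1, symmetric] sum_distrib_left scalar_feat_def by (simp add: power2_eq_square mult_ac)
    moreover have "(\<Sum>i\<in>tensor_idx p N. scalar_feat B p N b \<sigma> i * Y i) = b * Xfield p N Y \<sigma>"
      unfolding X sum_distrib_left scalar_feat_def by (simp add: mult_ac)
    ultimately show ?thesis by (simp add: cm_dens_def)
  qed
  have row: "(\<lambda>\<sigma>. \<sigma> k) \<in> borel_measurable ?M" if "k < N" for k
    using measurable_component_singleton[of k "{..<N}" "\<lambda>_. \<mu> r"] that s\<mu>[of r] by (simp cong: measurable_cong_sets)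
  have m2: "(\<lambda>\<sigma>. exp (b * Xfield p N Y \<sigma> - b\<^sup>2 * real N / 2 * overlap N \<sigma> \<sigma> ^ p)) \<in> borel_measurable ?M"
    unfolding Xfield_def overlap_def
    by (intro measurable_compose[OF _ borel_measurable_exp] borel_measurable_diff borel_measurable_sum borel_measurable_times borel_measurable_const
        borel_measurable_power borel_measurable_prod row) (auto dest: tensor_idx_less)
  have "(\<integral>\<sigma>. exp (b * Xfield p N Y \<sigma> - b\<^sup>2 * real N / 2 * overlap N \<sigma> \<sigma> ^ p) \<partial>?M) = mix_lik (tensor_idx p N) ?M (scalar_feat B p N b) Y"
    unfolding mix_lik_def
    by (rule integral_cong_AE[OF m2 cm_dens_feat_measurable1[OF bounded_feat_scalar_feat[OF \<mu> s\<mu> B centered p_ge_1]]])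
      (use bd in eventually_elim, rule eq)
  then show ?thesis by (simp add: scalar_FN_def)
qed

lemma scalar_F_eq: "scalar_F p (\<mu> r) (b r) = limsup (\<lambda>N. ereal (vec_null_ent \<mu> B p N (only {r} b) / N))"
  unfolding scalar_F_def scalar_FN_eq gauss_tensor_def vec_only_scalar null_ent_def by simp

lemma vec_null_ent_div_nonpos: "vec_null_ent \<mu> B p N b / N \<le> 0"
  using null_ent_nonpos[OF bounded_feat_vec_feat] unfolding vec_null_ent_def by (simp add: divide_nonpos_nonneg)

text \<open>Independence of the rows in \<open>S\<close> from the others, assembled site by
  site.\<close>

lemma row_coupling:
  "coupling (conf \<mu> N) (\<lambda>(x, y). \<lambda>k\<in>{..<N}. \<lambda>r\<in>UNIV. if r \<in> S then x k r else y k r)"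
proof -
  let ?h = "\<lambda>(x, y). \<lambda>r\<in>UNIV. if r \<in> S then x r else (y r :: real)"
  have c: "coupling (PiM UNIV \<mu>) ?h" by (rule coupling_PiM_splice) (auto simp: \<mu>)
  then have d: "distr (PiM UNIV \<mu> \<Otimes>\<^sub>M PiM UNIV \<mu>) (PiM UNIV \<mu>) ?h = PiM UNIV \<mu>" and m: "?h \<in> measurable (PiM UNIV \<mu> \<Otimes>\<^sub>M PiM UNIV \<mu>) (PiM UNIV \<mu>)"
    by (auto simp: coupling_def)
  have "distr (conf \<mu> N \<Otimes>\<^sub>M conf \<mu> N) (conf \<mu> N) (\<lambda>(x, y). \<lambda>k\<in>{..<N}. ?h (x k, y k)) = conf \<mu> N"
    by (rule distr_PiM_pair[OF _ prob_space_site prob_space_site prob_space_site m d]) simp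
  moreover have "(\<lambda>q. \<lambda>k\<in>{..<N}. ?h (fst q k, snd q k)) \<in> measurable (conf \<mu> N \<Otimes>\<^sub>M conf \<mu> N) (conf \<mu> N)"
    by (intro measurable_restrict measurable_compose[OF _ m]) auto
  moreover have "(\<lambda>(x, y). \<lambda>k\<in>{..<N}. ?h (x k, y k)) = (\<lambda>(x, y). \<lambda>k\<in>{..<N}. \<lambda>r\<in>UNIV. if r \<in> S then x k r else (y k r :: real))"
    by (simp add: fun_eq_iff)
  moreover have "(\<lambda>q. \<lambda>k\<in>{..<N}. ?h (fst q k, snd q k)) = (\<lambda>(x, y). \<lambda>k\<in>{..<N}. \<lambda>r\<in>UNIV. if r \<in> S then x k r else (y k r :: real))"
    by (rule ext) (clarsimp simp: fun_eq_iff)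
  ultimately show ?thesis unfolding coupling_def by metis
qed

lemma vec_feat_splice:
  fixes \<sigma> \<tau> :: "nat \<Rightarrow> 'k \<Rightarrow> real"
  assumes "i \<in> tensor_idx p N"
  shows "vec_feat B p N (only S b) ((\<lambda>(x, y). \<lambda>k\<in>{..<N}. \<lambda>r\<in>UNIV. if r \<in> S then x k r else y k r) (\<sigma>, \<tau>)) i = vec_feat B p N (only S b) \<sigma> i"
    "S \<inter> T = {} \<Longrightarrow> vec_feat B p N (only T b) ((\<lambda>(x, y). \<lambda>k\<in>{..<N}. \<lambda>r\<in>UNIV. if r \<in> S then x k r else y k r) (\<sigma>, \<tau>)) i = vec_feat B p N (only T b) \<tau> i"
  unfolding vec_feat_def only_def using assms
  by (auto intro!: sum.cong tfeat_cong simp: disjoint_iff)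

lemma vec_feat_union:
  assumes "S \<inter> T = {}"
  shows "vec_feat B p N (only (S \<union> T) b) = (\<lambda>\<sigma> i. vec_feat B p N (only S b) \<sigma> i + vec_feat B p N (only T b) \<sigma> i)"
  using assms by (auto simp: vec_feat_def only_def fun_eq_iff sum.distrib[symmetric] intro!: sum.cong)

lemma sum_only_le: "(\<Sum>r\<in>UNIV. \<bar>only S b r\<bar>) \<le> (\<Sum>r\<in>UNIV. \<bar>b r\<bar>)"
  by (intro sum_mono) (auto simp: only_def)

text \<open>\<open>null_ent_add_ge\<close> with the new row as \<open>v1\<close>: only its planted
  entropy is charged, while the rows already present enter through their null entropy.\<close>

lemma vec_null_ent_insert_ge:
  assumes r: "r \<notin> S" and s: "0 < s"
  shows "vec_null_ent \<mu> B p N (only (insert r S) b) \<ge> vec_null_ent \<mu> B p N (only S b) - scalar_ent (\<mu> r) B p N (b r) / s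
    - s * ((\<Sum>r\<in>UNIV. \<bar>b r\<bar>)\<^sup>2 * B ^ (2 * p) * N)"
proof -
  let ?c = "(\<Sum>r\<in>UNIV. \<bar>b r\<bar>) * (real N powr (- (real p - 1) / 2) * B ^ p)"
  have u: "vec_feat B p N (only (insert r S) b) = (\<lambda>\<sigma> i. vec_feat B p N (only {r} b) \<sigma> i + vec_feat B p N (only S b) \<sigma> i)"
    using vec_feat_union[of "{r}" S N b] r by simp
  have cc: "\<bar>vec_feat B p N (only {r} b) \<tau> i + vec_feat B p N (only S b) \<tau> i\<bar> \<le> ?c" for \<tau> i
  proof -
    have "\<bar>vec_feat B p N (only (insert r S) b) \<tau> i\<bar> \<le> ?c"
      using B by (intro order_trans[OF vec_feat_abs_le] mult_right_mono sum_only_le) auto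
    then show ?thesis by (simp add: u)
  qed
  have "null_ent (tensor_idx p N) (conf \<mu> N) (\<lambda>\<sigma> i. vec_feat B p N (only {r} b) \<sigma> i + vec_feat B p N (only S b) \<sigma> i)
     \<ge> null_ent (tensor_idx p N) (conf \<mu> N) (vec_feat B p N (only S b)) - planted_ent (tensor_idx p N) (conf \<mu> N) (vec_feat B p N (only {r} b)) / s
        - s * (\<Sum>i\<in>tensor_idx p N. ?c\<^sup>2)"
    by (rule null_ent_add_ge[OF bounded_feat_vec_feat_mono[OF sum_only_le] bounded_feat_vec_feat_mono[OF sum_only_le] row_coupling[of N "{r}"] _ _ _ s])
      ((rule vec_feat_splice(1), assumption) | (rule vec_feat_splice(2), assumption, use r in simp) | rule cc)+
  then show ?thesis unfolding vec_null_ent_def u vec_only_scalar(1) sum_tfeat_bound_square[OF p_ge_1] .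
qed

lemma vec_feat_only_inner:
  "(\<Sum>i\<in>tensor_idx p N. vec_feat B p N (only {r} b) \<tau> i * vec_feat B p N b' \<sigma> i)
   = (\<Sum>r'\<in>UNIV. b r * b' r' * tker p N (\<Sum>k<N. clip B (\<tau> k r) * clip B (\<sigma> k r')))"
proof -
  have z: "(\<Sum>r'\<in>UNIV. only {r} b t * b' r' * tker p N (\<Sum>k<N. clip B (\<tau> k t) * clip B (\<sigma> k r'))) = 0" if "t \<noteq> r" for t
    using that by (simp add: only_def)
  show ?thesis unfolding vec_feat_inner[OF p_ge_1]
    by (subst sum.remove[of _ r]) (simp_all add: z, simp add: only_def)
qed

lemma sum_clip_rows_le: "\<bar>\<Sum>k<N. clip B (\<tau> k r) * clip B (\<sigma> k r')\<bar> \<le> real N * B\<^sup>2"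
  using sum_sq_le[of "\<lambda>k. clip B (\<tau> k r)" B "\<lambda>k. clip B (\<sigma> k r')" "{..<N}"] abs_clip_le[of B] B by auto

end

section \<open>Transfer between the joint model and its rows\<close>

context vector_model
begin

text \<open>\<open>mix_lik_transfer_planted\<close> with all rows planted and the log-likelihood of
  row \<open>r\<close> as test function. The sites, each carrying all rows, are the independent
  coordinates of the configuration.\<close>

lemma vec_null_ent_transfer:
  assumes s: "0 \<le> s"
  shows "vec_null_ent \<mu> B p N b - s * vec_null_ent \<mu> B p N (only {r} b)
     + s * (\<integral>Y. mix_lik (tensor_idx p N) (conf \<mu> N) (vec_feat B p N b) Y * ln (mix_lik (tensor_idx p N) (conf \<mu> N) (vec_feat B p N (only {r} b)) Y) \<partial>gauss (tensor_idx p N))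
   \<le> s\<^sup>2 * (((\<Sum>r\<in>UNIV. \<bar>b r\<bar>)\<^sup>2 * B ^ (2 * p) + (site_osc B p b r)\<^sup>2) * N)"
proof -
  let ?c = "(\<Sum>r\<in>UNIV. \<bar>b r\<bar>) * (real N powr (- (real p - 1) / 2) * B ^ p)"
  have cc: "\<bar>vec_feat B p N (only {r} b) \<tau> i\<bar> \<le> ?c" for \<tau> i
    using B by (intro order_trans[OF vec_feat_abs_le] mult_right_mono sum_only_le) auto
  have bd: "\<bar>\<Sum>i\<in>tensor_idx p N. vec_feat B p N (only {r} b) \<tau> i * (vec_feat B p N b \<sigma> i - vec_feat B p N b (\<sigma>(j := x)) i)\<bar> \<le> site_osc B p b r"
    if j: "j \<in> {..<N}" for \<sigma> j x \<tau>
  proof -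
    let ?X = "\<lambda>\<sigma> r'. \<Sum>k<N. clip B (\<tau> k r) * clip B (\<sigma> k r')"
    \<comment> \<open>Only site \<open>j\<close> contributes to the difference, and every clipped
      spin is at most \<open>B\<close> in absolute value.\<close>
    have dif: "\<bar>?X \<sigma> r' - ?X (\<sigma>(j := x)) r'\<bar> \<le> 2 * B\<^sup>2" for r'
    proof -
      have "?X \<sigma> r' - ?X (\<sigma>(j := x)) r' = clip B (\<tau> j r) * (clip B (\<sigma> j r') - clip B (x r'))"
        using j by (simp add: sum_subtractf[symmetric] right_diff_distrib[symmetric], subst sum.remove[of _ j]) (auto intro!: sum.neutral)
      also have "\<bar>\<dots>\<bar> \<le> B * (B + B)"
        unfolding abs_mult using abs_clip_le[of B] B
        by (intro mult_mono order_trans[OF abs_triangle_ineq4] add_mono) auto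
      finally show ?thesis by (simp add: power2_eq_square)
    qed
    have eq: "(\<Sum>i\<in>tensor_idx p N. vec_feat B p N (only {r} b) \<tau> i * (vec_feat B p N b \<sigma> i - vec_feat B p N b (\<sigma>(j := x)) i))
      = (\<Sum>r'\<in>UNIV. b r * b r' * (tker p N (?X \<sigma> r') - tker p N (?X (\<sigma>(j := x)) r')))"
      unfolding right_diff_distrib sum_subtractf vec_feat_only_inner ..
    have "\<bar>\<Sum>r'\<in>UNIV. b r * b r' * (tker p N (?X \<sigma> r') - tker p N (?X (\<sigma>(j := x)) r'))\<bar> \<le> (\<Sum>r'\<in>UNIV. \<bar>b r\<bar> * \<bar>b r'\<bar> * (p * (B\<^sup>2) ^ p * (2 * B\<^sup>2)))"
    proof (intro order_trans[OF sum_abs] sum_mono)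
      fix r'
      have "\<bar>tker p N (?X \<sigma> r') - tker p N (?X (\<sigma>(j := x)) r')\<bar> \<le> p * (B\<^sup>2) ^ p * (2 * B\<^sup>2)"
        using B by (intro tker_diff_le sum_clip_rows_le p_ge_1 dif) (simp add: one_le_power)
      then show "\<bar>b r * b r' * (tker p N (?X \<sigma> r') - tker p N (?X (\<sigma>(j := x)) r'))\<bar> \<le> \<bar>b r\<bar> * \<bar>b r'\<bar> * (p * (B\<^sup>2) ^ p * (2 * B\<^sup>2))"
        unfolding abs_mult by (intro mult_left_mono) auto
    qed
    also have "\<dots> = site_osc B p b r" unfolding site_osc_def sum_distrib_left sum_distrib_right ..
    finally show ?thesis unfolding eq .
  qed
  have "vec_null_ent \<mu> B p N b - s * vec_null_ent \<mu> B p N (only {r} b)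
     + s * (\<integral>Y. mix_lik (tensor_idx p N) (conf \<mu> N) (vec_feat B p N b) Y * ln (mix_lik (tensor_idx p N) (conf \<mu> N) (vec_feat B p N (only {r} b)) Y) \<partial>gauss (tensor_idx p N))
    \<le> s\<^sup>2 * ((\<Sum>i\<in>tensor_idx p N. ?c\<^sup>2) + card {..<N} * (site_osc B p b r)\<^sup>2)"
    unfolding vec_null_ent_def
    by (rule mix_lik_transfer_planted[OF bounded_feat_vec_feat bounded_feat_vec_feat _ prob_space_site]) (use cc bd s in auto)
  then show ?thesis unfolding sum_tfeat_bound_square[OF p_ge_1] by (simp only: card_lessThan distrib_right mult.commute[of "real N" "(site_osc B p b r)\<^sup>2"])
qed

text \<open>Planting and testing the same row turns the test term into its planted entropy; minus
  \<open>s\<close> times the null entropy is nonnegative and is dropped.\<close>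

lemma scalar_ent_le_vec_null_ent:
  assumes s: "0 < s" "s \<le> 1"
  shows "scalar_ent (\<mu> r) B p N (b r) \<le> - vec_null_ent \<mu> B p N (only {r} b) / s
     + s * (((\<Sum>r'\<in>UNIV. \<bar>only {r} b r'\<bar>)\<^sup>2 * B ^ (2 * p) + (site_osc B p (only {r} b) r)\<^sup>2) * N)" (is "_ \<le> _ + s * ?D")
proof -
  have oo: "only {r} (only {r} b) = only {r} b" by (auto simp: only_def)
  have "vec_null_ent \<mu> B p N (only {r} b) - s * vec_null_ent \<mu> B p N (only {r} b) + s * scalar_ent (\<mu> r) B p N (b r) \<le> s\<^sup>2 * ?D"
    using vec_null_ent_transfer[of s N "only {r} b" r] s unfolding oo planted_ent_def[symmetric] vec_only_scalar(1) by simp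
  moreover have "vec_null_ent \<mu> B p N (only {r} b) \<le> 0" using null_ent_nonpos[OF bounded_feat_vec_feat] by (simp add: vec_null_ent_def)
  then have "s * vec_null_ent \<mu> B p N (only {r} b) \<le> 0" using s by (simp add: mult_nonneg_nonpos)
  ultimately have "s * scalar_ent (\<mu> r) B p N (b r) \<le> s\<^sup>2 * ?D - vec_null_ent \<mu> B p N (only {r} b)" by linarith
  then show ?thesis using s by (simp add: field_simps power2_eq_square)
qed

text \<open>The two configurations are independent, even for equal row indices. The kernel is
  dominated by the squared overlap divided by \<open>N\<close>, whose mean is bounded because the
  spins of row \<open>r\<close> are centred.\<close>

lemma prior_cross_ge:
  assumes N: "0 < N"
  shows "(\<integral>\<sigma>. \<integral>\<tau>. (\<Sum>i\<in>tensor_idx p N. vec_feat B p N b' \<sigma> i * vec_feat B p N (only {r} b) \<tau> i) \<partial>conf \<mu> N \<partial>conf \<mu> N)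
    \<ge> - (\<bar>b r\<bar> * (\<Sum>r'\<in>UNIV. \<bar>b' r'\<bar>) * ((B\<^sup>2) ^ (p - 2) * (4 * exp (B ^ 4 / 2))))" (is "_ \<ge> - ?D")
proof -
  interpret M: prob_space "conf \<mu> N" by (rule prob_space_conf)
  let ?X = "\<lambda>r' \<sigma> \<tau>. \<Sum>k<N. clip B (\<tau> k r) * clip B (\<sigma> k r')"
  let ?g = "\<lambda>r' \<sigma> \<tau>. (?X r' \<sigma> \<tau>)\<^sup>2 / real N"
  have gm: "(\<lambda>\<tau>. \<Sum>k<N. clip B (\<tau> k r) * s k) \<in> borel_measurable (conf \<mu> N)" for s
    by (intro borel_measurable_sum borel_measurable_times borel_measurable_const clip_row_measurable) auto
  have gi: "integrable (conf \<mu> N) (?g r' \<sigma>)" for r' \<sigma>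
  proof (rule M.integrable_const_bound[where B="(real N * B\<^sup>2)\<^sup>2 / real N"])
    have "(?X r' \<sigma> \<tau>)\<^sup>2 \<le> (real N * B\<^sup>2)\<^sup>2" for \<tau>
      using sum_clip_rows_le[of \<tau> r \<sigma> r' N] by (metis abs_ge_zero power2_abs power_mono)
    then show "AE \<tau> in conf \<mu> N. norm (?g r' \<sigma> \<tau>) \<le> (real N * B\<^sup>2)\<^sup>2 / real N" by (auto intro!: AE_I2 divide_right_mono)
  qed (use gm in measurable)
  \<comment> \<open>Transported to the law of row \<open>r\<close>, where the second moment bound
    for centred spins applies.\<close>
  have g4: "(\<integral>\<tau>. ?g r' \<sigma> \<tau> \<partial>conf \<mu> N) \<le> 4 * exp (B ^ 4 / 2)" for r' \<sigma>
  proof -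
    let ?f = "\<lambda>\<rho>. (\<Sum>k<N. clip B (\<rho> k) * clip B (\<sigma> k r'))\<^sup>2 / real N"
    have fm: "?f \<in> borel_measurable (PiM {..<N} (\<lambda>_. \<mu> r))"
      by (intro borel_measurable_divide borel_measurable_power borel_measurable_sum borel_measurable_times borel_measurable_const
          clip_coord_measurable[OF \<mu> s\<mu> B centered]) auto
    have "(\<integral>\<tau>. ?g r' \<sigma> \<tau> \<partial>conf \<mu> N) = (\<integral>\<tau>. ?f (\<lambda>k\<in>{..<N}. \<tau> k r) \<partial>conf \<mu> N)" by simp
    also have "\<dots> = (\<integral>\<rho>. ?f \<rho> \<partial>PiM {..<N} (\<lambda>_. \<mu> r))"
      unfolding integral_distr[OF row_distr(2) fm, symmetric] row_distr(1)[symmetric] ..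
    also have "\<dots> \<le> 4 * exp (B ^ 4 / 2)"
      by (rule moment_le(1)[OF \<mu> s\<mu> B centered]) (use N abs_clip_le[of B] B in auto)
    finally show ?thesis .
  qed
  have inner: "\<bar>\<integral>\<tau>. (\<Sum>i\<in>tensor_idx p N. vec_feat B p N b' \<sigma> i * vec_feat B p N (only {r} b) \<tau> i) \<partial>conf \<mu> N\<bar> \<le> ?D" for \<sigma>
  proof -
    have pw: "\<bar>\<Sum>i\<in>tensor_idx p N. vec_feat B p N b' \<sigma> i * vec_feat B p N (only {r} b) \<tau> i\<bar> \<le> (\<Sum>r'\<in>UNIV. \<bar>b r\<bar> * \<bar>b' r'\<bar> * ((B\<^sup>2) ^ (p - 2) * ?g r' \<sigma> \<tau>))" for \<tau>
    proof -
      have eq: "(\<Sum>i\<in>tensor_idx p N. vec_feat B p N b' \<sigma> i * vec_feat B p N (only {r} b) \<tau> i) = (\<Sum>r'\<in>UNIV. b r * b' r' * tker p N (?X r' \<sigma> \<tau>))"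
        using vec_feat_only_inner[of N r b \<tau> b' \<sigma>] by (simp add: mult.commute)
      have "\<bar>\<Sum>r'\<in>UNIV. b r * b' r' * tker p N (?X r' \<sigma> \<tau>)\<bar> \<le> (\<Sum>r'\<in>UNIV. \<bar>b r\<bar> * \<bar>b' r'\<bar> * ((B\<^sup>2) ^ (p - 2) * ?g r' \<sigma> \<tau>))"
      proof (intro order_trans[OF sum_abs] sum_mono)
        fix r'
        have "\<bar>tker p N (?X r' \<sigma> \<tau>)\<bar> \<le> (B\<^sup>2) ^ (p - 2) * ?g r' \<sigma> \<tau>"
          using p N by (intro tker_abs_le_square sum_clip_rows_le) auto
        then show "\<bar>b r * b' r' * tker p N (?X r' \<sigma> \<tau>)\<bar> \<le> \<bar>b r\<bar> * \<bar>b' r'\<bar> * ((B\<^sup>2) ^ (p - 2) * ?g r' \<sigma> \<tau>)"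
          unfolding abs_mult by (intro mult_left_mono) auto
      qed
      then show ?thesis unfolding eq .
    qed
    have ri: "integrable (conf \<mu> N) (\<lambda>\<tau>. \<Sum>r'\<in>UNIV. \<bar>b r\<bar> * \<bar>b' r'\<bar> * ((B\<^sup>2) ^ (p - 2) * ?g r' \<sigma> \<tau>))"
      using gi by (intro Bochner_Integration.integrable_sum integrable_mult_right) auto
    have "\<bar>\<integral>\<tau>. (\<Sum>i\<in>tensor_idx p N. vec_feat B p N b' \<sigma> i * vec_feat B p N (only {r} b) \<tau> i) \<partial>conf \<mu> N\<bar>
        \<le> (\<integral>\<tau>. \<bar>\<Sum>i\<in>tensor_idx p N. vec_feat B p N b' \<sigma> i * vec_feat B p N (only {r} b) \<tau> i\<bar> \<partial>conf \<mu> N)"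
      by (rule integral_abs_bound)
    also have "\<dots> \<le> (\<integral>\<tau>. (\<Sum>r'\<in>UNIV. \<bar>b r\<bar> * \<bar>b' r'\<bar> * ((B\<^sup>2) ^ (p - 2) * ?g r' \<sigma> \<tau>)) \<partial>conf \<mu> N)"
      by (rule integral_mono_AE'[OF ri AE_I2 AE_I2]) (rule pw, intro sum_nonneg mult_nonneg_nonneg divide_nonneg_nonneg, auto)
    also have "\<dots> = (\<Sum>r'\<in>UNIV. \<bar>b r\<bar> * \<bar>b' r'\<bar> * ((B\<^sup>2) ^ (p - 2) * (\<integral>\<tau>. ?g r' \<sigma> \<tau> \<partial>conf \<mu> N)))"
    proof (subst Bochner_Integration.integral_sum)
      show "integrable (conf \<mu> N) (\<lambda>\<tau>. \<bar>b r\<bar> * \<bar>b' r'\<bar> * ((B\<^sup>2) ^ (p - 2) * ?g r' \<sigma> \<tau>))" for r'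
        using gi by (intro integrable_mult_right)
    qed (simp only: integral_mult_right_zero)
    also have "\<dots> \<le> (\<Sum>r'\<in>UNIV. \<bar>b r\<bar> * \<bar>b' r'\<bar> * ((B\<^sup>2) ^ (p - 2) * (4 * exp (B ^ 4 / 2))))"
      using B by (intro sum_mono mult_left_mono g4) auto
    also have "\<dots> = ?D" unfolding sum_distrib_left sum_distrib_right ..
    finally show ?thesis .
  qed
  have "\<bar>\<integral>\<sigma>. \<integral>\<tau>. (\<Sum>i\<in>tensor_idx p N. vec_feat B p N b' \<sigma> i * vec_feat B p N (only {r} b) \<tau> i) \<partial>conf \<mu> N \<partial>conf \<mu> N\<bar> \<le> ?D"
    by (rule M.abs_integral_le[OF inner])
  then show ?thesis by linarith
qed

text \<open>The planted mean of the test term is at least the planted entropy of row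
  \<open>r\<close>, which is nonnegative, minus a bounded cross term with the other rows; the
  transfer inequality turns this into a bound on the null entropy of the row.\<close>

lemma vec_null_ent_only_ge:
  assumes N: "0 < N" and s: "0 < s"
  shows "vec_null_ent \<mu> B p N (only {r} b) \<ge> vec_null_ent \<mu> B p N b / s
     - (\<bar>b r\<bar> * (\<Sum>r'\<in>UNIV. \<bar>b r'\<bar>) * ((B\<^sup>2) ^ (p - 2) * (4 * exp (B ^ 4 / 2))))
     - s * (((\<Sum>r\<in>UNIV. \<bar>b r\<bar>)\<^sup>2 * B ^ (2 * p) + (site_osc B p b r)\<^sup>2) * N)" (is "_ \<ge> _ - ?D - s * ?E")
proof -
  let ?J = "\<integral>Y. mix_lik (tensor_idx p N) (conf \<mu> N) (vec_feat B p N b) Y * ln (mix_lik (tensor_idx p N) (conf \<mu> N) (vec_feat B p N (only {r} b)) Y) \<partial>gauss (tensor_idx p N)"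
  have u: "vec_feat B p N b = (\<lambda>\<sigma> i. vec_feat B p N (only {r} b) \<sigma> i + vec_feat B p N (only (- {r}) b) \<sigma> i)"
    using vec_feat_union[of "{r}" "- {r}" N b] by (simp add: only_def[abs_def])
  have "?J \<ge> planted_ent (tensor_idx p N) (conf \<mu> N) (vec_feat B p N (only {r} b))
      + (\<integral>\<sigma>. \<integral>\<tau>. (\<Sum>i\<in>tensor_idx p N. vec_feat B p N (only (- {r}) b) \<sigma> i * vec_feat B p N (only {r} b) \<tau> i) \<partial>conf \<mu> N \<partial>conf \<mu> N)"
    unfolding u
    by (rule mix_lik_add_ln_ge[OF bounded_feat_vec_feat_mono[OF sum_only_le] bounded_feat_vec_feat_mono[OF sum_only_le] row_coupling[of N "{r}"]])
      ((rule vec_feat_splice(1), assumption) | (rule vec_feat_splice(2), assumption, simp))+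
  moreover have "0 \<le> planted_ent (tensor_idx p N) (conf \<mu> N) (vec_feat B p N (only {r} b))" by (rule planted_ent_nonneg[OF bounded_feat_vec_feat])
  moreover note prior_cross_ge[OF N, of b r "only (- {r}) b"]
  moreover have "\<bar>b r\<bar> * (\<Sum>r'\<in>UNIV. \<bar>only (- {r}) b r'\<bar>) * ((B\<^sup>2) ^ (p - 2) * (4 * exp (B ^ 4 / 2))) \<le> ?D"
    using B by (intro mult_right_mono mult_left_mono sum_only_le) auto
  ultimately have J: "- ?D \<le> ?J" by linarith
  have "s * (- ?D) \<le> s * ?J" using J s by (intro mult_left_mono) auto
  then have "vec_null_ent \<mu> B p N b - s * ?D - s\<^sup>2 * ?E \<le> s * vec_null_ent \<mu> B p N (only {r} b)"
    using vec_null_ent_transfer[of s N b r] s by (simp only: mult_minus_right) linarith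
  then show ?thesis using s by (simp add: field_simps power2_eq_square)
qed

lemma vec_F_zero_iff:
  "vec_F p \<mu> \<beta> = 0 \<longleftrightarrow> (\<forall>\<epsilon>>0. \<exists>\<^sub>F N in sequentially. - \<epsilon> < vec_null_ent \<mu> B p N (\<lambda>r. \<beta> $ r) / N)"
  unfolding vec_F_eq by (rule limsup_eq_0_iff[OF vec_null_ent_div_nonpos])

lemma scalar_F_zero_iff:
  "scalar_F p (\<mu> r) (b r) = 0 \<longleftrightarrow> (\<forall>\<epsilon>>0. \<exists>\<^sub>F N in sequentially. - \<epsilon> < vec_null_ent \<mu> B p N (only {r} b) / N)"
  unfolding scalar_F_eq by (rule limsup_eq_0_iff[OF vec_null_ent_div_nonpos])

lemma scalar_zero_if_vec_zero:
  assumes "vec_F p \<mu> \<beta> = 0" shows "scalar_F p (\<mu> r) (\<beta> $ r) = 0"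
proof -
  let ?b = "\<lambda>r. \<beta> $ r"
  let ?D = "\<bar>?b r\<bar> * (\<Sum>r'\<in>UNIV. \<bar>?b r'\<bar>) * ((B\<^sup>2) ^ (p - 2) * (4 * exp (B ^ 4 / 2)))"
  define E where "E = (\<Sum>r\<in>UNIV. \<bar>?b r\<bar>)\<^sup>2 * B ^ (2 * p) + (site_osc B p ?b r)\<^sup>2"
  have E: "0 \<le> E" using B by (simp add: E_def)
  have fr: "\<exists>\<^sub>F N in sequentially. - \<epsilon> < vec_null_ent \<mu> B p N ?b / N" if "0 < \<epsilon>" for \<epsilon>
    using assms that unfolding vec_F_zero_iff by simp
  have "\<exists>\<^sub>F N in sequentially. - \<epsilon> < vec_null_ent \<mu> B p N (only {r} ?b) / N" if e: "0 < \<epsilon>" for \<epsilon>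
  proof -
    \<comment> \<open>\<open>s\<close> keeps the concentration error below a third of
      \<open>\<epsilon>\<close>. The joint null entropy must then be of size
      \<open>s * \<epsilon> / 3\<close>, because it is divided by \<open>s\<close>, and
      \<open>n0\<close> absorbs the bounded cross term.\<close>
    define s where "s = \<epsilon> / (3 * (E + 1))"
    have s: "0 < s" "s * E \<le> \<epsilon> / 3" using e E by (auto simp: s_def field_simps)
    obtain n0 :: nat where n0: "3 * ?D / \<epsilon> < n0" using reals_Archimedean2 by blast
    have "\<exists>\<^sub>F N in sequentially. - (s * \<epsilon> / 3) < vec_null_ent \<mu> B p N ?b / N \<and> Suc n0 \<le> N"
      using frequently_eventually_frequently[OF fr[of "s * \<epsilon> / 3"] eventually_ge_at_top[of "Suc n0"]] s e by simp
    then show ?thesis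
    proof (rule frequently_elim1)
      fix N assume *: "- (s * \<epsilon> / 3) < vec_null_ent \<mu> B p N ?b / N \<and> Suc n0 \<le> N"
      then have N: "0 < N" by simp
      have "3 * ?D / \<epsilon> < N" using n0 * by linarith
      then have 1: "?D \<le> \<epsilon> / 3 * N" using e by (simp add: field_simps)
      have "- (s * \<epsilon> / 3) * N < vec_null_ent \<mu> B p N ?b" using * N by (simp add: less_divide_eq)
      then have 2: "- (\<epsilon> / 3) * N < vec_null_ent \<mu> B p N ?b / s" using s by (simp add: field_simps)
      have 3: "s * (E * N) \<le> \<epsilon> / 3 * N" using mult_right_mono[OF s(2), of "real N"] by (simp only: of_nat_0_le_iff mult.assoc)
      have "- \<epsilon> * N < vec_null_ent \<mu> B p N (only {r} ?b)"
        using vec_null_ent_only_ge[OF N s(1), of ?b r] 1 2 3 unfolding E_def by argo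
      then show "- \<epsilon> < vec_null_ent \<mu> B p N (only {r} ?b) / N" using N by (simp add: less_divide_eq)
    qed
  qed
  then show ?thesis unfolding scalar_F_zero_iff[of r ?b] by simp
qed

text \<open>Here a sequence of good sizes becomes all large sizes: smallness passes from the null to
  the planted entropy along the sequence, and subadditivity of the latter extends it.\<close>

lemma scalar_ent_eventually_small:
  fixes x \<epsilon> :: real
  assumes "scalar_F p (\<mu> r) x = 0" "0 < x" "0 < \<epsilon>"
  shows "\<forall>\<^sub>F N in sequentially. scalar_ent (\<mu> r) B p N x < \<epsilon> * N"
proof (rule subadditive_frequently_imp_eventually[OF _ _ _ _ assms(3)])
  \<comment> \<open>Any vector with entry \<open>x\<close> at \<open>r\<close> serves, as the other
    rows are switched off.\<close>
  let ?b = "\<lambda>_::'k. x"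
  show "0 \<le> scalar_ent (\<mu> r) B p N x" for N by (rule scalar_ent_nonneg[OF \<mu> s\<mu> B centered p_ge_1])
  show "scalar_ent (\<mu> r) B p (n + m) x \<le> scalar_ent (\<mu> r) B p n x + scalar_ent (\<mu> r) B p m x + x\<^sup>2 * (B\<^sup>2) ^ (p - 2) * (1 + 128 * exp (B ^ 4 / 2)) / 2"
    if "0 < n" "0 < m" for n m by (rule scalar_ent_subadditive[OF \<mu> s\<mu> B centered p that assms(2)])
  show "0 \<le> x\<^sup>2 * (B\<^sup>2) ^ (p - 2) * (1 + 128 * exp (B ^ 4 / 2)) / 2" using B by (simp add: add_nonneg_nonneg)
  fix \<delta> :: real assume d: "0 < \<delta>"
  define E where "E = (\<Sum>r'\<in>UNIV. \<bar>only {r} ?b r'\<bar>)\<^sup>2 * B ^ (2 * p) + (site_osc B p (only {r} ?b) r)\<^sup>2"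
  have E: "0 \<le> E" using B by (simp add: E_def)
  define s where "s = min 1 (\<delta> / (3 * (E + 1)))"
  have s: "0 < s" "s \<le> 1" using d E by (auto simp: s_def)
  have "s * E \<le> \<delta> / (3 * (E + 1)) * E" using E by (intro mult_right_mono) (auto simp: s_def)
  also have "\<dots> \<le> \<delta> / 3" using d E by (simp add: field_simps)
  finally have sE: "s * E \<le> \<delta> / 3" .
  have "\<exists>\<^sub>F N in sequentially. - (s * \<delta> / 3) < vec_null_ent \<mu> B p N (only {r} ?b) / N"
    using assms(1) d s unfolding scalar_F_zero_iff[of r ?b] by simp
  then have "\<exists>\<^sub>F N in sequentially. - (s * \<delta> / 3) < vec_null_ent \<mu> B p N (only {r} ?b) / N \<and> 1 \<le> N"
    by (rule frequently_eventually_frequently) (rule eventually_ge_at_top)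
  then show "\<exists>\<^sub>F N in sequentially. scalar_ent (\<mu> r) B p N x < \<delta> * N"
  proof (rule frequently_elim1)
    fix N assume *: "- (s * \<delta> / 3) < vec_null_ent \<mu> B p N (only {r} ?b) / N \<and> 1 \<le> N"
    then have N: "0 < N" by simp
    have "- (s * \<delta> / 3) * N < vec_null_ent \<mu> B p N (only {r} ?b)" using * N by (simp add: less_divide_eq)
    then have 2: "- vec_null_ent \<mu> B p N (only {r} ?b) / s < \<delta> / 3 * N" using s by (simp add: field_simps)
    have 3: "s * (E * N) \<le> \<delta> / 3 * N" using mult_right_mono[OF sE, of "real N"] by (simp only: of_nat_0_le_iff mult.assoc)
    have "0 < \<delta> * N" using d N by simp
    then show "scalar_ent (\<mu> r) B p N x < \<delta> * N"
      using scalar_ent_le_vec_null_ent[OF s, of r N ?b] 2 3 unfolding E_def by argo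
  qed
qed

text \<open>The critical value is included, and the set of trivial temperatures is not known to be
  an interval: there is merely some trivial \<open>y\<close> above \<open>x - \<delta>\<close>.
  Monotonicity applies if \<open>y\<close> is at least \<open>x\<close>, and otherwise the Lipschitz
  bound in \<open>\<beta>\<^sup>2\<close>.\<close>

lemma scalar_ent_eventually_small_crit:
  fixes x \<epsilon> :: real
  assumes x: "0 < x" "ereal x \<le> crit_temp p (\<mu> r)" and e: "0 < \<epsilon>"
  shows "\<forall>\<^sub>F N in sequentially. scalar_ent (\<mu> r) B p N x < \<epsilon> * N"
proof -
  \<comment> \<open>Chosen so that \<open>(x\<^sup>2 - y\<^sup>2) * B ^ (2 * p)\<close> is at most
    \<open>\<epsilon> / 2\<close> whenever \<open>x - \<delta> < y < x\<close>.\<close>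
  define \<delta> where "\<delta> = \<epsilon> / (4 * x * B ^ (2 * p))"
  have d: "0 < \<delta>" using e x B by (simp add: \<delta>_def)
  have "ereal (x - \<delta>) < crit_temp p (\<mu> r)" using x d by (metis diff_less_eq ereal_less(2) ereal_less_eq(3) less_add_same_cancel1 less_ereal.simps(1) order_less_le_trans)
  then obtain y where y: "0 < y" "scalar_F p (\<mu> r) y = 0" "x - \<delta> < y"
    unfolding crit_temp_def less_Sup_iff by auto
  have ev: "\<forall>\<^sub>F N in sequentially. scalar_ent (\<mu> r) B p N y < \<epsilon> / 2 * N"
    using scalar_ent_eventually_small[OF y(2,1), of "\<epsilon> / 2"] e by simp
  show ?thesis using ev eventually_ge_at_top[of 1]
  proof eventually_elim
    case (elim N)
    have eN: "0 < \<epsilon> * N" using e elim by simp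
    show ?case
    proof (cases "x \<le> y")
      case True
      then show ?thesis using scalar_ent_scale(1)[OF \<mu> s\<mu> B centered p_ge_1 x(1) True, of r N] elim eN by argo
    next
      case False
      have "x\<^sup>2 - y\<^sup>2 = (x - y) * (x + y)" by (simp add: power2_eq_square algebra_simps)
      also have "\<dots> \<le> \<delta> * (2 * x)" using y False by (intro mult_mono) auto
      finally have "(x\<^sup>2 - y\<^sup>2) * (real N * B ^ (2 * p)) \<le> \<delta> * (2 * x) * (real N * B ^ (2 * p))"
        using B by (intro mult_right_mono) auto
      also have "\<dots> = \<epsilon> / 2 * N" using x B by (simp add: \<delta>_def field_simps)
      finally show ?thesis
        using scalar_ent_scale(2)[OF \<mu> s\<mu> B centered p_ge_1 y(1), of x r N] False elim by argo
    qed
  qed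
qed

text \<open>Each added row must be small at the same \<open>N\<close> as the rows before it, which
  is why smallness is required for all large sizes and not just along a sequence.\<close>

lemma vec_null_ent_eventually_small:
  fixes b :: "'k \<Rightarrow> real" and \<epsilon> :: real
  assumes small: "\<And>r (\<epsilon>::real). 0 < \<epsilon> \<Longrightarrow> \<forall>\<^sub>F N in sequentially. scalar_ent (\<mu> r) B p N (b r) < \<epsilon> * N"
    and "finite S" and "0 < \<epsilon>"
  shows "\<forall>\<^sub>F N in sequentially. - \<epsilon> * N < vec_null_ent \<mu> B p N (only S b)"
  using assms(2,3)
proof (induction S arbitrary: \<epsilon>)
  case empty
  have "vec_feat B p N (only {} b) = (\<lambda>\<sigma> i. 0)" for N by (auto simp: vec_feat_def only_def fun_eq_iff)
  then have "vec_null_ent \<mu> B p N (only {} b) = 0" for N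
    using prob_space.prob_space[OF prob_space_conf[of N]] by (simp add: vec_null_ent_def null_ent_def mix_lik_def cm_dens_def)
  moreover have "\<forall>\<^sub>F N in sequentially. 0 < \<epsilon> * N"
    using eventually_gt_at_top[of 0] by eventually_elim (use empty in auto)
  ultimately show ?case by simp
next
  case (insert r S)
  define E where "E = (\<Sum>r\<in>UNIV. \<bar>b r\<bar>)\<^sup>2 * B ^ (2 * p)"
  have E: "0 \<le> E" using B by (simp add: E_def)
  define s where "s = \<epsilon> / (3 * (E + 1))"
  have s: "0 < s" "s * E \<le> \<epsilon> / 3" using insert.prems E by (auto simp: s_def field_simps)
  have e3: "0 < \<epsilon> / 3" "0 < s * \<epsilon> / 3" using insert.prems s by auto
  show ?case using insert.IH[OF e3(1)] small[OF e3(2), of r]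
  proof eventually_elim
    case (elim N)
    have "scalar_ent (\<mu> r) B p N (b r) / s < \<epsilon> / 3 * N" using elim(2) s by (simp add: field_simps)
    moreover have "s * (E * N) \<le> \<epsilon> / 3 * N" using mult_right_mono[OF s(2), of "real N"] by (simp only: of_nat_0_le_iff mult.assoc)
    ultimately show ?case using vec_null_ent_insert_ge[OF insert.hyps(2) s(1), of N b] elim(1) unfolding E_def by argo
  qed
qed

lemma vec_zero_if_subcritical:
  assumes "\<And>r. 0 < \<beta> $ r" "\<And>r. ereal (\<beta> $ r) \<le> crit_temp p (\<mu> r)"
  shows "vec_F p \<mu> \<beta> = 0"
proof -
  let ?b = "\<lambda>r. \<beta> $ r"
  have ob: "only UNIV ?b = ?b" by (simp add: only_def fun_eq_iff)
  have "\<exists>\<^sub>F N in sequentially. - \<epsilon> < vec_null_ent \<mu> B p N ?b / N" if e: "0 < \<epsilon>" for \<epsilon>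
  proof -
    have "\<forall>\<^sub>F N in sequentially. - \<epsilon> * N < vec_null_ent \<mu> B p N (only UNIV ?b)"
      by (rule vec_null_ent_eventually_small[OF scalar_ent_eventually_small_crit[OF assms]]) (use e in auto)
    then have "\<forall>\<^sub>F N in sequentially. - \<epsilon> < vec_null_ent \<mu> B p N ?b / N"
      using eventually_gt_at_top[of 0] unfolding ob by eventually_elim (simp add: less_divide_eq)
    then show ?thesis by (rule eventually_frequently[rotated]) simp
  qed
  then show ?thesis unfolding vec_F_zero_iff by simp
qed

end

theorem theorem7:
  fixes p :: nat and \<mu> :: "'k::finite \<Rightarrow> real measure" and \<Lambda> :: "'k \<Rightarrow> real set"
  assumes "p \<ge> 3"
    and "\<And>r. prob_space (\<mu> r)"
    and "\<And>r. sets (\<mu> r) = sets borel"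
    and "\<And>r. \<Lambda> r \<in> sets borel"
    and "\<And>r. bounded (\<Lambda> r)"
    and "\<And>r. emeasure (\<mu> r) (\<Lambda> r) = 1"
    and "\<And>r. (\<integral>x. x \<partial>(\<mu> r)) = 0"
  shows "{\<beta> :: real ^ 'k. (\<forall>r. \<beta> $ r > 0) \<and> vec_F p \<mu> \<beta> = 0}
       = {\<beta> :: real ^ 'k. \<forall>r. \<beta> $ r > 0 \<and> ereal (\<beta> $ r) \<le> crit_temp p (\<mu> r)}"
proof -
  have "\<forall>r. \<exists>a>0. \<forall>x\<in>\<Lambda> r. norm x \<le> a" using assms(5) bounded_pos by blast
  then obtain a where a: "\<And>r. 0 < a r" "\<And>r x. x \<in> \<Lambda> r \<Longrightarrow> norm x \<le> a r" by metis
  \<comment> \<open>One bound for all rows; the summand 1 ensures \<open>1 \<le> B\<close>, as the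
    kernel estimates assume.\<close>
  define B where "B = 1 + (\<Sum>r\<in>UNIV. a r)"
  have aB: "a r \<le> B" for r
    using member_le_sum[of r UNIV a] a(1) by (auto simp: B_def less_imp_le add_increasing)
  have B: "1 \<le> B" using a(1) by (simp add: B_def sum_nonneg less_imp_le)
  have bd: "AE x in \<mu> r. \<bar>x\<bar> \<le> B" for r
  proof -
    interpret prob_space "\<mu> r" by (rule assms(2))
    have "prob (\<Lambda> r) = 1" using assms(6)[of r] by (simp add: measure_def)
    then have "AE x in \<mu> r. x \<in> \<Lambda> r" using assms(3,4) by (simp add: prob_eq_1)
    then show ?thesis by eventually_elim (use a(2) aB in \<open>force intro: order_trans\<close>)
  qed
  have cent: "(\<integral>x. clip B x \<partial>\<mu> r) = 0" for r
  proof -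
    have "(\<integral>x. clip B x \<partial>\<mu> r) = (\<integral>x. x \<partial>\<mu> r)"
    proof (rule integral_cong_AE)
      show "clip B \<in> borel_measurable (\<mu> r)" "(\<lambda>x. x) \<in> borel_measurable (\<mu> r)"
        using clip_measurable assms(3)[of r] by (simp_all cong: measurable_cong_sets)
      show "AE x in \<mu> r. clip B x = x" using bd[of r] by eventually_elim (rule clip_eq)
    qed
    then show ?thesis using assms(7) by simp
  qed
  interpret V: vector_model \<mu> B p by (rule vector_model.intro; fact)
  show ?thesis
  proof safe
    fix \<beta> :: "real ^ 'k" and r
    assume pos: "\<forall>r. 0 < \<beta> $ r" and z: "vec_F p \<mu> \<beta> = 0"
    show "0 < \<beta> $ r" using pos by blast
    \<comment> \<open>This places \<open>\<beta> $ r\<close> in the set whose supremum is the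
      critical temperature.\<close>
    have "scalar_F p (\<mu> r) (\<beta> $ r) = 0" by (rule V.scalar_zero_if_vec_zero[OF z])
    then show "ereal (\<beta> $ r) \<le> crit_temp p (\<mu> r)"
      unfolding crit_temp_def using pos by (intro Sup_upper) auto
  next
    fix \<beta> :: "real ^ 'k"
    assume H: "\<forall>r. 0 < \<beta> $ r \<and> ereal (\<beta> $ r) \<le> crit_temp p (\<mu> r)"
    show "vec_F p \<mu> \<beta> = 0" by (rule V.vec_zero_if_subcritical) (use H in auto)
  qed auto
qed

end
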